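(* Let $d\in\mathbb{N}$ and let $(K,K')$ be a pair of bunched Cantor sets in $\mathbb{R}^d$, with corresponding family $\mathcal{R}^*$ of renormalization operators acting on $\mathcal{Q}_{\mathrm{Aff}}$. Assume that there exists a bounded (i.e. relatively compact) open set $\mathcal{U}\subset\mathcal{Q}_{\mathrm{Aff}}$ satisfying the covering condition $$\overline{\mathcal{U}}\subset\bigcup_{\Psi\in\mathcal{R}^*}\Psi^{-1}(\mathcal{U}).$$ Then for every relative configuration $[h,h']\in\Phi_q(\mathcal{U})$ the Cantor sets $h(K)$ and $h'(K')$ have $\mathcal{C}^{1+\alpha}$ stable intersection, i.e. $[h,h']$ is stably intersecting. In particular, if $[\mathrm{Id}|_{G(a)},\mathrm{Id}|_{G'(a')}]\in\Phi_q(\mathcal{U})$ for some letters $a\in\mathfrak{A}$, $a'\in\mathfrak{A}'$, then $K$ and $K'$ have $\mathcal{C}^{1+\alpha}$ stable intersection.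
   Context: Fix $\alpha\in(0,1)$. For a linear map $A$, $\|A\|_{op}=\sup_{|v|=1}|Av|$, $m(A)=\inf_{|v|=1}|Av|$. $\mathrm{Aff}(d,\mathbb{R})$ is the group of invertible affine maps of $\mathbb{R}^d$. Regular Cantor sets. A ($\mathcal{C}^{1+\alpha}$) regular Cantor set $K$ in $\mathbb{R}^d$ is given by: a finite alphabet $\mathfrak{A}$ and a set $\mathfrak{B}\subset\mathfrak{A}\times\mathfrak{A}$ of admissible pairs; pairwise disjoint compact connected sets $G(a)\subset\mathbb{R}^d$, $a\in\mathfrak{A}$; a $\mathcal{C}^{1+\alpha}$ map $g:V\to\mathbb{R}^d$ on an open neighborhood $V$ of $\bigsqcup_a G(a)$ such that $(a,b)\in\mathfrak{B}$ implies $G(b)\subset g(G(a))$ and otherwise $G(b)\cap g(G(a))=\emptyset$; each $g|_{G(a)}$ extends to a $\mathcal{C}^{1+\alpha}$ embedding (with $\mathcal{C}^{1+\alpha}$ inverse) of an open neighborhood of $G(a)$; there is $\mu\in(0,1)$ with $m(Dg(x))>\mu^{-1}$ on $V$; the one-sided subshift $\Sigma$ of admissible sequences $(a_0,a_1,\dots)$, $(a_i,a_{i+1})\in\mathfrak{B}$, is topologically mixing under the shift. Then $K=\bigcap_{n\ge0}g^{-n}(\bigsqcup_aG(a))$ and $K(a)=K\cap G(a)$. $K$ is bunched if for some $N\in\mathbb{N}$, $\|Dg^N(x)\|_{op}\,m(Dg^N(x))^{-1}\mu^{\alpha N}<1$ for all $x\in K$. Let $G^*(a)$ be the open neighborhood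 of $G(a)$ of a fixed small radius, to which $g$ extends with the same properties. Objects of $K'$ carry primes. Words and inverse branches. $\Sigma^{\mathrm{fin}}$ is the set of finite admissible words $\underline a=(a_0,\dots,a_n)$; $\Sigma^-$ is the set of admissible left-infinite sequences $\underline\theta=(\dots,\theta_{-1},\theta_0)$, with its product topology; $\underline\theta_n=(\theta_{-n},\dots,\theta_0)$; if $\theta_0=a_0$, $\underline{\theta a}=(\dots,\theta_{-1},a_0,\dots,a_n)$. For $(a,b)\in\mathfrak{B}$, $f_{(a,b)}=(g|_{G^*(a)})^{-1}$ restricted to $G^*(b)$, and $f_{\underline a}=f_{(a_0,a_1)}\circ\cdots\circ f_{(a_{n-1},a_n)}$, defined on $G^*(a_n)$. Limit geometries. Fix base points $c(a)\in K(a)$. Let $A_{\underline\theta_n}$ be the affine map with $A_{\underline\theta_n}(c(\theta_0))=f_{\underline\theta_n}(c(\theta_0))$ and linear part $Df_{\underline\theta_n}(c(\theta_0))$. For a bunched Cantor set the maps $k_n^{\underline\theta}=A_{\underline\theta_n}^{-1}\circ f_{\underline\theta_n}:G^*(\theta_0)\to\mathbb{R}^d$ converge in $\mathcal{C}^{1+\alpha}$ to an embedding $k^{\underline\theta}$ (limit geometry), and for $\theta_0=a_0$ the map $F^{\underline{\theta a}}=k^{\underline\theta}\circ f_{\underline a}\circ(k^{\underline{\theta a}})^{-1}$ is (the restriction of) an element of $\mathrm{Aff}(d,\mathbb{R})$. Configurations. $\mathcal{P}(a)$ is the space of $\mathcal{C}^{1+\alpha}$ diffeomorphisms $h:G(a)\to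 h(G(a))\subset\mathbb{R}^d$, with the $\mathcal{C}^{1+\alpha}$ topology, $\mathcal{P}=\bigcup_a\mathcal{P}(a)$. $\mathcal{Q}$ is the quotient of $\mathcal{P}\times\mathcal{P}'$ by the action $(h,h')\mapsto(A\circ h,A\circ h')$ of $\mathrm{Aff}(d,\mathbb{R})$; the class of $(h,h')$ is $[h,h']$ (a relative configuration). $\mathcal{Q}_{\mathrm{Aff}}=\mathrm{Aff}(d,\mathbb{R})\times\Sigma^-\times\Sigma'^-$ and $\Phi_q:\mathcal{Q}_{\mathrm{Aff}}\to\mathcal{Q}$, $\Phi_q(B,\underline\theta,\underline\theta')=[k^{\underline\theta},B\circ k'^{\underline\theta'}]$. An element $[h,h']$ is said to be in $\mathcal{U}$ when it is in $\Phi_q(\mathcal{U})$. Renormalization operators. $\mathcal{R}^*$ is the family of operators $T^*_{\underline a,\underline a'}$, where $\underline a\in\Sigma^{\mathrm{fin}}\cup\{\emptyset\}$, $\underline a'\in\Sigma'^{\mathrm{fin}}\cup\{\emptyset\}$, not both void, acting on those $(B,\underline\theta,\underline\theta')\in\mathcal{Q}_{\mathrm{Aff}}$ with $\theta_0=a_0$, $\theta'_0=a'_0$ (no condition for a void word) by $$T^*_{\underline a,\underline a'}(B,\underline\theta,\underline\theta')=\big((F^{\underline{\theta a}})^{-1}\circ B\circ F'^{\underline{\theta}'\underline{a}'},\ \underline{\theta a},\ \underline{\theta}'\underline{a}'\big),$$ where for a void word the corresponding $F$ is the identity and the sequence is unchanged. $\Psi^{-1}$ denotes preimage. Topology and stability.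 Two $\mathcal{C}^r$ diffeomorphisms $f_1,f_2$ between open subsets of $\mathbb{R}^d$ are $\mathcal{C}^r$-close if there is a diffeomorphism $\phi:\mathrm{Dom}(f_1)\to\mathrm{Dom}(f_2)$ $\mathcal{C}^r$-close to the identity with $f_2\circ\phi$ $\mathcal{C}^r$-close to $f_1$. A bunched Cantor set $\tilde K$ with the same symbolic type is $\mathcal{C}^{1+\alpha}$-close to $K$ if $\tilde g|_{\tilde G^*(a)}$ is $\mathcal{C}^{1+\alpha}$-close to $g|_{G^*(a)}$ for every $a$. A pair $(h,h')\in\mathcal{P}(a)\times\mathcal{P}'(a')$ (or its class $[h,h']$) is stably intersecting if $\tilde h(\tilde K(a))\cap\tilde h'(\tilde K'(a'))\neq\emptyset$ for all $(\tilde K,\tilde K')$ sufficiently $\mathcal{C}^{1+\alpha}$-close to $(K,K')$ and all configurations $\tilde h,\tilde h'$ of the pieces $\tilde G(a),\tilde G'(a')$ sufficiently $\mathcal{C}^{1+\alpha}$-close to $h,h'$ on the common domains. $K,K'$ have $\mathcal{C}^{1+\alpha}$ stable intersection if $\tilde K\cap\tilde K'\ne\emptyset$ for all $(\tilde K,\tilde K')$ sufficiently $\mathcal{C}^{1+\alpha}$-close to $(K,K')$. *)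

theory Defs
  imports "HOL-Analysis.Analysis"
begin

subsection \<open>Linear and affine maps\<close>

text \<open>The operator norm is \<^const>\<open>onorm\<close>.\<close>

definition conorm :: "('v::euclidean_space \<Rightarrow> 'v) \<Rightarrow> real" where
  "conorm A = (INF v\<in>sphere 0 1. norm (A v))"

definition Aff :: "('v::euclidean_space \<Rightarrow> 'v) set" where
  "Aff = {A. \<exists>L t. linear L \<and> bij L \<and> A = (\<lambda>x. L x + t)}"

text \<open>The usual topology of the affine group: an affine map is identified with its linear part and
  its translation vector.\<close>

definition Aff_topology :: "('v::euclidean_space \<Rightarrow> 'v) topology" where
  "Aff_topology = pullback_topology Aff (\<lambda>A. (Blinfun (\<lambda>v. A v - A 0), A 0)) euclidean"

subsection \<open>Hoelder differentiable maps\<close>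

abbreviation deriv_at :: "('v::euclidean_space \<Rightarrow> 'v) \<Rightarrow> 'v \<Rightarrow> 'v \<Rightarrow> 'v" where
  "deriv_at f x \<equiv> frechet_derivative f (at x)"

text \<open>Hoelder continuity of the derivative is required locally, that is, uniformly on compact
  subsets of the open domain.\<close>

definition C1a_on :: "real \<Rightarrow> 'v::euclidean_space set \<Rightarrow> ('v \<Rightarrow> 'v) \<Rightarrow> bool" where
  "C1a_on \<alpha> U f \<longleftrightarrow> open U \<and> f differentiable_on U \<and>
     (\<forall>S. compact S \<and> S \<subseteq> U \<longrightarrow>
        (\<exists>C. \<forall>x\<in>S. \<forall>y\<in>S. onorm (\<lambda>v. deriv_at f x v - deriv_at f y v) \<le> C * dist x y powr \<alpha>))"

definition C1a_embedding :: "real \<Rightarrow> 'v::euclidean_space set \<Rightarrow> ('v \<Rightarrow> 'v) \<Rightarrow> bool" where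
  "C1a_embedding \<alpha> U f \<longleftrightarrow> C1a_on \<alpha> U f \<and> inj_on f U \<and> C1a_on \<alpha> (f ` U) (inv_into U f)"

definition C1a_close ::
  "real \<Rightarrow> real \<Rightarrow> 'v::euclidean_space set \<Rightarrow> ('v \<Rightarrow> 'v) \<Rightarrow> ('v \<Rightarrow> 'v) \<Rightarrow> bool" where
  "C1a_close \<alpha> \<epsilon> U f1 f2 \<longleftrightarrow> C1a_on \<alpha> U f1 \<and> C1a_on \<alpha> U f2 \<and>
     (\<forall>x\<in>U. dist (f1 x) (f2 x) < \<epsilon>) \<and>
     (\<forall>x\<in>U. onorm (\<lambda>v. deriv_at f1 x v - deriv_at f2 x v) < \<epsilon>) \<and>
     (\<forall>x\<in>U. \<forall>y\<in>U. onorm (\<lambda>v. (deriv_at f1 x v - deriv_at f2 x v)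
                              - (deriv_at f1 y v - deriv_at f2 y v)) \<le> \<epsilon> * dist x y powr \<alpha>)"

text \<open>Closeness of diffeomorphisms whose domains \<open>D1\<close> and \<open>D2\<close> may differ.\<close>

definition diffeo_close ::
  "real \<Rightarrow> real \<Rightarrow> 'v::euclidean_space set \<Rightarrow> ('v \<Rightarrow> 'v) \<Rightarrow> 'v set \<Rightarrow> ('v \<Rightarrow> 'v) \<Rightarrow> bool" where
  "diffeo_close \<alpha> \<epsilon> D1 f1 D2 f2 \<longleftrightarrow>
     (\<exists>\<phi>. C1a_embedding \<alpha> D1 \<phi> \<and> \<phi> ` D1 = D2 \<and>
          C1a_close \<alpha> \<epsilon> D1 id \<phi> \<and> C1a_close \<alpha> \<epsilon> D1 f1 (f2 \<circ> \<phi>))"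

subsection \<open>Regular and bunched Cantor sets\<close>

text \<open>\<open>nbhd\<close> is the open set on which the expanding map \<open>gmap\<close> is considered, and \<open>radius\<close> is the
  radius of the neighbourhoods \<open>star a\<close> of the pieces.\<close>

record ('a, 'v) cantor =
  letters :: "'a set"
  pairs :: "('a \<times> 'a) set"
  piece :: "'a \<Rightarrow> 'v set"
  nbhd :: "'v set"
  gmap :: "'v \<Rightarrow> 'v"
  radius :: real

definition subshift :: "('a, 'v) cantor \<Rightarrow> (nat \<Rightarrow> 'a) set" where
  "subshift K = {s. \<forall>i. s i \<in> letters K \<and> (s i, s (Suc i)) \<in> pairs K}"

definition subshift_topology :: "('a, 'v) cantor \<Rightarrow> (nat \<Rightarrow> 'a) topology" where
  "subshift_topology K =
     subtopology (product_topology (\<lambda>_. discrete_topology (letters K)) UNIV) (subshift K)"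

definition topologically_mixing :: "'x topology \<Rightarrow> ('x \<Rightarrow> 'x) \<Rightarrow> bool" where
  "topologically_mixing X T \<longleftrightarrow>
     (\<forall>U V. openin X U \<and> U \<noteq> {} \<and> openin X V \<and> V \<noteq> {} \<longrightarrow>
        (\<exists>N. \<forall>n\<ge>N. (T ^^ n) ` U \<inter> V \<noteq> {}))"

definition expands_by :: "real \<Rightarrow> ('a, 'v::euclidean_space) cantor \<Rightarrow> bool" where
  "expands_by \<mu> K \<longleftrightarrow> 0 < \<mu> \<and> \<mu> < 1 \<and> (\<forall>x\<in>nbhd K. conorm (deriv_at (gmap K) x) > 1 / \<mu>)"

definition regular_cantor :: "real \<Rightarrow> ('a, 'v::euclidean_space) cantor \<Rightarrow> bool" where
  "regular_cantor \<alpha> K \<longleftrightarrow>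
     finite (letters K) \<and> pairs K \<subseteq> letters K \<times> letters K \<and>
     (\<forall>a\<in>letters K. compact (piece K a) \<and> connected (piece K a) \<and> piece K a \<noteq> {}) \<and>
     disjoint_family_on (piece K) (letters K) \<and>
     (\<Union>a\<in>letters K. piece K a) \<subseteq> nbhd K \<and>
     C1a_on \<alpha> (nbhd K) (gmap K) \<and>
     (\<forall>a\<in>letters K. \<forall>b\<in>letters K.
        if (a, b) \<in> pairs K then piece K b \<subseteq> gmap K ` piece K a
        else piece K b \<inter> gmap K ` piece K a = {}) \<and>
     (\<forall>a\<in>letters K. \<exists>W e. piece K a \<subseteq> W \<and> C1a_embedding \<alpha> W e \<and>
        (\<forall>x\<in>piece K a. e x = gmap K x)) \<and>
     (\<exists>\<mu>. expands_by \<mu> K) \<and>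
     topologically_mixing (subshift_topology K) (\<lambda>s i. s (Suc i))"

definition cantor_set :: "('a, 'v) cantor \<Rightarrow> 'v set" where
  "cantor_set K = (\<Inter>n. (gmap K ^^ n) -` (\<Union>a\<in>letters K. piece K a))"

definition cantor_piece :: "('a, 'v) cantor \<Rightarrow> 'a \<Rightarrow> 'v set" where
  "cantor_piece K a = cantor_set K \<inter> piece K a"

definition star :: "('a, 'v::euclidean_space) cantor \<Rightarrow> 'a \<Rightarrow> 'v set" where
  "star K a = (\<Union>x\<in>piece K a. ball x (radius K))"

text \<open>The radius is small enough for the map and the pieces to keep their properties.\<close>

definition good_radius :: "real \<Rightarrow> ('a, 'v::euclidean_space) cantor \<Rightarrow> bool" where
  "good_radius \<alpha> K \<longleftrightarrow> 0 < radius K \<and>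
     (\<Union>a\<in>letters K. star K a) \<subseteq> nbhd K \<and>
     disjoint_family_on (star K) (letters K) \<and>
     (\<forall>a\<in>letters K. C1a_embedding \<alpha> (star K a) (gmap K)) \<and>
     (\<forall>a\<in>letters K. \<forall>b\<in>letters K.
        if (a, b) \<in> pairs K then star K b \<subseteq> gmap K ` star K a
        else star K b \<inter> gmap K ` star K a = {})"

text \<open>The bunching inequality fails for \<open>N = 0\<close> unless the Cantor set is empty.\<close>

definition bunched_cantor :: "real \<Rightarrow> ('a, 'v::euclidean_space) cantor \<Rightarrow> bool" where
  "bunched_cantor \<alpha> K \<longleftrightarrow> regular_cantor \<alpha> K \<and> good_radius \<alpha> K \<and>
     (\<exists>\<mu>. expands_by \<mu> K \<and>
        (\<exists>N::nat. \<forall>x\<in>cantor_set K.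
           onorm (deriv_at (gmap K ^^ N) x) * inverse (conorm (deriv_at (gmap K ^^ N) x))
             * \<mu> powr (\<alpha> * real N) < 1))"

subsection \<open>Words and inverse branches\<close>

definition words :: "('a, 'v) cantor \<Rightarrow> 'a list set" where
  "words K = {w. w \<noteq> [] \<and> set w \<subseteq> letters K \<and> successively (\<lambda>a b. (a, b) \<in> pairs K) w}"

text \<open>A left-infinite sequence \<open>(\<dots>, \<theta>\<^sub>-\<^sub>1, \<theta>\<^sub>0)\<close> is stored as \<open>\<theta> :: nat \<Rightarrow> 'a\<close>, where \<open>\<theta> i\<close>
  is the entry of index \<open>-i\<close>.\<close>

definition past :: "('a, 'v) cantor \<Rightarrow> (nat \<Rightarrow> 'a) set" where
  "past K = {\<theta>. \<forall>i. \<theta> i \<in> letters K \<and> (\<theta> (Suc i), \<theta> i) \<in> pairs K}"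

definition past_topology :: "('a, 'v) cantor \<Rightarrow> (nat \<Rightarrow> 'a) topology" where
  "past_topology K =
     subtopology (product_topology (\<lambda>_. discrete_topology (letters K)) UNIV) (past K)"

definition truncate :: "(nat \<Rightarrow> 'a) \<Rightarrow> nat \<Rightarrow> 'a list" where
  "truncate \<theta> n = map \<theta> (rev [0..<Suc n])"

text \<open>In \<open>append_word \<theta> w\<close> the last entry of \<open>\<theta>\<close> and the first letter of \<open>w\<close> are assumed equal
  and are merged.\<close>

definition append_word :: "(nat \<Rightarrow> 'a) \<Rightarrow> 'a list \<Rightarrow> nat \<Rightarrow> 'a" where
  "append_word \<theta> w =
     (if w = [] then \<theta>
      else (\<lambda>i. if i < length w then rev w ! i else \<theta> (Suc i - length w)))"

fun branch :: "('a, 'v::euclidean_space) cantor \<Rightarrow> 'a list \<Rightarrow> 'v \<Rightarrow> 'v" where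
  "branch K (a # b # w) = inv_into (star K a) (gmap K) \<circ> branch K (b # w)"
| "branch K [a] = id"
| "branch K [] = id"

subsection \<open>Limit geometries\<close>

definition base_points :: "('a, 'v) cantor \<Rightarrow> ('a \<Rightarrow> 'v) \<Rightarrow> bool" where
  "base_points K c \<longleftrightarrow> (\<forall>a\<in>letters K. c a \<in> cantor_piece K a)"

definition affine_part ::
  "('a, 'v::euclidean_space) cantor \<Rightarrow> ('a \<Rightarrow> 'v) \<Rightarrow> (nat \<Rightarrow> 'a) \<Rightarrow> nat \<Rightarrow> 'v \<Rightarrow> 'v" where
  "affine_part K c \<theta> n =
     (let f = branch K (truncate \<theta> n); p = c (\<theta> 0) in (\<lambda>x. f p + deriv_at f p (x - p)))"

definition limit_geometry ::
  "('a, 'v::euclidean_space) cantor \<Rightarrow> ('a \<Rightarrow> 'v) \<Rightarrow> (nat \<Rightarrow> 'a) \<Rightarrow> 'v \<Rightarrow> 'v" where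
  "limit_geometry K c \<theta> x =
     lim (\<lambda>n. (inv (affine_part K c \<theta> n) \<circ> branch K (truncate \<theta> n)) x)"

text \<open>The affine map extending \<open>k\<^sup>\<theta> \<circ> f\<^sub>w \<circ> (k\<^sup>\<theta>\<^sup>w)\<^sup>-\<^sup>1\<close>; it is unique because the set on which it is
  prescribed is open and nonempty.\<close>

definition transition ::
  "('a, 'v::euclidean_space) cantor \<Rightarrow> ('a \<Rightarrow> 'v) \<Rightarrow> (nat \<Rightarrow> 'a) \<Rightarrow> 'a list \<Rightarrow> 'v \<Rightarrow> 'v" where
  "transition K c \<theta> w =
     (if w = [] then id
      else (let k = limit_geometry K c \<theta>; l = limit_geometry K c (append_word \<theta> w); D = star K (last w)
            in THE A. A \<in> Aff \<and> (\<forall>y\<in>l ` D. A y = (k \<circ> branch K w \<circ> inv_into D l) y)))"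

subsection \<open>Configurations\<close>

text \<open>A configuration of the piece \<open>a\<close> is a pair \<open>(a, h)\<close>, where \<open>h\<close> is an embedding of some
  neighbourhood of the compact set \<open>piece K a\<close>. Only the values and the derivative of \<open>h\<close> on
  \<open>piece K a\<close> matter (the derivative is determined by the values if the piece is the closure of its
  interior): the relation \<open>aff_rel\<close> below identifies configurations with the same values and
  derivatives there.\<close>

definition configs :: "real \<Rightarrow> ('a, 'v::euclidean_space) cantor \<Rightarrow> ('a \<times> ('v \<Rightarrow> 'v)) set" where
  "configs \<alpha> K =
     {(a, h). a \<in> letters K \<and> (\<exists>W. piece K a \<subseteq> W \<and> C1a_embedding \<alpha> W h)}"

definition same_on :: "'v::euclidean_space set \<Rightarrow> ('v \<Rightarrow> 'v) \<Rightarrow> ('v \<Rightarrow> 'v) \<Rightarrow> bool" where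
  "same_on S h l \<longleftrightarrow> (\<forall>x\<in>S. h x = l x \<and> deriv_at h x = deriv_at l x)"

definition aff_rel ::
  "real \<Rightarrow> ('a, 'v::euclidean_space) cantor \<Rightarrow> ('b, 'v) cantor \<Rightarrow>
   ((('a \<times> ('v \<Rightarrow> 'v)) \<times> ('b \<times> ('v \<Rightarrow> 'v))) \<times> (('a \<times> ('v \<Rightarrow> 'v)) \<times> ('b \<times> ('v \<Rightarrow> 'v)))) set" where
  "aff_rel \<alpha> K K' =
     {(((a, h), (a', h')), ((b, l), (b', l'))).
        (a, h) \<in> configs \<alpha> K \<and> (a', h') \<in> configs \<alpha> K' \<and>
        (b, l) \<in> configs \<alpha> K \<and> (b', l') \<in> configs \<alpha> K' \<and>
        b = a \<and> b' = a' \<and>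
        (\<exists>A\<in>Aff. same_on (piece K a) l (A \<circ> h) \<and> same_on (piece K' a') l' (A \<circ> h'))}"

definition relative_config ::
  "real \<Rightarrow> ('a, 'v::euclidean_space) cantor \<Rightarrow> ('b, 'v) cantor \<Rightarrow>
   'a \<times> ('v \<Rightarrow> 'v) \<Rightarrow> 'b \<times> ('v \<Rightarrow> 'v) \<Rightarrow> (('a \<times> ('v \<Rightarrow> 'v)) \<times> ('b \<times> ('v \<Rightarrow> 'v))) set" where
  "relative_config \<alpha> K K' p p' = aff_rel \<alpha> K K' `` {(p, p')}"

type_synonym ('a, 'b, 'v) affine_config = "('v \<Rightarrow> 'v) \<times> (nat \<Rightarrow> 'a) \<times> (nat \<Rightarrow> 'b)"

definition QAff_topology ::
  "('a, 'v::euclidean_space) cantor \<Rightarrow> ('b, 'v) cantor \<Rightarrow> ('a, 'b, 'v) affine_config topology" where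
  "QAff_topology K K' =
     prod_topology Aff_topology (prod_topology (past_topology K) (past_topology K'))"

definition Phi_q ::
  "real \<Rightarrow> ('a, 'v::euclidean_space) cantor \<Rightarrow> ('a \<Rightarrow> 'v) \<Rightarrow> ('b, 'v) cantor \<Rightarrow> ('b \<Rightarrow> 'v) \<Rightarrow>
   ('a, 'b, 'v) affine_config \<Rightarrow> (('a \<times> ('v \<Rightarrow> 'v)) \<times> ('b \<times> ('v \<Rightarrow> 'v))) set" where
  "Phi_q \<alpha> K c K' c' = (\<lambda>(B, \<theta>, \<theta>').
     relative_config \<alpha> K K'
       (\<theta> 0, limit_geometry K c \<theta>) (\<theta>' 0, B \<circ> limit_geometry K' c' \<theta>'))"

subsection \<open>Renormalization operators\<close>

definition renorm ::
  "('a, 'v::euclidean_space) cantor \<Rightarrow> ('a \<Rightarrow> 'v) \<Rightarrow> ('b, 'v) cantor \<Rightarrow> ('b \<Rightarrow> 'v) \<Rightarrow>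
   'a list \<Rightarrow> 'b list \<Rightarrow> ('a, 'b, 'v) affine_config \<rightharpoonup> ('a, 'b, 'v) affine_config" where
  "renorm K c K' c' w w' = (\<lambda>(B, \<theta>, \<theta>').
     if B \<in> Aff \<and> \<theta> \<in> past K \<and> \<theta>' \<in> past K' \<and>
        (w \<noteq> [] \<longrightarrow> \<theta> 0 = hd w) \<and> (w' \<noteq> [] \<longrightarrow> \<theta>' 0 = hd w')
     then Some (inv (transition K c \<theta> w) \<circ> B \<circ> transition K' c' \<theta>' w',
                append_word \<theta> w, append_word \<theta>' w')
     else None)"

text \<open>The void word is \<open>[]\<close>. A one-letter word acts exactly like the void word (its inverse branch
  is the identity), so the requirement that the two words be not both void has to exclude it too:
  otherwise the identity would be a renormalization operator. Therefore the nonvoid words used here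
  have at least two letters.\<close>

definition renorm_operators ::
  "('a, 'v::euclidean_space) cantor \<Rightarrow> ('a \<Rightarrow> 'v) \<Rightarrow> ('b, 'v) cantor \<Rightarrow> ('b \<Rightarrow> 'v) \<Rightarrow>
   (('a, 'b, 'v) affine_config \<rightharpoonup> ('a, 'b, 'v) affine_config) set" where
  "renorm_operators K c K' c' =
     {renorm K c K' c' w w' | w w'.
        (w = [] \<or> w \<in> words K \<and> length w \<ge> 2) \<and>
        (w' = [] \<or> w' \<in> words K' \<and> length w' \<ge> 2) \<and>
        \<not> (w = [] \<and> w' = [])}"

subsection \<open>Stable intersection\<close>

definition cantor_close ::
  "real \<Rightarrow> real \<Rightarrow> ('a, 'v::euclidean_space) cantor \<Rightarrow> ('a, 'v) cantor \<Rightarrow> bool" where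
  "cantor_close \<alpha> \<epsilon> K L \<longleftrightarrow>
     bunched_cantor \<alpha> L \<and> letters L = letters K \<and> pairs L = pairs K \<and>
     (\<forall>a\<in>letters K. diffeo_close \<alpha> \<epsilon> (star K a) (gmap K) (star L a) (gmap L))"

text \<open>Closeness of configurations of \<open>piece K a\<close> and of the perturbed piece \<open>piece L a\<close> is measured
  on a common domain \<open>W\<close>, an open neighbourhood of \<open>piece K a\<close> embedded by \<open>h\<close>. The neighbourhood
  may be prescribed arbitrarily (small); the size \<open>\<epsilon>\<close> of the perturbations may depend on it.\<close>

definition stably_intersecting ::
  "real \<Rightarrow> ('a, 'v::euclidean_space) cantor \<Rightarrow> ('b, 'v) cantor \<Rightarrow>
   'a \<times> ('v \<Rightarrow> 'v) \<Rightarrow> 'b \<times> ('v \<Rightarrow> 'v) \<Rightarrow> bool" where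
  "stably_intersecting \<alpha> K K' = (\<lambda>(a, h) (a', h').
     \<forall>W W'. piece K a \<subseteq> W \<and> C1a_embedding \<alpha> W h \<and> piece K' a' \<subseteq> W' \<and> C1a_embedding \<alpha> W' h' \<longrightarrow>
       (\<exists>\<epsilon>>0. \<forall>L L' l l'.
          cantor_close \<alpha> \<epsilon> K L \<and> cantor_close \<alpha> \<epsilon> K' L' \<and>
          (a, l) \<in> configs \<alpha> L \<and> (a', l') \<in> configs \<alpha> L' \<and>
          C1a_close \<alpha> \<epsilon> W h l \<and> C1a_close \<alpha> \<epsilon> W' h' l' \<longrightarrow>
          l ` cantor_piece L a \<inter> l' ` cantor_piece L' a' \<noteq> {}))"

definition stable_intersection ::
  "real \<Rightarrow> ('a, 'v::euclidean_space) cantor \<Rightarrow> ('b, 'v) cantor \<Rightarrow> bool" where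
  "stable_intersection \<alpha> K K' \<longleftrightarrow>
     (\<exists>\<epsilon>>0. \<forall>L L'. cantor_close \<alpha> \<epsilon> K L \<and> cantor_close \<alpha> \<epsilon> K' L' \<longrightarrow>
        cantor_set L \<inter> cantor_set L' \<noteq> {})"

end

theory Submission
  imports Defs
begin

text \<open>
  Renormalizing a pair of configured Cantor sets means to pass to the subpieces with longer words and
  to look at their relative position in the affine frame of the first. While the relative position
  stays in the bounded set \<open>U\<close>, the distance of the two subpieces is at most a multiple of their size,
  and the covering condition provides the next words. The sizes tend to \<open>0\<close>, so the two nested
  sequences of subpieces shrink to a common point (\<open>tracked_pair_intersects\<close>).

  For stability, the same must work for perturbed Cantor sets and for configurations that are
  not affine copies of limit geometries. These are never compared in a function space.
  Instead, the subpiece with word \<open>u\<close> of a configuration \<open>l\<close> is given the frame \<open>F u\<close>, the tangent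
  affine map at the base point of \<open>l\<close> composed with the inverse branch of \<open>u\<close>. Renormalization only sees the
  quotients \<open>inv (F u) \<circ> F (u @ tl w)\<close>, and it is enough to show that they are close to the
  transition maps of the unperturbed limit geometries, with an error that does not depend on the length of \<open>u\<close>
  (\<open>shadowing\<close>). By compactness, the covering condition leaves room for such an error (\<open>uniform_covering\<close>).

  The uniform error bound comes from bunching. By \<open>normalized_comp_close\<close>, composing on the left with one more
  map changes the normalized branch by the product of the oscillation of the derivative of
  that map with the distortion of the branch; after \<open>n\<close> steps, Hoelder continuity bounds the first
  factor by a multiple of \<open>\<mu> powr (\<alpha> * n)\<close>, and bunching makes the product decay exponentially. So only
  the last letters of \<open>u\<close> matter, up to a small error, and for finitely many words continuity suffices.
  The same estimate for the unperturbed Cantor set gives the convergence of limit geometries and the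
  existence and continuity of the transition maps (\<open>limit_geometry_has_derivative\<close>, \<open>transition_approx\<close>,
  \<open>limit_transition_conjugates\<close>).

  Two facts make this uniform over the perturbations: their inverse branches are defined on fixed
  neighbourhoods of the unperturbed pieces, with common constants (\<open>perturbed_branches\<close>), and the bunching
  inequality for words of all lengths persists (\<open>bunched_perturbation\<close>).
\<close>

section \<open>Derivatives and the mean value inequality\<close>

lemma expanding_linear_inverse:
  fixes T :: "'v::euclidean_space \<Rightarrow> 'v"
  assumes "linear T" "\<And>v. m * norm v \<le> norm (T v)" "0 < m"
  shows "bij T" "linear (inv T)" "inv T (T v) = v" "T (inv T v) = v" "norm (inv T v) \<le> norm v / m"
proof -
  have "inj T"
    unfolding linear_injective_0[OF assms(1)]
  proof (intro allI impI)
    fix v assume "T v = 0"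
    then have "m * norm v \<le> 0" using assms(2)[of v] by simp
    then show "v = 0" using assms(3) by (simp add: mult_le_0_iff)
  qed
  then show b: "bij T"
    using assms(1) linear_injective_imp_surjective by (auto simp: bij_def)
  show "inv T (T v) = v" using b by (simp add: bij_is_inj)
  show e: "T (inv T v) = v" by (simp add: b bij_is_surj surj_f_inv_f)
  show "linear (inv T)"
    by (rule inj_linear_imp_inv_linear[OF assms(1) \<open>inj T\<close>])
  show "norm (inv T v) \<le> norm v / m"
    using assms(2)[of "inv T v"] assms(3) by (simp add: e field_simps)
qed

lemma norm_le_of_onorm_le:
  fixes A B :: "'v::euclidean_space \<Rightarrow> 'v"
  assumes "linear A" "linear B" "onorm (\<lambda>v. A v - B v) \<le> e"
  shows "norm (A v - B v) \<le> e * norm v"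
proof -
  have "bounded_linear (\<lambda>v. A v - B v)"
    using assms by (simp add: bounded_linear_sub linear_conv_bounded_linear)
  then have "norm (A v - B v) \<le> onorm (\<lambda>v. A v - B v) * norm v"
    by (rule onorm)
  then show ?thesis using assms(3)
    by (meson mult_right_mono norm_ge_zero order_trans)
qed

lemma frechet_has_derivative:
  assumes "f differentiable at x"
  shows "(f has_derivative frechet_derivative f (at x)) (at x)"
  using assms frechet_derivative_works by blast

lemma deriv_at_eqI: "(f has_derivative f') (at x) \<Longrightarrow> deriv_at f x = f'"
  by (metis frechet_derivative_at)

lemma linear_deriv_at: "f differentiable at x \<Longrightarrow> linear (deriv_at f x)"
  by (simp add: linear_frechet_derivative)

lemma lipschitz_on_convex:
  fixes e :: "'v::euclidean_space \<Rightarrow> 'v"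
  assumes "convex S" "\<And>x. x \<in> S \<Longrightarrow> (e has_derivative e' x) (at x)"
    "\<And>x v. x \<in> S \<Longrightarrow> norm (e' x v) \<le> B * norm v" "x \<in> S" "y \<in> S"
  shows "norm (e x - e y) \<le> B * norm (x - y)"
  by (rule differentiable_bound[OF assms(1) _ _ assms(4,5), of e e'])
    (auto intro: assms onorm_le has_derivative_at_withinI)

text \<open>A substitute for the intrinsic diameter of an open set that need not be convex: the mean value
inequality holds on \<open>S\<close> with \<open>M\<close> in the place of the distance of the two points. Defining the
number by this use of it avoids paths and their lengths.\<close>

definition path_diam_le :: "'v::euclidean_space set \<Rightarrow> real \<Rightarrow> bool" where
  "path_diam_le S M \<longleftrightarrow> 0 \<le> M \<and>
     (\<forall>(e::'v \<Rightarrow> 'v) e' B.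
        0 \<le> B \<and> (\<forall>x\<in>S. (e has_derivative e' x) (at x) \<and> (\<forall>v. norm (e' x v) \<le> B * norm v)) \<longrightarrow>
        (\<forall>x\<in>S. \<forall>y\<in>S. norm (e x - e y) \<le> M * B))"

definition thicken :: "real \<Rightarrow> 'v::metric_space set \<Rightarrow> 'v set" where
  "thicken r A = (\<Union>x\<in>A. ball x r)"

lemma open_thicken: "open (thicken r A)"
  by (auto simp: thicken_def)

lemma subset_thicken: "0 < r \<Longrightarrow> A \<subseteq> thicken r A"
  by (auto simp: thicken_def)

lemma thicken_mono: "r \<le> s \<Longrightarrow> thicken r A \<subseteq> thicken s A"
  by (force simp: thicken_def)

lemma path_diam_leD:
  fixes e :: "'v::euclidean_space \<Rightarrow> 'v"
  assumes "path_diam_le S M" "0 \<le> B"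
    "\<And>x. x \<in> S \<Longrightarrow> (e has_derivative e' x) (at x)"
    "\<And>x v. x \<in> S \<Longrightarrow> norm (e' x v) \<le> B * norm v" "x \<in> S" "y \<in> S"
  shows "norm (e x - e y) \<le> M * B"
proof -
  have "0 \<le> B \<and> (\<forall>x\<in>S. (e has_derivative e' x) (at x) \<and> (\<forall>v. norm (e' x v) \<le> B * norm v)) \<longrightarrow>
        (\<forall>x\<in>S. \<forall>y\<in>S. norm (e x - e y) \<le> M * B)"
    by (rule assms(1)[unfolded path_diam_le_def, THEN conjunct2, THEN spec, THEN spec, THEN spec])
  then show ?thesis using assms(2-) by simp
qed

text \<open>Call two points of \<open>A\<close> related if the increments between them of all maps with derivative at most
\<open>B\<close> have a common bound, proportional to \<open>B\<close>. Inside a ball of radius \<open>r\<close> around a point of \<open>A\<close> the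
usual mean value inequality applies, so this equivalence relation has open classes in \<open>A\<close>, and
connectedness leaves one class. Finitely many balls cover \<open>A\<close>, which makes the bound uniform.\<close>

lemma path_diam_le_thicken:
  fixes A :: "'v::euclidean_space set"
  assumes "compact A" "connected A" "0 < r"
  shows "\<exists>M. path_diam_le (thicken r A) M"
proof (cases "A = {}")
  case True
  then show ?thesis by (intro exI[of _ 0]) (auto simp: path_diam_le_def thicken_def)
next
  case False
  then obtain p where p: "p \<in> A" by auto
  define ok where "ok = (\<lambda>(e::'v \<Rightarrow> 'v) B. 0 \<le> B \<and> (\<exists>e'. \<forall>x\<in>thicken r A.
     (e has_derivative e' x) (at x) \<and> (\<forall>v. norm (e' x v) \<le> B * norm v)))"
  define R where "R = (\<lambda>x y. \<exists>M\<ge>0. \<forall>e B. ok e B \<longrightarrow> norm (e x - e y) \<le> M * B)"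
  have lip: "norm (e x - e y) \<le> B * norm (x - y)" if "ok e B" "a \<in> A" "x \<in> ball a r" "y \<in> ball a r" for e B a x y
  proof -
    note ok = that(1)
    obtain e' where e': "\<forall>x\<in>thicken r A. (e has_derivative e' x) (at x) \<and> (\<forall>v. norm (e' x v) \<le> B * norm v)"
      using ok unfolding ok_def by auto
    have "ball a r \<subseteq> thicken r A" using that(2) by (auto simp: thicken_def)
    then show ?thesis
      using e' that by (intro lipschitz_on_convex[of "ball a r" e e']) auto
  qed
  have Bpos: "0 \<le> B" if "ok e B" for e B using that by (auto simp: ok_def)
  have loc: "R x y" if "x \<in> A" "y \<in> ball x r" for x y
    unfolding R_def
  proof (intro exI[of _ r] conjI allI impI)
    fix e B assume ok: "ok e B"
    have "norm (e x - e y) \<le> B * norm (x - y)"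
      using lip[OF ok that(1) _ that(2), of x] that assms(3) by auto
    also have "\<dots> \<le> r * B" using that(2) Bpos[OF ok] by (simp add: dist_norm mult.commute mult_left_mono)
    finally show "norm (e x - e y) \<le> r * B" .
  qed (use assms in auto)
  have trans: "R x z" if "R x y" "R y z" for x y z
  proof -
    obtain M1 M2 where M: "M1 \<ge> 0" "\<And>e B. ok e B \<Longrightarrow> norm (e x - e y) \<le> M1 * B"
       "M2 \<ge> 0" "\<And>e B. ok e B \<Longrightarrow> norm (e y - e z) \<le> M2 * B"
      using \<open>R x y\<close> \<open>R y z\<close> unfolding R_def by metis
    have "norm (e x - e z) \<le> (M1 + M2) * B" if "ok e B" for e B
      using M(2)[OF that] M(4)[OF that] norm_triangle_ineq[of "e x - e y" "e y - e z"]
      by (simp add: algebra_simps)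
    then show ?thesis unfolding R_def using M(1,3) by (intro exI[of _ "M1+M2"]) auto
  qed
  have Rp: "R p x" if "x \<in> A" for x
  proof (rule connected_equivalence_relation[OF assms(2) p that])
    show "R y x" if "R x y" for x y
      using that unfolding R_def by (simp add: norm_minus_commute)
    show "R x z" if "R x y" "R y z" for x y z using trans that by blast
    show "\<exists>T. openin (top_of_set A) T \<and> a \<in> T \<and> (\<forall>x\<in>T. R a x)" if "a \<in> A" for a
      using that loc assms(3) by (intro exI[of _ "A \<inter> ball a r"]) (auto intro: openin_open_Int)
  qed
  obtain X where X: "finite X" "X \<subseteq> A" "A \<subseteq> (\<Union>x\<in>X. ball x r)"
    using compactE_image[OF assms(1), of A "\<lambda>x. ball x r"] assms(3) by (metis (no_types, lifting) UN_I centre_in_ball open_ball subsetI)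
  have "\<forall>x\<in>X. \<exists>M\<ge>0. \<forall>e B. ok e B \<longrightarrow> norm (e p - e x) \<le> M * B"
    using Rp X(2) unfolding R_def by blast
  then obtain Mf where Mf: "\<And>x e B. x \<in> X \<Longrightarrow> Mf x \<ge> 0 \<and> (ok e B \<longrightarrow> norm (e p - e x) \<le> Mf x * B)"
    by metis
  define M0 where "M0 = (\<Sum>x\<in>X. Mf x)"
  have M0: "Mf x \<le> M0" if "x \<in> X" for x
    unfolding M0_def using that X(1) Mf by (intro member_le_sum) auto
  have M0p: "0 \<le> M0" unfolding M0_def using Mf by (intro sum_nonneg) auto
  have bd: "norm (e p - e y) \<le> (M0 + 2 * r) * B" if ok: "ok e B" and y: "y \<in> thicken r A" for e B y
  proof -
    obtain a where a: "a \<in> A" "y \<in> ball a r" using y by (auto simp: thicken_def)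
    obtain x where x: "x \<in> X" "a \<in> ball x r" using a X(3) by auto
    have "norm (e p - e x) \<le> M0 * B"
      using Mf[OF x(1), of e B] M0[OF x(1)] ok Bpos[OF ok] by (meson mult_right_mono order_trans)
    moreover have "norm (e x - e a) \<le> B * norm (x - a)"
      using lip[OF ok, of x x a] x X(2) assms(3) by auto
    moreover have "norm (e a - e y) \<le> B * norm (a - y)"
      using lip[OF ok a(1), of a y] a assms(3) by auto
    moreover have "norm (x - a) \<le> r" "norm (a - y) \<le> r" using x a by (auto simp: dist_norm)
    then have "B * norm (x - a) \<le> B * r" "B * norm (a - y) \<le> B * r"
      using Bpos[OF ok] by (auto intro: mult_left_mono)
    moreover have "norm (e p - e y) \<le> norm (e p - e x) + norm (e x - e a) + norm (e a - e y)"
      using norm_triangle_ineq[of "e p - e x" "e x - e a"] norm_triangle_ineq[of "e p - e a" "e a - e y"] by simp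
    ultimately show ?thesis by (simp add: algebra_simps)
  qed
  have "path_diam_le (thicken r A) (2 * (M0 + 2 * r))"
    unfolding path_diam_le_def
  proof (intro conjI allI impI ballI)
    fix e :: "'v \<Rightarrow> 'v" and e' B x y
    assume h: "0 \<le> B \<and> (\<forall>x\<in>thicken r A. (e has_derivative e' x) (at x) \<and> (\<forall>v. norm (e' x v) \<le> B * norm v))"
      and xy: "x \<in> thicken r A" "y \<in> thicken r A"
    have ok: "ok e B" using h unfolding ok_def by blast
    show "norm (e x - e y) \<le> 2 * (M0 + 2 * r) * B"
      using bd[OF ok xy(1)] bd[OF ok xy(2)] norm_triangle_ineq4[of "e p - e y" "e p - e x"]
      by (simp add: algebra_simps)
  qed (use M0p assms in auto)
  then show ?thesis by blast
qed

lemma path_diam_le_mono: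
  assumes "path_diam_le S M" "M \<le> M'"
  shows "path_diam_le S M'"
  unfolding path_diam_le_def
proof (intro conjI allI impI ballI)
  show "0 \<le> M'" using assms by (auto simp: path_diam_le_def)
next
  fix e :: "'a \<Rightarrow> 'a" and e' B x y
  assume h: "0 \<le> B \<and> (\<forall>x\<in>S. (e has_derivative e' x) (at x) \<and> (\<forall>v. norm (e' x v) \<le> B * norm v))"
    and "x \<in> S" "y \<in> S"
  then have "norm (e x - e y) \<le> M * B"
    by (intro path_diam_leD[OF assms(1), where e' = e']) auto
  also have "\<dots> \<le> M' * B" using assms(2) h by (simp add: mult_right_mono)
  finally show "norm (e x - e y) \<le> M' * B" .
qed

lemma closed_thickening_subset:
  fixes A :: "'v::euclidean_space set"
  assumes "compact A"
  shows "compact {x. \<exists>a\<in>A. dist a x \<le> r}" (is "compact ?C")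
proof -
  have "?C = {a + d |a d. a \<in> A \<and> d \<in> cball 0 r}"
  proof (intro equalityI subsetI)
    fix x assume "x \<in> ?C"
    then obtain a where "a \<in> A" "dist a x \<le> r" by blast
    then show "x \<in> {a + d |a d. a \<in> A \<and> d \<in> cball 0 r}"
      by (intro CollectI exI[of _ a] exI[of _ "x - a"]) (auto simp: dist_norm norm_minus_commute)
  next
    fix x assume "x \<in> {a + d |a d. a \<in> A \<and> d \<in> cball 0 r}"
    then obtain a d where "a \<in> A" "norm d \<le> r" "x = a + d" by auto
    then show "x \<in> ?C" by (intro CollectI bexI[of _ a]) (auto simp: dist_norm)
  qed
  then show ?thesis using compact_sums[OF assms compact_cball[of 0 r]] by simp
qed

section \<open>Nearby affine maps\<close>

text \<open>Distances of affine maps are measured with the weight \<open>1 + norm x\<close>, which controls linear parts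
and translations at the same time and behaves well under composition.\<close>

definition aff_near :: "real \<Rightarrow> ('v::euclidean_space \<Rightarrow> 'v) \<Rightarrow> ('v \<Rightarrow> 'v) \<Rightarrow> bool" where
  "aff_near \<eta> A B \<longleftrightarrow> (\<forall>x. norm (A x - B x) \<le> \<eta> * (1 + norm x))"

lemma aff_nearD: "aff_near \<eta> A B \<Longrightarrow> norm (A x - B x) \<le> \<eta> * (1 + norm x)"
  by (simp add: aff_near_def)

lemma aff_near_sym: "aff_near \<eta> A B \<Longrightarrow> aff_near \<eta> B A"
  by (simp add: aff_near_def norm_minus_commute)

lemma aff_near_trans:
  assumes "aff_near a A B" "aff_near b B C"
  shows "aff_near (a + b) A C"
  unfolding aff_near_def
proof
  fix x :: 'a
  show "norm (A x - C x) \<le> (a + b) * (1 + norm x)"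
    using norm_triangle_ineq[of "A x - B x" "B x - C x"] aff_nearD[OF assms(1), of x]
      aff_nearD[OF assms(2), of x]
    by (simp add: algebra_simps)
qed

lemma aff_near_mono:
  assumes "aff_near a A B" "a \<le> b"
  shows "aff_near b A B"
  unfolding aff_near_def
proof
  fix x :: 'a
  have "a * (1 + norm x) \<le> b * (1 + norm x)" using assms(2) by (intro mult_right_mono) auto
  then show "norm (A x - B x) \<le> b * (1 + norm x)"
    using aff_nearD[OF assms(1), of x] by simp
qed

lemma aff_near_refl: "0 \<le> a \<Longrightarrow> aff_near a A A"
  by (simp add: aff_near_def)

lemma AffE:
  assumes "A \<in> Aff"
  obtains L where "linear L" "bij L" "\<And>x. A x = L x + A 0" "\<And>x y. A x - A y = L (x - y)"
    "L = (\<lambda>v. A v - A 0)"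
proof -
  obtain L t where L: "linear L" "bij L" "A = (\<lambda>x. L x + t)"
    using assms by (auto simp: Aff_def)
  show thesis
    by (rule that[OF L(1,2)]) (use L in \<open>auto simp: linear_0 linear_diff\<close>)
qed

lemma AffI:
  assumes "linear T" "\<And>v. m * norm v \<le> norm (T v)" "0 < m"
  shows "(\<lambda>x. a + T (x - p)) \<in> Aff"
  unfolding Aff_def
proof (intro CollectI exI conjI)
  show "bij T" using expanding_linear_inverse[OF assms] by simp
  show "(\<lambda>x. a + T (x - p)) = (\<lambda>x. T x + (a - T p))"
    using assms(1) by (auto simp: linear_diff)
qed (fact assms(1))

lemma id_Aff: "(id::'v::euclidean_space \<Rightarrow> 'v) \<in> Aff"
  unfolding Aff_def
proof (intro CollectI exI conjI)
  show "(id::'v \<Rightarrow> 'v) = (\<lambda>x. id x + 0)" by auto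
qed (rule linear_id bij_id)+

lemma Aff_comp:
  assumes "A \<in> Aff" "B \<in> Aff"
  shows "A \<circ> B \<in> Aff"
proof -
  obtain L t L' t' where L: "linear L" "bij L" "A = (\<lambda>x. L x + t)"
      "linear L'" "bij L'" "B = (\<lambda>x. L' x + t')"
    using assms by (auto simp: Aff_def)
  have "A \<circ> B = (\<lambda>x. (L \<circ> L') x + (L t' + t))"
    using L by (auto simp: linear_add)
  then show ?thesis
    using L unfolding Aff_def
    by (intro CollectI exI[of _ "L \<circ> L'"] exI[of _ "L t' + t"]) (auto simp: bij_comp linear_compose)
qed

lemma Aff_bij: "A \<in> Aff \<Longrightarrow> bij A"
proof -
  assume "A \<in> Aff"
  then obtain L t where L: "linear L" "bij L" "A = (\<lambda>x. L x + t)"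
    by (auto simp: Aff_def)
  have "A = (\<lambda>x. x + t) \<circ> L" using L by auto
  moreover have "bij (\<lambda>x::'a. x + t)" by (rule bij_betw_byWitness[of _ "\<lambda>x. x - t"]) auto
  ultimately show ?thesis using L(2) bij_comp by blast
qed

lemma Aff_inv_simps:
  assumes "A \<in> Aff"
  shows "inv A (A x) = x" "A (inv A x) = x"
  using Aff_bij[OF assms] by (auto simp: bij_is_inj bij_is_surj surj_f_inv_f)

lemma Aff_inv:
  assumes "A \<in> Aff"
  shows "inv A \<in> Aff"
proof -
  obtain L where L: "linear L" "bij L" "\<And>x. A x = L x + A 0"
    using AffE[OF assms] by metis
  have L': "linear (inv L)" "bij (inv L)"
    using L inj_linear_imp_inv_linear[OF L(1)] bij_imp_bij_inv bij_is_inj by blast+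
  have "inv A = (\<lambda>x. inv L x + - inv L (A 0))"
  proof
    fix x
    have "A (inv L x + - inv L (A 0)) = x"
      using L(3)[of "inv L x + - inv L (A 0)"] L(1,2) by (simp add: linear_diff bij_is_surj surj_f_inv_f)
    then show "inv A x = inv L x + - inv L (A 0)"
      using Aff_inv_simps(1)[OF assms] by metis
  qed
  then show ?thesis unfolding Aff_def using L' by blast
qed

lemma Aff_bounds:
  assumes "A \<in> Aff"
  obtains k where "0 < k" "\<And>x y. k * norm (x - y) \<le> norm (A x - A y)"
    "\<And>x y. norm (A x - A y) \<le> norm (x - y) / k" "\<And>x. norm (A x) \<le> (1 + norm x) / k"
proof -
  obtain L where L: "linear L" "bij L" "\<And>x y. A x - A y = L (x - y)"
    using AffE[OF assms] by metis
  obtain B where B: "B > 0" "\<And>x. norm (L x) \<le> B * norm x"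
    using linear_bounded_pos[OF L(1)] by auto
  obtain C where C: "C > 0" "\<And>x. norm (L x) \<ge> C * norm x"
    using linear_inj_bounded_below_pos[OF L(1)] L(2) bij_is_inj by metis
  define k where "k = min C (1 / (B + norm (A 0)))"
  have pos: "0 < B + norm (A 0)" using B by (simp add: add_pos_nonneg)
  have k: "0 < k" "k \<le> C" "B + norm (A 0) \<le> 1 / k"
    using C pos by (auto simp: k_def field_simps min_def)
  show thesis
  proof (rule that[OF k(1)])
    fix x y
    show "k * norm (x - y) \<le> norm (A x - A y)"
      using C(2)[of "x - y"] k(2) L(3) by (metis mult_right_mono norm_ge_zero order_trans)
    have *: "B * norm z \<le> (1 / k) * norm z" for z :: 'a
      using k(3) by (intro mult_right_mono) (auto intro: order_trans[rotated])
    show "norm (A x - A y) \<le> norm (x - y) / k"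
      using B(2)[of "x - y"] * [of "x - y"] L(3) by simp
    have "norm (A x) \<le> norm (A x - A 0) + norm (A 0)"
      using norm_triangle_sub[of "A x" "A 0"] by simp
    also have "\<dots> \<le> B * norm x + norm (A 0)"
      using B(2)[of x] L(3)[of x 0] by simp
    also have "\<dots> \<le> (B + norm (A 0)) * (1 + norm x)"
      using B(1) by (simp add: algebra_simps)
    also have "\<dots> \<le> (1 / k) * (1 + norm x)"
      using k(3) by (intro mult_right_mono) auto
    finally show "norm (A x) \<le> (1 + norm x) / k" by simp
  qed
qed

text \<open>The linear part is recovered from the values on the unit sphere and at the origin, where the
weight is \<open>2\<close> and \<open>1\<close>; this is the origin of the factor \<open>3\<close>.\<close>

lemma aff_near_diff:
  assumes "A \<in> Aff" "B \<in> Aff" "aff_near \<eta> A B"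
  shows "norm ((A x - A y) - (B x - B y)) \<le> 3 * \<eta> * norm (x - y)"
proof -
  obtain L where L: "linear L" "\<And>x y. A x - A y = L (x - y)" using AffE[OF assms(1)] by metis
  obtain L' where L': "linear L'" "\<And>x y. B x - B y = L' (x - y)" using AffE[OF assms(2)] by metis
  have unit: "norm (L u - L' u) \<le> 3 * \<eta>" if "norm u = 1" for u
  proof -
    have "L u - L' u = (A u - B u) - (A 0 - B 0)"
      using L(2)[of u 0] L'(2)[of u 0] by (simp add: algebra_simps)
    moreover have "norm (A u - B u) \<le> 2 * \<eta>" "norm (A 0 - B 0) \<le> \<eta>"
      using aff_nearD[OF assms(3), of u] aff_nearD[OF assms(3), of 0] that by simp_all
    ultimately show ?thesis using norm_triangle_ineq4[of "A u - B u" "A 0 - B 0"] by simp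
  qed
  show ?thesis
  proof (cases "x = y")
    case False
    define u where "u = (x - y) /\<^sub>R norm (x - y)"
    have "norm u = 1" using False by (simp add: u_def)
    have xy: "x - y = norm (x - y) *\<^sub>R u" using False by (simp add: u_def)
    have "L (x - y) = norm (x - y) *\<^sub>R L u" "L' (x - y) = norm (x - y) *\<^sub>R L' u"
      by (subst xy, simp add: linear_cmul[OF L(1)] linear_cmul[OF L'(1)])+
    then have "norm ((A x - A y) - (B x - B y)) = norm (x - y) * norm (L u - L' u)"
      by (simp add: L(2) L'(2) scaleR_diff_right[symmetric])
    then show ?thesis using unit[OF \<open>norm u = 1\<close>] by (simp add: mult.commute mult_left_mono)
  qed auto
qed

lemma aff_near_lower_bound:
  assumes "A \<in> Aff" "B \<in> Aff" "aff_near \<eta> A B" "\<And>x y. k * norm (x - y) \<le> norm (B x - B y)"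
  shows "(k - 3 * \<eta>) * norm (x - y) \<le> norm (A x - A y)"
  using aff_near_diff[OF assms(1-3), of x y] assms(4)[of x y]
    norm_triangle_ineq2[of "B x - B y" "A x - A y"]
  by (simp add: algebra_simps norm_minus_commute)

text \<open>Renormalization operators act on the affine coordinate by \<open>B \<mapsto> inv F \<circ> B \<circ> G\<close>; this is the joint
continuity of that expression. If \<open>y\<close> and \<open>y0\<close> are the images of \<open>x\<close> under the two maps, then
\<open>F y - F y0\<close> is the sum of three terms that are small because \<open>B\<close>, \<open>G\<close> and \<open>F\<close> are near \<open>B0\<close>, \<open>G0\<close> and
\<open>F0\<close>, while \<open>F\<close> does not shrink \<open>y - y0\<close> much more than \<open>F0\<close> does.\<close>

lemma aff_near_conjugate:
  assumes "F0 \<in> Aff" "B0 \<in> Aff" "G0 \<in> Aff" "0 < e"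
  obtains \<eta> where "0 < \<eta>"
    "\<And>F B G. F \<in> Aff \<Longrightarrow> B \<in> Aff \<Longrightarrow> G \<in> Aff \<Longrightarrow> aff_near \<eta> F F0 \<Longrightarrow> aff_near \<eta> B B0 \<Longrightarrow> aff_near \<eta> G G0
      \<Longrightarrow> aff_near e (inv F \<circ> B \<circ> G) (inv F0 \<circ> B0 \<circ> G0)"
proof -
  obtain k where k: "0 < k" "\<And>x y. k * norm (x - y) \<le> norm (F0 x - F0 y)"
    using Aff_bounds[OF assms(1)] by metis
  obtain b where b: "0 < b" "\<And>x y. norm (B0 x - B0 y) \<le> norm (x - y) / b"
    using Aff_bounds[OF assms(2)] by metis
  obtain g where g: "0 < g" "\<And>x. norm (G0 x) \<le> (1 + norm x) / g"
    using Aff_bounds[OF assms(3)] by metis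
  obtain h where h: "0 < h" "\<And>x. norm ((inv F0 \<circ> B0 \<circ> G0) x) \<le> (1 + norm x) / h"
    using Aff_bounds[OF Aff_comp[OF Aff_comp[OF Aff_inv[OF assms(1)] assms(2)] assms(3)]] by metis
  define C where "C = 3 + 1 / g + 1 / b + 1 / h"
  have C: "0 < C" using g b h by (auto simp: C_def intro!: add_pos_pos)
  define \<eta> where "\<eta> = min 1 (min (k / 6) (e * k / (2 * C)))"
  have \<eta>: "0 < \<eta>" "\<eta> \<le> 1" "\<eta> \<le> k / 6" "\<eta> \<le> e * k / (2 * C)"
    using k assms(4) C by (auto simp: \<eta>_def)
  show thesis
  proof (rule that[OF \<eta>(1)])
    fix F B G :: "'a \<Rightarrow> 'a"
    assume A: "F \<in> Aff" "B \<in> Aff" "G \<in> Aff" and near: "aff_near \<eta> F F0" "aff_near \<eta> B B0" "aff_near \<eta> G G0"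
    show "aff_near e (inv F \<circ> B \<circ> G) (inv F0 \<circ> B0 \<circ> G0)"
      unfolding aff_near_def
    proof
      fix x
      define y y0 where "y = (inv F \<circ> B \<circ> G) x" and "y0 = (inv F0 \<circ> B0 \<circ> G0) x"
      have Fy: "F y = B (G x)" "F0 y0 = B0 (G0 x)"
        by (simp_all add: y_def y0_def Aff_inv_simps A(1) assms(1))
      have G: "norm (G x - G0 x) \<le> \<eta> * (1 + norm x)" by (rule aff_nearD[OF near(3)])
      have "norm (G x) \<le> norm (G0 x) + norm (G x - G0 x)"
        using norm_triangle_sub[of "G x" "G0 x"] by simp
      also have "\<dots> \<le> (1 + norm x) / g + 1 * (1 + norm x)"
        using g(2)[of x] order_trans[OF G mult_right_mono[OF \<eta>(2), of "1 + norm x"]] by (intro add_mono) auto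
      finally have "norm (G x) \<le> (1 + norm x) / g + 1 * (1 + norm x)" .
      moreover have "(2 + 1 / g) * (1 + norm x) = 1 + ((1 + norm x) / g + 1 * (1 + norm x)) + norm x"
        using g(1) by (simp add: field_simps)
      ultimately have Gx: "1 + norm (G x) \<le> (2 + 1 / g) * (1 + norm x)"
        using norm_ge_zero[of x] by linarith
      have "(k / 2) * norm (y - y0) \<le> (k - 3 * \<eta>) * norm (y - y0)"
        using \<eta>(3) by (intro mult_right_mono) auto
      also have "\<dots> \<le> norm (F y - F y0)"
        by (rule aff_near_lower_bound[OF A(1) assms(1) near(1) k(2)])
      also have "F y - F y0 = (B (G x) - B0 (G x)) + (B0 (G x) - B0 (G0 x)) + (F0 y0 - F y0)"
        by (simp add: Fy)
      also have "norm \<dots> \<le> norm (B (G x) - B0 (G x)) + norm (B0 (G x) - B0 (G0 x)) + norm (F0 y0 - F y0)"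
        using norm_triangle_ineq[of "(B (G x) - B0 (G x)) + (B0 (G x) - B0 (G0 x))" "F0 y0 - F y0"]
          norm_triangle_ineq[of "B (G x) - B0 (G x)" "B0 (G x) - B0 (G0 x)"] by linarith
      also have "\<dots> \<le> \<eta> * ((2 + 1 / g) * (1 + norm x)) + \<eta> * (1 + norm x) / b + \<eta> * ((1 + 1 / h) * (1 + norm x))"
      proof (intro add_mono)
        show "norm (B (G x) - B0 (G x)) \<le> \<eta> * ((2 + 1 / g) * (1 + norm x))"
          using aff_nearD[OF near(2), of "G x"] Gx \<eta>(1) by (meson less_imp_le mult_left_mono order_trans)
        show "norm (B0 (G x) - B0 (G0 x)) \<le> \<eta> * (1 + norm x) / b"
          using b(2)[of "G x" "G0 x"] G b(1) by (meson divide_right_mono less_imp_le order_trans)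
        have "norm y0 \<le> (1 + norm x) / h" using h(2)[of x] by (simp only: y0_def)
        moreover have "(1 + 1 / h) * (1 + norm x) = 1 + norm x + (1 + norm x) / h"
          using h(1) by (simp add: field_simps)
        ultimately have "1 + norm y0 \<le> (1 + 1 / h) * (1 + norm x)"
          using norm_ge_zero[of x] by linarith
        then have "\<eta> * (1 + norm y0) \<le> \<eta> * ((1 + 1 / h) * (1 + norm x))"
          using \<eta>(1) by (intro mult_left_mono) auto
        then show "norm (F0 y0 - F y0) \<le> \<eta> * ((1 + 1 / h) * (1 + norm x))"
          using aff_nearD[OF near(1), of y0] by (simp add: norm_minus_commute)
      qed
      also have "\<dots> = \<eta> * C * (1 + norm x)" by (simp add: C_def algebra_simps add_divide_distrib)
      also have "\<dots> \<le> (e * k / 2) * (1 + norm x)"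
        using \<eta>(4) C by (intro mult_right_mono) (auto simp: field_simps)
      finally have "(k / 2) * norm (y - y0) \<le> (k / 2) * (e * (1 + norm x))" by (simp add: mult_ac)
      then have "norm (y - y0) \<le> e * (1 + norm x)" using k(1) by simp
      then show "norm ((inv F \<circ> B \<circ> G) x - (inv F0 \<circ> B0 \<circ> G0) x) \<le> e * (1 + norm x)"
        by (simp add: y_def y0_def)
    qed
  qed
qed

lemma Aff_bounded_linear:
  assumes "A \<in> Aff"
  shows "bounded_linear (\<lambda>v. A v - A 0)"
proof -
  obtain L where "linear L" "L = (\<lambda>v. A v - A 0)" by (rule AffE[OF assms])
  then show ?thesis by (simp add: linear_conv_bounded_linear)
qed

text \<open>This lemma and the next one say that the sets of affine maps near a given one form a neighbourhood
base of the affine group.\<close>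

lemma Aff_topology_contains_near:
  assumes "openin Aff_topology W" "A \<in> W"
  obtains \<eta> where "0 < \<eta>" "\<And>B. B \<in> Aff \<Longrightarrow> aff_near \<eta> B A \<Longrightarrow> B \<in> W"
proof -
  let ?f = "\<lambda>A::'a \<Rightarrow> 'a. (Blinfun (\<lambda>v. A v - A 0), A 0)"
  have "\<exists>V. openin euclidean V \<and> W = ?f -` V \<inter> Aff"
    using assms(1) unfolding Aff_topology_def openin_pullback_topology .
  then obtain V where V: "open V" "W = ?f -` V \<inter> Aff" by (auto simp only: open_openin)
  have A: "A \<in> Aff" "?f A \<in> V" using assms(2) V by auto
  obtain e where e: "e > 0" "\<And>z. dist z (?f A) < e \<Longrightarrow> z \<in> V"
    using V(1) A(2) unfolding open_dist by blast
  show thesis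
  proof (rule that[of "e / 8"])
    fix B :: "'a \<Rightarrow> 'a" assume B: "B \<in> Aff" "aff_near (e / 8) B A"
    have "norm (Blinfun (\<lambda>v. B v - B 0) - Blinfun (\<lambda>v. A v - A 0)) \<le> 3 * (e / 8)"
    proof (rule norm_blinfun_bound)
      fix x
      show "norm (blinfun_apply (Blinfun (\<lambda>v. B v - B 0) - Blinfun (\<lambda>v. A v - A 0)) x) \<le> 3 * (e / 8) * norm x"
        using aff_near_diff[OF B(1) A(1) B(2), of x 0] Aff_bounded_linear[OF A(1)] Aff_bounded_linear[OF B(1)]
        by (simp add: blinfun.diff_left bounded_linear_Blinfun_apply)
    qed (use e in auto)
    moreover have "norm (B 0 - A 0) \<le> e / 8" using aff_nearD[OF B(2), of 0] by simp
    moreover have "dist (?f B) (?f A) \<le> dist (fst (?f B)) (fst (?f A)) + dist (snd (?f B)) (snd (?f A))"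
      unfolding dist_prod_def by (rule order_trans[OF sqrt_sum_squares_le_sum]) auto
    ultimately have "dist (?f B) (?f A) < e" using e(1) by (simp add: dist_norm)
    then show "B \<in> W" using e(2) B(1) V(2) by auto
  qed (use e in auto)
qed

lemma Aff_topology_near_nbhd:
  assumes "A \<in> Aff" "0 < \<eta>"
  obtains W where "openin Aff_topology W" "A \<in> W" "\<And>B. B \<in> W \<Longrightarrow> B \<in> Aff \<and> aff_near \<eta> B A"
proof -
  let ?f = "\<lambda>A::'a \<Rightarrow> 'a. (Blinfun (\<lambda>v. A v - A 0), A 0)"
  let ?W = "?f -` (ball (?f A) \<eta>) \<inter> Aff"
  have "openin Aff_topology ?W"
    unfolding Aff_topology_def openin_pullback_topology
    by (intro exI[of _ "ball (?f A) \<eta>"]) (simp add: open_openin[symmetric])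
  moreover have "A \<in> ?W" using assms by simp
  moreover have "aff_near \<eta> B A" if "B \<in> ?W" for B
    unfolding aff_near_def
  proof
    fix x
    have B: "B \<in> Aff" "dist (?f A) (?f B) < \<eta>" using that by auto
    have d: "norm (Blinfun (\<lambda>v. A v - A 0) - Blinfun (\<lambda>v. B v - B 0)) < \<eta>" "norm (A 0 - B 0) < \<eta>"
      using le_less_trans[OF dist_fst_le B(2)] le_less_trans[OF dist_snd_le B(2)] by (auto simp: dist_norm)
    have "norm ((A x - A 0) - (B x - B 0)) = norm (blinfun_apply (Blinfun (\<lambda>v. A v - A 0) - Blinfun (\<lambda>v. B v - B 0)) x)"
      using Aff_bounded_linear[OF assms(1)] Aff_bounded_linear[OF B(1)]
      by (simp add: blinfun.diff_left bounded_linear_Blinfun_apply)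
    also have "\<dots> \<le> \<eta> * norm x"
      using norm_blinfun[of "Blinfun (\<lambda>v. A v - A 0) - Blinfun (\<lambda>v. B v - B 0)" x] d(1)
      by (meson less_imp_le mult_right_mono norm_ge_zero order_trans)
    finally have "norm ((A x - A 0) - (B x - B 0)) \<le> \<eta> * norm x" .
    then show "norm (B x - A x) \<le> \<eta> * (1 + norm x)"
      using d(2) norm_triangle_ineq[of "(A x - A 0) - (B x - B 0)" "A 0 - B 0"]
      by (simp add: algebra_simps norm_minus_commute)
  qed
  ultimately show thesis using that by blast
qed

lemma topspace_Aff_topology: "topspace Aff_topology = Aff"
  by (simp add: Aff_topology_def topspace_pullback_topology)

section \<open>Maps normalized at a base point\<close>

definition tangent_map :: "('v::euclidean_space \<Rightarrow> 'v) \<Rightarrow> 'v \<Rightarrow> 'v \<Rightarrow> 'v" where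
  "tangent_map \<Phi> p = (\<lambda>x. \<Phi> p + deriv_at \<Phi> p (x - p))"

text \<open>Normalizing a long inverse branch at the base point gives the maps \<open>k\<^sub>n\<close> whose limit is the limit
geometry.\<close>

definition normalized :: "('v::euclidean_space \<Rightarrow> 'v) \<Rightarrow> 'v \<Rightarrow> 'v \<Rightarrow> 'v" where
  "normalized \<Phi> p x = inv (tangent_map \<Phi> p) (\<Phi> x)"

text \<open>The derivative of the normalized map: the derivative of \<open>\<Phi>\<close> at \<open>x\<close> relative to the one at \<open>p\<close>.\<close>

definition slope :: "('v::euclidean_space \<Rightarrow> 'v) \<Rightarrow> 'v \<Rightarrow> 'v \<Rightarrow> 'v \<Rightarrow> 'v" where
  "slope \<Phi> p x v = inv (deriv_at \<Phi> p) (deriv_at \<Phi> x v)"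

definition expanding_at :: "real \<Rightarrow> ('v::euclidean_space \<Rightarrow> 'v) \<Rightarrow> 'v \<Rightarrow> bool" where
  "expanding_at m \<Phi> x \<longleftrightarrow> 0 < m \<and> \<Phi> differentiable at x \<and> (\<forall>v. m * norm v \<le> norm (deriv_at \<Phi> x v))"

lemma expanding_at_inverse:
  assumes "expanding_at m \<Phi> p"
  shows "bij (deriv_at \<Phi> p)" "linear (inv (deriv_at \<Phi> p))"
    "inv (deriv_at \<Phi> p) (deriv_at \<Phi> p v) = v" "deriv_at \<Phi> p (inv (deriv_at \<Phi> p) v) = v"
    "norm (inv (deriv_at \<Phi> p) v) \<le> norm v / m" "linear (deriv_at \<Phi> p)"
proof -
  have a: "linear (deriv_at \<Phi> p)" "\<And>v. m * norm v \<le> norm (deriv_at \<Phi> p v)" "0 < m"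
    using assms by (auto simp: expanding_at_def linear_deriv_at)
  note i = expanding_linear_inverse[OF a]
  show "bij (deriv_at \<Phi> p)" "linear (inv (deriv_at \<Phi> p))"
    "inv (deriv_at \<Phi> p) (deriv_at \<Phi> p v) = v" "deriv_at \<Phi> p (inv (deriv_at \<Phi> p) v) = v"
    "norm (inv (deriv_at \<Phi> p) v) \<le> norm v / m" "linear (deriv_at \<Phi> p)"
    using i a(1) by auto
qed

lemma tangent_map_Aff: "expanding_at m \<Phi> p \<Longrightarrow> tangent_map \<Phi> p \<in> Aff"
  unfolding tangent_map_def expanding_at_def by (rule AffI[of _ m]) (auto simp: linear_deriv_at)

lemma tangent_map_inverse:
  assumes "expanding_at m \<Phi> p"
  shows "inv (tangent_map \<Phi> p) y = p + inv (deriv_at \<Phi> p) (y - \<Phi> p)"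
proof -
  have "tangent_map \<Phi> p (p + inv (deriv_at \<Phi> p) (y - \<Phi> p)) = y"
    by (simp add: tangent_map_def expanding_at_inverse[OF assms])
  then show ?thesis
    using Aff_inv_simps(1)[OF tangent_map_Aff[OF assms]] by metis
qed

lemma normalized_eq:
  assumes "expanding_at m \<Phi> p"
  shows "normalized \<Phi> p x = p + inv (deriv_at \<Phi> p) (\<Phi> x - \<Phi> p)"
  by (simp add: normalized_def tangent_map_inverse[OF assms])

lemma normalized_base: "expanding_at m \<Phi> p \<Longrightarrow> normalized \<Phi> p p = p"
  by (simp add: normalized_eq linear_0[OF expanding_at_inverse(2)])

lemma slope_base: "expanding_at m \<Phi> p \<Longrightarrow> slope \<Phi> p p v = v"
  by (simp add: slope_def expanding_at_inverse)

lemma normalized_has_derivative: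
  assumes "expanding_at m \<Phi> p" "\<Phi> differentiable at x"
  shows "(normalized \<Phi> p has_derivative slope \<Phi> p x) (at x)"
proof -
  have eq: "normalized \<Phi> p = (\<lambda>x. p + inv (deriv_at \<Phi> p) (\<Phi> x - \<Phi> p))"
    using normalized_eq[OF assms(1)] by blast
  have bl: "bounded_linear (inv (deriv_at \<Phi> p))"
    using expanding_at_inverse(2)[OF assms(1)] by (simp add: linear_conv_bounded_linear)
  have "((\<lambda>x. \<Phi> x - \<Phi> p) has_derivative (\<lambda>v. deriv_at \<Phi> x v - 0)) (at x)"
    by (intro derivative_intros frechet_has_derivative assms)
  then have "((\<lambda>x. inv (deriv_at \<Phi> p) (\<Phi> x - \<Phi> p)) has_derivative (\<lambda>v. inv (deriv_at \<Phi> p) (deriv_at \<Phi> x v - 0))) (at x)"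
    by (rule bounded_linear.has_derivative[OF bl])
  then show ?thesis
    unfolding eq slope_def by (auto intro: derivative_eq_intros)
qed

lemma deriv_at_comp:
  assumes "\<Phi> differentiable at x" "\<psi> differentiable at (\<Phi> x)"
  shows "deriv_at (\<psi> \<circ> \<Phi>) x = deriv_at \<psi> (\<Phi> x) \<circ> deriv_at \<Phi> x"
  by (rule deriv_at_eqI[OF diff_chain_at]) (auto intro: frechet_has_derivative assms)

lemma expanding_at_comp:
  assumes "expanding_at m \<Phi> x" "expanding_at m' \<psi> (\<Phi> x)"
  shows "expanding_at (m' * m) (\<psi> \<circ> \<Phi>) x"
  unfolding expanding_at_def
proof (intro conjI allI)
  have d: "\<Phi> differentiable at x" "\<psi> differentiable at (\<Phi> x)"
    using assms by (auto simp: expanding_at_def)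
  show "\<psi> \<circ> \<Phi> differentiable at x" using d by (rule differentiable_chain_at)
  show "0 < m' * m" using assms by (auto simp: expanding_at_def)
  fix v
  have "m' * m * norm v \<le> m' * norm (deriv_at \<Phi> x v)"
    using assms by (auto simp: expanding_at_def mult.assoc)
  also have "\<dots> \<le> norm (deriv_at \<psi> (\<Phi> x) (deriv_at \<Phi> x v))"
    using assms by (auto simp: expanding_at_def)
  finally show "m' * m * norm v \<le> norm (deriv_at (\<psi> \<circ> \<Phi>) x v)"
    by (simp add: deriv_at_comp[OF d])
qed

text \<open>Why composing on the left hardly changes a normalized map. The derivatives of \<open>\<psi>\<close> at \<open>\<Phi> p\<close> and at
\<open>\<Phi> y\<close> differ by a factor within \<open>\<Delta> / m\<close> of the identity. In the slope this factor stands between the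
inverse derivative of \<open>\<Phi>\<close> at \<open>p\<close> and the derivative of \<open>\<Phi>\<close> at \<open>y\<close>, and the product of the norms of
these two is at most \<open>D\<close>. The estimate on the values follows by integration over \<open>S\<close>.\<close>

lemma normalized_comp_close:
  assumes S: "path_diam_le S M"
    and exp: "\<And>x. x \<in> S \<Longrightarrow> expanding_at k \<Phi> x"
    and ratio: "\<And>x y u v. x \<in> S \<Longrightarrow> y \<in> S \<Longrightarrow>
        norm (deriv_at \<Phi> x u) * norm v \<le> D * norm u * norm (deriv_at \<Phi> y v)"
    and exp': "\<And>x. x \<in> S \<Longrightarrow> expanding_at m \<psi> (\<Phi> x)"
    and osc: "\<And>x y v. x \<in> S \<Longrightarrow> y \<in> S \<Longrightarrow>
        norm (deriv_at \<psi> (\<Phi> x) v - deriv_at \<psi> (\<Phi> y) v) \<le> \<Delta> * norm v"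
    and pos: "0 \<le> D" "0 \<le> \<Delta>" and px: "p \<in> S" "x \<in> S"
  shows "norm (slope (\<psi> \<circ> \<Phi>) p x v - slope \<Phi> p x v) \<le> D * \<Delta> / m * norm v"
    and "norm (normalized (\<psi> \<circ> \<Phi>) p x - normalized \<Phi> p x) \<le> M * (D * \<Delta> / m)"
proof -
  have m: "0 < m" using exp'[OF px(1)] by (simp add: expanding_at_def)
  have E: "expanding_at (m * k) (\<psi> \<circ> \<Phi>) y" if "y \<in> S" for y
    using expanding_at_comp exp exp' that by blast
  have diff: "\<Phi> differentiable at y" "\<psi> differentiable at (\<Phi> y)" if "y \<in> S" for y
    using exp[OF that] exp'[OF that] by (auto simp: expanding_at_def)
  have slope: "norm (slope (\<psi> \<circ> \<Phi>) p y v - slope \<Phi> p y v) \<le> D * \<Delta> / m * norm v" if y: "y \<in> S" for y v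
  proof -
    define X where "X = deriv_at \<Phi> y v"
    define Z where "Z = inv (deriv_at \<psi> (\<Phi> p)) (deriv_at \<psi> (\<Phi> y) X) - X"
    define Y where "Y = inv (deriv_at \<Phi> p) Z"
    note ip = expanding_at_inverse[OF exp[OF px(1)]] and jp = expanding_at_inverse[OF exp'[OF px(1)]]
    have "deriv_at (\<psi> \<circ> \<Phi>) p (inv (deriv_at \<Phi> p) (inv (deriv_at \<psi> (\<Phi> p)) w)) = w" for w
      by (simp add: deriv_at_comp[OF diff[OF px(1)]] ip jp)
    then have "inv (deriv_at (\<psi> \<circ> \<Phi>) p) w = inv (deriv_at \<Phi> p) (inv (deriv_at \<psi> (\<Phi> p)) w)" for w
      using expanding_at_inverse(3)[OF E[OF px(1)]] by metis
    then have "slope (\<psi> \<circ> \<Phi>) p y v - slope \<Phi> p y v = Y"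
      by (simp add: slope_def deriv_at_comp[OF diff[OF y]] Y_def Z_def X_def linear_diff[OF ip(2)])
    moreover have "norm Y \<le> D * \<Delta> / m * norm v"
    proof (cases "X = 0")
      case True
      then show ?thesis
        using m pos linear_0[OF jp(2)] linear_0[OF ip(2)] linear_0[OF expanding_at_inverse(6)[OF exp'[OF y]]]
        by (simp add: Y_def Z_def)
    next
      case False
      have "deriv_at \<psi> (\<Phi> p) Z = deriv_at \<psi> (\<Phi> y) X - deriv_at \<psi> (\<Phi> p) X"
        by (simp add: Z_def linear_diff[OF jp(6)] jp)
      then have "m * norm Z \<le> \<Delta> * norm X"
        using exp'[OF px(1)] osc[OF y px(1), of X] unfolding expanding_at_def by (metis order_trans)
      then have Z: "norm Z \<le> \<Delta> / m * norm X" using m by (simp add: field_simps)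
      have "norm X * norm Y \<le> D * norm v * norm Z"
        using ratio[OF y px(1), of v Y] by (simp add: X_def Y_def ip)
      also have "\<dots> \<le> D * norm v * (\<Delta> / m * norm X)"
        using Z pos by (intro mult_left_mono) auto
      finally have "norm X * norm Y \<le> norm X * (D * \<Delta> / m * norm v)" by (simp add: mult_ac)
      then show ?thesis using False by (intro mult_left_le_imp_le[of "norm X" "norm Y"]) auto
    qed
    ultimately show ?thesis by simp
  qed
  show "norm (slope (\<psi> \<circ> \<Phi>) p x v - slope \<Phi> p x v) \<le> D * \<Delta> / m * norm v"
    by (rule slope[OF px(2)])
  let ?e = "\<lambda>x. normalized (\<psi> \<circ> \<Phi>) p x - normalized \<Phi> p x"
  have "norm (?e x - ?e p) \<le> M * (D * \<Delta> / m)"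
  proof (rule path_diam_leD[OF S _ _ slope px(2,1)])
    show "0 \<le> D * \<Delta> / m" using m pos by simp
    fix y assume y: "y \<in> S"
    show "(?e has_derivative (\<lambda>v. slope (\<psi> \<circ> \<Phi>) p y v - slope \<Phi> p y v)) (at y)"
      using E exp px y
      by (intro has_derivative_diff normalized_has_derivative[of "m * k"] normalized_has_derivative[of k])
        (auto simp: expanding_at_def)
  qed
  then show "norm (normalized (\<psi> \<circ> \<Phi>) p x - normalized \<Phi> p x) \<le> M * (D * \<Delta> / m)"
    by (simp add: normalized_base[OF E[OF px(1)]] normalized_base[OF exp[OF px(1)]])
qed

text \<open>The affine map that leads from the frame of \<open>\<Phi> \<circ> b\<close> at \<open>q\<close> to the frame of \<open>\<Phi>\<close> at \<open>p\<close> depends on \<open>\<Phi>\<close>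
only through the normalized map and its slope at the single point \<open>b q\<close>.\<close>

lemma tangent_transition:
  assumes "expanding_at m \<Phi> p" "\<Phi> differentiable at (b q)" "b differentiable at q"
  shows "(inv (tangent_map \<Phi> p) \<circ> tangent_map (\<Phi> \<circ> b) q) x
    = normalized \<Phi> p (b q) + slope \<Phi> p (b q) (deriv_at b q (x - q))"
  using linear_add[OF expanding_at_inverse(2)[OF assms(1)]]
  by (simp add: tangent_map_inverse[OF assms(1)] normalized_eq[OF assms(1)] slope_def)
    (simp add: tangent_map_def deriv_at_comp[OF assms(3,2)] algebra_simps flip: linear_add[OF expanding_at_inverse(2)[OF assms(1)]])

lemma aff_near_of_normalized:
  assumes "norm (n1 - n2) \<le> E" "\<And>v. norm (s1 v - s2 v) \<le> E * norm v" "\<And>v. norm (b v) \<le> norm v" "0 \<le> E"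
  shows "aff_near (E * (1 + norm q)) (\<lambda>x. n1 + s1 (b (x - q))) (\<lambda>x. n2 + s2 (b (x - q)))"
  unfolding aff_near_def
proof
  fix x :: 'a
  have "norm (n1 + s1 (b (x - q)) - (n2 + s2 (b (x - q)))) \<le> norm (n1 - n2) + norm (s1 (b (x - q)) - s2 (b (x - q)))"
    using norm_triangle_ineq[of "n1 - n2" "s1 (b (x - q)) - s2 (b (x - q))"] by (simp add: algebra_simps)
  also have "\<dots> \<le> E + E * norm (b (x - q))" using assms by (intro add_mono) auto
  also have "\<dots> \<le> E + E * (norm x + norm q)"
    using assms(3)[of "x - q"] norm_triangle_ineq4[of x q] assms(4)
    by (intro add_left_mono mult_left_mono) auto
  also have "\<dots> \<le> E * (1 + norm q) * (1 + norm x)"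
    using assms(4) by (simp add: algebra_simps)
  finally show "norm (n1 + s1 (b (x - q)) - (n2 + s2 (b (x - q)))) \<le> E * (1 + norm q) * (1 + norm x)" .
qed

section \<open>Bunched iterated function systems\<close>

text \<open>Inverse branches are indexed by one letter only: the branch of an admissible pair \<open>(a, b)\<close> is the
restriction of the map of \<open>a\<close> to the domain of \<open>b\<close>.\<close>

fun word_map :: "('a \<Rightarrow> 'v \<Rightarrow> 'v) \<Rightarrow> 'a list \<Rightarrow> 'v \<Rightarrow> 'v" where
  "word_map f (a # b # w) = f a \<circ> word_map f (b # w)"
| "word_map f [a] = id"
| "word_map f [] = id"

lemma words_Cons_Cons:
  "a # b # w \<in> words K \<longleftrightarrow> a \<in> letters K \<and> (a, b) \<in> pairs K \<and> b # w \<in> words K"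
  by (auto simp: words_def)

lemma words_appendD: "u @ w \<in> words K \<Longrightarrow> w \<noteq> [] \<Longrightarrow> w \<in> words K"
  by (auto simp: words_def successively_append_iff)

lemma words_letters: "w \<in> words K \<Longrightarrow> last w \<in> letters K \<and> hd w \<in> letters K"
  by (auto simp: words_def)

lemma words_glue:
  assumes "u \<in> words K" "w \<in> words K" "last u = hd w"
  shows "u @ tl w \<in> words K" "last (u @ tl w) = last w" "hd (u @ tl w) = hd u"
proof -
  obtain a v where w: "w = a # v" using assms(2) by (cases w) (auto simp: words_def)
  show "u @ tl w \<in> words K"
    using assms w by (cases v) (auto simp: words_def successively_append_iff successively_Cons)
  show "last (u @ tl w) = last w" "hd (u @ tl w) = hd u"
    using assms w by (auto simp: words_def)
qed

lemma word_map_glue: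
  assumes "u \<noteq> []" "w \<noteq> []" "last u = hd w"
  shows "word_map f (u @ tl w) = word_map f u \<circ> word_map f w"
  using assms
proof (induction f u rule: word_map.induct)
  case (1 f a b u)
  then show ?case by (simp add: comp_assoc)
next
  case (2 f a)
  then show ?case by (cases w) auto
qed auto

lemma words_split:
  assumes "w \<in> words K" "k < length w"
  shows "take (Suc k) w \<in> words K" "drop k w \<in> words K" "last (take (Suc k) w) = hd (drop k w)"
    "last (drop k w) = last w" "word_map f w = word_map f (take (Suc k) w) \<circ> word_map f (drop k w)"
proof -
  have ne: "w \<noteq> []" using assms(2) by auto
  have s: "successively (\<lambda>a b. (a, b) \<in> pairs K) (take n w)" "successively (\<lambda>a b. (a, b) \<in> pairs K) (drop n w)" for n
    using assms(1) successively_append_iff[of _ "take n w" "drop n w"] by (auto simp: words_def)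
  show t: "take (Suc k) w \<in> words K" using assms s by (auto simp: words_def dest: in_set_takeD)
  show d: "drop k w \<in> words K" using assms s by (auto simp: words_def dest: in_set_dropD)
  show l: "last (take (Suc k) w) = hd (drop k w)" using assms(2) by (simp add: take_Suc_conv_app_nth hd_drop_conv_nth)
  show "last (drop k w) = last w" using assms(2) by simp
  have "take (Suc k) w @ tl (drop k w) = w" by (metis append_take_drop_id drop_Suc tl_drop)
  then show "word_map f w = word_map f (take (Suc k) w) \<circ> word_map f (drop k w)"
    using word_map_glue[of "take (Suc k) w" "drop k w" f] l assms(2) ne by simp
qed

text \<open>Contracting inverse branches with the transition rules of \<open>K\<close>, on domains that are left open. The
Hoelder condition involves the distance of the images, because this is what the Hoelder
continuity of the derivative of an expanding map yields for its inverse, and because two points of a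
domain may be close to each other without being joined by a short path in it.\<close>

locale ifs =
  fixes K :: "('a, 'v::euclidean_space) cantor" and S :: "'a \<Rightarrow> 'v set" and f :: "'a \<Rightarrow> 'v \<Rightarrow> 'v"
    and \<alpha> \<mu> H m M :: real
  assumes alpha: "0 < \<alpha>" and mu: "0 < \<mu>" "\<mu> < 1" and H: "0 \<le> H" and m: "0 < m" and M: "0 \<le> M"
    and maps: "\<And>a b x. (a, b) \<in> pairs K \<Longrightarrow> x \<in> S b \<Longrightarrow> f a x \<in> S a"
    and exp: "\<And>a b x. (a, b) \<in> pairs K \<Longrightarrow> x \<in> S b \<Longrightarrow> expanding_at m (f a) x"
    and contr: "\<And>a b x v. (a, b) \<in> pairs K \<Longrightarrow> x \<in> S b \<Longrightarrow> norm (deriv_at (f a) x v) \<le> \<mu> * norm v"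
    and hoelder: "\<And>a b x y v. (a, b) \<in> pairs K \<Longrightarrow> x \<in> S b \<Longrightarrow> y \<in> S b \<Longrightarrow>
        norm (deriv_at (f a) x v - deriv_at (f a) y v) \<le> H * norm (f a x - f a y) powr \<alpha> * norm v"
    and diam: "\<And>a. a \<in> letters K \<Longrightarrow> path_diam_le (S a) M"
begin

lemma word_map_props:
  assumes "w \<in> words K" "x \<in> S (last w)"
  shows "word_map f w x \<in> S (hd w) \<and> expanding_at (m ^ (length w - 1)) (word_map f w) x \<and>
    (\<forall>v. norm (deriv_at (word_map f w) x v) \<le> \<mu> ^ (length w - 1) * norm v)"
  using assms
proof (induction w rule: induct_list012)
  case 1
  then show ?case by (simp add: words_def)
next
  case (2 a)
  have "(id has_derivative id) (at x)" by (simp add: id_def)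
  then show ?case
    using 2 deriv_at_eqI[of id id x] by (auto simp: expanding_at_def differentiable_def id_def)
next
  case (3 a b w)
  have ab: "(a, b) \<in> pairs K" and bw: "b # w \<in> words K" using 3(3) by (auto simp: words_Cons_Cons)
  have x: "x \<in> S (last (b # w))" using 3(4) by simp
  let ?\<Phi> = "word_map f (b # w)"
  have IH: "?\<Phi> x \<in> S b" "expanding_at (m ^ length w) ?\<Phi> x"
    "\<And>v. norm (deriv_at ?\<Phi> x v) \<le> \<mu> ^ length w * norm v"
    using 3(2)[OF bw x] by auto
  have E: "expanding_at m (f a) (?\<Phi> x)" by (rule exp[OF ab IH(1)])
  have d: "deriv_at (f a \<circ> ?\<Phi>) x = deriv_at (f a) (?\<Phi> x) \<circ> deriv_at ?\<Phi> x"
    using E IH(2) by (intro deriv_at_comp) (auto simp: expanding_at_def)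
  have "norm (deriv_at (f a \<circ> ?\<Phi>) x v) \<le> \<mu> * \<mu> ^ length w * norm v" for v
  proof -
    have "norm (deriv_at (f a \<circ> ?\<Phi>) x v) \<le> \<mu> * norm (deriv_at ?\<Phi> x v)"
      unfolding d using contr[OF ab IH(1)] by simp
    also have "\<dots> \<le> \<mu> * (\<mu> ^ length w * norm v)" using IH(3)[of v] mu by (intro mult_left_mono) auto
    finally show ?thesis by simp
  qed
  moreover have "expanding_at (m * m ^ length w) (f a \<circ> ?\<Phi>) x"
    by (rule expanding_at_comp[OF IH(2) E])
  ultimately show ?case using maps[OF ab IH(1)] by (simp add: o_def)
qed

lemma word_map_in: "w \<in> words K \<Longrightarrow> x \<in> S (last w) \<Longrightarrow> word_map f w x \<in> S (hd w)"
  and word_map_exp: "w \<in> words K \<Longrightarrow> x \<in> S (last w) \<Longrightarrow> expanding_at (m ^ (length w - 1)) (word_map f w) x"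
  and word_map_contr: "w \<in> words K \<Longrightarrow> x \<in> S (last w) \<Longrightarrow>
    norm (deriv_at (word_map f w) x v) \<le> \<mu> ^ (length w - 1) * norm v"
  using word_map_props by blast+

lemma word_map_nonexpanding:
  assumes "w \<in> words K" "x \<in> S (last w)"
  shows "norm (deriv_at (word_map f w) x v) \<le> norm v"
proof -
  have "\<mu> ^ (length w - 1) * norm v \<le> 1 * norm v"
    using mu by (intro mult_right_mono power_le_one) auto
  then show ?thesis using word_map_contr[OF assms, of v] by simp
qed

lemma word_map_differentiable: "w \<in> words K \<Longrightarrow> x \<in> S (last w) \<Longrightarrow> word_map f w differentiable at x"
  using word_map_exp by (auto simp: expanding_at_def)

lemma word_map_diam:
  assumes "w \<in> words K" "x \<in> S (last w)" "y \<in> S (last w)"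
  shows "norm (word_map f w x - word_map f w y) \<le> M * \<mu> ^ (length w - 1)"
proof (rule path_diam_leD[OF diam _ _ _ assms(2,3), where e' = "\<lambda>x. deriv_at (word_map f w) x"])
  show "last w \<in> letters K" using words_letters assms(1) by blast
  show "0 \<le> \<mu> ^ (length w - 1)" using mu by simp
  fix z assume z: "z \<in> S (last w)"
  show "(word_map f w has_derivative deriv_at (word_map f w) z) (at z)"
    using word_map_differentiable[OF assms(1) z] by (rule frechet_has_derivative)
  show "norm (deriv_at (word_map f w) z v) \<le> \<mu> ^ (length w - 1) * norm v" for v
    by (rule word_map_contr[OF assms(1) z])
qed

end

text \<open>Bunching without inverses and at two different points: the norm of the derivative at \<open>x\<close> times the
norm of the inverse derivative at \<open>y\<close> is at most \<open>C * \<nu> ^ n / \<mu> powr (\<alpha> * n)\<close> for words with \<open>n\<close>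
steps.\<close>

locale bunched_ifs = ifs +
  fixes C \<nu> :: real
  assumes C: "0 \<le> C" and lam: "0 < \<nu>" "\<nu> < 1"
    and bunching: "\<And>w x y u v. w \<in> words K \<Longrightarrow> x \<in> S (last w) \<Longrightarrow> y \<in> S (last w) \<Longrightarrow>
        norm (deriv_at (word_map f w) x u) * norm v * (\<mu> powr \<alpha>) ^ (length w - 1)
          \<le> C * \<nu> ^ (length w - 1) * norm u * norm (deriv_at (word_map f w) y v)"
begin

text \<open>After \<open>n\<close> steps the image has diameter of order \<open>\<mu> ^ n\<close>, so the derivative of a Hoelder map \<open>\<psi>\<close>
oscillates on it by at most a multiple of \<open>\<mu> powr (\<alpha> * n)\<close>. The bunching inequality says that the
product of this oscillation with the distortion \<open>D\<close> decays like \<open>\<nu> ^ n\<close>.\<close>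

lemma normalized_post_close:
  assumes w: "w \<in> words K" and px: "p \<in> S (last w)" "x \<in> S (last w)"
    and psi: "\<And>z. z \<in> S (last w) \<Longrightarrow> expanding_at m' \<psi> (word_map f w z)"
    and osc: "\<And>y z v. y \<in> S (last w) \<Longrightarrow> z \<in> S (last w) \<Longrightarrow>
      norm (deriv_at \<psi> (word_map f w y) v - deriv_at \<psi> (word_map f w z) v)
        \<le> H' * (M * \<mu> ^ (length w - 1)) powr \<alpha> * norm v"
    and H': "0 \<le> H'"
  shows "norm (slope (\<psi> \<circ> word_map f w) p x v - slope (word_map f w) p x v)
      \<le> C * H' * M powr \<alpha> / m' * \<nu> ^ (length w - 1) * norm v"
    and "norm (normalized (\<psi> \<circ> word_map f w) p x - normalized (word_map f w) p x)
      \<le> M * (C * H' * M powr \<alpha> / m' * \<nu> ^ (length w - 1))"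
proof -
  define n where "n = length w - 1"
  define D where "D = C * \<nu> ^ n / (\<mu> powr \<alpha>) ^ n"
  define \<Delta> where "\<Delta> = H' * (M * \<mu> ^ n) powr \<alpha>"
  have mp: "0 < (\<mu> powr \<alpha>) ^ n" using mu by simp
  have "(\<mu> ^ n) powr \<alpha> = (\<mu> powr \<alpha>) ^ n"
    using mu by (simp add: powr_powr powr_realpow[symmetric] mult.commute)
  then have "\<Delta> = H' * M powr \<alpha> * (\<mu> powr \<alpha>) ^ n"
    using M mu by (simp add: \<Delta>_def powr_mult)
  then have eq: "D * \<Delta> / m' = C * H' * M powr \<alpha> / m' * \<nu> ^ n"
    using mp mu by (simp add: D_def)
  have ratio: "norm (deriv_at (word_map f w) y u) * norm v \<le> D * norm u * norm (deriv_at (word_map f w) z v)"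
    if "y \<in> S (last w)" "z \<in> S (last w)" for y z u v
    using bunching[OF w that, of u v, folded n_def] mp by (simp add: D_def field_simps)
  have "path_diam_le (S (last w)) M" using diam words_letters[OF w] by blast
  note nc = normalized_comp_close[OF this word_map_exp[OF w] ratio psi, of \<Delta> p x]
  have pos: "0 \<le> D" "0 \<le> \<Delta>" using C lam mu H' by (auto simp: D_def \<Delta>_def)
  have osc': "norm (deriv_at \<psi> (word_map f w y) v - deriv_at \<psi> (word_map f w z) v) \<le> \<Delta> * norm v"
    if "y \<in> S (last w)" "z \<in> S (last w)" for y z v
    using osc[OF that] by (simp add: \<Delta>_def n_def)
  show "norm (slope (\<psi> \<circ> word_map f w) p x v - slope (word_map f w) p x v)
      \<le> C * H' * M powr \<alpha> / m' * \<nu> ^ (length w - 1) * norm v"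
    using nc(1)[OF _ _ _ _ osc' pos px] eq by (simp add: n_def)
  show "norm (normalized (\<psi> \<circ> word_map f w) p x - normalized (word_map f w) p x)
      \<le> M * (C * H' * M powr \<alpha> / m' * \<nu> ^ (length w - 1))"
    using nc(2)[OF _ _ _ _ osc' pos px] eq by (simp add: n_def)
qed

text \<open>The sum of the geometric series of the errors made by prefixing letters one at a time.\<close>

definition Q where "Q = C * H * M powr \<alpha> / m / (1 - \<nu>)"

lemma Q_nonneg: "0 \<le> Q"
  using C H m lam by (simp add: Q_def)

text \<open>Each letter in front of \<open>w\<close> contributes an error, and the errors decay geometrically with the number of
letters that follow; the difference of two powers of \<open>\<nu>\<close> is a partial sum of the series.\<close>

lemma normalized_tail:
  assumes "u @ w \<in> words K" "w \<noteq> []" "p \<in> S (last w)" "x \<in> S (last w)"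
  shows "norm (slope (word_map f (u @ w)) p x v - slope (word_map f w) p x v)
      \<le> Q * (\<nu> ^ (length w - 1) - \<nu> ^ (length w - 1 + length u)) * norm v
    \<and> norm (normalized (word_map f (u @ w)) p x - normalized (word_map f w) p x)
      \<le> M * (Q * (\<nu> ^ (length w - 1) - \<nu> ^ (length w - 1 + length u)))"
  using assms
proof (induction u)
  case Nil
  then show ?case by simp
next
  case (Cons a u)
  define n where "n = length w - 1 + length u"
  define t where "t = u @ w"
  have len: "length t - 1 = n" using Cons(3) by (cases w) (auto simp: t_def n_def)
  obtain b t' where t: "t = b # t'" using Cons(3) by (cases t) (auto simp: t_def)
  have at: "a # t \<in> words K" using Cons(2) by (simp add: t_def)
  then have ab: "(a, b) \<in> pairs K" and tw: "t \<in> words K" by (auto simp: t words_Cons_Cons)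
  have lt: "last t = last w" using Cons(3) by (simp add: t_def)
  have wm: "word_map f (a # t) = f a \<circ> word_map f t" by (simp add: t)
  have inb: "word_map f t z \<in> S b" if "z \<in> S (last t)" for z
    using word_map_in[OF tw that] by (simp add: t)
  have osc: "norm (deriv_at (f a) (word_map f t y) v - deriv_at (f a) (word_map f t z) v)
        \<le> H * (M * \<mu> ^ (length t - 1)) powr \<alpha> * norm v" if yz: "y \<in> S (last t)" "z \<in> S (last t)" for y z v
  proof -
    have "norm (word_map f (a # t) y - word_map f (a # t) z) \<le> M * \<mu> ^ (length (a # t) - 1)"
      using yz t by (intro word_map_diam[OF at]) auto
    also have "\<dots> \<le> M * \<mu> ^ (length t - 1)"
      using mu M by (intro mult_left_mono power_decreasing) auto
    finally have "norm (f a (word_map f t y) - f a (word_map f t z)) powr \<alpha> \<le> (M * \<mu> ^ (length t - 1)) powr \<alpha>"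
      using alpha by (intro powr_mono2) (auto simp: wm)
    then have "H * norm (f a (word_map f t y) - f a (word_map f t z)) powr \<alpha> * norm v
        \<le> H * (M * \<mu> ^ (length t - 1)) powr \<alpha> * norm v"
      using H by (intro mult_right_mono mult_left_mono) auto
    then show ?thesis using hoelder[OF ab inb[OF yz(1)] inb[OF yz(2)], of v] by linarith
  qed
  have q: "C * H * M powr \<alpha> / m = Q * (1 - \<nu>)" using lam by (simp add: Q_def)
  have px: "p \<in> S (last t)" "x \<in> S (last t)" using Cons(4,5) lt by auto
  have step: "norm (slope (word_map f (a # t)) p x v - slope (word_map f t) p x v) \<le> Q * (1 - \<nu>) * \<nu> ^ n * norm v"
    "norm (normalized (word_map f (a # t)) p x - normalized (word_map f t) p x) \<le> M * (Q * (1 - \<nu>) * \<nu> ^ n)"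
    using normalized_post_close[OF tw px exp[OF ab inb] osc H] unfolding q len wm by auto
  have IH: "norm (slope (word_map f t) p x v - slope (word_map f w) p x v) \<le> Q * (\<nu> ^ (length w - 1) - \<nu> ^ n) * norm v"
    "norm (normalized (word_map f t) p x - normalized (word_map f w) p x) \<le> M * (Q * (\<nu> ^ (length w - 1) - \<nu> ^ n))"
    using Cons tw by (auto simp: t_def n_def)
  have sum: "Q * (1 - \<nu>) * \<nu> ^ n + Q * (\<nu> ^ (length w - 1) - \<nu> ^ n) = Q * (\<nu> ^ (length w - 1) - \<nu> ^ Suc n)"
    by (simp add: algebra_simps)
  have "norm (slope (word_map f (a # t)) p x v - slope (word_map f w) p x v)
      \<le> (Q * (1 - \<nu>) * \<nu> ^ n + Q * (\<nu> ^ (length w - 1) - \<nu> ^ n)) * norm v"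
    using norm_triangle_ineq[of "slope (word_map f (a # t)) p x v - slope (word_map f t) p x v" "slope (word_map f t) p x v - slope (word_map f w) p x v"]
      step(1) IH(1) by (simp add: distrib_right)
  moreover have "norm (normalized (word_map f (a # t)) p x - normalized (word_map f w) p x)
      \<le> M * (Q * (1 - \<nu>) * \<nu> ^ n + Q * (\<nu> ^ (length w - 1) - \<nu> ^ n))"
    using norm_triangle_ineq[of "normalized (word_map f (a # t)) p x - normalized (word_map f t) p x" "normalized (word_map f t) p x - normalized (word_map f w) p x"]
      step(2) IH(2) by (simp add: distrib_left)
  moreover have "Suc n = length w - 1 + length (a # u)" by (simp add: n_def)
  ultimately show ?case unfolding sum t_def by simp
qed

lemma normalized_tail_le:
  assumes "u @ w \<in> words K" "w \<noteq> []" "p \<in> S (last w)" "x \<in> S (last w)"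
  shows "norm (slope (word_map f (u @ w)) p x v - slope (word_map f w) p x v) \<le> Q * \<nu> ^ (length w - 1) * norm v"
    and "norm (normalized (word_map f (u @ w)) p x - normalized (word_map f w) p x) \<le> M * (Q * \<nu> ^ (length w - 1))"
proof -
  have "Q * (\<nu> ^ (length w - 1) - \<nu> ^ (length w - 1 + length u)) \<le> Q * \<nu> ^ (length w - 1)"
    using Q_nonneg lam by (intro mult_left_mono) auto
  then show "norm (slope (word_map f (u @ w)) p x v - slope (word_map f w) p x v) \<le> Q * \<nu> ^ (length w - 1) * norm v"
    "norm (normalized (word_map f (u @ w)) p x - normalized (word_map f w) p x) \<le> M * (Q * \<nu> ^ (length w - 1))"
    using normalized_tail[OF assms, of v] M
    by (auto intro: order_trans[OF _ mult_right_mono] order_trans[OF _ mult_left_mono])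
qed

text \<open>The map \<open>\<psi>\<close> plays the role of one more letter in front, the last error of the series. In
the application it is a configuration.\<close>

lemma normalized_post_tail:
  assumes w: "u @ w \<in> words K" "w \<noteq> []" and px: "p \<in> S (last w)" "x \<in> S (last w)"
    and psi: "\<And>z. z \<in> S (hd (u @ w)) \<Longrightarrow> expanding_at m' \<psi> z"
    and osc: "\<And>y z v. y \<in> S (hd (u @ w)) \<Longrightarrow> z \<in> S (hd (u @ w)) \<Longrightarrow>
      norm (deriv_at \<psi> y v - deriv_at \<psi> z v) \<le> H' * norm (y - z) powr \<alpha> * norm v"
    and H': "0 \<le> H'" "0 < m'"
  defines "R \<equiv> C * H' * M powr \<alpha> / m' + Q"
  shows "norm (slope (\<psi> \<circ> word_map f (u @ w)) p x v - slope (word_map f w) p x v) \<le> R * \<nu> ^ (length w - 1) * norm v"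
    and "norm (normalized (\<psi> \<circ> word_map f (u @ w)) p x - normalized (word_map f w) p x) \<le> M * (R * \<nu> ^ (length w - 1))"
proof -
  define t where "t = u @ w"
  have lt: "last t = last w" using w(2) by (simp add: t_def)
  have tw: "t \<in> words K" using w(1) by (simp add: t_def)
  have osc': "norm (deriv_at \<psi> (word_map f t y) v - deriv_at \<psi> (word_map f t z) v)
        \<le> H' * (M * \<mu> ^ (length t - 1)) powr \<alpha> * norm v" if yz: "y \<in> S (last t)" "z \<in> S (last t)" for y z v
  proof -
    have "norm (word_map f t y - word_map f t z) powr \<alpha> \<le> (M * \<mu> ^ (length t - 1)) powr \<alpha>"
      using alpha word_map_diam[OF tw yz] by (intro powr_mono2) auto
    then have "H' * norm (word_map f t y - word_map f t z) powr \<alpha> * norm v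
        \<le> H' * (M * \<mu> ^ (length t - 1)) powr \<alpha> * norm v"
      using H' by (intro mult_right_mono mult_left_mono) auto
    then show ?thesis
      using osc[of "word_map f t y" "word_map f t z" v] word_map_in[OF tw yz(1)] word_map_in[OF tw yz(2)]
      unfolding t_def by linarith
  qed
  have px': "p \<in> S (last t)" "x \<in> S (last t)" using px lt by auto
  have psi': "expanding_at m' \<psi> (word_map f t z)" if "z \<in> S (last t)" for z
    using psi word_map_in[OF tw that] by (simp add: t_def)
  let ?q = "C * H' * M powr \<alpha> / m'"
  have le: "?q * \<nu> ^ (length t - 1) \<le> ?q * \<nu> ^ (length w - 1)"
    using H' C lam by (intro mult_left_mono power_decreasing) (auto simp: t_def)
  have "norm (slope (\<psi> \<circ> word_map f t) p x v - slope (word_map f t) p x v) \<le> ?q * \<nu> ^ (length w - 1) * norm v"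
    using order_trans[OF normalized_post_close(1)[OF tw px' psi' osc' H'(1)] mult_right_mono[OF le, of "norm v"]] by simp
  moreover have "norm (normalized (\<psi> \<circ> word_map f t) p x - normalized (word_map f t) p x) \<le> M * (?q * \<nu> ^ (length w - 1))"
    using order_trans[OF normalized_post_close(2)[OF tw px' psi' osc' H'(1)] mult_left_mono[OF le M]] by simp
  ultimately show "norm (slope (\<psi> \<circ> word_map f (u @ w)) p x v - slope (word_map f w) p x v) \<le> R * \<nu> ^ (length w - 1) * norm v"
    "norm (normalized (\<psi> \<circ> word_map f (u @ w)) p x - normalized (word_map f w) p x) \<le> M * (R * \<nu> ^ (length w - 1))"
    using normalized_tail_le(1)[OF w px, of v] normalized_tail_le(2)[OF w px]
      norm_triangle_ineq[of "slope (\<psi> \<circ> word_map f t) p x v - slope (word_map f t) p x v" "slope (word_map f t) p x v - slope (word_map f w) p x v"]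
      norm_triangle_ineq[of "normalized (\<psi> \<circ> word_map f t) p x - normalized (word_map f t) p x" "normalized (word_map f t) p x - normalized (word_map f w) p x"]
    unfolding R_def t_def by (simp_all add: algebra_simps)
qed

text \<open>Exchanging \<open>p\<close> and \<open>x\<close> inverts the slope, so that an upper bound for all pairs of points is a lower
bound as well.\<close>

lemma slope_bounds:
  assumes "w \<in> words K" "p \<in> S (last w)" "x \<in> S (last w)"
  shows "norm (slope (word_map f w) p x v) \<le> (1 + Q) * norm v"
    and "norm v \<le> (1 + Q) * norm (slope (word_map f w) p x v)"
proof -
  have w: "w = butlast w @ [last w]" using assms(1) by (simp add: words_def)
  have id: "slope (word_map f [last w]) p x v = v" for p x v
  proof -
    have "deriv_at (id::'b \<Rightarrow> 'b) z = id" for z by (rule deriv_at_eqI) (simp add: id_def)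
    then show ?thesis by (simp add: slope_def)
  qed
  have b: "norm (slope (word_map f w) p x v) \<le> (1 + Q) * norm v" if "p \<in> S (last w)" "x \<in> S (last w)" for p x v
  proof -
    have "norm (slope (word_map f w) p x v - v) \<le> Q * norm v"
      using normalized_tail_le(1)[of "butlast w" "[last w]" p x v] w assms(1) that id by simp
    then show ?thesis using norm_triangle_sub[of "slope (word_map f w) p x v" v] by (simp add: algebra_simps)
  qed
  show "norm (slope (word_map f w) p x v) \<le> (1 + Q) * norm v" by (rule b[OF assms(2,3)])
  have "slope (word_map f w) x p (slope (word_map f w) p x v) = v"
    using expanding_at_inverse[OF word_map_exp[OF assms(1,2)]] expanding_at_inverse[OF word_map_exp[OF assms(1,3)]]
    by (simp add: slope_def)
  then show "norm v \<le> (1 + Q) * norm (slope (word_map f w) p x v)"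
    using b[OF assms(3,2), of "slope (word_map f w) p x v"] by simp
qed

end

section \<open>Hoelder differentiable maps on compact sets\<close>

lemma conorm_le:
  assumes "linear T"
  shows "conorm T * norm v \<le> norm (T v)"
proof (cases "v = 0")
  case False
  have "conorm T \<le> norm (T (v /\<^sub>R norm v))"
    unfolding conorm_def using False by (intro cINF_lower bdd_belowI2[of _ 0]) auto
  also have "\<dots> = norm (T v) / norm v"
    using linear_cmul[OF assms] by (simp add: divide_inverse mult.commute)
  finally show ?thesis using False by (simp add: field_simps)
qed simp

lemma C1a_on_differentiable: "C1a_on \<alpha> W f \<Longrightarrow> x \<in> W \<Longrightarrow> f differentiable at x"
  unfolding C1a_on_def using differentiable_on_eq_differentiable_at by blast

lemma C1a_on_hoelder:
  fixes f :: "'v::euclidean_space \<Rightarrow> 'v"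
  assumes "C1a_on \<alpha> W f" "compact Z" "Z \<subseteq> W"
  obtains C where "0 \<le> C"
    "\<And>x y v. x \<in> Z \<Longrightarrow> y \<in> Z \<Longrightarrow> norm (deriv_at f x v - deriv_at f y v) \<le> C * norm (x - y) powr \<alpha> * norm v"
proof -
  have "\<forall>S. compact S \<and> S \<subseteq> W \<longrightarrow>
      (\<exists>C. \<forall>x\<in>S. \<forall>y\<in>S. onorm (\<lambda>v. deriv_at f x v - deriv_at f y v) \<le> C * dist x y powr \<alpha>)"
    using assms(1) unfolding C1a_on_def by (elim conjE)
  from spec[OF this, of Z]
  obtain C where C: "\<And>x y. x \<in> Z \<Longrightarrow> y \<in> Z \<Longrightarrow> onorm (\<lambda>v. deriv_at f x v - deriv_at f y v) \<le> C * dist x y powr \<alpha>"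
    using assms(2,3) by auto
  show thesis
  proof (rule that[of "max C 0"])
    fix x y v :: 'v assume xy: "x \<in> Z" "y \<in> Z"
    have "C * dist x y powr \<alpha> \<le> max C 0 * dist x y powr \<alpha>" by (intro mult_right_mono) auto
    then have "onorm (\<lambda>v. deriv_at f x v - deriv_at f y v) \<le> max C 0 * dist x y powr \<alpha>"
      using C[OF xy] by simp
    moreover have "linear (deriv_at f x)" "linear (deriv_at f y)"
      using xy assms C1a_on_differentiable linear_deriv_at by blast+
    ultimately show "norm (deriv_at f x v - deriv_at f y v) \<le> max C 0 * norm (x - y) powr \<alpha> * norm v"
      by (simp add: norm_le_of_onorm_le dist_norm)
  qed simp
qed

lemma C1a_on_bounded:
  fixes f :: "'v::euclidean_space \<Rightarrow> 'v"
  assumes "C1a_on \<alpha> W f" "compact Z" "Z \<subseteq> W" "0 < \<alpha>"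
  obtains B where "0 < B" "\<And>x v. x \<in> Z \<Longrightarrow> norm (deriv_at f x v) \<le> B * norm v"
proof (cases "Z = {}")
  case True
  then show thesis using that[of 1] by auto
next
  case False
  then obtain z where z: "z \<in> Z" by auto
  obtain C where C: "0 \<le> C"
    "\<And>x y v. x \<in> Z \<Longrightarrow> y \<in> Z \<Longrightarrow> norm (deriv_at f x v - deriv_at f y v) \<le> C * norm (x - y) powr \<alpha> * norm v"
    using C1a_on_hoelder[OF assms(1-3)] by blast
  obtain d where d: "\<And>x. x \<in> Z \<Longrightarrow> dist z x \<le> d"
    using compact_imp_bounded[OF assms(2)] unfolding bounded_any_center[of _ z] by auto
  have "linear (deriv_at f z)" using z assms C1a_on_differentiable linear_deriv_at by blast
  then obtain b where b: "b > 0" "\<And>v. norm (deriv_at f z v) \<le> b * norm v"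
    using linear_bounded_pos by blast
  show thesis
  proof (rule that[of "b + C * d powr \<alpha>"])
    show "0 < b + C * d powr \<alpha>" using b C by (simp add: add_pos_nonneg)
    fix x v :: 'v assume x: "x \<in> Z"
    have "norm (x - z) powr \<alpha> \<le> d powr \<alpha>"
      using d[OF x] assms(4) by (intro powr_mono2) (auto simp: dist_norm norm_minus_commute)
    then have "C * norm (x - z) powr \<alpha> * norm v \<le> C * d powr \<alpha> * norm v"
      using C(1) by (intro mult_right_mono mult_left_mono) auto
    then show "norm (deriv_at f x v) \<le> (b + C * d powr \<alpha>) * norm v"
      using C(2)[OF x z, of v] b(2)[of v] norm_triangle_sub[of "deriv_at f x v" "deriv_at f z v"]
      by (simp add: algebra_simps)
  qed
qed

lemma C1a_embedding_inverse:
  fixes f :: "'v::euclidean_space \<Rightarrow> 'v"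
  assumes "C1a_embedding \<alpha> W f" "x \<in> W"
  shows "inv_into W f (f x) = x" "inv_into W f differentiable at (f x)"
    "deriv_at (inv_into W f) (f x) (deriv_at f x v) = v"
    "deriv_at f x (deriv_at (inv_into W f) (f x) v) = v"
proof -
  have e: "C1a_on \<alpha> W f" "inj_on f W" "C1a_on \<alpha> (f ` W) (inv_into W f)"
    using assms(1) by (auto simp: C1a_embedding_def)
  show i: "inv_into W f (f x) = x" using e(2) assms(2) by simp
  show d: "inv_into W f differentiable at (f x)"
    using C1a_on_differentiable[OF e(3)] assms(2) by blast
  have f: "f differentiable at x" using C1a_on_differentiable[OF e(1)] assms(2) by blast
  have "((inv_into W f \<circ> f) has_derivative deriv_at (inv_into W f) (f x) \<circ> deriv_at f x) (at x)"
    by (rule diff_chain_at) (auto intro: frechet_has_derivative d f)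
  moreover have "((inv_into W f \<circ> f) has_derivative id) (at x)"
  proof (rule has_derivative_transform_within_open[of id id x UNIV W])
    show "(id has_derivative id) (at x)" by (simp add: id_def)
    show "open W" using e(1) by (simp add: C1a_on_def)
  qed (use e(2) assms(2) in auto)
  ultimately have id: "deriv_at (inv_into W f) (f x) \<circ> deriv_at f x = id"
    using has_derivative_unique by blast
  then show "deriv_at (inv_into W f) (f x) (deriv_at f x v) = v" by (metis comp_apply id_apply)
  have "deriv_at f x \<circ> deriv_at (inv_into W f) (f x) = id"
    using id linear_inverse_left[OF linear_deriv_at[OF d] linear_deriv_at[OF f]] by blast
  then show "deriv_at f x (deriv_at (inv_into W f) (f x) v) = v" by (metis comp_apply id_apply)
qed

text \<open>The derivative of the inverse map is bounded on the compact image of \<open>Z\<close>.\<close>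

lemma C1a_embedding_expanding:
  fixes f :: "'v::euclidean_space \<Rightarrow> 'v"
  assumes "C1a_embedding \<alpha> W f" "compact Z" "Z \<subseteq> W" "0 < \<alpha>"
  obtains m where "0 < m" "\<And>x. x \<in> Z \<Longrightarrow> expanding_at m f x"
proof -
  have e: "C1a_on \<alpha> W f" "C1a_on \<alpha> (f ` W) (inv_into W f)"
    using assms(1) by (auto simp: C1a_embedding_def)
  have "continuous_on Z f"
    using C1a_on_differentiable[OF e(1)] assms(3)
    by (intro continuous_at_imp_continuous_on) (auto intro: differentiable_imp_continuous_within)
  then have "compact (f ` Z)" using assms(2) compact_continuous_image by blast
  then obtain B where B: "0 < B" "\<And>y v. y \<in> f ` Z \<Longrightarrow> norm (deriv_at (inv_into W f) y v) \<le> B * norm v"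
    using C1a_on_bounded[OF e(2) _ _ assms(4), of "f ` Z"] assms(3) by blast
  show thesis
  proof (rule that[of "1 / B"])
    fix x assume x: "x \<in> Z"
    have "norm v \<le> B * norm (deriv_at f x v)" for v
      using B(2)[of "f x" "deriv_at f x v"] x C1a_embedding_inverse(3)[OF assms(1), of x v] assms(3) by auto
    then show "expanding_at (1 / B) f x"
      using B(1) C1a_on_differentiable[OF e(1)] x assms(3) by (auto simp: expanding_at_def field_simps)
  qed (use B in auto)
qed

section \<open>Inverse branches of a Cantor set\<close>

definition ibranch :: "('a, 'v::euclidean_space) cantor \<Rightarrow> 'a \<Rightarrow> 'v \<Rightarrow> 'v" where
  "ibranch K a = inv_into (star K a) (gmap K)"

lemma branch_eq_word_map: "branch K w = word_map (ibranch K) w"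
  by (induction w rule: induct_list012) (auto simp: ibranch_def)

lemma star_eq_thicken: "star K a = thicken (radius K) (piece K a)"
  by (simp add: star_def thicken_def)

locale cantor_map =
  fixes K :: "('a, 'v::euclidean_space) cantor" and \<alpha> \<mu> :: real
  assumes regular: "regular_cantor \<alpha> K" and good: "good_radius \<alpha> K" and expands: "expands_by \<mu> K"
    and alpha: "0 < \<alpha>"
begin

lemma mu: "0 < \<mu>" "\<mu> < 1" using expands by (auto simp: expands_by_def)

lemma radius_pos: "0 < radius K" using good by (simp add: good_radius_def)

lemma pair_letters: "(a, b) \<in> pairs K \<Longrightarrow> a \<in> letters K" "(a, b) \<in> pairs K \<Longrightarrow> b \<in> letters K"
  using regular by (auto simp: regular_cantor_def)

lemma finite_letters: "finite (letters K)" using regular by (simp add: regular_cantor_def)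

lemma piece_props: "a \<in> letters K \<Longrightarrow> compact (piece K a)" "a \<in> letters K \<Longrightarrow> connected (piece K a)"
    "a \<in> letters K \<Longrightarrow> piece K a \<noteq> {}"
  using regular by (auto simp: regular_cantor_def)

lemma piece_subset_star: "piece K a \<subseteq> star K a"
  unfolding star_eq_thicken by (rule subset_thicken[OF radius_pos])

lemma star_subset_nbhd: "a \<in> letters K \<Longrightarrow> star K a \<subseteq> nbhd K"
  using good by (auto simp: good_radius_def)

lemma star_embedding: "a \<in> letters K \<Longrightarrow> C1a_embedding \<alpha> (star K a) (gmap K)"
  using good by (simp add: good_radius_def)

lemma gmap_C1a: "C1a_on \<alpha> (nbhd K) (gmap K)"
  using regular by (simp add: regular_cantor_def)

lemma gmap_expanding: "x \<in> nbhd K \<Longrightarrow> expanding_at (1 / \<mu>) (gmap K) x"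
proof -
  assume x: "x \<in> nbhd K"
  have d: "gmap K differentiable at x" using C1a_on_differentiable[OF gmap_C1a x] .
  have "1 / \<mu> * norm v \<le> norm (deriv_at (gmap K) x v)" for v
  proof -
    have "1 / \<mu> * norm v \<le> conorm (deriv_at (gmap K) x) * norm v"
      using expands x by (intro mult_right_mono) (auto simp: expands_by_def less_imp_le)
    then show ?thesis using conorm_le[OF linear_deriv_at[OF d], of v] by linarith
  qed
  then show ?thesis using mu d by (auto simp: expanding_at_def)
qed

lemma star_covered:
  assumes "(a, b) \<in> pairs K"
  shows "star K b \<subseteq> gmap K ` star K a" "piece K b \<subseteq> gmap K ` piece K a"
  using good regular assms pair_letters[OF assms] unfolding good_radius_def regular_cantor_def by presburger+

lemma ibranch_star:
  assumes "(a, b) \<in> pairs K" "x \<in> star K b"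
  shows "ibranch K a x \<in> star K a" "gmap K (ibranch K a x) = x"
  using star_covered(1)[OF assms(1)] assms(2) unfolding ibranch_def
  by (auto intro: inv_into_into f_inv_into_f)

lemma ibranch_gmap:
  assumes "a \<in> letters K" "x \<in> star K a"
  shows "ibranch K a (gmap K x) = x"
  using C1a_embedding_inverse(1)[OF star_embedding[OF assms(1)] assms(2)] by (simp add: ibranch_def)

lemma ibranch_piece:
  assumes "(a, b) \<in> pairs K" "x \<in> piece K b"
  shows "ibranch K a x \<in> piece K a"
proof -
  obtain y where "y \<in> piece K a" "x = gmap K y" using star_covered(2)[OF assms(1)] assms(2) by auto
  moreover from this(1) have "y \<in> star K a" using piece_subset_star by blast
  ultimately show ?thesis using ibranch_gmap[OF pair_letters(1)[OF assms(1)]] by simp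
qed

lemma ibranch_deriv:
  assumes "(a, b) \<in> pairs K" "x \<in> star K b"
  shows "ibranch K a differentiable at x"
    "deriv_at (ibranch K a) x (deriv_at (gmap K) (ibranch K a x) v) = v"
    "deriv_at (gmap K) (ibranch K a x) (deriv_at (ibranch K a) x v) = v"
    "norm (deriv_at (ibranch K a) x v) \<le> \<mu> * norm v"
proof -
  note i = ibranch_star[OF assms]
  note e = C1a_embedding_inverse(2-4)[OF star_embedding[OF pair_letters(1)[OF assms(1)]] i(1), unfolded i(2), folded ibranch_def]
  show "ibranch K a differentiable at x" by (rule e(1))
  show "deriv_at (ibranch K a) x (deriv_at (gmap K) (ibranch K a x) v) = v" by (rule e(2))
  show s: "deriv_at (gmap K) (ibranch K a x) (deriv_at (ibranch K a) x v) = v" by (rule e(3))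
  have "expanding_at (1 / \<mu>) (gmap K) (ibranch K a x)"
    using gmap_expanding i(1) star_subset_nbhd pair_letters(1)[OF assms(1)] by blast
  then have "1 / \<mu> * norm (deriv_at (ibranch K a) x v) \<le> norm v"
    unfolding expanding_at_def using s by metis
  then show "norm (deriv_at (ibranch K a) x v) \<le> \<mu> * norm v"
    using mu by (simp add: field_simps)
qed

lemma ibranch_lipschitz:
  assumes "(a, b) \<in> pairs K" "convex A" "A \<subseteq> star K b" "x \<in> A" "y \<in> A"
  shows "norm (ibranch K a x - ibranch K a y) \<le> \<mu> * norm (x - y)"
  using assms(3) ibranch_deriv[OF assms(1)]
  by (intro lipschitz_on_convex[OF assms(2) _ _ assms(4,5), where e' = "\<lambda>x. deriv_at (ibranch K a) x"])
    (auto intro: frechet_has_derivative)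

text \<open>A compact set in the domain of the map that contains the images of all inverse branches. The
constants of the inverse branches come from Hoelder bounds for the map there.\<close>

definition core :: "'v set" where
  "core = (\<Union>a\<in>letters K. {x. \<exists>p\<in>piece K a. dist p x \<le> \<mu> * radius K})"

lemma core: "compact core" "core \<subseteq> nbhd K"
proof -
  show "compact core" unfolding core_def
    by (intro compact_UN finite_letters closed_thickening_subset piece_props)
  have "\<mu> * radius K < radius K" using mu radius_pos by simp
  then show "core \<subseteq> nbhd K"
    using star_subset_nbhd unfolding core_def star_def by (force intro: le_less_trans)
qed

lemma ibranch_near_piece:
  assumes "(a, b) \<in> pairs K" "x \<in> ball z s" "z \<in> piece K b" "s \<le> radius K"
  shows "ibranch K a z \<in> piece K a" "dist (ibranch K a z) (ibranch K a x) \<le> \<mu> * s"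
proof -
  show "ibranch K a z \<in> piece K a" by (rule ibranch_piece[OF assms(1,3)])
  have s: "0 < s" "ball z s \<subseteq> star K b"
    using assms(2-4) by (auto simp: star_def intro: le_less_trans[OF zero_le_dist])
  have "norm (ibranch K a z - ibranch K a x) \<le> \<mu> * norm (z - x)"
    by (rule ibranch_lipschitz[OF assms(1) convex_ball s(2)]) (use assms(2) s(1) in auto)
  also have "\<dots> \<le> \<mu> * s" using assms(2) mu by (intro mult_left_mono) (auto simp: dist_norm)
  finally show "dist (ibranch K a z) (ibranch K a x) \<le> \<mu> * s" by (simp add: dist_norm)
qed

lemma ibranch_core:
  assumes "(a, b) \<in> pairs K" "x \<in> star K b"
  shows "ibranch K a x \<in> core"
proof -
  obtain z where z: "z \<in> piece K b" "x \<in> ball z (radius K)" using assms(2) by (auto simp: star_def)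
  show ?thesis
    using ibranch_near_piece[OF assms(1) z(2,1)] pair_letters(1)[OF assms(1)] by (auto simp: core_def)
qed

text \<open>The derivative of an inverse branch at \<open>x\<close> is the inverse of the derivative of the map at the image
of \<open>x\<close>, which lies in the compact set \<open>core\<close>. Bounds for the map on \<open>core\<close> thus turn into bounds for the
branches on all of \<open>star K b\<close>.\<close>

lemma ifs_star: "\<exists>H m M. ifs K (star K) (ibranch K) \<alpha> \<mu> H m M"
proof -
  obtain H where H: "0 \<le> H" "\<And>x y v. x \<in> core \<Longrightarrow> y \<in> core \<Longrightarrow>
      norm (deriv_at (gmap K) x v - deriv_at (gmap K) y v) \<le> H * norm (x - y) powr \<alpha> * norm v"
    using C1a_on_hoelder[OF gmap_C1a core] by blast
  obtain B where B: "0 < B" "\<And>x v. x \<in> core \<Longrightarrow> norm (deriv_at (gmap K) x v) \<le> B * norm v"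
    using C1a_on_bounded[OF gmap_C1a core alpha] by blast
  have "\<forall>a\<in>letters K. \<exists>M. path_diam_le (star K a) M"
    unfolding star_eq_thicken using path_diam_le_thicken piece_props radius_pos by blast
  then obtain M where M: "\<And>a. a \<in> letters K \<Longrightarrow> path_diam_le (star K a) (M a)" by metis
  define M' where "M' = (\<Sum>a\<in>letters K. M a)"
  have Mp: "0 \<le> M a" if "a \<in> letters K" for a using M[OF that] by (simp add: path_diam_le_def)
  have M': "path_diam_le (star K a) M'" if "a \<in> letters K" for a
    using Mp finite_letters that unfolding M'_def
    by (intro path_diam_le_mono[OF M[OF that]] member_le_sum) auto
  have "ifs K (star K) (ibranch K) \<alpha> \<mu> H (1 / B) M'"
  proof (unfold_locales)
    show "0 \<le> M'" unfolding M'_def using Mp by (intro sum_nonneg) auto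
    fix a b x assume ab: "(a, b) \<in> pairs K" and x: "x \<in> star K b"
    show "ibranch K a x \<in> star K a" by (rule ibranch_star[OF ab x])
    show "norm (deriv_at (ibranch K a) x v) \<le> \<mu> * norm v" for v by (rule ibranch_deriv[OF ab x])
    show "expanding_at (1 / B) (ibranch K a) x"
      unfolding expanding_at_def
    proof (intro conjI allI)
      fix v
      show "1 / B * norm v \<le> norm (deriv_at (ibranch K a) x v)"
        using B(2)[OF ibranch_core[OF ab x], of "deriv_at (ibranch K a) x v"] B(1)
        by (simp add: ibranch_deriv(3)[OF ab x] field_simps)
    qed (use B(1) ibranch_deriv(1)[OF ab x] in auto)
    fix y v :: 'v assume y: "y \<in> star K b"
    define u where "u = deriv_at (ibranch K a) y v"
    let ?g = "deriv_at (gmap K)" and ?p = "ibranch K a x" and ?q = "ibranch K a y"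
    have lin: "linear (deriv_at (ibranch K a) x)" by (rule linear_deriv_at[OF ibranch_deriv(1)[OF ab x]])
    have "deriv_at (ibranch K a) x v - u = deriv_at (ibranch K a) x (?g ?q u - ?g ?p u)"
      by (simp add: linear_diff[OF lin] ibranch_deriv(2)[OF ab x] u_def ibranch_deriv(3)[OF ab y])
    also have "norm \<dots> \<le> \<mu> * norm (?g ?q u - ?g ?p u)" by (rule ibranch_deriv(4)[OF ab x])
    also have "\<dots> \<le> 1 * (H * norm (?q - ?p) powr \<alpha> * norm u)"
      using mu by (intro mult_mono H(2) ibranch_core[OF ab] x y) auto
    also have "\<dots> \<le> H * norm (?q - ?p) powr \<alpha> * norm v"
    proof -
      have "norm u \<le> 1 * norm v"
        using ibranch_deriv(4)[OF ab y, of v] mu unfolding u_def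
        by (meson less_imp_le mult_right_mono norm_ge_zero order_trans)
      then show ?thesis using H(1) by (auto intro: mult_left_mono)
    qed
    finally show "norm (deriv_at (ibranch K a) x v - deriv_at (ibranch K a) y v)
       \<le> H * norm (ibranch K a x - ibranch K a y) powr \<alpha> * norm v"
      by (simp add: u_def norm_minus_commute)
  qed (use H B alpha mu M' in auto)
  then show ?thesis by blast
qed

lemma cantor_set_iff: "x \<in> cantor_set K \<longleftrightarrow> (\<forall>n. (gmap K ^^ n) x \<in> (\<Union>a\<in>letters K. piece K a))"
  by (auto simp: cantor_set_def)

lemma ibranch_cantor:
  assumes "(a, b) \<in> pairs K" "x \<in> cantor_piece K b"
  shows "ibranch K a x \<in> cantor_piece K a"
proof -
  have x: "x \<in> piece K b" "x \<in> cantor_set K" using assms(2) by (auto simp: cantor_piece_def)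
  have p: "ibranch K a x \<in> piece K a" by (rule ibranch_piece[OF assms(1) x(1)])
  have g: "gmap K (ibranch K a x) = x" using ibranch_star(2)[OF assms(1)] x(1) piece_subset_star by blast
  have "(gmap K ^^ n) (ibranch K a x) \<in> (\<Union>a\<in>letters K. piece K a)" for n
  proof (cases n)
    case 0
    then show ?thesis using p pair_letters(1)[OF assms(1)] by auto
  next
    case (Suc k)
    then show ?thesis using x(2) g by (simp add: funpow_Suc_right cantor_set_iff del: funpow.simps)
  qed
  then show ?thesis using p by (simp add: cantor_piece_def cantor_set_iff)
qed

lemma gmap_cantor:
  assumes "x \<in> cantor_set K"
  shows "gmap K x \<in> cantor_set K"
  using assms unfolding cantor_set_iff by (metis funpow_Suc_right o_apply)

lemma cantor_set_subset: "cantor_set K \<subseteq> (\<Union>a\<in>letters K. piece K a)"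
  unfolding cantor_set_def by (force dest: spec[of _ 0])

lemma word_map_piece:
  assumes "w \<in> words K"
  shows "x \<in> piece K (last w) \<Longrightarrow> word_map (ibranch K) w x \<in> piece K (hd w)"
    and "x \<in> cantor_piece K (last w) \<Longrightarrow> word_map (ibranch K) w x \<in> cantor_piece K (hd w)"
    and "x \<in> star K (last w) \<Longrightarrow> (gmap K ^^ (length w - 1)) (word_map (ibranch K) w x) = x
        \<and> word_map (ibranch K) w x \<in> star K (hd w)"
  using assms
proof (induction w rule: induct_list012)
  case (3 a b w)
  { case 1
    then show ?case using 3 ibranch_piece by (auto simp: words_Cons_Cons)
  next
    case 2
    then show ?case using 3 ibranch_cantor by (auto simp: words_Cons_Cons)
  next
    case 3
    then show ?case using "3.IH" ibranch_star
      by (auto simp: words_Cons_Cons funpow_Suc_right simp del: funpow.simps) }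
qed (auto simp: words_def)

end

section \<open>Bunching is uniform near a bunched Cantor set\<close>

text \<open>For invertible \<open>U\<close>: the norm of \<open>T\<close> times the norm of the inverse of \<open>U\<close> is at most \<open>R\<close>.\<close>

definition ratio_le :: "real \<Rightarrow> ('v::euclidean_space \<Rightarrow> 'v) \<Rightarrow> ('v \<Rightarrow> 'v) \<Rightarrow> bool" where
  "ratio_le R T U \<longleftrightarrow> (\<forall>a b. norm (T a) * norm b \<le> R * norm a * norm (U b))"

lemma ratio_le_mono:
  assumes "ratio_le R T U" "R \<le> R'"
  shows "ratio_le R' T U"
  unfolding ratio_le_def
proof (intro allI)
  fix a b :: 'a
  have "R * norm a * norm (U b) \<le> R' * norm a * norm (U b)"
    using assms(2) by (intro mult_right_mono) auto
  then show "norm (T a) * norm b \<le> R' * norm a * norm (U b)"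
    using assms(1) unfolding ratio_le_def by (meson order_trans)
qed

lemma ratio_le_perturb:
  assumes R: "ratio_le R T T" "0 \<le> R" and \<kappa>: "0 \<le> \<kappa>"
    and near: "\<And>v. norm (T1 v - T v) \<le> \<kappa> * norm v" "\<And>v. norm (T2 v - T v) \<le> \<kappa> * norm v"
    and low: "0 < k" "\<And>v. k * norm v \<le> norm (T2 v)"
  shows "ratio_le (R + (R + 1) * \<kappa> / k) T1 T2"
  unfolding ratio_le_def
proof (intro allI)
  fix a b :: 'a
  have 1: "norm (T1 a) \<le> norm (T a) + \<kappa> * norm a"
    using near(1)[of a] norm_triangle_sub[of "T1 a" "T a"] by linarith
  have 2: "norm (T b) \<le> norm (T2 b) + \<kappa> * norm b"
    using near(2)[of b] norm_triangle_sub[of "T b" "T2 b"] by (simp add: norm_minus_commute)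
  have 3: "norm b \<le> norm (T2 b) / k" using low(2)[of b] low(1) by (simp add: field_simps)
  have "norm (T1 a) * norm b \<le> norm (T a) * norm b + \<kappa> * norm a * norm b"
    using mult_right_mono[OF 1, of "norm b"] by (simp add: algebra_simps)
  also have "\<dots> \<le> R * norm a * norm (T b) + \<kappa> * norm a * norm b"
    using R(1) by (simp add: ratio_le_def)
  also have "\<dots> \<le> R * norm a * (norm (T2 b) + \<kappa> * norm b) + \<kappa> * norm a * norm b"
    using R(2) by (intro add_right_mono mult_left_mono 2) auto
  also have "\<dots> = R * norm a * norm (T2 b) + (R + 1) * \<kappa> * norm a * norm b"
    by (simp add: algebra_simps)
  also have "\<dots> \<le> R * norm a * norm (T2 b) + (R + 1) * \<kappa> * norm a * (norm (T2 b) / k)"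
    using R(2) \<kappa> by (intro add_left_mono mult_left_mono 3) auto
  also have "\<dots> = (R + (R + 1) * \<kappa> / k) * norm a * norm (T2 b)"
    using low(1) by (simp add: field_simps)
  finally show "norm (T1 a) * norm b \<le> (R + (R + 1) * \<kappa> / k) * norm a * norm (T2 b)" .
qed

lemma finite_uniform_bound:
  fixes B :: real
  assumes "finite A" "\<And>v. v \<in> A \<Longrightarrow> \<exists>R<B. P v R" "\<And>v R R'. P v R \<Longrightarrow> R \<le> R' \<Longrightarrow> P v R'"
  shows "\<exists>R<B. \<forall>v\<in>A. P v R"
  using assms(1,2)
proof (induction A)
  case empty
  show ?case by (intro exI[of _ "B - 1"]) auto
next
  case (insert v A)
  obtain R where R: "R < B" "\<forall>v\<in>A. P v R" using insert by auto
  obtain R' where R': "R' < B" "P v R'" using insert by auto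
  have "P w (max R R')" if "w \<in> insert v A" for w
  proof (cases "w = v")
    case True
    show ?thesis unfolding True by (rule assms(3)[OF R'(2)]) simp
  next
    case False
    then have "P w R" using R(2) that by simp
    then show ?thesis by (rule assms(3)) simp
  qed
  then show ?case using R(1) R'(1) by (intro exI[of _ "max R R'"]) auto
qed

lemma small_powr:
  fixes \<alpha> A \<kappa> :: real
  assumes "0 < \<alpha>" "0 \<le> A" "0 < \<kappa>"
  obtains d where "0 < d" "\<And>t. 0 \<le> t \<Longrightarrow> t \<le> d \<Longrightarrow> A * t powr \<alpha> \<le> \<kappa>"
proof (rule that[of "(\<kappa> / (A + 1)) powr (1 / \<alpha>)"])
  show "0 < (\<kappa> / (A + 1)) powr (1 / \<alpha>)" using assms by simp
  fix t :: real assume t: "0 \<le> t" "t \<le> (\<kappa> / (A + 1)) powr (1 / \<alpha>)"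
  have "t powr \<alpha> \<le> ((\<kappa> / (A + 1)) powr (1 / \<alpha>)) powr \<alpha>"
    using t assms(1) by (intro powr_mono2) auto
  also have "\<dots> = \<kappa> / (A + 1)" using assms by (simp add: powr_powr)
  finally have "A * t powr \<alpha> \<le> A * (\<kappa> / (A + 1))" using assms(2) by (intro mult_left_mono)
  also have "\<dots> \<le> \<kappa>" using assms by (simp add: field_simps)
  finally show "A * t powr \<alpha> \<le> \<kappa>" .
qed

lemma finite_words_of_length:
  assumes "finite (letters K)"
  shows "finite {w \<in> words K. length w = n}" "finite {w \<in> words K. length w \<le> n}"
proof -
  have "finite {w. set w \<subseteq> letters K \<and> length w \<le> n}" by (rule finite_lists_length_le[OF assms])
  then show "finite {w \<in> words K. length w = n}" "finite {w \<in> words K. length w \<le> n}"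
    by (auto simp: words_def elim!: rev_finite_subset)
qed

locale cantor_ifs = cantor_map K \<alpha> \<mu> + I: ifs K "star K" "ibranch K" \<alpha> \<mu> H m M
  for K :: "('a, 'v::euclidean_space) cantor" and \<alpha> \<mu> H m M :: real
begin

text \<open>Points of a piece are centres of balls contained in the star, and inverse branches map such balls
into balls of the same kind. Near a point of the piece the straight line distance can therefore be
used along the whole word.\<close>

lemma word_map_hoelder:
  assumes "w \<in> words K" "z \<in> piece K (last w)" "y \<in> ball z (radius K)"
  shows "norm (word_map (ibranch K) w y - word_map (ibranch K) w z) \<le> norm (y - z) \<and>
    (\<forall>v. norm (deriv_at (word_map (ibranch K) w) y v - deriv_at (word_map (ibranch K) w) z v)
      \<le> real (length w - 1) * (H * norm (y - z) powr \<alpha>) * norm v)"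
  using assms
proof (induction w rule: induct_list012)
  case 1
  then show ?case by (simp add: words_def)
next
  case (2 a)
  have "deriv_at (id::'v \<Rightarrow> 'v) z = id" for z by (rule deriv_at_eqI) (simp add: id_def)
  then show ?case by simp
next
  case (3 a b w)
  have ab: "(a, b) \<in> pairs K" and bw: "b # w \<in> words K" using 3(3) by (auto simp: words_Cons_Cons)
  let ?\<Phi> = "word_map (ibranch K) (b # w)" and ?f = "ibranch K a"
  have z: "z \<in> piece K (last (b # w))" using 3(4) by simp
  have IH: "norm (?\<Phi> y - ?\<Phi> z) \<le> norm (y - z)"
    "\<And>v. norm (deriv_at ?\<Phi> y v - deriv_at ?\<Phi> z v) \<le> real (length w) * (H * norm (y - z) powr \<alpha>) * norm v"
    using 3(2)[OF bw z 3(5)] by auto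
  have zy: "z \<in> star K (last (b # w))" "y \<in> star K (last (b # w))"
    using z piece_subset_star apply blast
    using z 3(5) unfolding star_def by blast
  have \<Phi>z: "?\<Phi> z \<in> piece K b" using word_map_piece(1)[OF bw z] by simp
  have "norm (y - z) < radius K" using 3(5) by (simp add: dist_norm norm_minus_commute)
  then have b: "?\<Phi> y \<in> ball (?\<Phi> z) (radius K)" "?\<Phi> z \<in> ball (?\<Phi> z) (radius K)"
    using IH(1) radius_pos by (auto simp: dist_norm norm_minus_commute)
  have bs: "ball (?\<Phi> z) (radius K) \<subseteq> star K b" using \<Phi>z by (auto simp: star_def)
  have lip: "norm (?f (?\<Phi> y) - ?f (?\<Phi> z)) \<le> norm (y - z)"
  proof -
    have "norm (?f (?\<Phi> y) - ?f (?\<Phi> z)) \<le> \<mu> * norm (?\<Phi> y - ?\<Phi> z)"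
      by (rule ibranch_lipschitz[OF ab convex_ball bs b])
    also have "\<dots> \<le> 1 * norm (y - z)" using mu IH(1) by (intro mult_mono) auto
    finally show ?thesis by simp
  qed
  have in_b: "?\<Phi> y \<in> star K b" "?\<Phi> z \<in> star K b" using b bs by blast+
  have d: "deriv_at (?f \<circ> ?\<Phi>) x = deriv_at ?f (?\<Phi> x) \<circ> deriv_at ?\<Phi> x" if "x \<in> star K (last (b # w))" "?\<Phi> x \<in> star K b" for x
    using ibranch_deriv(1)[OF ab that(2)] I.word_map_differentiable[OF bw that(1)] by (intro deriv_at_comp)
  have "norm (deriv_at (?f \<circ> ?\<Phi>) y v - deriv_at (?f \<circ> ?\<Phi>) z v)
      \<le> (real (length w) + 1) * (H * norm (y - z) powr \<alpha>) * norm v" for v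
  proof -
    let ?Y = "deriv_at ?\<Phi> y v" and ?Z = "deriv_at ?\<Phi> z v"
    have lin: "linear (deriv_at ?f (?\<Phi> z))" by (rule linear_deriv_at[OF ibranch_deriv(1)[OF ab in_b(2)]])
    have 1: "norm (deriv_at ?f (?\<Phi> y) ?Y - deriv_at ?f (?\<Phi> z) ?Y) \<le> H * norm (y - z) powr \<alpha> * norm v"
    proof -
      have "norm (deriv_at ?f (?\<Phi> y) ?Y - deriv_at ?f (?\<Phi> z) ?Y)
          \<le> H * norm (?f (?\<Phi> y) - ?f (?\<Phi> z)) powr \<alpha> * norm ?Y"
        by (rule I.hoelder[OF ab in_b])
      also have "\<dots> \<le> H * norm (y - z) powr \<alpha> * norm v"
        using I.H I.word_map_nonexpanding[OF bw zy(2)] lip alpha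
        by (intro mult_mono mult_nonneg_nonneg powr_mono2) auto
      finally show ?thesis .
    qed
    have "norm (deriv_at ?f (?\<Phi> z) (?Y - ?Z)) \<le> 1 * norm (?Y - ?Z)"
      using ibranch_deriv(4)[OF ab in_b(2), of "?Y - ?Z"] mu by (meson less_imp_le mult_right_mono norm_ge_zero order_trans)
    then have 2: "norm (deriv_at ?f (?\<Phi> z) ?Y - deriv_at ?f (?\<Phi> z) ?Z) \<le> real (length w) * (H * norm (y - z) powr \<alpha>) * norm v"
      using IH(2)[of v] by (simp add: linear_diff[OF lin])
    show ?thesis
      using 1 2 norm_triangle_ineq[of "deriv_at ?f (?\<Phi> y) ?Y - deriv_at ?f (?\<Phi> z) ?Y" "deriv_at ?f (?\<Phi> z) ?Y - deriv_at ?f (?\<Phi> z) ?Z"]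
      by (simp add: d[OF zy(1) in_b(2)] d[OF zy(2) in_b(1)] algebra_simps)
  qed
  then show ?case using lip by (simp add: o_def add.commute)
qed

definition near_branches :: "real \<Rightarrow> real \<Rightarrow> ('a \<Rightarrow> 'v \<Rightarrow> 'v) \<Rightarrow> bool" where
  "near_branches \<rho> \<epsilon> f \<longleftrightarrow> (\<forall>(a, b)\<in>pairs K. \<forall>x\<in>thicken \<rho> (piece K b).
     norm (f a x - ibranch K a x) \<le> \<epsilon> \<and>
     (\<forall>v. norm (deriv_at (f a) x v - deriv_at (ibranch K a) x v) \<le> \<epsilon> * norm v))"

lemma near_branchesD:
  assumes "near_branches \<rho> \<epsilon> f" "(a, b) \<in> pairs K" "x \<in> thicken \<rho> (piece K b)"
  shows "norm (f a x - ibranch K a x) \<le> \<epsilon>"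
    "norm (deriv_at (f a) x v - deriv_at (ibranch K a) x v) \<le> \<epsilon> * norm v"
  using assms unfolding near_branches_def by blast+

text \<open>The orbits of \<open>x\<close> under the two systems remain in a common ball centred at a point of a piece. This
is the reason for bounding \<open>\<rho>\<close> plus the accumulated error by the radius.\<close>

lemma word_map_close:
  assumes J: "ifs K (\<lambda>a. thicken \<rho> (piece K a)) f \<alpha> \<mu>' H' m' M'"
    and near: "\<And>a b x. (a, b) \<in> pairs K \<Longrightarrow> x \<in> thicken \<rho> (piece K b) \<Longrightarrow> norm (f a x - ibranch K a x) \<le> \<epsilon>"
      "\<And>a b x v. (a, b) \<in> pairs K \<Longrightarrow> x \<in> thicken \<rho> (piece K b) \<Longrightarrow>
        norm (deriv_at (f a) x v - deriv_at (ibranch K a) x v) \<le> \<epsilon> * norm v"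
    and \<epsilon>: "0 \<le> \<epsilon>" "\<rho> + real L * \<epsilon> \<le> radius K"
    and w: "w \<in> words K" "length w \<le> L + 1" "x \<in> thicken \<rho> (piece K (last w))"
  shows "norm (word_map f w x - word_map (ibranch K) w x) \<le> real (length w - 1) * \<epsilon> \<and>
    (\<forall>v. norm (deriv_at (word_map f w) x v - deriv_at (word_map (ibranch K) w) x v)
      \<le> real (length w - 1) * (\<epsilon> + H * (real L * \<epsilon>) powr \<alpha>) * norm v)"
  using w
proof (induction w rule: induct_list012)
  case 1
  then show ?case by (simp add: words_def)
next
  case (2 a)
  then show ?case by simp
next
  case (3 a b w)
  interpret J: ifs K "\<lambda>a. thicken \<rho> (piece K a)" f \<alpha> \<mu>' H' m' M' by (rule J)
  have ab: "(a, b) \<in> pairs K" and bw: "b # w \<in> words K" using 3(3) by (auto simp: words_Cons_Cons)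
  let ?\<Phi> = "word_map f (b # w)" and ?\<Psi> = "word_map (ibranch K) (b # w)" and ?f = "f a" and ?g = "ibranch K a"
  let ?S = "\<lambda>a. thicken \<rho> (piece K a)"
  have x: "x \<in> ?S (last (b # w))" using 3(5) by simp
  have "length w \<le> L" using 3(4) by simp
  have "length (b # w) \<le> L + 1" using 3(4) by simp
  then have IH: "norm (?\<Phi> x - ?\<Psi> x) \<le> real (length w) * \<epsilon>"
    "\<And>v. norm (deriv_at ?\<Phi> x v - deriv_at ?\<Psi> x v) \<le> real (length w) * (\<epsilon> + H * (real L * \<epsilon>) powr \<alpha>) * norm v"
    using 3(2)[OF bw _ x] by auto
  have "real (length w) * \<epsilon> \<le> real L * \<epsilon>" using \<open>length w \<le> L\<close> \<epsilon> by (intro mult_right_mono) auto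
  then have close: "norm (?\<Phi> x - ?\<Psi> x) \<le> real L * \<epsilon>" using IH(1) by simp
  have \<Phi>x: "?\<Phi> x \<in> ?S b" using J.word_map_in[OF bw x] by simp
  then obtain z where z: "z \<in> piece K b" "?\<Phi> x \<in> ball z \<rho>" by (auto simp: thicken_def)
  have "dist z (?\<Psi> x) \<le> dist z (?\<Phi> x) + dist (?\<Phi> x) (?\<Psi> x)" by (rule dist_triangle)
  then have b: "?\<Phi> x \<in> ball z (radius K)" "?\<Psi> x \<in> ball z (radius K)"
    using z(2) close \<epsilon> by (auto simp: dist_norm)
       (smt (verit, best) of_nat_0_le_iff mult_nonneg_nonneg)
  have bs: "ball z (radius K) \<subseteq> star K b" using z(1) by (auto simp: star_def)
  have in_b: "?\<Phi> x \<in> star K b" "?\<Psi> x \<in> star K b" using b bs by blast+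
  have "\<rho> \<le> radius K" using \<epsilon> by (smt (verit, best) of_nat_0_le_iff mult_nonneg_nonneg)
  then have xs: "x \<in> star K (last (b # w))" using x thicken_mono unfolding star_eq_thicken by blast
  have lip: "norm (?g (?\<Phi> x) - ?g (?\<Psi> x)) \<le> norm (?\<Phi> x - ?\<Psi> x)"
  proof -
    have "norm (?g (?\<Phi> x) - ?g (?\<Psi> x)) \<le> \<mu> * norm (?\<Phi> x - ?\<Psi> x)"
      by (rule ibranch_lipschitz[OF ab convex_ball bs b])
    also have "\<dots> \<le> 1 * norm (?\<Phi> x - ?\<Psi> x)" using mu by (intro mult_right_mono) auto
    finally show ?thesis by simp
  qed
  have val: "norm (?f (?\<Phi> x) - ?g (?\<Psi> x)) \<le> (real (length w) + 1) * \<epsilon>"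
    using norm_triangle_ineq[of "?f (?\<Phi> x) - ?g (?\<Phi> x)" "?g (?\<Phi> x) - ?g (?\<Psi> x)"] near(1)[OF ab \<Phi>x] lip IH(1)
    by (simp add: algebra_simps)
  have d1: "deriv_at (?f \<circ> ?\<Phi>) x = deriv_at ?f (?\<Phi> x) \<circ> deriv_at ?\<Phi> x"
    using J.exp[OF ab \<Phi>x] J.word_map_differentiable[OF bw x] by (intro deriv_at_comp) (auto simp: expanding_at_def)
  have d2: "deriv_at (?g \<circ> ?\<Psi>) x = deriv_at ?g (?\<Psi> x) \<circ> deriv_at ?\<Psi> x"
    using ibranch_deriv(1)[OF ab in_b(2)] I.word_map_differentiable[OF bw xs] by (intro deriv_at_comp)
  have "norm (deriv_at (?f \<circ> ?\<Phi>) x v - deriv_at (?g \<circ> ?\<Psi>) x v)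
      \<le> (real (length w) + 1) * (\<epsilon> + H * (real L * \<epsilon>) powr \<alpha>) * norm v" for v
  proof -
    let ?Y = "deriv_at ?\<Phi> x v" and ?Z = "deriv_at ?\<Psi> x v"
    have Y: "norm ?Y \<le> norm v" by (rule J.word_map_nonexpanding[OF bw x])
    have lin: "linear (deriv_at ?g (?\<Psi> x))" by (rule linear_deriv_at[OF ibranch_deriv(1)[OF ab in_b(2)]])
    have 0: "norm (deriv_at ?f (?\<Phi> x) ?Y - deriv_at ?g (?\<Phi> x) ?Y) \<le> \<epsilon> * norm v"
      using near(2)[OF ab \<Phi>x, of ?Y] mult_left_mono[OF Y \<epsilon>(1)] by linarith
    have 1: "norm (deriv_at ?g (?\<Phi> x) ?Y - deriv_at ?g (?\<Psi> x) ?Y) \<le> H * (real L * \<epsilon>) powr \<alpha> * norm v"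
    proof -
      have "norm (deriv_at ?g (?\<Phi> x) ?Y - deriv_at ?g (?\<Psi> x) ?Y)
          \<le> H * norm (?g (?\<Phi> x) - ?g (?\<Psi> x)) powr \<alpha> * norm ?Y"
        by (rule I.hoelder[OF ab in_b])
      also have "\<dots> \<le> H * (real L * \<epsilon>) powr \<alpha> * norm v"
        using I.H Y lip close alpha
        by (intro mult_mono mult_nonneg_nonneg powr_mono2) auto
      finally show ?thesis .
    qed
    have "norm (deriv_at ?g (?\<Psi> x) (?Y - ?Z)) \<le> 1 * norm (?Y - ?Z)"
      using ibranch_deriv(4)[OF ab in_b(2), of "?Y - ?Z"] mu by (meson less_imp_le mult_right_mono norm_ge_zero order_trans)
    then have 2: "norm (deriv_at ?g (?\<Psi> x) ?Y - deriv_at ?g (?\<Psi> x) ?Z) \<le> real (length w) * (\<epsilon> + H * (real L * \<epsilon>) powr \<alpha>) * norm v"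
      using IH(2)[of v] by (simp add: linear_diff[OF lin])
    have "norm (deriv_at ?f (?\<Phi> x) ?Y - deriv_at ?g (?\<Psi> x) ?Z)
      \<le> norm (deriv_at ?f (?\<Phi> x) ?Y - deriv_at ?g (?\<Phi> x) ?Y) + norm (deriv_at ?g (?\<Phi> x) ?Y - deriv_at ?g (?\<Psi> x) ?Y)
        + norm (deriv_at ?g (?\<Psi> x) ?Y - deriv_at ?g (?\<Psi> x) ?Z)"
      using norm_triangle_ineq[of "deriv_at ?f (?\<Phi> x) ?Y - deriv_at ?g (?\<Phi> x) ?Y" "deriv_at ?g (?\<Phi> x) ?Y - deriv_at ?g (?\<Psi> x) ?Y"]
        norm_triangle_ineq[of "deriv_at ?f (?\<Phi> x) ?Y - deriv_at ?g (?\<Psi> x) ?Y" "deriv_at ?g (?\<Psi> x) ?Y - deriv_at ?g (?\<Psi> x) ?Z"]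
      by simp
    then show ?thesis using 0 1 2 by (simp add: d1 d2 algebra_simps)
  qed
  then show ?case using val by (simp add: o_def add.commute)
qed

lemma compact_cantor_piece:
  assumes "a \<in> letters K"
  shows "compact (cantor_piece K a)"
proof -
  let ?P = "\<Union>a\<in>letters K. piece K a"
  have P: "closed ?P" by (intro closed_UN finite_letters compact_imp_closed ballI piece_props)
  have P': "?P \<subseteq> nbhd K" using regular by (simp add: regular_cantor_def)
  have "closed (cantor_piece K a)"
    unfolding closed_sequential_limits
  proof (intro allI impI, elim conjE)
    fix x l assume x: "\<forall>k. x k \<in> cantor_piece K a" and l: "x \<longlonglongrightarrow> l"
    have xn: "(gmap K ^^ n) (x k) \<in> ?P" for n k
      using x by (auto simp: cantor_piece_def cantor_set_def)
    have "(\<lambda>k. (gmap K ^^ n) (x k)) \<longlonglongrightarrow> (gmap K ^^ n) l \<and> (gmap K ^^ n) l \<in> ?P" for n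
    proof (induction n)
      case 0
      then show ?case using l closed_sequentially[OF P, of x l] xn[of 0] by simp
    next
      case (Suc n)
      have "isCont (gmap K) ((gmap K ^^ n) l)"
        using Suc P' C1a_on_differentiable[OF gmap_C1a] differentiable_imp_continuous_within by blast
      then have lim: "(\<lambda>k. (gmap K ^^ Suc n) (x k)) \<longlonglongrightarrow> (gmap K ^^ Suc n) l"
        using Suc isCont_tendsto_compose by auto
      then show ?case using closed_sequentially[OF P _ lim] xn[of "Suc n"] by blast
    qed
    moreover have "l \<in> piece K a"
      using closed_sequentially[OF compact_imp_closed[OF piece_props(1)[OF assms]], of x l] x l
      by (auto simp: cantor_piece_def)
    ultimately show "l \<in> cantor_piece K a" by (simp add: cantor_piece_def cantor_set_iff)
  qed
  then show ?thesis
    using piece_props(1)[OF assms] closed_Int_compact unfolding cantor_piece_def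
    by (metis Int_absorb2 inf_le2)
qed

end

locale bunched_map = cantor_ifs K \<alpha> \<mu> H m M
  for K :: "('a, 'v::euclidean_space) cantor" and \<alpha> \<mu> H m M :: real +
  fixes N :: nat and c :: "'a \<Rightarrow> 'v"
  assumes bunch: "\<And>x. x \<in> cantor_set K \<Longrightarrow>
      onorm (deriv_at (gmap K ^^ N) x) * inverse (conorm (deriv_at (gmap K ^^ N) x))
        * \<mu> powr (\<alpha> * real N) < 1"
    and base: "base_points K c"
begin

lemma base_cantor: "a \<in> letters K \<Longrightarrow> c a \<in> cantor_piece K a"
  using base by (simp add: base_points_def)

lemma base_piece: "a \<in> letters K \<Longrightarrow> c a \<in> piece K a"
  using base_cantor by (auto simp: cantor_piece_def)

lemma gmap_power_differentiable:
  assumes "x \<in> cantor_set K"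
  shows "(gmap K ^^ n) differentiable at x"
  using assms
proof (induction n arbitrary: x)
  case 0
  have "((\<lambda>x. x) has_derivative (\<lambda>x. x)) (at x)" by simp
  then show ?case by (auto simp: differentiable_def id_def)
next
  case (Suc n)
  have "x \<in> nbhd K" using Suc(2) cantor_set_subset piece_subset_star star_subset_nbhd by blast
  then have "gmap K differentiable at x" using C1a_on_differentiable[OF gmap_C1a] by blast
  then show ?case unfolding funpow_Suc_right
    using Suc.IH[OF gmap_cantor[OF Suc(2)]] by (rule differentiable_chain_at)
qed

text \<open>At the point \<open>x\<close> that the word reaches from \<open>z\<close>, the derivative of the \<open>N\<close>-th iterate of the map is
the inverse of \<open>T\<close>; the bunching inequality at \<open>x\<close> is an inequality for \<open>T\<close>.\<close>

lemma bunching_ratio_at: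
  assumes w: "w \<in> words K" "length w = Suc N" and z: "z \<in> cantor_piece K (last w)"
  defines "T \<equiv> deriv_at (word_map (ibranch K) w) z"
  shows "\<exists>R\<ge>0. R * \<mu> powr (\<alpha> * real N) < 1 \<and> ratio_le R T T"
proof -
  define x where "x = word_map (ibranch K) w z"
  have zs: "z \<in> star K (last w)" using z piece_subset_star by (auto simp: cantor_piece_def)
  have x: "x \<in> cantor_set K" using word_map_piece(2)[OF w(1) z] by (simp add: x_def cantor_piece_def)
  define G where "G = deriv_at (gmap K ^^ N) x"
  have dg: "(gmap K ^^ N) differentiable at x" by (rule gmap_power_differentiable[OF x])
  have lG: "linear G" unfolding G_def by (rule linear_deriv_at[OF dg])
  note E = I.word_map_exp[OF w(1) zs]
  have dw: "word_map (ibranch K) w differentiable at z" by (rule I.word_map_differentiable[OF w(1) zs])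
  have "((gmap K ^^ N) \<circ> word_map (ibranch K) w has_derivative G \<circ> T) (at z)"
    unfolding G_def T_def x_def by (rule diff_chain_at) (auto intro: frechet_has_derivative dw dg[unfolded x_def])
  moreover have "((gmap K ^^ N) \<circ> word_map (ibranch K) w has_derivative id) (at z)"
  proof (rule has_derivative_transform_within_open[of id id z UNIV "star K (last w)"])
    show "(id has_derivative id) (at z)" by (simp add: id_def)
    show "open (star K (last w))" by (simp add: star_eq_thicken open_thicken)
    show "id y = ((gmap K ^^ N) \<circ> word_map (ibranch K) w) y" if "y \<in> star K (last w)" for y
      using word_map_piece(3)[OF w(1) that] w(2) by simp
  qed (use zs in auto)
  ultimately have "G \<circ> T = id" by (rule has_derivative_unique)
  then have GT: "G (T v) = v" for v by (metis comp_apply id_apply)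
  have lT: "linear T" unfolding T_def by (rule linear_deriv_at[OF dw])
  have "T \<circ> G = id" using \<open>G \<circ> T = id\<close> linear_inverse_left[OF lT lG] by blast
  then have TG: "T (G v) = v" for v by (metis comp_apply id_apply)
  have "1 \<le> conorm G"
    unfolding conorm_def
  proof (rule cINF_greatest)
    show "sphere 0 (1::real) \<noteq> ({}::'v set)" by (simp add: sphere_eq_empty)
    fix v :: 'v assume "v \<in> sphere 0 1"
    then show "1 \<le> norm (G v)"
      using I.word_map_nonexpanding[OF w(1) zs, of "G v", folded T_def] TG[of v] by simp
  qed
  let ?R = "onorm G * inverse (conorm G)"
  have bG: "bounded_linear G" using lG by (simp add: linear_conv_bounded_linear)
  have "norm (T a) * norm b \<le> ?R * norm a * norm (T b)" for a b
  proof -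
    have "norm (T a) \<le> inverse (conorm G) * norm a"
      using conorm_le[OF lG, of "T a"] \<open>1 \<le> conorm G\<close> by (simp add: GT field_simps)
    moreover have "norm b \<le> onorm G * norm (T b)" using onorm[OF bG, of "T b"] by (simp add: GT)
    ultimately have "norm (T a) * norm b \<le> (inverse (conorm G) * norm a) * (onorm G * norm (T b))"
      using \<open>1 \<le> conorm G\<close> by (intro mult_mono) auto
    then show ?thesis by (simp add: mult_ac)
  qed
  moreover have "0 \<le> ?R" using \<open>1 \<le> conorm G\<close> onorm_pos_le[OF bG] by simp
  moreover have "?R * \<mu> powr (\<alpha> * real N) < 1" using bunch[OF x] by (simp add: G_def)
  ultimately show ?thesis unfolding ratio_le_def by blast
qed

text \<open>The ratio depends continuously on the point, and the pieces of the Cantor set are compact.\<close>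

lemma bunching_ratio_uniform:
  "\<exists>R\<ge>0. R * \<mu> powr (\<alpha> * real N) < 1 \<and>
    (\<forall>w\<in>words K. length w = Suc N \<longrightarrow> (\<forall>z\<in>cantor_piece K (last w).
       ratio_le R (deriv_at (word_map (ibranch K) w) z) (deriv_at (word_map (ibranch K) w) z)))"
proof -
  define B where "B = inverse (\<mu> powr (\<alpha> * real N))"
  have Bpos: "0 < B" and B: "\<And>R. R * \<mu> powr (\<alpha> * real N) < 1 \<longleftrightarrow> R < B"
    using mu by (auto simp: B_def field_simps)
  let ?D = "\<lambda>w z. deriv_at (word_map (ibranch K) w) z"
  define P where "P = (\<lambda>w z R. ratio_le R (?D w z) (?D w z))"
  have Pmono: "P w z R \<Longrightarrow> R \<le> R' \<Longrightarrow> P w z R'" for w z R R'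
    unfolding P_def by (rule ratio_le_mono)
  have one: "\<exists>R<B. \<forall>z\<in>cantor_piece K (last w). P w z R" if w: "w \<in> words K" "length w = Suc N" for w
  proof -
    let ?Z = "cantor_piece K (last w)"
    have loc: "\<exists>d>0. \<exists>R<B. \<forall>y\<in>?Z \<inter> ball z d. P w y R" if z: "z \<in> ?Z" for z
    proof -
      obtain R where R: "0 \<le> R" "R < B" "ratio_le R (?D w z) (?D w z)"
        using bunching_ratio_at[OF w z] B by blast
      define \<kappa> where "\<kappa> = (B - R) / 2 * m ^ N / (R + 1)"
      have \<kappa>: "0 < \<kappa>" using R I.m by (simp add: \<kappa>_def)
      obtain d where d: "0 < d" "\<And>t. 0 \<le> t \<Longrightarrow> t \<le> d \<Longrightarrow> (real N * H) * t powr \<alpha> \<le> \<kappa>"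
        using small_powr[OF alpha, of "real N * H" \<kappa>] I.H \<kappa> by auto
      have "P w y ((R + B) / 2)" if y: "y \<in> ?Z" "y \<in> ball z (min d (radius K))" for y
      proof -
        have zp: "z \<in> piece K (last w)" "y \<in> star K (last w)"
          using z y(1) piece_subset_star by (auto simp: cantor_piece_def)
        have "norm (?D w y v - ?D w z v) \<le> \<kappa> * norm v" for v
        proof -
          have "norm (?D w y v - ?D w z v) \<le> real N * (H * norm (y - z) powr \<alpha>) * norm v"
            using word_map_hoelder[OF w(1) zp(1), of y] y(2) w(2) by auto
          also have "\<dots> \<le> \<kappa> * norm v"
            using d(2)[of "norm (y - z)"] y(2)
            by (intro mult_right_mono) (auto simp: dist_norm norm_minus_commute mult.assoc)
          finally show ?thesis .
        qed
        then have "ratio_le (R + (R + 1) * \<kappa> / m ^ N) (?D w y) (?D w y)"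
          using R \<kappa> I.m I.word_map_exp[OF w(1) zp(2)] w(2)
          by (intro ratio_le_perturb[OF R(3,1)]) (auto simp: expanding_at_def)
        moreover have "R + 1 \<noteq> 0" using R(1) by simp
        then have "(R + 1) * \<kappa> = (B - R) / 2 * m ^ N"
          unfolding \<kappa>_def by (metis nonzero_mult_div_cancel_left times_divide_eq_right)
        then have "(R + 1) * \<kappa> / m ^ N = (B - R) / 2" using I.m by (simp del: distrib_right_numeral)
        then have "R + (R + 1) * \<kappa> / m ^ N = (R + B) / 2" by (simp add: field_simps)
        ultimately show ?thesis by (simp add: P_def)
      qed
      then show ?thesis using d(1) radius_pos R(2)
        by (intro exI[of _ "min d (radius K)"] conjI exI[of _ "(R + B) / 2"]) auto
    qed
    then obtain d where d: "\<And>z. z \<in> ?Z \<Longrightarrow> 0 < d z \<and> (\<exists>R<B. \<forall>y\<in>?Z \<inter> ball z (d z). P w y R)"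
      by metis
    have "compact ?Z" using compact_cantor_piece words_letters[OF w(1)] by blast
    then obtain X where X: "X \<subseteq> ?Z" "finite X" "?Z \<subseteq> (\<Union>z\<in>X. ball z (d z))"
      by (rule compactE_image[of _ ?Z "\<lambda>z. ball z (d z)"]) (use d in auto)
    have "\<exists>R<B. \<forall>z\<in>X. \<forall>y\<in>?Z \<inter> ball z (d z). P w y R"
      by (rule finite_uniform_bound[OF X(2)]) (use d X(1) Pmono in blast)+
    then show ?thesis using X(3) by blast
  qed
  have "\<exists>R<B. \<forall>w\<in>{w\<in>words K. length w = Suc N}. \<forall>z\<in>cantor_piece K (last w). P w z R"
    by (rule finite_uniform_bound[OF finite_words_of_length(1)[OF finite_letters]]) (use one Pmono in blast)+
  then obtain R where R: "R < B" "\<And>w z. w \<in> words K \<Longrightarrow> length w = Suc N \<Longrightarrow> z \<in> cantor_piece K (last w) \<Longrightarrow> P w z R"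
    by blast
  show ?thesis
  proof (intro exI[of _ "max R 0"] conjI ballI impI)
    show "max R 0 * \<mu> powr (\<alpha> * real N) < 1" using R(1) Bpos B[of "max R 0"] by simp
    show "ratio_le (max R 0) (?D w z) (?D w z)" if "w \<in> words K" "length w = Suc N" "z \<in> cantor_piece K (last w)" for w z
      using Pmono[OF R(2)[OF that], of "max R 0"] by (simp add: P_def)
  qed simp
qed

text \<open>For \<open>N = 0\<close> the bunching inequality would say that \<open>1 < 1\<close>.\<close>

lemma N_pos:
  assumes "a \<in> letters K"
  shows "0 < N"
proof (rule ccontr)
  assume "\<not> 0 < N"
  then have N: "N = 0" by simp
  have w: "[a] \<in> words K" using assms by (simp add: words_def)
  obtain R where R: "R * \<mu> powr (\<alpha> * real N) < 1"
      "ratio_le R (deriv_at (word_map (ibranch K) [a]) (c a)) (deriv_at (word_map (ibranch K) [a]) (c a))"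
    using bunching_ratio_at[OF w, of "c a"] base_cantor[OF assms] N by auto
  have "deriv_at (id::'v \<Rightarrow> 'v) z = id" for z by (rule deriv_at_eqI) (simp add: id_def)
  then have r: "norm (u::'v) * norm (v::'v) \<le> R * norm u * norm v" for u v
    using R(2) by (simp add: ratio_le_def)
  obtain u :: 'v where "u \<in> Basis" using nonempty_Basis by blast
  then show False using r[of u u] R(1) N mu by simp
qed

text \<open>Bunching with constants that are common to all systems near the inverse branches of \<open>K\<close> and with
given constants of contraction and regularity. Uniformity is essential: the number of letters that
matter has to be chosen before the perturbation.\<close>

definition stays_bunched :: "real \<Rightarrow> bool" where
  "stays_bunched \<mu>' \<longleftrightarrow> (\<forall>H' m' M'. 0 < m' \<longrightarrow> (\<exists>e>0. \<exists>L C \<nu>. 0 < \<nu> \<and> \<nu> < 1 \<and> (\<forall>\<rho> f \<epsilon>.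
     0 \<le> \<epsilon> \<and> \<epsilon> \<le> e \<and> 0 < \<rho> \<and> \<rho> + real L * \<epsilon> \<le> radius K \<and> near_branches \<rho> \<epsilon> f \<and>
     ifs K (\<lambda>a. thicken \<rho> (piece K a)) f \<alpha> \<mu>' H' m' M' \<longrightarrow>
     bunched_ifs K (\<lambda>a. thicken \<rho> (piece K a)) f \<alpha> \<mu>' H' m' M' C \<nu>)))"

lemma stays_bunchedE:
  assumes "stays_bunched \<mu>'" "0 < m'"
  obtains e L C \<nu> where "0 < e" "0 < \<nu>" "\<nu> < 1"
    "\<And>\<rho> f \<epsilon>. 0 \<le> \<epsilon> \<Longrightarrow> \<epsilon> \<le> e \<Longrightarrow> 0 < \<rho> \<Longrightarrow> \<rho> + real L * \<epsilon> \<le> radius K \<Longrightarrow> near_branches \<rho> \<epsilon> f \<Longrightarrow>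
       ifs K (\<lambda>a. thicken \<rho> (piece K a)) f \<alpha> \<mu>' H' m' M' \<Longrightarrow>
       bunched_ifs K (\<lambda>a. thicken \<rho> (piece K a)) f \<alpha> \<mu>' H' m' M' C \<nu>"
proof -
  obtain e L C \<nu> where e: "0 < e" "0 < \<nu>" "\<nu> < 1" and b: "\<forall>\<rho> f \<epsilon>.
       0 \<le> \<epsilon> \<and> \<epsilon> \<le> e \<and> 0 < \<rho> \<and> \<rho> + real L * \<epsilon> \<le> radius K \<and> near_branches \<rho> \<epsilon> f \<and>
       ifs K (\<lambda>a. thicken \<rho> (piece K a)) f \<alpha> \<mu>' H' m' M' \<longrightarrow>
       bunched_ifs K (\<lambda>a. thicken \<rho> (piece K a)) f \<alpha> \<mu>' H' m' M' C \<nu>"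
    using assms(1)[unfolded stays_bunched_def, rule_format, OF assms(2), of H' M'] by (elim exE conjE) (rule that)
  show thesis
    by (rule that[OF e]) (rule b[rule_format], intro conjI)
qed

text \<open>A long word is cut into blocks of \<open>N\<close> letters. The argument of a block that is followed by enough
letters is close to a point of the Cantor set, where the block satisfies the strict inequality of
\<open>bunching_ratio_uniform\<close>; there is room for a small error, for a nearby system, and for a contraction
rate \<open>\<mu>'\<close> slightly worse than \<open>\<mu>\<close>. Multiplying the inequalities of the blocks gives the decay. The
boundedly many letters at the end only affect the constant.\<close>

lemma bunched_perturbation:
  obtains \<mu>' where "\<mu> < \<mu>'" "\<mu>' < 1" "stays_bunched \<mu>'"
proof -
  let ?D = "\<lambda>w z. deriv_at (word_map (ibranch K) w) z"
  obtain R where R: "0 \<le> R" "R * \<mu> powr (\<alpha> * real N) < 1"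
    "\<And>w z. w \<in> words K \<Longrightarrow> length w = Suc N \<Longrightarrow> z \<in> cantor_piece K (last w) \<Longrightarrow> ratio_le R (?D w z) (?D w z)"
    using bunching_ratio_uniform by blast
  have "((\<lambda>t. R * t powr (\<alpha> * real N)) \<longlongrightarrow> R * \<mu> powr (\<alpha> * real N)) (at_right \<mu>)"
    using mu by (intro tendsto_intros) auto
  then have "eventually (\<lambda>t. R * t powr (\<alpha> * real N) < 1) (at_right \<mu>)"
    using R(2) by (rule order_tendstoD)
  then obtain b where b: "b > \<mu>" "\<And>t. t > \<mu> \<Longrightarrow> t < b \<Longrightarrow> R * t powr (\<alpha> * real N) < 1"
    unfolding eventually_at_right_field by blast
  define \<mu>' where "\<mu>' = (\<mu> + min b 1) / 2"
  have mu': "\<mu> < \<mu>'" "\<mu>' < 1" "\<mu>' < b" "0 < \<mu>'" using b(1) mu by (auto simp: \<mu>'_def min_def)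
  define P where "P = \<mu>' powr \<alpha>"
  have P: "0 < P" "\<mu>' powr (\<alpha> * real N) = P ^ N"
    using mu' by (simp_all add: P_def powr_powr[symmetric] powr_realpow)
  have RP: "R * P ^ N < 1" using b(2)[OF mu'(1,3)] P(2) by simp
  define q where "q = (1 + R * P ^ N) / 2"
  have q: "R * P ^ N < q" "q < 1" "0 < q" using RP R(1) P(1) by (auto simp: q_def add_pos_nonneg)
  define Rq where "Rq = q / P ^ N"
  have Rq: "R < Rq" using q(1) P(1) by (simp add: Rq_def field_simps)
  define \<nu> where "\<nu> = q powr (1 / real (max 1 N))"
  have nu: "0 < \<nu>" "\<nu> < 1" "\<nu> ^ max 1 N = q"
    using q powr_less_mono2[of "1 / real (max 1 N)" q 1]
    by (auto simp: \<nu>_def powr_realpow[symmetric] powr_powr)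
  show thesis
  proof (rule that[OF mu'(1,2)], unfold stays_bunched_def, intro allI impI)
    fix H' m' M' :: real assume m': "0 < m'"
    (* a perturbation of size \<kappa> of the derivative of a block worsens its ratio from R to exactly Rq *)
    define \<kappa> where "\<kappa> = (Rq - R) * m' ^ N / (R + 1)"
    have \<kappa>: "0 < \<kappa>" using Rq R(1) m' by (simp add: \<kappa>_def)
    obtain d0 where d0: "0 < d0" "\<And>t. 0 \<le> t \<Longrightarrow> t \<le> d0 \<Longrightarrow> (real N * H) * t powr \<alpha> \<le> \<kappa> / 2"
      using small_powr[OF alpha, of "real N * H" "\<kappa> / 2"] I.H \<kappa> by auto
    define d where "d = min d0 (radius K / 2)"
    have d: "0 < d" "d \<le> d0" "d < radius K" using d0(1) radius_pos by (auto simp: d_def min_def)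
    have "(\<lambda>n. M' * \<mu>' ^ n) \<longlonglongrightarrow> M' * 0" using mu' by (intro tendsto_intros LIMSEQ_realpow_zero) auto
    then have "eventually (\<lambda>n. M' * \<mu>' ^ n < d / 2) sequentially" using d(1) by (intro order_tendstoD) auto
    (* n0 letters after a block bring its argument within d / 2 of a point of the Cantor set *)
    then obtain n0 where n0: "M' * \<mu>' ^ n0 < d / 2" unfolding eventually_sequentially by blast
    define L where "L = N + n0"
    obtain e1 where e1: "0 < e1" "\<And>t. 0 \<le> t \<Longrightarrow> t \<le> e1 \<Longrightarrow> (real N * H) * t powr \<alpha> \<le> \<kappa> / 4"
      using small_powr[OF alpha, of "real N * H" "\<kappa> / 4"] I.H \<kappa> by auto
    define e where "e = min (d / 2 / (real n0 + 1)) (min (\<kappa> / 4 / (real N + 1)) (e1 / (real L + 1)))"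
    have e: "0 < e" using d \<kappa> e1 by (simp add: e_def)
    have e_le: "real n0 * \<epsilon> \<le> d / 2" "real N * \<epsilon> \<le> \<kappa> / 4" "real L * \<epsilon> \<le> e1" if "0 \<le> \<epsilon>" "\<epsilon> \<le> e" for \<epsilon>
    proof -
      have "(real n0 + 1) * \<epsilon> \<le> d / 2" "(real N + 1) * \<epsilon> \<le> \<kappa> / 4" "(real L + 1) * \<epsilon> \<le> e1"
        using that by (simp_all add: e_def field_simps)
      then show "real n0 * \<epsilon> \<le> d / 2" "real N * \<epsilon> \<le> \<kappa> / 4" "real L * \<epsilon> \<le> e1"
        using that by (simp_all add: algebra_simps)
    qed
    (* words with fewer than L steps are absorbed in the constant C *)
    define k where "k = min m' 1 * \<nu>"
    have k: "0 < k" "k \<le> 1" using m' nu by (auto simp: k_def mult_le_one)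
    define C where "C = 1 / k ^ L"
    show "\<exists>e>0. \<exists>L C \<nu>. 0 < \<nu> \<and> \<nu> < 1 \<and> (\<forall>\<rho> f \<epsilon>.
       0 \<le> \<epsilon> \<and> \<epsilon> \<le> e \<and> 0 < \<rho> \<and> \<rho> + real L * \<epsilon> \<le> radius K \<and> near_branches \<rho> \<epsilon> f \<and>
       ifs K (\<lambda>a. thicken \<rho> (piece K a)) f \<alpha> \<mu>' H' m' M' \<longrightarrow>
       bunched_ifs K (\<lambda>a. thicken \<rho> (piece K a)) f \<alpha> \<mu>' H' m' M' C \<nu>)"
    proof (rule exI[of _ e], rule conjI, rule e, rule exI[of _ L], rule exI[of _ C], rule exI[of _ \<nu>],
        rule conjI, rule nu(1), rule conjI, rule nu(2), intro allI impI, elim conjE)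
      fix \<rho> f \<epsilon>
      assume \<epsilon>: "0 \<le> \<epsilon>" "\<epsilon> \<le> e" and \<rho>: "0 < \<rho>" "\<rho> + real L * \<epsilon> \<le> radius K"
        and near: "near_branches \<rho> \<epsilon> f" and J: "ifs K (\<lambda>a. thicken \<rho> (piece K a)) f \<alpha> \<mu>' H' m' M'"
      interpret J: ifs K "\<lambda>a. thicken \<rho> (piece K a)" f \<alpha> \<mu>' H' m' M' by (rule J)
      let ?S = "\<lambda>a. thicken \<rho> (piece K a)"
      let ?E = "\<lambda>w z. deriv_at (word_map f w) z"
      have close: "norm (word_map f w x - word_map (ibranch K) w x) \<le> real (length w - 1) * \<epsilon> \<and>
          (\<forall>v. norm (?E w x v - ?D w x v) \<le> real (length w - 1) * (\<epsilon> + H * (real L * \<epsilon>) powr \<alpha>) * norm v)"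
        if "w \<in> words K" "length w \<le> L + 1" "x \<in> ?S (last w)" for w x
        by (rule word_map_close[OF J _ _ \<epsilon>(1) \<rho>(2) that]) (auto intro: near_branchesD[OF near])
      have block: "ratio_le Rq (?E v (word_map f u x)) (?E v (word_map f u y))"
        if v: "v \<in> words K" "length v = Suc N" and u: "u \<in> words K" "length u = Suc n0" and vu: "last v = hd u"
          and xy: "x \<in> ?S (last u)" "y \<in> ?S (last u)" for u v x y
      proof -
        define p where "p = c (last u)"
        have lu: "last u \<in> letters K" using words_letters[OF u(1)] by simp
        have p: "p \<in> ?S (last u)" "p \<in> cantor_piece K (last u)"
          using base_piece[OF lu] base_cantor[OF lu] subset_thicken[OF \<rho>(1)] by (auto simp: p_def)
        define z where "z = word_map (ibranch K) u p"
        have z: "z \<in> cantor_piece K (last v)" unfolding z_def vu by (rule word_map_piece(2)[OF u(1) p(2)])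
        then have zp: "z \<in> piece K (last v)" by (simp add: cantor_piece_def)
        have near_z: "norm (?E v (word_map f u t) a - ?D v z a) \<le> \<kappa> * norm a" if t: "t \<in> ?S (last u)" for t a
        proof -
          define s where "s = word_map f u t"
          have s: "s \<in> ?S (last v)" unfolding s_def vu by (rule J.word_map_in[OF u(1) t])
          have "norm (s - word_map f u p) \<le> M' * \<mu>' ^ n0"
            using J.word_map_diam[OF u(1) t p(1)] u(2) by (simp add: s_def)
          moreover have "norm (word_map f u p - z) \<le> real n0 * \<epsilon>"
            using close[OF u(1) _ p(1)] u(2) by (simp add: z_def L_def)
          ultimately have sz: "norm (s - z) \<le> d"
            using n0 e_le(1)[OF \<epsilon>] norm_triangle_ineq[of "s - word_map f u p" "word_map f u p - z"] by simp
          then have "s \<in> ball z (radius K)" using d(3) by (simp add: dist_norm norm_minus_commute)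
          then have "norm (?D v s a - ?D v z a) \<le> real N * (H * norm (s - z) powr \<alpha>) * norm a"
            using word_map_hoelder[OF v(1) zp] v(2) by auto
          also have "\<dots> \<le> \<kappa> / 2 * norm a"
            using d0(2)[of "norm (s - z)"] sz d(2) by (intro mult_right_mono) (auto simp: mult.assoc)
          finally have 1: "norm (?D v s a - ?D v z a) \<le> \<kappa> / 2 * norm a" .
          have "norm (?E v s a - ?D v s a) \<le> real N * (\<epsilon> + H * (real L * \<epsilon>) powr \<alpha>) * norm a"
            using close[OF v(1) _ s] v(2) by (simp add: L_def)
          also have "\<dots> \<le> \<kappa> / 2 * norm a"
            using e_le(2)[OF \<epsilon>] e1(2)[OF _ e_le(3)[OF \<epsilon>]] \<epsilon>(1)
            by (intro mult_right_mono) (auto simp: algebra_simps)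
          finally have "norm (?E v s a - ?D v s a) \<le> \<kappa> / 2 * norm a" .
          then show ?thesis
            using 1 norm_triangle_ineq[of "?E v s a - ?D v s a" "?D v s a - ?D v z a"] by (simp add: s_def)
        qed
        have "word_map f u y \<in> ?S (last v)" unfolding vu by (rule J.word_map_in[OF u(1) xy(2)])
        then have "m' ^ N * norm a \<le> norm (?E v (word_map f u y) a)" for a
          using J.word_map_exp[OF v(1)] v(2) by (auto simp: expanding_at_def)
        then have "ratio_le (R + (R + 1) * \<kappa> / m' ^ N) (?E v (word_map f u x)) (?E v (word_map f u y))"
          using \<kappa> m' near_z xy
          by (intro ratio_le_perturb[OF R(3)[OF v z] R(1)]) auto
        moreover have "R + 1 \<noteq> 0" using R(1) by simp
        then have "R + (R + 1) * \<kappa> / m' ^ N = Rq" using m' by (simp add: \<kappa>_def)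
        ultimately show ?thesis by simp
      qed
      have bunching: "norm (?E w x u) * norm v * P ^ (length w - 1) \<le> C * \<nu> ^ (length w - 1) * norm u * norm (?E w y v)"
        if "w \<in> words K" "x \<in> ?S (last w)" "y \<in> ?S (last w)" for w x y u v
        using that
      proof (induction "length w" arbitrary: w u v rule: less_induct)
        case less
        define n where "n = length w - 1"
        have len: "length w = Suc n" using less(2) by (cases w) (auto simp: words_def n_def)
        note w = less(2)
        show ?case
        proof (cases "n < L")
          case True
          have P1: "P \<le> 1" using mu' alpha powr_mono2[of \<alpha> \<mu>' 1] by (simp add: P_def)
          have "min m' 1 ^ n * norm v \<le> m' ^ n * norm v"
            using m' by (intro mult_right_mono power_mono) auto
          also have "\<dots> \<le> norm (?E w y v)"
            using J.word_map_exp[OF w less(4)] by (simp add: expanding_at_def n_def)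
          finally have 1: "min m' 1 ^ n * norm v \<le> norm (?E w y v)" .
          have "k ^ L \<le> k ^ n" using k True by (intro power_decreasing) auto
          then have "1 \<le> C * (k ^ n)" using k by (simp add: C_def field_simps)
          then have 2: "1 * norm v \<le> C * k ^ n * norm v" by (intro mult_right_mono) auto
          also have "\<dots> = C * \<nu> ^ n * (min m' 1 ^ n * norm v)" by (simp add: k_def power_mult_distrib)
          also have "\<dots> \<le> C * \<nu> ^ n * norm (?E w y v)"
            using 1 k nu by (intro mult_left_mono) (auto simp: C_def)
          finally have 3: "norm v \<le> C * \<nu> ^ n * norm (?E w y v)" by simp
          have "norm (?E w x u) * norm v * P ^ n \<le> norm u * norm v * 1"
            using J.word_map_nonexpanding[OF w less(3)] P P1 by (intro mult_mono power_le_one) auto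
          also have "\<dots> \<le> norm u * (C * \<nu> ^ n * norm (?E w y v))" using 3 by (simp add: mult_left_mono)
          finally show ?thesis by (simp add: n_def mult_ac)
        next
          case False
          have N: "0 < N" using N_pos words_letters[OF w] by blast
          define a t where "a = take (Suc N) w" and "t = drop N w"
          have Nw: "N < length w" using False len by (simp add: L_def)
          note sp = words_split[OF w Nw, folded a_def t_def]
          have lt: "length t = Suc (n - N)" using len False by (simp add: t_def L_def)
          have n0t: "n0 < length t" using lt False by (simp add: L_def)
          (* the letters u1 after the block a bring the argument of a close to the Cantor set *)
          define u1 t1 where "u1 = take (Suc n0) t" and "t1 = drop n0 t"
          note sp' = words_split[OF sp(2) n0t, folded u1_def t1_def]
          have xy: "x \<in> ?S (last t)" "y \<in> ?S (last t)" using less(3,4) sp(4) by auto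
          have inS: "word_map f t1 z \<in> ?S (last u1)" if "z \<in> ?S (last t)" for z
            using J.word_map_in[OF sp'(2)] that sp'(3,4) by simp
          have "ratio_le Rq (?E a (word_map f u1 (word_map f t1 x))) (?E a (word_map f u1 (word_map f t1 y)))"
          proof (rule block[OF sp(1) _ sp'(1) _ _ inS inS])
            show "length a = Suc N" using Nw by (simp add: a_def)
            show "length u1 = Suc n0" using n0t by (simp add: u1_def)
            show "last a = hd u1" using sp(3) by (simp add: u1_def)
          qed (use xy in auto)
          then have rq: "ratio_le Rq (?E a (word_map f t x)) (?E a (word_map f t y))"
            by (simp add: sp'(5)[of f])
          have d: "?E w z b = ?E a (word_map f t z) (?E t z b)" if "z \<in> ?S (last t)" for z b
          proof -
            have "word_map f t z \<in> ?S (last a)" using J.word_map_in[OF sp(2) that] sp(3) by simp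
            then have "?E w z = ?E a (word_map f t z) \<circ> ?E t z"
              unfolding sp(5)[of f]
              using J.word_map_differentiable[OF sp(2) that] J.word_map_differentiable[OF sp(1)] by (intro deriv_at_comp)
            then show ?thesis by simp
          qed
          define X Y where "X = ?E t x u" and "Y = ?E t y v"
          have IH: "norm X * norm v * P ^ (n - N) \<le> C * \<nu> ^ (n - N) * norm u * norm Y"
            using less(1)[of t u v] len lt N sp(2) xy False by (simp add: X_def Y_def L_def)
          have r: "norm (?E w x u) * norm Y \<le> Rq * norm X * norm (?E w y v)"
            using rq unfolding ratio_le_def d[OF xy(1)] d[OF xy(2)] X_def Y_def by blast
          show ?thesis
          proof (cases "v = 0")
            case True
            then show ?thesis using k nu by (simp add: C_def)
          next
            case vz: False
            have "0 < m' ^ (n - N) * norm v" using vz m' by simp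
            then have Y: "0 < norm Y"
              using J.word_map_exp[OF sp(2) xy(2)] lt unfolding expanding_at_def Y_def by (smt (verit) diff_Suc_1)
            have pn: "P ^ N * P ^ (n - N) = P ^ n" using False by (simp add: L_def flip: power_add)
            have "norm (?E w x u) * norm v * P ^ n * norm Y = (norm (?E w x u) * norm Y) * (norm v * P ^ n)"
              by (simp add: mult_ac)
            also have "\<dots> \<le> (Rq * norm X * norm (?E w y v)) * (norm v * P ^ n)"
              using r P by (intro mult_right_mono) auto
            also have "P ^ n = P ^ N * P ^ (n - N)" by (rule pn[symmetric])
            also have "(Rq * norm X * norm (?E w y v)) * (norm v * (P ^ N * P ^ (n - N)))
                = q * norm (?E w y v) * (norm X * norm v * P ^ (n - N))"
              using P by (simp add: Rq_def mult_ac)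
            also have "\<dots> \<le> q * norm (?E w y v) * (C * \<nu> ^ (n - N) * norm u * norm Y)"
              using IH q by (intro mult_left_mono) auto
            also have "\<dots> = C * (\<nu> ^ N * \<nu> ^ (n - N)) * norm u * norm (?E w y v) * norm Y"
              using nu(3) N by (simp add: mult_ac max_def split: if_splits)
            also have "\<nu> ^ N * \<nu> ^ (n - N) = \<nu> ^ n" using False by (simp add: L_def flip: power_add)
            finally have le: "norm (?E w x u) * norm v * P ^ n * norm Y \<le> C * \<nu> ^ n * norm u * norm (?E w y v) * norm Y"
              by (simp add: pn)
            show ?thesis using mult_right_le_imp_le[OF le Y] by (simp add: n_def)
          qed
        qed
      qed
      show "bunched_ifs K (\<lambda>a. thicken \<rho> (piece K a)) f \<alpha> \<mu>' H' m' M' C \<nu>"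
        by (unfold_locales) (use bunching k nu in \<open>auto simp: C_def P_def\<close>)
    qed
  qed
qed

end

section \<open>Left-infinite sequences\<close>

lemma truncate_Suc: "truncate \<theta> (Suc n) = \<theta> (Suc n) # truncate \<theta> n"
  by (simp add: truncate_def)

lemma length_truncate [simp]: "length (truncate \<theta> n) = Suc n"
  by (simp add: truncate_def)

lemma last_truncate [simp]: "last (truncate \<theta> n) = \<theta> 0"
  by (induction n) (auto simp: truncate_Suc, auto simp: truncate_def)

lemma hd_truncate [simp]: "hd (truncate \<theta> n) = \<theta> n"
  by (cases n) (auto simp: truncate_Suc, auto simp: truncate_def)

lemma truncate_nth: "j \<le> n \<Longrightarrow> truncate \<theta> n ! j = \<theta> (n - j)"
  unfolding truncate_def by (subst nth_map) (auto simp: rev_nth simp del: upt_Suc)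

lemma truncate_in_words: "\<theta> \<in> past K \<Longrightarrow> truncate \<theta> n \<in> words K"
proof (induction n)
  case 0
  then show ?case by (auto simp: truncate_def words_def past_def)
next
  case (Suc n)
  obtain v where v: "truncate \<theta> n = \<theta> n # v"
    using hd_truncate[of \<theta> n] length_truncate[of \<theta> n] by (cases "truncate \<theta> n") auto
  show ?case using Suc unfolding truncate_Suc v words_Cons_Cons by (auto simp: past_def)
qed

lemma truncate_extend:
  assumes "n \<le> k"
  obtains u where "truncate \<theta> k = u @ truncate \<theta> n"
  using assms
proof (induction k arbitrary: thesis rule: dec_induct)
  case base
  then show ?case by (metis append_Nil)
next
  case (step k)
  then show ?case by (metis append_Cons truncate_Suc)
qed

lemma truncate_append_word:
  assumes "w \<noteq> []" "hd w = \<theta> 0"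
  shows "truncate (append_word \<theta> w) (n + (length w - 1)) = truncate \<theta> n @ tl w"
proof (rule nth_equalityI)
  have len: "0 < length w" using assms(1) by simp
  show "length (truncate (append_word \<theta> w) (n + (length w - 1))) = length (truncate \<theta> n @ tl w)"
    using len by simp
  fix j assume "j < length (truncate (append_word \<theta> w) (n + (length w - 1)))"
  then have j: "j \<le> n + (length w - 1)" by simp
  define i where "i = n + (length w - 1) - j"
  have l: "truncate (append_word \<theta> w) (n + (length w - 1)) ! j = append_word \<theta> w i"
    using truncate_nth[OF j] by (simp add: i_def)
  show "truncate (append_word \<theta> w) (n + (length w - 1)) ! j = (truncate \<theta> n @ tl w) ! j"
  proof (cases "j \<le> n")
    case True
    then have r: "(truncate \<theta> n @ tl w) ! j = \<theta> (n - j)" by (simp add: nth_append truncate_nth)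
    show ?thesis
    proof (cases "j = n")
      case True
      then have "i = length w - 1" by (simp add: i_def)
      then have "append_word \<theta> w i = w ! 0" using len assms(1) by (simp add: append_word_def rev_nth)
      then show ?thesis using l r True assms by (simp add: hd_conv_nth)
    next
      case False
      then have "\<not> i < length w" "Suc i - length w = n - j" using \<open>j \<le> n\<close> len unfolding i_def by arith+
      then show ?thesis using l r assms by (simp add: append_word_def)
    qed
  next
    case False
    then have "i < length w" "length w - Suc i = j - n" using j len by (auto simp: i_def)
    then have "append_word \<theta> w i = w ! (j - n)" using assms(1) by (simp add: append_word_def rev_nth)
    moreover have "(truncate \<theta> n @ tl w) ! j = w ! (j - n)"
      using False j len by (simp add: nth_append nth_tl Suc_diff_Suc)
    ultimately show ?thesis using l by simp
  qed
qed

lemma sequence_eqI: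
  assumes "\<And>n. truncate \<theta> (n + k) = truncate \<tau> (n + k)"
  shows "\<theta> = \<tau>"
proof
  fix i
  have "truncate \<theta> (i + k) ! k = truncate \<tau> (i + k) ! k" using assms by simp
  then show "\<theta> i = \<tau> i" by (simp add: truncate_nth)
qed

lemma append_word_glue:
  assumes "u \<noteq> []" "w \<noteq> []" "hd u = \<theta> 0" "last u = hd w"
  shows "append_word (append_word \<theta> u) w = append_word \<theta> (u @ tl w)"
proof (rule sequence_eqI)
  fix n
  have "0 < length u" "0 < length w" using assms by auto
  then have len: "length (u @ tl w) - 1 = (length u - 1) + (length w - 1)" by (simp only: length_append length_tl)
  have "append_word \<theta> u 0 = last u"
    using assms(1) by (simp add: append_word_def rev_nth last_conv_nth)
  then have "truncate (append_word (append_word \<theta> u) w) ((n + (length u - 1)) + (length w - 1))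
      = truncate (append_word \<theta> u) (n + (length u - 1)) @ tl w"
    using assms by (intro truncate_append_word) auto
  also have "\<dots> = truncate \<theta> n @ tl (u @ tl w)"
    using truncate_append_word[of u \<theta> n] assms by simp
  also have "\<dots> = truncate (append_word \<theta> (u @ tl w)) (n + (length (u @ tl w) - 1))"
    using assms by (intro truncate_append_word[symmetric]) auto
  finally show "truncate (append_word (append_word \<theta> u) w) (n + ((length u - 1) + (length w - 1)))
      = truncate (append_word \<theta> (u @ tl w)) (n + ((length u - 1) + (length w - 1)))"
    unfolding len by (simp only: add.assoc)
qed

lemma append_word_0: "w \<noteq> [] \<Longrightarrow> append_word \<theta> w 0 = last w"
  by (simp add: append_word_def rev_nth last_conv_nth)

lemma append_word_past:
  assumes "\<theta> \<in> past K" "w \<in> words K" "hd w = \<theta> 0"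
  shows "append_word \<theta> w \<in> past K"
proof -
  let ?\<tau> = "append_word \<theta> w"
  have w: "w \<noteq> []" using assms(2) by (simp add: words_def)
  have "?\<tau> i \<in> letters K \<and> (?\<tau> (Suc i), ?\<tau> i) \<in> pairs K" for i
  proof -
    have t: "truncate ?\<tau> (Suc i + (length w - 1)) = truncate \<theta> (Suc i) @ tl w"
      by (rule truncate_append_word[where \<theta> = \<theta>, OF w assms(3)])
    have "truncate \<theta> (Suc i) @ tl w \<in> words K"
      using truncate_in_words[OF assms(1)] assms by (intro words_glue(1)) auto
    then have "truncate ?\<tau> (Suc i + (length w - 1)) \<in> words K" by (simp only: t)
    then have s: "set (truncate ?\<tau> (Suc i + (length w - 1))) \<subseteq> letters K"
      "successively (\<lambda>a b. (a, b) \<in> pairs K) (truncate ?\<tau> (Suc i + (length w - 1)))"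
      by (auto simp: words_def)
    let ?j = "length w - 1"
    have n: "truncate ?\<tau> (Suc i + (length w - 1)) ! ?j = ?\<tau> (Suc i)"
      "truncate ?\<tau> (Suc i + (length w - 1)) ! Suc ?j = ?\<tau> i"
      by (simp_all add: truncate_nth)
    have "?\<tau> i \<in> set (truncate ?\<tau> (Suc i + (length w - 1)))"
      unfolding n(2)[symmetric] by (rule nth_mem) simp
    moreover have "(?\<tau> (Suc i), ?\<tau> i) \<in> pairs K"
      using s(2) unfolding successively_conv_nth n[symmetric] by auto
    ultimately show ?thesis using s(1) by blast
  qed
  then show ?thesis by (simp add: past_def)
qed

section \<open>Limit geometries and transition maps\<close>

lemma geometric_limit:
  fixes x :: "nat \<Rightarrow> 'v::banach"
  assumes "\<And>n k. n \<le> k \<Longrightarrow> norm (x k - x n) \<le> B * \<nu> ^ n" "0 < \<nu>" "\<nu> < 1"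
  shows "x \<longlonglongrightarrow> lim x" "norm (x n - lim x) \<le> B * \<nu> ^ n"
proof -
  have "(\<lambda>n. B * \<nu> ^ n) \<longlonglongrightarrow> B * 0" using assms by (intro tendsto_intros LIMSEQ_realpow_zero) auto
  then have B: "(\<lambda>n. B * \<nu> ^ n) \<longlonglongrightarrow> 0" by simp
  have "Cauchy x"
  proof (rule CauchyI)
    fix e :: real assume "0 < e"
    then have "eventually (\<lambda>n. B * \<nu> ^ n < e / 2) sequentially" using B by (intro order_tendstoD) auto
    then obtain n where n: "B * \<nu> ^ n < e / 2" unfolding eventually_sequentially by blast
    have "norm (x i - x j) < e" if "n \<le> i" "n \<le> j" for i j
      using assms(1)[OF that(1)] assms(1)[OF that(2)] n norm_triangle_ineq4[of "x i - x n" "x j - x n"] by simp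
    then show "\<exists>M. \<forall>m\<ge>M. \<forall>n\<ge>M. norm (x m - x n) < e" by blast
  qed
  then show lim: "x \<longlonglongrightarrow> lim x" using Cauchy_convergent convergent_LIMSEQ_iff by blast
  have "(\<lambda>k. norm (x k - x n)) \<longlonglongrightarrow> norm (lim x - x n)" using lim by (intro tendsto_intros)
  then have "norm (lim x - x n) \<le> B * \<nu> ^ n"
    by (rule LIMSEQ_le_const2) (use assms(1) in blast)
  then show "norm (x n - lim x) \<le> B * \<nu> ^ n" by (simp add: norm_minus_commute)
qed

lemma Aff_has_derivative:
  assumes "A \<in> Aff"
  shows "(A has_derivative (\<lambda>v. A v - A 0)) (at x)"
proof -
  obtain L where L: "linear L" "\<And>x. A x = L x + A 0" "L = (\<lambda>v. A v - A 0)" using AffE[OF assms] by blast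
  have "bounded_linear L" using L(1) by (simp add: linear_conv_bounded_linear)
  then have "((\<lambda>x. L x + A 0) has_derivative (\<lambda>v. L v + 0)) (at x)"
    by (intro has_derivative_add bounded_linear_imp_has_derivative has_derivative_const)
  moreover have "(\<lambda>x. L x + A 0) = A" by (rule ext) (rule L(2)[symmetric])
  ultimately show ?thesis unfolding L(3)[symmetric] by simp
qed

text \<open>The derivatives of \<open>A \<circ> l\<close> and \<open>B \<circ> l\<close> at \<open>q\<close> are the linear parts of \<open>A\<close> and \<open>B\<close>.\<close>

lemma Aff_eqI:
  assumes A: "A \<in> Aff" "B \<in> Aff" and D: "open D" "q \<in> D" and l: "(l has_derivative id) (at q)"
    and eq: "\<And>x. x \<in> D \<Longrightarrow> A (l x) = B (l x)"
  shows "A = B"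
proof -
  have "(A \<circ> l has_derivative (\<lambda>v. A v - A 0) \<circ> id) (at q)"
    by (rule diff_chain_at[OF l Aff_has_derivative[OF A(1)]])
  moreover have "(B \<circ> l has_derivative (\<lambda>v. B v - B 0) \<circ> id) (at q)"
    by (rule diff_chain_at[OF l Aff_has_derivative[OF A(2)]])
  then have "(A \<circ> l has_derivative (\<lambda>v. B v - B 0) \<circ> id) (at q)"
    by (rule has_derivative_transform_within_open[OF _ D]) (simp add: eq)
  ultimately have "(\<lambda>v. A v - A 0) \<circ> id = (\<lambda>v. B v - B 0) \<circ> id"
    by (rule has_derivative_unique)
  from fun_cong[OF this] have d: "A v - A 0 = B v - B 0" for v by simp
  then have "A 0 = B 0" using d[of "l q"] eq[OF D(2)] by simp
  then show ?thesis using d by (intro ext) simp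
qed

text \<open>The rate \<open>\<mu>'\<close> of the bunching inequality may be slightly worse than the rate \<open>\<mu>\<close> of the map.\<close>

locale limit_map = bunched_map K \<alpha> \<mu> H m M N c + B: bunched_ifs K "star K" "ibranch K" \<alpha> \<mu>' H m M C \<nu>
  for K :: "('a, 'v::euclidean_space) cantor" and \<alpha> \<mu> H m M :: real and N c \<mu>' C \<nu>
begin

abbreviation br :: "'a list \<Rightarrow> 'v \<Rightarrow> 'v" where "br \<equiv> word_map (ibranch K)"

abbreviation k_n :: "(nat \<Rightarrow> 'a) \<Rightarrow> nat \<Rightarrow> 'v \<Rightarrow> 'v" where
  "k_n \<theta> n \<equiv> normalized (br (truncate \<theta> n)) (c (\<theta> 0))"

abbreviation s_n :: "(nat \<Rightarrow> 'a) \<Rightarrow> nat \<Rightarrow> 'v \<Rightarrow> 'v \<Rightarrow> 'v" where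
  "s_n \<theta> n \<equiv> slope (br (truncate \<theta> n)) (c (\<theta> 0))"

definition limit_slope :: "(nat \<Rightarrow> 'a) \<Rightarrow> 'v \<Rightarrow> 'v \<Rightarrow> 'v" where
  "limit_slope \<theta> x v = lim (\<lambda>n. s_n \<theta> n x v)"

lemma limit_geometry_eq: "limit_geometry K c \<theta> x = lim (\<lambda>n. k_n \<theta> n x)"
  by (simp add: limit_geometry_def affine_part_def normalized_def tangent_map_def branch_eq_word_map Let_def)

lemma base_star: "a \<in> letters K \<Longrightarrow> c a \<in> star K a"
  using base_piece piece_subset_star by blast

lemma past_letter: "\<theta> \<in> past K \<Longrightarrow> \<theta> i \<in> letters K"
  by (simp add: past_def)

lemma truncate_tail:
  assumes \<theta>: "\<theta> \<in> past K" and x: "x \<in> star K (\<theta> 0)" and nk: "n \<le> k"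
  shows "norm (s_n \<theta> k x v - s_n \<theta> n x v) \<le> B.Q * norm v * \<nu> ^ n"
    "norm (k_n \<theta> k x - k_n \<theta> n x) \<le> M * B.Q * \<nu> ^ n"
proof -
  obtain u where u: "truncate \<theta> k = u @ truncate \<theta> n" using truncate_extend[OF nk] by blast
  have "u @ truncate \<theta> n \<in> words K" "truncate \<theta> n \<noteq> []"
    using truncate_in_words[OF \<theta>, of k] u length_truncate[of \<theta> n] by (auto simp del: length_truncate)
  note t = B.normalized_tail_le[OF this, unfolded last_truncate length_truncate, OF base_star[OF past_letter[OF \<theta>]] x]
  show "norm (s_n \<theta> k x v - s_n \<theta> n x v) \<le> B.Q * norm v * \<nu> ^ n"
    "norm (k_n \<theta> k x - k_n \<theta> n x) \<le> M * B.Q * \<nu> ^ n"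
    using t(1)[of v] t(2) by (simp_all add: u mult_ac)
qed

lemma limit_geometry_tendsto:
  assumes "\<theta> \<in> past K" "x \<in> star K (\<theta> 0)"
  shows "(\<lambda>n. k_n \<theta> n x) \<longlonglongrightarrow> limit_geometry K c \<theta> x"
    "norm (k_n \<theta> n x - limit_geometry K c \<theta> x) \<le> M * B.Q * \<nu> ^ n"
  unfolding limit_geometry_eq
  using geometric_limit[where x = "\<lambda>n. k_n \<theta> n x", OF truncate_tail(2)[OF assms] B.lam] by simp_all

lemma limit_slope_tendsto:
  assumes "\<theta> \<in> past K" "x \<in> star K (\<theta> 0)"
  shows "(\<lambda>n. s_n \<theta> n x v) \<longlonglongrightarrow> limit_slope \<theta> x v"
    "norm (s_n \<theta> n x v - limit_slope \<theta> x v) \<le> B.Q * norm v * \<nu> ^ n"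
  unfolding limit_slope_def
  using geometric_limit[where x = "\<lambda>n. s_n \<theta> n x v", OF truncate_tail(1)[OF assms] B.lam] by simp_all

lemma truncate_exp:
  assumes "\<theta> \<in> past K" "x \<in> star K (\<theta> 0)"
  shows "expanding_at (m ^ n) (br (truncate \<theta> n)) x"
  using B.word_map_exp[OF truncate_in_words[OF assms(1), of n]] assms(2) by simp

text \<open>The derivatives of the maps \<open>k\<^sub>n\<close> converge uniformly, so the limit may be differentiated
termwise on a ball inside the star.\<close>

lemma limit_geometry_has_derivative:
  assumes \<theta>: "\<theta> \<in> past K" and x: "x \<in> star K (\<theta> 0)"
  shows "(limit_geometry K c \<theta> has_derivative limit_slope \<theta> x) (at x)"
proof -
  obtain z where z: "z \<in> piece K (\<theta> 0)" "x \<in> ball z (radius K)" using x by (auto simp: star_def)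
  let ?S = "ball z (radius K)"
  have sub: "?S \<subseteq> star K (\<theta> 0)" using z(1) by (auto simp: star_def)
  note E = truncate_exp[OF \<theta>]
  have pc: "c (\<theta> 0) \<in> star K (\<theta> 0)" by (rule base_star[OF past_letter[OF \<theta>]])
  have "\<exists>g. \<forall>y\<in>?S. (\<lambda>n. k_n \<theta> n y) \<longlonglongrightarrow> g y \<and> (g has_derivative limit_slope \<theta> y) (at y within ?S)"
  proof (rule has_derivative_sequence[where f = "k_n \<theta>" and f' = "s_n \<theta>" and ?x0.0 = x
        and l = "limit_geometry K c \<theta> x"])
    show "convex ?S" "x \<in> ?S" using z(2) by auto
    show "(\<lambda>n. k_n \<theta> n x) \<longlonglongrightarrow> limit_geometry K c \<theta> x" by (rule limit_geometry_tendsto(1)[OF \<theta> x])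
    show "(k_n \<theta> n has_derivative s_n \<theta> n y) (at y within ?S)" if "y \<in> ?S" for n y
    proof (rule has_derivative_at_withinI, rule normalized_has_derivative[OF E[OF pc]])
      have "y \<in> star K (\<theta> 0)" using that sub by blast
      then show "br (truncate \<theta> n) differentiable at y" using E[of y n] by (simp add: expanding_at_def)
    qed
    show "\<forall>\<^sub>F n in sequentially. \<forall>x\<in>?S. \<forall>h. norm (s_n \<theta> n x h - limit_slope \<theta> x h) \<le> e * norm h" if e: "0 < e" for e
    proof -
      have "(\<lambda>n. B.Q * \<nu> ^ n) \<longlonglongrightarrow> B.Q * 0" using B.lam by (intro tendsto_intros LIMSEQ_realpow_zero) auto
      then have "\<forall>\<^sub>F n in sequentially. B.Q * \<nu> ^ n < e" using e by (intro order_tendstoD) auto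
      then show ?thesis
      proof (eventually_elim, intro ballI allI)
        fix n y h assume n: "B.Q * \<nu> ^ n < e" and y: "y \<in> ?S"
        have "norm (s_n \<theta> n y h - limit_slope \<theta> y h) \<le> B.Q * \<nu> ^ n * norm h"
          using limit_slope_tendsto(2)[OF \<theta>, of y n h] y sub by (auto simp: mult_ac)
        also have "\<dots> \<le> e * norm h" using n by (intro mult_right_mono) auto
        finally show "norm (s_n \<theta> n y h - limit_slope \<theta> y h) \<le> e * norm h" .
      qed
    qed
  qed
  then obtain g where g: "\<And>y. y \<in> ?S \<Longrightarrow> (\<lambda>n. k_n \<theta> n y) \<longlonglongrightarrow> g y"
    "\<And>y. y \<in> ?S \<Longrightarrow> (g has_derivative limit_slope \<theta> y) (at y within ?S)" by blast
  have eq: "g y = limit_geometry K c \<theta> y" if "y \<in> ?S" for y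
    using LIMSEQ_unique[OF g(1)[OF that] limit_geometry_tendsto(1)[OF \<theta>]] sub that by blast
  have "(g has_derivative limit_slope \<theta> x) (at x)"
    using g(2)[OF z(2)] at_within_open[OF z(2) open_ball] by simp
  then show ?thesis
    by (rule has_derivative_transform_within_open[OF _ open_ball z(2)]) (use eq in auto)
qed

lemma limit_geometry_base:
  assumes \<theta>: "\<theta> \<in> past K"
  shows "limit_geometry K c \<theta> (c (\<theta> 0)) = c (\<theta> 0)" "limit_slope \<theta> (c (\<theta> 0)) = id"
proof -
  have pc: "c (\<theta> 0) \<in> star K (\<theta> 0)" by (rule base_star[OF past_letter[OF \<theta>]])
  show "limit_geometry K c \<theta> (c (\<theta> 0)) = c (\<theta> 0)"
    using limit_geometry_tendsto(1)[OF \<theta> pc] normalized_base[OF truncate_exp[OF \<theta> pc]]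
    by (simp add: LIMSEQ_const_iff)
  show "limit_slope \<theta> (c (\<theta> 0)) = id"
  proof
    fix v
    show "limit_slope \<theta> (c (\<theta> 0)) v = id v"
      using limit_slope_tendsto(1)[OF \<theta> pc, of v] slope_base[OF truncate_exp[OF \<theta> pc]]
      by (simp add: LIMSEQ_const_iff)
  qed
qed

lemma limit_geometry_expanding:
  assumes \<theta>: "\<theta> \<in> past K" and x: "x \<in> star K (\<theta> 0)"
  shows "expanding_at (1 / (1 + B.Q)) (limit_geometry K c \<theta>) x"
  unfolding expanding_at_def
proof (intro conjI allI)
  note d = limit_geometry_has_derivative[OF assms]
  show "limit_geometry K c \<theta> differentiable at x" using d by (auto simp: differentiable_def)
  show "0 < 1 / (1 + B.Q)" using B.Q_nonneg by simp
  fix v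
  have "(\<lambda>n. (1 + B.Q) * norm (s_n \<theta> n x v)) \<longlonglongrightarrow> (1 + B.Q) * norm (limit_slope \<theta> x v)"
    by (intro tendsto_intros limit_slope_tendsto[OF assms])
  then have "norm v \<le> (1 + B.Q) * norm (limit_slope \<theta> x v)"
    by (rule LIMSEQ_le_const)
      (use B.slope_bounds(2)[OF truncate_in_words[OF \<theta>]] base_star[OF past_letter[OF \<theta>]] x in auto)
  then show "1 / (1 + B.Q) * norm v \<le> norm (deriv_at (limit_geometry K c \<theta>) x v)"
    using B.Q_nonneg by (simp add: deriv_at_eqI[OF d] field_simps)
qed

definition approx_const :: real where
  "approx_const = (1 + M) * B.Q * (1 + (\<Sum>a\<in>letters K. norm (c a)))"

lemma norm_base_le: "a \<in> letters K \<Longrightarrow> norm (c a) \<le> (\<Sum>a\<in>letters K. norm (c a))"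
  using finite_letters by (intro member_le_sum) auto

abbreviation limit_transition :: "(nat \<Rightarrow> 'a) \<Rightarrow> 'a list \<Rightarrow> 'v \<Rightarrow> 'v" where
  "limit_transition \<theta> w \<equiv> tangent_map (limit_geometry K c \<theta> \<circ> br w) (c (last w))"

lemma limit_transition_exp:
  assumes "\<theta> \<in> past K" "w \<in> words K" "hd w = \<theta> 0"
  shows "expanding_at (1 / (1 + B.Q) * m ^ (length w - 1)) (limit_geometry K c \<theta> \<circ> br w) (c (last w))"
    "limit_transition \<theta> w \<in> Aff"
proof -
  have q: "c (last w) \<in> star K (last w)" using base_star words_letters[OF assms(2)] by blast
  have "br w (c (last w)) \<in> star K (\<theta> 0)" using B.word_map_in[OF assms(2) q] assms(3) by simp
  then show "expanding_at (1 / (1 + B.Q) * m ^ (length w - 1)) (limit_geometry K c \<theta> \<circ> br w) (c (last w))"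
    by (intro expanding_at_comp limit_geometry_expanding B.word_map_exp assms q)
  then show "limit_transition \<theta> w \<in> Aff" by (rule tangent_map_Aff)
qed

text \<open>The affine transition map of the limit geometries is a limit of transitions between tangent maps,
with an exponential rate that does not depend on \<open>\<theta>\<close>. Hence the last letters of \<open>\<theta>\<close> determine
the transition map up to a small error; this gives both its continuity and its stability.\<close>

lemma transition_approx:
  assumes \<theta>: "\<theta> \<in> past K" and w: "w \<in> words K" "hd w = \<theta> 0"
  shows "aff_near (approx_const * \<nu> ^ n)
    (inv (tangent_map (br (truncate \<theta> n)) (c (\<theta> 0))) \<circ> tangent_map (br (truncate \<theta> n) \<circ> br w) (c (last w)))
    (limit_transition \<theta> w)"
proof -
  let ?\<Phi> = "br (truncate \<theta> n)" and ?p = "c (\<theta> 0)" and ?q = "c (last w)"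
  have p: "?p \<in> star K (\<theta> 0)" by (rule base_star[OF past_letter[OF \<theta>]])
  have q: "?q \<in> star K (last w)" using base_star words_letters[OF w(1)] by blast
  define z where "z = br w ?q"
  have z: "z \<in> star K (\<theta> 0)" using B.word_map_in[OF w(1) q] w(2) by (simp add: z_def)
  define D where "D = deriv_at (br w) ?q"
  have T: "(inv (tangent_map ?\<Phi> ?p) \<circ> tangent_map (?\<Phi> \<circ> br w) ?q) = (\<lambda>x. k_n \<theta> n z + s_n \<theta> n z (D (x - ?q)))"
    using tangent_transition[OF truncate_exp[OF \<theta> p, of n], of "br w" ?q]
      truncate_exp[OF \<theta> z, of n] B.word_map_differentiable[OF w(1) q]
    by (auto simp: z_def D_def expanding_at_def)
  note d = limit_geometry_has_derivative[OF \<theta> z]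
  have "deriv_at (limit_geometry K c \<theta> \<circ> br w) ?q = limit_slope \<theta> z \<circ> D"
    using deriv_at_comp[of "br w" ?q "limit_geometry K c \<theta>"] B.word_map_differentiable[OF w(1) q] d
    by (auto simp: z_def[symmetric] D_def deriv_at_eqI[OF d] differentiable_def)
  then have F: "limit_transition \<theta> w = (\<lambda>x. limit_geometry K c \<theta> z + limit_slope \<theta> z (D (x - ?q)))"
    by (simp add: tangent_map_def z_def)
  let ?E = "(1 + M) * (B.Q * \<nu> ^ n)"
  have pos: "0 \<le> B.Q * \<nu> ^ n" using B.Q_nonneg B.lam by simp
  have E: "M * (B.Q * \<nu> ^ n) \<le> ?E" "B.Q * \<nu> ^ n \<le> ?E" "0 \<le> ?E"
    using pos B.M by (auto simp: algebra_simps)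
  have "aff_near (?E * (1 + norm ?q)) (\<lambda>x. k_n \<theta> n z + s_n \<theta> n z (D (x - ?q)))
    (\<lambda>x. limit_geometry K c \<theta> z + limit_slope \<theta> z (D (x - ?q)))"
  proof (rule aff_near_of_normalized[OF _ _ _ E(3)])
    show "norm (k_n \<theta> n z - limit_geometry K c \<theta> z) \<le> ?E"
      using limit_geometry_tendsto(2)[OF \<theta> z, of n] E(1) by (simp add: mult.assoc)
    show "norm (s_n \<theta> n z v - limit_slope \<theta> z v) \<le> ?E * norm v" for v
      using limit_slope_tendsto(2)[OF \<theta> z, of n v] mult_right_mono[OF E(2), of "norm v"] by (simp add: mult_ac)
    show "norm (D v) \<le> norm v" for v unfolding D_def by (rule B.word_map_nonexpanding[OF w(1) q])
  qed
  moreover have "?E * (1 + norm ?q) \<le> approx_const * \<nu> ^ n"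
  proof -
    have "?E * (1 + norm ?q) \<le> ?E * (1 + (\<Sum>a\<in>letters K. norm (c a)))"
      using norm_base_le words_letters[OF w(1)] E(3) by (intro mult_left_mono) auto
    then show ?thesis by (simp add: approx_const_def mult_ac)
  qed
  ultimately show ?thesis unfolding T F by (rule aff_near_mono)
qed

text \<open>At a finite level, the transition \<open>T n\<close> between tangent maps relates the two normalized maps exactly,
since both are normalizations of one inverse branch. The relation passes to the limit.\<close>

lemma limit_transition_conjugates:
  assumes \<theta>: "\<theta> \<in> past K" and w: "w \<in> words K" "hd w = \<theta> 0" and y: "y \<in> star K (last w)"
  shows "limit_transition \<theta> w (limit_geometry K c (append_word \<theta> w) y) = limit_geometry K c \<theta> (br w y)"
proof -
  let ?\<tau> = "append_word \<theta> w" and ?F = "limit_transition \<theta> w"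
  have wne: "w \<noteq> []" using w(1) by (auto simp: words_def)
  have \<tau>: "?\<tau> \<in> past K" "?\<tau> 0 = last w" using append_word_past[OF \<theta> w] append_word_0[OF wne] by auto
  have p: "c (\<theta> 0) \<in> star K (\<theta> 0)" by (rule base_star[OF past_letter[OF \<theta>]])
  define T where "T = (\<lambda>n. inv (tangent_map (br (truncate \<theta> n)) (c (\<theta> 0))) \<circ> tangent_map (br (truncate \<theta> n) \<circ> br w) (c (last w)))"
  define Y where "Y = (\<lambda>n. k_n ?\<tau> (n + (length w - 1)) y)"
  have ins: "br w y \<in> star K (\<theta> 0)" using B.word_map_in[OF w(1) y] w(2) by simp
  have glue: "br (truncate ?\<tau> (n + (length w - 1))) = br (truncate \<theta> n) \<circ> br w" for n
    unfolding truncate_append_word[where \<theta> = \<theta>, OF wne w(2)]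
    by (rule word_map_glue) (simp_all add: wne w(2), simp add: truncate_def)
  have TY: "T n (Y n) = k_n \<theta> n (br w y)" for n
  proof -
    have "tangent_map (br (truncate \<theta> n) \<circ> br w) (c (last w)) \<in> Aff"
      using tangent_map_Aff[OF truncate_exp[OF \<tau>(1), of "c (last w)" "n + (length w - 1)"]] \<tau> base_star words_letters[OF w(1)]
      unfolding glue by simp
    then show ?thesis
      unfolding T_def Y_def normalized_def glue \<tau>(2) by (simp add: Aff_inv_simps)
  qed
  have Y: "Y \<longlonglongrightarrow> limit_geometry K c ?\<tau> y"
    using LIMSEQ_ignore_initial_segment[OF limit_geometry_tendsto(1)[OF \<tau>(1)], of y "length w - 1"] y \<tau>(2)
    by (simp add: Y_def)
  have F: "(\<lambda>n. ?F (Y n)) \<longlonglongrightarrow> ?F (limit_geometry K c ?\<tau> y)"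
    using has_derivative_continuous[OF Aff_has_derivative[OF limit_transition_exp(2)[OF \<theta> w]]] Y
    by (intro isCont_tendsto_compose[of _ ?F])
  have "(\<lambda>n. approx_const * \<nu> ^ n * (1 + norm (Y n))) \<longlonglongrightarrow> approx_const * 0 * (1 + norm (limit_geometry K c ?\<tau> y))"
    using B.lam Y by (intro tendsto_intros LIMSEQ_realpow_zero) auto
  then have g: "(\<lambda>n. approx_const * \<nu> ^ n * (1 + norm (Y n))) \<longlonglongrightarrow> 0" by simp
  have "norm (T n (Y n) - ?F (Y n)) \<le> approx_const * \<nu> ^ n * (1 + norm (Y n))" for n
    unfolding T_def by (rule aff_nearD[OF transition_approx[OF \<theta> w]])
  then have "(\<lambda>n. T n (Y n) - ?F (Y n)) \<longlonglongrightarrow> 0"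
    by (intro Lim_null_comparison[OF always_eventually g]) blast
  then have "(\<lambda>n. T n (Y n)) \<longlonglongrightarrow> ?F (limit_geometry K c ?\<tau> y)"
    by (rule Lim_transform[OF F])
  then show ?thesis
    using limit_geometry_tendsto(1)[OF \<theta> ins] LIMSEQ_unique unfolding TY by blast
qed

lemma transition_unique:
  assumes \<tau>: "\<tau> \<in> past K" and A: "A \<in> Aff" "B \<in> Aff"
    and eq: "\<And>y. y \<in> star K (\<tau> 0) \<Longrightarrow> A (limit_geometry K c \<tau> y) = B (limit_geometry K c \<tau> y)"
  shows "A = B"
proof (rule Aff_eqI[OF A _ _ _ eq])
  show "open (star K (\<tau> 0))" by (simp add: star_eq_thicken open_thicken)
  show "c (\<tau> 0) \<in> star K (\<tau> 0)" by (rule base_star[OF past_letter[OF \<tau>]])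
  then show "(limit_geometry K c \<tau> has_derivative id) (at (c (\<tau> 0)))"
    using limit_geometry_has_derivative[OF \<tau>] limit_geometry_base(2)[OF \<tau>] by metis
qed

text \<open>The tangent map satisfies the defining property of the transition map, and the property has only one solution
because the limit geometry has the derivative \<open>id\<close> at the base point.\<close>

lemma transition_eq:
  assumes \<theta>: "\<theta> \<in> past K" and w: "w \<in> words K" "hd w = \<theta> 0"
  shows "transition K c \<theta> w = limit_transition \<theta> w"
proof -
  have wne: "w \<noteq> []" using w(1) by (auto simp: words_def)
  let ?\<tau> = "append_word \<theta> w" and ?l = "limit_geometry K c (append_word \<theta> w)" and ?D = "star K (last w)"
  have \<tau>: "?\<tau> \<in> past K" "?\<tau> 0 = last w" using append_word_past[OF \<theta> w] append_word_0[OF wne] by auto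
  have F: "limit_transition \<theta> w y = (limit_geometry K c \<theta> \<circ> branch K w \<circ> inv_into ?D ?l) y" if "y \<in> ?l ` ?D" for y
    using limit_transition_conjugates[OF \<theta> w, of "inv_into ?D ?l y"] that
    by (simp add: branch_eq_word_map f_inv_into_f inv_into_into)
  have "(THE A. A \<in> Aff \<and> (\<forall>y\<in>?l ` ?D. A y = (limit_geometry K c \<theta> \<circ> branch K w \<circ> inv_into ?D ?l) y)) = limit_transition \<theta> w"
  proof (rule the_equality)
    show "limit_transition \<theta> w \<in> Aff \<and> (\<forall>y\<in>?l ` ?D. limit_transition \<theta> w y = (limit_geometry K c \<theta> \<circ> branch K w \<circ> inv_into ?D ?l) y)"
      using F limit_transition_exp(2)[OF \<theta> w] by blast
    fix A assume A: "A \<in> Aff \<and> (\<forall>y\<in>?l ` ?D. A y = (limit_geometry K c \<theta> \<circ> branch K w \<circ> inv_into ?D ?l) y)"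
    show "A = limit_transition \<theta> w"
    proof (rule transition_unique[OF \<tau>(1)])
      show "A (?l y) = limit_transition \<theta> w (?l y)" if "y \<in> star K (?\<tau> 0)" for y
        using A F[of "?l y"] that \<tau>(2) by (metis imageI)
    qed (use A limit_transition_exp(2)[OF \<theta> w] in auto)
  qed
  then show ?thesis using wne unfolding transition_def Let_def by simp
qed

lemma transition_Aff:
  assumes "\<theta> \<in> past K" "w = [] \<or> w \<in> words K \<and> hd w = \<theta> 0"
  shows "transition K c \<theta> w \<in> Aff"
proof (cases "w = []")
  case True
  then show ?thesis using id_Aff by (simp add: transition_def)
next
  case False
  then show ?thesis using assms transition_eq limit_transition_exp(2) by metis
qed

lemma transition_cocycle:
  assumes \<theta>: "\<theta> \<in> past K" and u: "u \<in> words K" "hd u = \<theta> 0" and w: "w \<in> words K" "hd w = last u"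
  shows "limit_transition \<theta> (u @ tl w) = limit_transition \<theta> u \<circ> limit_transition (append_word \<theta> u) w"
proof -
  have ne: "u \<noteq> []" "w \<noteq> []" using u w by (auto simp: words_def)
  note g = words_glue[OF u(1) w(1) w(2)[symmetric]]
  let ?\<tau> = "append_word \<theta> u"
  have \<tau>: "?\<tau> \<in> past K" "?\<tau> 0 = last u" using append_word_past[OF \<theta> u] append_word_0[OF ne(1)] by auto
  have aw: "append_word ?\<tau> w = append_word \<theta> (u @ tl w)"
    using ne u w by (intro append_word_glue) auto
  have wg: "br (u @ tl w) = br u \<circ> br w" using ne w by (intro word_map_glue) auto
  have ap: "append_word \<theta> (u @ tl w) \<in> past K" "append_word \<theta> (u @ tl w) 0 = last w"
    using append_word_past[OF \<theta> g(1)] g u append_word_0[of "u @ tl w" \<theta>] ne by auto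
  have hw: "hd w = ?\<tau> 0" using \<tau> w by simp
  show ?thesis
  proof (rule transition_unique[OF ap(1)])
    show "limit_transition \<theta> (u @ tl w) \<in> Aff" using limit_transition_exp(2)[OF \<theta> g(1)] g(3) u by simp
    show "limit_transition \<theta> u \<circ> limit_transition ?\<tau> w \<in> Aff"
      by (intro Aff_comp limit_transition_exp \<theta> u \<tau> w hw)
    fix y assume "y \<in> star K (append_word \<theta> (u @ tl w) 0)"
    then have y: "y \<in> star K (last w)" by (simp add: ap(2))
    have "limit_transition \<theta> (u @ tl w) (limit_geometry K c (append_word \<theta> (u @ tl w)) y)
        = limit_geometry K c \<theta> (br u (br w y))"
      using limit_transition_conjugates[OF \<theta> g(1), of y] g u y wg by simp
    moreover have "limit_transition ?\<tau> w (limit_geometry K c (append_word ?\<tau> w) y) = limit_geometry K c ?\<tau> (br w y)"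
      by (rule limit_transition_conjugates[OF \<tau>(1) w(1) hw y])
    moreover have "limit_transition \<theta> u (limit_geometry K c ?\<tau> (br w y)) = limit_geometry K c \<theta> (br u (br w y))"
      using B.word_map_in[OF w(1) y] w(2) by (intro limit_transition_conjugates[OF \<theta> u]) simp
    ultimately show "limit_transition \<theta> (u @ tl w) (limit_geometry K c (append_word \<theta> (u @ tl w)) y)
        = (limit_transition \<theta> u \<circ> limit_transition ?\<tau> w) (limit_geometry K c (append_word \<theta> (u @ tl w)) y)"
      by (simp add: aw)
  qed
qed

end

section \<open>Inverse branches of a nearby Cantor set\<close>

lemma C1a_closeD:
  fixes f1 f2 :: "'v::euclidean_space \<Rightarrow> 'v"
  assumes "C1a_close \<alpha> \<epsilon> U f1 f2" "x \<in> U"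
  shows "f1 differentiable at x" "f2 differentiable at x" "norm (f1 x - f2 x) < \<epsilon>"
    "norm (deriv_at f1 x v - deriv_at f2 x v) \<le> \<epsilon> * norm v"
    "y \<in> U \<Longrightarrow> norm ((deriv_at f1 x v - deriv_at f2 x v) - (deriv_at f1 y v - deriv_at f2 y v))
        \<le> \<epsilon> * norm (x - y) powr \<alpha> * norm v"
proof -
  note close = assms(1)[unfolded C1a_close_def]
  have C: "C1a_on \<alpha> U f1" "C1a_on \<alpha> U f2" using close by simp_all
  have c0: "\<forall>x\<in>U. dist (f1 x) (f2 x) < \<epsilon>" using close by (elim conjE)
  have c1: "\<forall>x\<in>U. onorm (\<lambda>v. deriv_at f1 x v - deriv_at f2 x v) < \<epsilon>" using close by (elim conjE)
  have c2: "\<forall>x\<in>U. \<forall>y\<in>U. onorm (\<lambda>v. (deriv_at f1 x v - deriv_at f2 x v)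
                              - (deriv_at f1 y v - deriv_at f2 y v)) \<le> \<epsilon> * dist x y powr \<alpha>"
    using close by (elim conjE)
  have d: "f1 differentiable at y" "f2 differentiable at y" if "y \<in> U" for y
    using C C1a_on_differentiable that by blast+
  then show "f1 differentiable at x" "f2 differentiable at x" using assms(2) by auto
  have l: "linear (deriv_at f1 y)" "linear (deriv_at f2 y)" if "y \<in> U" for y
    using d[OF that] linear_deriv_at by blast+
  show "norm (f1 x - f2 x) < \<epsilon>" using c0 assms(2) by (simp add: dist_norm)
  show "norm (deriv_at f1 x v - deriv_at f2 x v) \<le> \<epsilon> * norm v"
    using c1 assms(2) by (intro norm_le_of_onorm_le l) auto
  assume y: "y \<in> U"
  have "norm ((\<lambda>v. deriv_at f1 x v - deriv_at f2 x v) v - (\<lambda>v. deriv_at f1 y v - deriv_at f2 y v) v)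
      \<le> \<epsilon> * dist x y powr \<alpha> * norm v"
    using c2 assms(2) y by (intro norm_le_of_onorm_le linear_compose_sub l) auto
  then show "norm ((deriv_at f1 x v - deriv_at f2 x v) - (deriv_at f1 y v - deriv_at f2 y v))
        \<le> \<epsilon> * norm (x - y) powr \<alpha> * norm v" by (simp add: dist_norm)
qed

text \<open>A fixed point of \<open>z \<mapsto> z - \<phi> z + x\<close> is a preimage of \<open>x\<close>, and Brouwer's theorem provides one.\<close>

lemma near_identity_covers:
  fixes \<phi> :: "'v::euclidean_space \<Rightarrow> 'v"
  assumes "continuous_on (cball x \<delta>) \<phi>" "\<And>z. z \<in> cball x \<delta> \<Longrightarrow> norm (z - \<phi> z) \<le> \<delta>" "0 \<le> \<delta>"
  shows "x \<in> \<phi> ` cball x \<delta>"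
proof -
  obtain z where z: "z \<in> cball x \<delta>" "z - \<phi> z + x = z"
  proof (rule brouwer[of "cball x \<delta>" "\<lambda>z. z - \<phi> z + x"])
    show "continuous_on (cball x \<delta>) (\<lambda>z. z - \<phi> z + x)" using assms(1) by (intro continuous_intros)
    show "(\<lambda>z. z - \<phi> z + x) \<in> cball x \<delta> \<rightarrow> cball x \<delta>" using assms(2) by (auto simp: dist_norm norm_minus_commute)
  qed (use assms(3) in auto)
  then show ?thesis by (intro image_eqI[of _ _ z]) (auto simp: algebra_simps)
qed

lemma deriv_at_id: "deriv_at (id::'v::euclidean_space \<Rightarrow> 'v) x = id"
  by (rule deriv_at_eqI) (simp add: id_def)

context cantor_ifs
begin

text \<open>With \<open>\<phi>\<close> the change of domain, the perturbed inverse branch is \<open>\<phi> \<circ> inv (gmap L \<circ> \<phi>)\<close>. The point \<open>z\<close>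
is the value of the second factor. Applying the unperturbed branch to \<open>gmap K z\<close>, which is close to
\<open>x\<close>, gives \<open>z\<close> back, so \<open>z\<close> is close to the unperturbed value.\<close>

lemma perturbed_branch_point:
  assumes L: "cantor_map L \<alpha> \<mu>L" and ab: "(a, b) \<in> pairs K" "(a, b) \<in> pairs L"
    and \<phi>: "\<phi> ` star K a = star L a" "C1a_close \<alpha> \<epsilon> (star K a) id \<phi>"
      "C1a_close \<alpha> \<epsilon> (star K a) (gmap K) (gmap L \<circ> \<phi>)"
    and \<epsilon>: "\<rho> + \<epsilon> \<le> radius K" and x: "x \<in> thicken \<rho> (piece K b)" "x \<in> star L b"
  obtains z q where "z \<in> star K a" "z \<in> core" "\<phi> z = ibranch L a x" "norm (z - ibranch K a x) \<le> \<epsilon>"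
    "\<And>v. deriv_at (ibranch L a) x (deriv_at (gmap L \<circ> \<phi>) z v) = deriv_at \<phi> z v"
    "q \<in> piece K a" "dist q z \<le> \<mu> * radius K"
proof -
  interpret L: cantor_map L \<alpha> \<mu>L by (rule L)
  obtain z where z: "z \<in> star K a" "\<phi> z = ibranch L a x"
    using L.ibranch_star(1)[OF ab(2) x(2)] \<phi>(1) by (metis imageE)
  have gz: "gmap L (\<phi> z) = x" using L.ibranch_star(2)[OF ab(2) x(2)] z(2) by simp
  have gx: "norm (gmap K z - x) < \<epsilon>" using C1a_closeD(3)[OF \<phi>(3) z(1)] gz by simp
  obtain p where p: "p \<in> piece K b" "x \<in> ball p \<rho>" using x(1) by (auto simp: thicken_def)
  have "\<rho> \<le> radius K" using gx \<epsilon> norm_ge_zero[of "gmap K z - x"] by linarith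
  have "dist p (gmap K z) \<le> dist p x + dist x (gmap K z)" by (rule dist_triangle)
  then have bz: "gmap K z \<in> ball p (radius K)" "x \<in> ball p (radius K)"
    using p(2) gx \<epsilon> \<open>\<rho> \<le> radius K\<close> by (auto simp: dist_norm norm_minus_commute)
  have bs: "ball p (radius K) \<subseteq> star K b" using p(1) by (auto simp: star_def)
  have fz: "ibranch K a (gmap K z) = z" by (rule ibranch_gmap[OF pair_letters(1)[OF ab(1)] z(1)])
  have core: "z \<in> core" using ibranch_core[OF ab(1), of "gmap K z"] bz bs fz by auto
  have "norm (z - ibranch K a x) \<le> \<mu> * norm (gmap K z - x)"
    using ibranch_lipschitz[OF ab(1) convex_ball bs bz] by (simp add: fz)
  also have "\<dots> \<le> 1 * \<epsilon>" using mu gx by (intro mult_mono) auto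
  finally have near: "norm (z - ibranch K a x) \<le> \<epsilon>" by simp
  have d\<phi>: "\<phi> differentiable at z" by (rule C1a_closeD(2)[OF \<phi>(2) z(1)])
  have "\<phi> z \<in> nbhd L" using z \<phi>(1) L.star_subset_nbhd[OF L.pair_letters(1)[OF ab(2)]] by blast
  then have dg: "gmap L differentiable at (\<phi> z)" by (rule C1a_on_differentiable[OF L.gmap_C1a])
  have der: "deriv_at (ibranch L a) x (deriv_at (gmap L \<circ> \<phi>) z v) = deriv_at \<phi> z v" for v
    using L.ibranch_deriv(2)[OF ab(2) x(2)] by (simp add: deriv_at_comp[OF d\<phi> dg] z(2))
  note np = ibranch_near_piece[OF ab(1) bz(1) p(1) order_refl, unfolded fz]
  show thesis by (rule that[OF z(1) core z(2) near der np])
qed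

text \<open>The stars of \<open>L\<close> need not be close to the pieces of \<open>K\<close>, so the branches of \<open>L\<close> are studied on
neighbourhoods of the pieces of \<open>K\<close> that are thinner than the stars of \<open>K\<close>; there the branches of both systems are
defined. All estimates express the derivative of the branch of \<open>L\<close> as the derivative of \<open>\<phi>\<close> composed
with the inverse of the derivative of \<open>gmap L \<circ> \<phi>\<close>, two maps that are close to the identity and to
\<open>gmap K\<close>. The constants \<open>H'\<close>, \<open>m'\<close>, \<open>M'\<close> are chosen before the size of the perturbation.\<close>

lemma perturbed_branches:
  assumes \<rho>: "0 < \<rho>" "\<rho> < radius K" and \<mu>': "\<mu> < \<mu>'" "\<mu>' < 1"
  obtains H' m' M' where "0 < m'"
    "\<And>e. 0 < e \<Longrightarrow> \<exists>\<delta>>0. \<forall>\<epsilon> L. \<epsilon> \<le> \<delta> \<and> cantor_close \<alpha> \<epsilon> K L \<longrightarrow>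
       near_branches \<rho> e (ibranch L) \<and> ifs K (\<lambda>a. thicken \<rho> (piece K a)) (ibranch L) \<alpha> \<mu>' H' m' M' \<and>
       (\<forall>b\<in>letters K. thicken \<rho> (piece K b) \<subseteq> star L b)"
proof -
  obtain G where G: "0 \<le> G" "\<And>x y v. x \<in> core \<Longrightarrow> y \<in> core \<Longrightarrow>
      norm (deriv_at (gmap K) x v - deriv_at (gmap K) y v) \<le> G * norm (x - y) powr \<alpha> * norm v"
    using C1a_on_hoelder[OF gmap_C1a core] by blast
  let ?S = "\<lambda>a. thicken \<rho> (piece K a)"
  have "\<forall>a\<in>letters K. \<exists>M. path_diam_le (?S a) M"
    using path_diam_le_thicken piece_props \<rho>(1) by blast
  then obtain Mf where Mf: "\<And>a. a \<in> letters K \<Longrightarrow> path_diam_le (?S a) (Mf a)" by metis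
  define M' where "M' = (\<Sum>a\<in>letters K. Mf a)"
  have Mp: "0 \<le> Mf a" if "a \<in> letters K" for a using Mf[OF that] by (simp add: path_diam_le_def)
  have M': "0 \<le> M'" "\<And>a. a \<in> letters K \<Longrightarrow> path_diam_le (?S a) M'"
    using Mp finite_letters unfolding M'_def
    by (auto intro!: sum_nonneg path_diam_le_mono[OF Mf] member_le_sum)
  define H' where "H' = 2 * (2 + G) * 2 powr \<alpha>"
  have H': "0 \<le> H'" using G by (simp add: H'_def)
  show thesis
  proof (rule that[of "m / 2" H' M'])
    show "0 < m / 2" using I.m by simp
    fix e :: real assume e: "0 < e"
    (* closeness e' also keeps the contraction rate below \<mu>' and the lower bound above m / 2 *)
    define e' where "e' = min e (min (\<mu>' - \<mu>) (m / 2))"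
    have e': "0 < e'" "e' \<le> e" "e' \<le> \<mu>' - \<mu>" "e' \<le> m / 2"
      using e \<mu>' I.m unfolding e'_def by linarith+
    obtain d where d: "0 < d" "\<And>t. 0 \<le> t \<Longrightarrow> t \<le> d \<Longrightarrow> G * t powr \<alpha> \<le> e' / 2"
      using small_powr[OF alpha G(1), of "e' / 2"] e' by auto
    (* s: two points of core at a distance below 4 s share a ball inside the star;
       t: branches map the neighbourhoods of radius \<rho> into those of radius \<rho> - 2 t *)
    define s t where "s = (1 - \<mu>) * radius K / 4" and "t = (1 - \<mu>) * \<rho> / 2"
    have st: "0 < s" "0 < t" using mu radius_pos \<rho> by (simp_all add: s_def t_def)
    define \<delta> where "\<delta> = min d (min (e' / 4) (min (radius K - \<rho>) (min (1 / 2) (min s t))))"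
    have "0 < \<delta>" "\<delta> \<le> d" "\<delta> \<le> e' / 4" "\<delta> \<le> radius K - \<rho>" "\<delta> \<le> 1 / 2" "\<delta> \<le> s" "\<delta> \<le> t"
      using d(1) e'(1) \<rho>(2) st unfolding \<delta>_def by linarith+
    then
    have \<delta>: "0 < \<delta>" "\<delta> \<le> d" "\<delta> \<le> e' / 4" "\<delta> \<le> radius K - \<rho>" "\<delta> \<le> 1 / 2"
      "\<delta> \<le> (1 - \<mu>) * radius K / 4" "\<delta> \<le> (1 - \<mu>) * \<rho> / 2"
      by (simp_all only: s_def t_def)
    show "\<exists>\<delta>>0. \<forall>\<epsilon> L. \<epsilon> \<le> \<delta> \<and> cantor_close \<alpha> \<epsilon> K L \<longrightarrow>
       near_branches \<rho> e (ibranch L) \<and> ifs K ?S (ibranch L) \<alpha> \<mu>' H' (m / 2) M' \<and>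
       (\<forall>b\<in>letters K. ?S b \<subseteq> star L b)"
    proof (rule exI[of _ \<delta>], rule conjI[OF \<delta>(1)], intro allI impI, elim conjE)
      fix \<epsilon> L assume le: "\<epsilon> \<le> \<delta>" and close: "cantor_close \<alpha> \<epsilon> K L"
      have lp: "letters L = letters K" "pairs L = pairs K" using close by (auto simp: cantor_close_def)
      have bL: "bunched_cantor \<alpha> L" using close by (simp add: cantor_close_def)
      then obtain \<mu>L where "expands_by \<mu>L L" unfolding bunched_cantor_def by blast
      then have LM: "cantor_map L \<alpha> \<mu>L"
        using bL alpha by unfold_locales (auto simp: bunched_cantor_def)
      interpret L: cantor_map L \<alpha> \<mu>L by (rule LM)
      have "\<forall>a\<in>letters K. \<exists>\<phi>. \<phi> ` star K a = star L a \<and> C1a_close \<alpha> \<epsilon> (star K a) id \<phi> \<and>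
          C1a_close \<alpha> \<epsilon> (star K a) (gmap K) (gmap L \<circ> \<phi>)"
        using close unfolding cantor_close_def diffeo_close_def by blast
      then obtain \<phi> where \<phi>: "\<And>a. a \<in> letters K \<Longrightarrow> \<phi> a ` star K a = star L a"
          "\<And>a. a \<in> letters K \<Longrightarrow> C1a_close \<alpha> \<epsilon> (star K a) id (\<phi> a)"
          "\<And>a. a \<in> letters K \<Longrightarrow> C1a_close \<alpha> \<epsilon> (star K a) (gmap K) (gmap L \<circ> \<phi> a)"
        by metis
      have cover: "?S b \<subseteq> star L b" if b: "b \<in> letters K" for b
      proof
        fix x assume "x \<in> ?S b"
        then obtain p where p: "p \<in> piece K b" "dist p x < \<rho>" by (auto simp: thicken_def)
        have sub: "cball x \<delta> \<subseteq> star K b"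
        proof
          fix y assume "y \<in> cball x \<delta>"
          then have "dist p y < radius K" using p(2) dist_triangle[of p y x] \<delta>(4) by simp
          then show "y \<in> star K b" using p(1) by (auto simp: star_def)
        qed
        have "x \<in> \<phi> b ` cball x \<delta>"
        proof (rule near_identity_covers)
          show "continuous_on (cball x \<delta>) (\<phi> b)"
            using C1a_closeD(2)[OF \<phi>(2)[OF b]] sub
            by (intro continuous_at_imp_continuous_on ballI differentiable_imp_continuous_within) auto
          show "norm (z - \<phi> b z) \<le> \<delta>" if "z \<in> cball x \<delta>" for z
            using C1a_closeD(3)[OF \<phi>(2)[OF b], of z] that sub le by auto
        qed (use \<delta> in auto)
        then show "x \<in> star L b" using \<phi>(1)[OF b] sub by blast
      qed
      have rho\<epsilon>: "\<rho> + \<epsilon> \<le> radius K" using \<delta>(4) le by simp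
      have near: "norm (ibranch L a x - ibranch K a x) \<le> 2 * \<delta> \<and>
          (\<forall>v. norm (deriv_at (ibranch L a) x v - deriv_at (ibranch K a) x v) \<le> e' * norm v)"
        if ab: "(a, b) \<in> pairs K" and x: "x \<in> ?S b" for a b x
      proof -
        note al = pair_letters(1)[OF ab] and bl = pair_letters(2)[OF ab]
        have ab': "(a, b) \<in> pairs L" using ab lp by simp
        have xL: "x \<in> star L b" using cover[OF bl] x by blast
        have xK: "x \<in> star K b" using x thicken_mono[of \<rho> "radius K"] \<rho> unfolding star_eq_thicken by auto
        obtain z q where z: "z \<in> star K a" "z \<in> core" "\<phi> a z = ibranch L a x" "norm (z - ibranch K a x) \<le> \<epsilon>"
          "\<And>v. deriv_at (ibranch L a) x (deriv_at (gmap L \<circ> \<phi> a) z v) = deriv_at (\<phi> a) z v"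
          using perturbed_branch_point[OF LM ab ab' \<phi>(1)[OF al] \<phi>(2)[OF al] \<phi>(3)[OF al] rho\<epsilon> x xL] by metis
        have "norm (z - \<phi> a z) < \<epsilon>" using C1a_closeD(3)[OF \<phi>(2)[OF al] z(1)] by simp
        then have val: "norm (ibranch L a x - ibranch K a x) \<le> 2 * \<delta>"
          using z(3,4) le norm_triangle_ineq[of "\<phi> a z - z" "z - ibranch K a x"] by (simp add: norm_minus_commute)
        define p where "p = ibranch K a x"
        have pc: "p \<in> core" unfolding p_def by (rule ibranch_core[OF ab xK])
        have lin: "linear (deriv_at (ibranch L a) x)" by (rule linear_deriv_at[OF L.ibranch_deriv(1)[OF ab' xL]])
        have "norm (deriv_at (ibranch L a) x v - deriv_at (ibranch K a) x v) \<le> e' * norm v" for v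
        proof -
          define T where "T = deriv_at (ibranch K a) x v"
          have T: "norm T \<le> norm v"
            using ibranch_deriv(4)[OF ab xK, of v] mu unfolding T_def
            by (meson less_imp_le mult_left_le_one_le norm_ge_zero order_trans)
          let ?A = "deriv_at (gmap K) p T" and ?B = "deriv_at (gmap L \<circ> \<phi> a) z T" and ?C = "deriv_at (gmap K) z T"
          have v: "v = ?A" unfolding T_def p_def by (rule ibranch_deriv(3)[OF ab xK, symmetric])
          have "norm (?A - ?B) \<le> norm (?A - ?C) + norm (?C - ?B)"
            using norm_triangle_ineq[of "?A - ?C" "?C - ?B"] by simp
          also have "\<dots> \<le> e' / 2 * norm T + \<delta> * norm T"
          proof (rule add_mono)
            have "norm (?A - ?C) \<le> G * norm (p - z) powr \<alpha> * norm T" by (rule G(2)[OF pc z(2)])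
            also have "\<dots> \<le> e' / 2 * norm T"
              using d(2)[of "norm (p - z)"] z(4) le \<delta>(2) by (intro mult_right_mono) (auto simp: p_def norm_minus_commute)
            finally show "norm (?A - ?C) \<le> e' / 2 * norm T" .
            show "norm (?C - ?B) \<le> \<delta> * norm T"
              using C1a_closeD(4)[OF \<phi>(3)[OF al] z(1), of T] mult_right_mono[OF le, of "norm T"] by simp
          qed
          finally have AB: "norm (?A - ?B) \<le> (e' / 2 + \<delta>) * norm T" by (simp add: algebra_simps)
          have "norm (deriv_at (ibranch L a) x (?A - ?B)) \<le> 1 * norm (?A - ?B)"
            using L.ibranch_deriv(4)[OF ab' xL, of "?A - ?B"] L.mu by (meson less_imp_le mult_right_mono norm_ge_zero order_trans)
          then have 1: "norm (deriv_at (ibranch L a) x ?A - deriv_at (\<phi> a) z T) \<le> (e' / 2 + \<delta>) * norm T"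
            using AB by (simp add: linear_diff[OF lin] z(5))
          have 2: "norm (deriv_at (\<phi> a) z T - T) \<le> \<delta> * norm T"
            using C1a_closeD(4)[OF \<phi>(2)[OF al] z(1), of T] mult_right_mono[OF le, of "norm T"]
            by (simp add: deriv_at_id norm_minus_commute)
          have "norm (deriv_at (ibranch L a) x v - T) \<le> (e' / 2 + \<delta>) * norm T + \<delta> * norm T"
            using 1 2 norm_triangle_ineq[of "deriv_at (ibranch L a) x ?A - deriv_at (\<phi> a) z T" "deriv_at (\<phi> a) z T - T"] v by simp
          also have "\<dots> = (e' / 2 + 2 * \<delta>) * norm T" by (simp add: algebra_simps)
          also have "\<dots> \<le> e' * norm v" using \<delta>(1,3) e' T by (intro mult_mono) auto
          finally show ?thesis by (simp add: T_def)
        qed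
        then show ?thesis using val by blast
      qed
      have ndelta: "2 * \<delta> \<le> e" using \<delta>(3) e'(1,2) by simp
      have "near_branches \<rho> e (ibranch L)"
        unfolding near_branches_def
      proof (intro ballI, clarify, intro conjI allI)
        fix a b x and v :: 'v assume ab: "(a, b) \<in> pairs K" and x: "x \<in> ?S b"
        show "norm (ibranch L a x - ibranch K a x) \<le> e" using near[OF ab x] ndelta by simp
        have "e' * norm v \<le> e * norm v" using e'(2) by (intro mult_right_mono) auto
        then show "norm (deriv_at (ibranch L a) x v - deriv_at (ibranch K a) x v) \<le> e * norm v"
          using near[OF ab x] by (meson order_trans)
      qed
      moreover have "ifs K ?S (ibranch L) \<alpha> \<mu>' H' (m / 2) M'"
      proof (unfold_locales)
        fix a b x assume ab: "(a, b) \<in> pairs K" and x: "x \<in> ?S b"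
        note al = pair_letters(1)[OF ab] and bl = pair_letters(2)[OF ab]
        have ab': "(a, b) \<in> pairs L" using ab lp by simp
        have inL: "y \<in> star L b" if "y \<in> ?S b" for y using cover[OF bl] that by blast
        have xK: "x \<in> star K b" using x thicken_mono[of \<rho> "radius K"] \<rho> unfolding star_eq_thicken by auto
        show "ibranch L a x \<in> ?S a"
        proof -
          obtain p where p: "p \<in> piece K b" "x \<in> ball p \<rho>" using x by (auto simp: thicken_def)
          note np = ibranch_near_piece[OF ab p(2,1) less_imp_le[OF \<rho>(2)]]
          have "dist (ibranch K a x) (ibranch L a x) < 2 * \<delta> \<or> dist (ibranch K a x) (ibranch L a x) = 2 * \<delta>"
            using near[OF ab x] by (auto simp: dist_norm norm_minus_commute)
          moreover have "dist p x < \<rho>" using p(2) by simp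
          moreover have "dist (ibranch K a p) (ibranch K a x) \<le> \<mu> * dist p x"
            unfolding dist_norm
            by (rule ibranch_lipschitz[OF ab, of "ball p (radius K)"]) (use p \<rho> radius_pos in \<open>auto simp: star_def\<close>)
          then have "dist (ibranch K a p) (ibranch K a x) < \<mu> * \<rho>"
            using p(2) mu by (smt (verit) mem_ball mult_strict_left_mono)
          moreover have "\<mu> * \<rho> + 2 * \<delta> \<le> \<rho>" using \<delta>(7) by (simp add: algebra_simps)
          ultimately have "dist (ibranch K a p) (ibranch L a x) < \<rho>"
            using dist_triangle[of "ibranch K a p" "ibranch L a x" "ibranch K a x"] by linarith
          then show ?thesis using np(1) by (auto simp: thicken_def)
        qed
        show "norm (deriv_at (ibranch L a) x v) \<le> \<mu>' * norm v" for v
        proof -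
          have "norm (deriv_at (ibranch L a) x v) \<le> \<mu> * norm v + e' * norm v"
            using near[OF ab x] ibranch_deriv(4)[OF ab xK, of v]
              norm_triangle_sub[of "deriv_at (ibranch L a) x v" "deriv_at (ibranch K a) x v"]
            by (meson add_mono order_trans)
          also have "\<dots> \<le> \<mu>' * norm v"
            using e'(3) mult_right_mono[of "\<mu> + e'" \<mu>' "norm v"] by (simp add: algebra_simps)
          finally show ?thesis .
        qed
        show "expanding_at (m / 2) (ibranch L a) x"
          unfolding expanding_at_def
        proof (intro conjI allI)
          show "ibranch L a differentiable at x" by (rule L.ibranch_deriv(1)[OF ab' inL[OF x]])
          fix v :: 'v
          have "m * norm v \<le> norm (deriv_at (ibranch K a) x v)"
            using I.exp[OF ab xK] by (simp add: expanding_at_def)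
          moreover have "norm (deriv_at (ibranch L a) x v - deriv_at (ibranch K a) x v) \<le> m / 2 * norm v"
            using near[OF ab x] e'(4) by (meson mult_right_mono norm_ge_zero order_trans)
          ultimately show "m / 2 * norm v \<le> norm (deriv_at (ibranch L a) x v)"
            using norm_triangle_sub[of "deriv_at (ibranch K a) x v" "deriv_at (ibranch L a) x v"]
            by (simp add: norm_minus_commute)
        qed (use I.m in auto)
        fix y and v :: 'v assume y: "y \<in> ?S b"
        obtain z q where z: "z \<in> star K a" "z \<in> core" "\<phi> a z = ibranch L a x"
          "\<And>v. deriv_at (ibranch L a) x (deriv_at (gmap L \<circ> \<phi> a) z v) = deriv_at (\<phi> a) z v"
          "q \<in> piece K a" "dist q z \<le> \<mu> * radius K"
          using perturbed_branch_point[OF LM ab ab' \<phi>(1)[OF al] \<phi>(2)[OF al] \<phi>(3)[OF al] rho\<epsilon> x inL[OF x]] by metis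
        obtain w where w: "w \<in> star K a" "w \<in> core" "\<phi> a w = ibranch L a y"
          "\<And>v. deriv_at (ibranch L a) y (deriv_at (gmap L \<circ> \<phi> a) w v) = deriv_at (\<phi> a) w v"
          using perturbed_branch_point[OF LM ab ab' \<phi>(1)[OF al] \<phi>(2)[OF al] \<phi>(3)[OF al] rho\<epsilon> y inL[OF y]] by metis
        have lip: "norm (z - w) \<le> 2 * norm (\<phi> a z - \<phi> a w)"
        proof (cases "norm (z - w) < (1 - \<mu>) * radius K")
          case True
          let ?b = "ball q (radius K)"
          have bs: "?b \<subseteq> star K a" using z(5) by (auto simp: star_def)
          have "\<mu> * radius K < 1 * radius K" using mu radius_pos by (intro mult_strict_right_mono) auto
          then have zw: "z \<in> ?b" "w \<in> ?b"
            using z(6) True dist_triangle[of q w z] by (auto simp: dist_norm algebra_simps)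
          have "norm ((z - \<phi> a z) - (w - \<phi> a w)) \<le> \<delta> * norm (z - w)"
          proof (rule lipschitz_on_convex[OF convex_ball _ _ zw])
            fix t assume "t \<in> ?b"
            then have t: "t \<in> star K a" using bs by blast
            show "((\<lambda>t. t - \<phi> a t) has_derivative (\<lambda>v. v - deriv_at (\<phi> a) t v)) (at t)"
              by (intro derivative_intros frechet_has_derivative C1a_closeD(2)[OF \<phi>(2)[OF al] t])
            show "norm (v - deriv_at (\<phi> a) t v) \<le> \<delta> * norm v" for v
              using C1a_closeD(4)[OF \<phi>(2)[OF al] t, of v] mult_right_mono[OF le, of "norm v"]
              by (simp add: deriv_at_id)
          qed
          also have "\<dots> \<le> 1 / 2 * norm (z - w)" using \<delta>(5) by (intro mult_right_mono) auto
          finally show ?thesis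
            using norm_triangle_ineq[of "(z - \<phi> a z) - (w - \<phi> a w)" "\<phi> a z - \<phi> a w"] by simp
        next
          case False
          have "norm (z - \<phi> a z) \<le> \<delta>" "norm (w - \<phi> a w) \<le> \<delta>"
            using C1a_closeD(3)[OF \<phi>(2)[OF al] z(1)] C1a_closeD(3)[OF \<phi>(2)[OF al] w(1)] le by auto
          moreover have "z - w = (z - \<phi> a z) + (\<phi> a z - \<phi> a w) - (w - \<phi> a w)" by simp
          then have "norm (z - w) \<le> norm (z - \<phi> a z) + norm (\<phi> a z - \<phi> a w) + norm (w - \<phi> a w)"
            by (metis (no_types, lifting) add_mono_thms_linordered_semiring(3) norm_triangle_ineq norm_triangle_ineq4 order_trans)
          ultimately show ?thesis using False \<delta>(6) by (simp add: algebra_simps)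
        qed
        let ?DG = "deriv_at (gmap L \<circ> \<phi> a)"
        have lowG: "1 / 2 * norm u \<le> norm (?DG w u)" for u
        proof -
          have "1 / \<mu> * norm u \<le> norm (deriv_at (gmap K) w u)"
            using gmap_expanding[of w] star_subset_nbhd[OF al] w(1) by (auto simp: expanding_at_def)
          moreover have "1 * norm u \<le> 1 / \<mu> * norm u" using mu by (intro mult_right_mono) auto
          moreover have "norm (deriv_at (gmap K) w u - ?DG w u) \<le> 1 / 2 * norm u"
            using C1a_closeD(4)[OF \<phi>(3)[OF al] w(1), of u] le \<delta>(5) by (meson mult_right_mono norm_ge_zero order_trans)
          ultimately show ?thesis
            using norm_triangle_sub[of "deriv_at (gmap K) w u" "?DG w u"] by linarith
        qed
        have linG: "linear (?DG w)" by (rule linear_deriv_at[OF C1a_closeD(2)[OF \<phi>(3)[OF al] w(1)]])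
        define u where "u = inv (?DG w) v"
        have u: "?DG w u = v" unfolding u_def by (rule expanding_linear_inverse(4)[OF linG lowG]) simp
        have nu: "norm u \<le> 2 * norm v"
          using expanding_linear_inverse(5)[OF linG lowG, of v] by (simp add: u_def)
        have linx: "linear (deriv_at (ibranch L a) x)" by (rule linear_deriv_at[OF L.ibranch_deriv(1)[OF ab' inL[OF x]]])
        let ?t = "norm (z - w) powr \<alpha>"
        have e1: "norm (deriv_at (\<phi> a) z u - deriv_at (\<phi> a) w u) \<le> ?t * norm u"
        proof -
          have "norm (deriv_at (\<phi> a) z u - deriv_at (\<phi> a) w u) \<le> \<epsilon> * ?t * norm u"
            using C1a_closeD(5)[OF \<phi>(2)[OF al] z(1) w(1), of u] by (simp add: deriv_at_id norm_minus_commute)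
          also have "\<dots> \<le> 1 * ?t * norm u" using le \<delta>(5) by (intro mult_right_mono) auto
          finally show ?thesis by simp
        qed
        have e2: "norm (?DG w u - ?DG z u) \<le> (1 + G) * ?t * norm u"
        proof -
          let ?k = "deriv_at (gmap K)"
          have "norm ((?k z u - ?DG z u) - (?k w u - ?DG w u)) \<le> \<epsilon> * ?t * norm u"
            by (rule C1a_closeD(5)[OF \<phi>(3)[OF al] z(1) w(1)])
          also have "\<dots> \<le> 1 * ?t * norm u" using le \<delta>(5) by (intro mult_right_mono) auto
          finally have 1: "norm ((?k z u - ?DG z u) - (?k w u - ?DG w u)) \<le> ?t * norm u" by simp
          have 2: "norm (?k z u - ?k w u) \<le> G * ?t * norm u" by (rule G(2)[OF z(2) w(2)])
          have "?DG w u - ?DG z u = ((?k z u - ?DG z u) - (?k w u - ?DG w u)) - (?k z u - ?k w u)" by simp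
          then have "norm (?DG w u - ?DG z u) \<le> norm ((?k z u - ?DG z u) - (?k w u - ?DG w u)) + norm (?k z u - ?k w u)"
            by (metis norm_triangle_ineq4)
          then show ?thesis using 1 2 by (simp add: algebra_simps)
        qed
        have "deriv_at (ibranch L a) x v - deriv_at (ibranch L a) y v
            = (deriv_at (\<phi> a) z u - deriv_at (\<phi> a) w u) + deriv_at (ibranch L a) x (?DG w u - ?DG z u)"
          using w(4)[of u] z(4)[of u] by (simp add: u linear_diff[OF linx])
        then have "norm (deriv_at (ibranch L a) x v - deriv_at (ibranch L a) y v)
            \<le> norm (deriv_at (\<phi> a) z u - deriv_at (\<phi> a) w u) + norm (deriv_at (ibranch L a) x (?DG w u - ?DG z u))"
          by (metis norm_triangle_ineq)
        also have "\<dots> \<le> ?t * norm u + (1 + G) * ?t * norm u"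
        proof (rule add_mono[OF e1])
          have "norm (deriv_at (ibranch L a) x (?DG w u - ?DG z u)) \<le> 1 * norm (?DG w u - ?DG z u)"
            using L.ibranch_deriv(4)[OF ab' inL[OF x], of "?DG w u - ?DG z u"] L.mu
            by (meson less_imp_le mult_right_mono norm_ge_zero order_trans)
          then show "norm (deriv_at (ibranch L a) x (?DG w u - ?DG z u)) \<le> (1 + G) * ?t * norm u" using e2 by simp
        qed
        also have "\<dots> = (2 + G) * ?t * norm u" by (simp add: algebra_simps)
        also have "\<dots> \<le> (2 + G) * ((2 * norm (\<phi> a z - \<phi> a w)) powr \<alpha>) * (2 * norm v)"
          using lip nu G(1) alpha by (intro mult_mono mult_nonneg_nonneg powr_mono2) auto
        also have "\<dots> = H' * norm (ibranch L a x - ibranch L a y) powr \<alpha> * norm v"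
          by (simp add: H'_def powr_mult z(3) w(3))
        finally show "norm (deriv_at (ibranch L a) x v - deriv_at (ibranch L a) y v)
            \<le> H' * norm (ibranch L a x - ibranch L a y) powr \<alpha> * norm v" .
      qed (use alpha mu \<mu>' H' M' I.m in auto)
      ultimately show "near_branches \<rho> e (ibranch L) \<and> ifs K ?S (ibranch L) \<alpha> \<mu>' H' (m / 2) M' \<and>
        (\<forall>b\<in>letters K. ?S b \<subseteq> star L b)" using cover by blast
    qed
  qed
qed

end

section \<open>Frames of perturbed configurations\<close>

lemma finite_uniform_pos:
  assumes "finite A" "\<And>x. x \<in> A \<Longrightarrow> \<exists>e>0. P x e" "\<And>x e e'. P x e \<Longrightarrow> 0 < e' \<Longrightarrow> e' \<le> e \<Longrightarrow> P x e'"
  shows "\<exists>e>0::real. \<forall>x\<in>A. P x e"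
  using assms(1,2)
proof (induction A)
  case empty
  show ?case by (intro exI[of _ 1]) auto
next
  case (insert v A)
  obtain e where e: "e > 0" "\<forall>x\<in>A. P x e" using insert by auto
  obtain e' where e': "e' > 0" "P v e'" using insert by auto
  have "P x (min e e')" if "x \<in> insert v A" for x
  proof (cases "x = v")
    case True
    show ?thesis unfolding True by (rule assms(3)[OF e'(2)]) (use e e' in auto)
  next
    case False
    then have "P x e" using e(2) that by simp
    then show ?thesis by (rule assms(3)) (use e e' in auto)
  qed
  then show ?case using e(1) e'(1) by (intro exI[of _ "min e e'"]) auto
qed

lemma finite_transition_close:
  assumes "finite X" "\<And>x. x \<in> X \<Longrightarrow> F x \<in> Aff \<and> B x \<in> Aff" "0 < \<eta>"
  obtains \<kappa> where "0 < \<kappa>"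
    "\<And>x F' B'. x \<in> X \<Longrightarrow> F' \<in> Aff \<Longrightarrow> B' \<in> Aff \<Longrightarrow> aff_near \<kappa> F' (F x) \<Longrightarrow> aff_near \<kappa> B' (B x) \<Longrightarrow>
      aff_near \<eta> (inv F' \<circ> B') (inv (F x) \<circ> B x)"
proof -
  have "\<exists>\<kappa>>0. \<forall>x\<in>X. \<forall>F' B'. F' \<in> Aff \<and> B' \<in> Aff \<and> aff_near \<kappa> F' (F x) \<and> aff_near \<kappa> B' (B x) \<longrightarrow>
      aff_near \<eta> (inv F' \<circ> B') (inv (F x) \<circ> B x)"
  proof (rule finite_uniform_pos[OF assms(1)])
    fix x assume "x \<in> X"
    then have A: "F x \<in> Aff" "B x \<in> Aff" using assms(2) by auto
    obtain \<kappa> where \<kappa>: "0 < \<kappa>" "\<And>F' B' G. F' \<in> Aff \<Longrightarrow> B' \<in> Aff \<Longrightarrow> G \<in> Aff \<Longrightarrow> aff_near \<kappa> F' (F x) \<Longrightarrow>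
        aff_near \<kappa> B' (B x) \<Longrightarrow> aff_near \<kappa> G id \<Longrightarrow> aff_near \<eta> (inv F' \<circ> B' \<circ> G) (inv (F x) \<circ> B x \<circ> id)"
      using aff_near_conjugate[OF A id_Aff assms(3)] by metis
    show "\<exists>\<kappa>>0. \<forall>F' B'. F' \<in> Aff \<and> B' \<in> Aff \<and> aff_near \<kappa> F' (F x) \<and> aff_near \<kappa> B' (B x) \<longrightarrow>
      aff_near \<eta> (inv F' \<circ> B') (inv (F x) \<circ> B x)"
      using \<kappa>(1) \<kappa>(2)[OF _ _ id_Aff _ _ aff_near_refl] by (intro exI[of _ \<kappa>]) auto
  next
    fix x e e'
    assume h: "\<forall>F' B'. F' \<in> Aff \<and> B' \<in> Aff \<and> aff_near e F' (F x) \<and> aff_near e B' (B x) \<longrightarrow>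
      aff_near \<eta> (inv F' \<circ> B') (inv (F x) \<circ> B x)" and e': "0 < e'" "e' \<le> e"
    show "\<forall>F' B'. F' \<in> Aff \<and> B' \<in> Aff \<and> aff_near e' F' (F x) \<and> aff_near e' B' (B x) \<longrightarrow>
      aff_near \<eta> (inv F' \<circ> B') (inv (F x) \<circ> B x)"
      using h aff_near_mono[OF _ e'(2)] by blast
  qed
  then show thesis using that by blast
qed

lemma tangent_map_near:
  assumes "norm (\<Phi> p - \<Psi> p) \<le> \<kappa>" "\<And>v. norm (deriv_at \<Phi> p v - deriv_at \<Psi> p v) \<le> \<kappa> * norm v" "0 \<le> \<kappa>"
  shows "aff_near (\<kappa> * (1 + norm p)) (tangent_map \<Phi> p) (tangent_map \<Psi> p)"
  unfolding tangent_map_def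
  by (rule aff_near_of_normalized[where b = "\<lambda>v. v"]) (use assms in auto)

text \<open>The affine frame of the subpiece with word \<open>u\<close> in the configuration \<open>l\<close>. Since the quotients of successive
frames are all that renormalization sees, configurations that are not affine copies of limit
geometries need no function space of their own.\<close>

definition frame :: "('a \<Rightarrow> 'v::euclidean_space) \<Rightarrow> ('a \<Rightarrow> 'v \<Rightarrow> 'v) \<Rightarrow> ('v \<Rightarrow> 'v) \<Rightarrow> 'a list \<Rightarrow> 'v \<Rightarrow> 'v" where
  "frame c f l u = tangent_map (l \<circ> word_map f u) (c (last u))"

context bunched_ifs
begin

text \<open>By \<open>tangent_transition\<close>, the quotient of two successive frames is a value and a slope of a
normalized map, on which the letters of \<open>u\<close> and the configuration \<open>\<psi>\<close> have only an effect of order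
\<open>\<nu> ^ (length v - 1)\<close>.\<close>

lemma frame_transition_tail:
  assumes uv: "u @ v \<in> words K" "v \<noteq> []" and w: "w \<in> words K" "hd w = last v"
    and pq: "c (last v) \<in> S (last v)" "c (last w) \<in> S (last w)"
    and psi: "\<And>z. z \<in> S (hd (u @ v)) \<Longrightarrow> expanding_at m' \<psi> z"
    and osc: "\<And>y z v'. y \<in> S (hd (u @ v)) \<Longrightarrow> z \<in> S (hd (u @ v)) \<Longrightarrow>
      norm (deriv_at \<psi> y v' - deriv_at \<psi> z v') \<le> H' * norm (y - z) powr \<alpha> * norm v'"
    and H': "0 \<le> H'" "0 < m'"
  defines "R \<equiv> C * H' * M powr \<alpha> / m' + Q"
  shows "aff_near ((1 + M) * (R * \<nu> ^ (length v - 1)) * (1 + norm (c (last w))))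
    (inv (frame c f \<psi> (u @ v)) \<circ> frame c f \<psi> (u @ v @ tl w)) (inv (frame c f id v) \<circ> frame c f id (v @ tl w))"
proof -
  let ?p = "c (last v)" and ?q = "c (last w)"
  have vw: "v \<in> words K" by (rule words_appendD[OF uv])
  have wne: "w \<noteq> []" using w(1) by (auto simp: words_def)
  have luv: "last (u @ v) = last v" using uv(2) by simp
  define z where "z = word_map f w ?q"
  have z: "z \<in> S (last v)" using word_map_in[OF w(1) pq(2)] w(2) by (simp add: z_def)
  note dw = word_map_differentiable[OF w(1) pq(2)]
  define D where "D = deriv_at (word_map f w) ?q"
  let ?\<Phi> = "\<psi> \<circ> word_map f (u @ v)" and ?\<Psi> = "word_map f v"
  have px: "?p \<in> S (last (u @ v))" "z \<in> S (last (u @ v))" using pq(1) z luv by simp_all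
  have E\<Phi>: "expanding_at (m' * m ^ (length (u @ v) - 1)) ?\<Phi> y" if "y \<in> S (last (u @ v))" for y
    by (rule expanding_at_comp[OF word_map_exp[OF uv(1) that] psi[OF word_map_in[OF uv(1) that]]])
  have E\<Psi>: "expanding_at (m ^ (length v - 1)) ?\<Psi> y" if "y \<in> S (last v)" for y
    by (rule word_map_exp[OF vw that])
  have g: "word_map f (u @ v @ tl w) = word_map f (u @ v) \<circ> word_map f w"
    using word_map_glue[of "u @ v" w f] uv(2) wne w(2) by simp
  have g': "word_map f (v @ tl w) = word_map f v \<circ> word_map f w"
    using word_map_glue[of v w f] uv(2) wne w(2) by simp
  have l: "last (u @ v @ tl w) = last w" "last (v @ tl w) = last w"
    using words_glue[OF vw w(1) w(2)[symmetric]] uv(2) by auto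
  have T1: "inv (frame c f \<psi> (u @ v)) \<circ> frame c f \<psi> (u @ v @ tl w)
      = (\<lambda>x. normalized ?\<Phi> ?p z + slope ?\<Phi> ?p z (D (x - ?q)))"
  proof
    fix x
    have "?\<Phi> differentiable at (word_map f w ?q)" using E\<Phi>[OF px(2)] by (simp add: expanding_at_def z_def)
    from tangent_transition[OF E\<Phi>[OF px(1)] this dw, of x]
    show "(inv (frame c f \<psi> (u @ v)) \<circ> frame c f \<psi> (u @ v @ tl w)) x
        = normalized ?\<Phi> ?p z + slope ?\<Phi> ?p z (D (x - ?q))"
      by (simp add: frame_def g l luv z_def D_def comp_assoc)
  qed
  have T2: "inv (frame c f id v) \<circ> frame c f id (v @ tl w)
      = (\<lambda>x. normalized ?\<Psi> ?p z + slope ?\<Psi> ?p z (D (x - ?q)))"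
  proof
    fix x
    have "?\<Psi> differentiable at (word_map f w ?q)" using E\<Psi>[OF z] by (simp add: expanding_at_def z_def)
    from tangent_transition[OF E\<Psi>[OF pq(1)] this dw, of x]
    show "(inv (frame c f id v) \<circ> frame c f id (v @ tl w)) x
        = normalized ?\<Psi> ?p z + slope ?\<Psi> ?p z (D (x - ?q))"
      by (simp add: frame_def g' l z_def D_def)
  qed
  have R: "0 \<le> R * \<nu> ^ (length v - 1)" unfolding R_def using H' C lam Q_nonneg by simp
  let ?E = "(1 + M) * (R * \<nu> ^ (length v - 1))"
  have E: "M * (R * \<nu> ^ (length v - 1)) \<le> ?E" "R * \<nu> ^ (length v - 1) \<le> ?E" "0 \<le> ?E"
    using R M by (auto simp: algebra_simps)
  note nt = normalized_post_tail[OF uv pq(1) z psi osc H', folded R_def]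
  show ?thesis
    unfolding T1 T2
  proof (rule aff_near_of_normalized[OF _ _ _ E(3)])
    show "norm (normalized ?\<Phi> ?p z - normalized ?\<Psi> ?p z) \<le> ?E" using nt(2) E(1) by simp
    show "norm (slope ?\<Phi> ?p z v' - slope ?\<Psi> ?p z v') \<le> ?E * norm v'" for v'
      using nt(1)[of v'] mult_right_mono[OF E(2), of "norm v'"] by simp
    show "norm (D v') \<le> norm v'" for v' unfolding D_def by (rule word_map_nonexpanding[OF w(1) pq(2)])
  qed
qed

end

context cantor_map
begin

text \<open>The images of the compact pieces under the words \<open>u n\<close> are nested. A common point belongs to the Cantor
set, because every iterate of it lies in a piece, and the diameters of the images tend to \<open>0\<close>.\<close>

lemma nested_limit:
  assumes u: "\<And>n. u n \<in> words K" "\<And>n. hd (u n) = a" and chain: "\<And>n. \<exists>z. u (Suc n) = u n @ z"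
    and long: "\<And>k. \<exists>n. k < length (u n)" and p: "\<And>n. p n \<in> star K (last (u n))"
  obtains x where "x \<in> cantor_piece K a" "(\<lambda>n. word_map (ibranch K) (u n) (p n)) \<longlonglongrightarrow> x"
proof -
  let ?b = "word_map (ibranch K)"
  obtain H m M where I: "ifs K (star K) (ibranch K) \<alpha> \<mu> H m M" using ifs_star by blast
  interpret I: ifs K "star K" "ibranch K" \<alpha> \<mu> H m M by (rule I)
  define Q where "Q = (\<lambda>n. ?b (u n) ` piece K (last (u n)))"
  have "\<Inter>(range Q) \<noteq> {}"
  proof (rule compact_nest)
    fix n
    have "last (u n) \<in> letters K" using words_letters[OF u(1)] by blast
    note pc = piece_props[OF this]
    have "continuous_on (piece K (last (u n))) (?b (u n))"
      using I.word_map_differentiable[OF u(1)] piece_subset_star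
      by (intro continuous_at_imp_continuous_on ballI differentiable_imp_continuous_within) blast
    then show "compact (Q n)" unfolding Q_def using pc(1) compact_continuous_image by blast
    show "Q n \<noteq> {}" using pc(3) by (simp add: Q_def)
  next
    have "Q (Suc n) \<subseteq> Q n" for n
    proof
      fix x assume "x \<in> Q (Suc n)"
      then obtain y where y: "y \<in> piece K (last (u (Suc n)))" "x = ?b (u (Suc n)) y" by (auto simp: Q_def)
      obtain z where z: "u (Suc n) = u n @ z" using chain by blast
      have ne: "u n \<noteq> []" using u(1)[of n] by (simp add: words_def)
      let ?w = "last (u n) # z"
      have "butlast (u n) @ ?w = u (Suc n)" using z ne by simp
      then have w: "?w \<in> words K" using u(1)[of "Suc n"] words_appendD[of "butlast (u n)" ?w K] by simp
      have "?b (u (Suc n)) = ?b (u n) \<circ> ?b ?w" using word_map_glue[of "u n" ?w "ibranch K"] ne z by simp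
      moreover have "last ?w = last (u (Suc n))" using z ne by simp
      then have "?b ?w y \<in> piece K (last (u n))" using word_map_piece(1)[OF w, of y] y(1) by simp
      ultimately show "x \<in> Q n" using y(2) by (auto simp: Q_def)
    qed
    then show "Q n \<subseteq> Q k" if "k \<le> n" for k n using that by (rule lift_Suc_antimono_le)
  qed
  then obtain x where "\<And>n. x \<in> Q n" by blast
  then have "\<exists>y. y \<in> piece K (last (u n)) \<and> x = ?b (u n) y" for n by (auto simp: Q_def)
  then obtain y where y: "\<And>n. y n \<in> piece K (last (u n))" "\<And>n. x = ?b (u n) (y n)" by metis
  have "x \<in> piece K a" using word_map_piece(1)[OF u(1) y(1), of 0] u(2) y(2)[of 0] by simp
  moreover have "(gmap K ^^ k) x \<in> (\<Union>a\<in>letters K. piece K a)" for k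
  proof -
    obtain n where n: "k < length (u n)" using long by blast
    note sp = words_split[OF u(1) n]
    let ?v = "take (Suc k) (u n)" and ?t = "?b (drop k (u n)) (y n)"
    have t: "?t \<in> piece K (last ?v)" using word_map_piece(1)[OF sp(2), of "y n"] y(1)[of n] sp(3,4) by simp
    have "x = ?b ?v ?t" using y(2)[of n] sp(5)[of "ibranch K"] by simp
    then have "(gmap K ^^ k) x = ?t"
      using word_map_piece(3)[OF sp(1), of ?t] t piece_subset_star n by auto
    then show ?thesis using t words_letters[OF sp(1)] by auto
  qed
  ultimately have x: "x \<in> cantor_piece K a" by (simp add: cantor_piece_def cantor_set_iff)
  have mono: "length (u n) \<le> length (u k)" if "n \<le> k" for n k
  proof (rule lift_Suc_mono_le[OF _ that])
    show "length (u n) \<le> length (u (Suc n))" for n using chain[of n] by auto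
  qed
  have "(\<lambda>n. ?b (u n) (p n)) \<longlonglongrightarrow> x"
  proof (rule LIMSEQ_I)
    fix e :: real assume e: "0 < e"
    have "(\<lambda>k. M * \<mu> ^ k) \<longlonglongrightarrow> M * 0" using mu by (intro tendsto_intros LIMSEQ_realpow_zero) auto
    then have "eventually (\<lambda>k. M * \<mu> ^ k < e) sequentially" using e by (intro order_tendstoD) auto
    then obtain k where k: "M * \<mu> ^ k < e" unfolding eventually_sequentially by blast
    obtain n0 where n0: "k < length (u n0)" using long by blast
    have "norm (?b (u n) (p n) - x) < e" if n: "n0 \<le> n" for n
    proof -
      have "norm (?b (u n) (p n) - ?b (u n) (y n)) \<le> M * \<mu> ^ (length (u n) - 1)"
        using p[of n] y(1)[of n] piece_subset_star by (intro I.word_map_diam[OF u(1)]) auto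
      also have "\<dots> \<le> M * \<mu> ^ k"
        using mu I.M n0 mono[OF n] by (intro mult_left_mono power_decreasing) auto
      finally show ?thesis using y(2)[of n] k by simp
    qed
    then show "\<exists>n0. \<forall>n\<ge>n0. norm (?b (u n) (p n) - x) < e" by blast
  qed
  then show thesis using that x by blast
qed

end

context cantor_ifs
begin

lemma near_branches_mono: "near_branches \<rho> e f \<Longrightarrow> e \<le> e' \<Longrightarrow> near_branches \<rho> e' f"
  unfolding near_branches_def
  by (fastforce intro: order_trans mult_right_mono)

lemma words_close:
  assumes \<rho>: "0 < \<rho>" "\<rho> < radius K" and \<kappa>: "0 < \<kappa>"
  obtains e where "0 < e"
    "\<And>f \<mu>' H' m' M' w x v. ifs K (\<lambda>a. thicken \<rho> (piece K a)) f \<alpha> \<mu>' H' m' M' \<Longrightarrow> near_branches \<rho> e f \<Longrightarrow>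
      w \<in> words K \<Longrightarrow> length w \<le> n + 1 \<Longrightarrow> x \<in> thicken \<rho> (piece K (last w)) \<Longrightarrow>
      norm (word_map f w x - word_map (ibranch K) w x) \<le> \<kappa> \<and>
      norm (deriv_at (word_map f w) x v - deriv_at (word_map (ibranch K) w) x v) \<le> \<kappa> * norm v"
proof -
  obtain d where d: "0 < d" "\<And>t. 0 \<le> t \<Longrightarrow> t \<le> d \<Longrightarrow> (real n * H) * t powr \<alpha> \<le> \<kappa> / 2"
    using small_powr[OF alpha, of "real n * H" "\<kappa> / 2"] I.H \<kappa> by auto
  define s where "s = min (radius K - \<rho>) (min (\<kappa> / 2) d)"
  have s: "0 < s" "s \<le> radius K - \<rho>" "s \<le> \<kappa> / 2" "s \<le> d" using \<rho> \<kappa> d(1) unfolding s_def by linarith+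
  define e where "e = s / (real n + 1)"
  have e: "0 < e" using s by (simp add: e_def)
  have "(real n + 1) * e = s" by (simp add: e_def)
  then have ne: "real n * e \<le> s" using e by (simp add: algebra_simps)
  show thesis
  proof (rule that[OF e])
    fix f \<mu>' H' m' M' w x and v :: 'v
    assume J: "ifs K (\<lambda>a. thicken \<rho> (piece K a)) f \<alpha> \<mu>' H' m' M'" and near: "near_branches \<rho> e f"
      and w: "w \<in> words K" "length w \<le> n + 1" "x \<in> thicken \<rho> (piece K (last w))"
    have wc: "norm (word_map f w x - word_map (ibranch K) w x) \<le> real (length w - 1) * e \<and>
      (\<forall>v. norm (deriv_at (word_map f w) x v - deriv_at (word_map (ibranch K) w) x v)
        \<le> real (length w - 1) * (e + H * (real n * e) powr \<alpha>) * norm v)"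
      by (rule word_map_close[OF J _ _ _ _ w]) (use near_branchesD[OF near] e ne s in auto)
    have l: "real (length w - 1) \<le> real n" using w(2) by simp
    have "real (length w - 1) * e \<le> real n * e" using l e by (intro mult_right_mono) auto
    then have 1: "real (length w - 1) * e \<le> \<kappa>" using ne s \<kappa> by linarith
    have "real (length w - 1) * (e + H * (real n * e) powr \<alpha>) \<le> real n * (e + H * (real n * e) powr \<alpha>)"
      using l e I.H by (intro mult_right_mono) auto
    also have "\<dots> = real n * e + (real n * H) * (real n * e) powr \<alpha>" by (simp add: algebra_simps)
    also have "\<dots> \<le> \<kappa> / 2 + \<kappa> / 2" using d(2)[of "real n * e"] ne s e by (intro add_mono) auto
    finally have "real (length w - 1) * (e + H * (real n * e) powr \<alpha>) * norm v \<le> \<kappa> * norm v"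
      by (intro mult_right_mono) auto
    then show "norm (word_map f w x - word_map (ibranch K) w x) \<le> \<kappa> \<and>
      norm (deriv_at (word_map f w) x v - deriv_at (word_map (ibranch K) w) x v) \<le> \<kappa> * norm v"
      using wc 1 by (meson order_trans)
  qed
qed

end

text \<open>What has to be known of a Cantor set \<open>L\<close> and a configuration \<open>l\<close> in order to renormalize them along
with \<open>K\<close> and the affine copy \<open>A \<circ> limit_geometry K c \<theta>\<close>: frames are affine maps, the first
one is near \<open>A\<close>, and the quotients of successive frames are near the transition maps of \<open>K\<close>, with an
error that does not grow with the length of \<open>u\<close>. The remaining clauses say that frames
shrink at exponential rates and that their origins converge to points of the configured Cantor set.\<close>

definition tracks ::
  "('a, 'v::euclidean_space) cantor \<Rightarrow> ('a \<Rightarrow> 'v) \<Rightarrow> (nat \<Rightarrow> 'a) \<Rightarrow> ('v \<Rightarrow> 'v) \<Rightarrow> nat \<Rightarrow> real \<Rightarrow>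
   ('a, 'v) cantor \<Rightarrow> ('v \<Rightarrow> 'v) \<Rightarrow> bool" where
  "tracks K c \<theta> A n \<eta> L l \<longleftrightarrow> (let F = frame c (ibranch L) l; X = {u \<in> words K. hd u = \<theta> 0} in
     (\<forall>u\<in>X. F u \<in> Aff) \<and>
     aff_near \<eta> (F [\<theta> 0]) A \<and>
     (\<forall>u\<in>X. \<forall>w\<in>words K. hd w = last u \<and> length w \<le> n \<longrightarrow>
        aff_near \<eta> (inv (F u) \<circ> F (u @ tl w)) (transition K c (append_word \<theta> u) w)) \<and>
     (\<exists>C q. 0 < q \<and> q < 1 \<and> (\<forall>u\<in>X. \<forall>x y. norm (F u x - F u y) \<le> C * q ^ length u * norm (x - y))) \<and>
     (\<exists>C k. 0 < C \<and> 0 < k \<and> (\<forall>u\<in>X. \<forall>x y. C * k ^ length u * norm (x - y) \<le> norm (F u x - F u y))) \<and>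
     (\<forall>u. (\<forall>i. u i \<in> X \<and> (\<exists>z. u (Suc i) = u i @ z)) \<and> (\<forall>k. \<exists>i. k < length (u i)) \<longrightarrow>
        (\<exists>x\<in>cantor_piece L (\<theta> 0). (\<lambda>i. F (u i) (c (last (u i)))) \<longlonglongrightarrow> l x)))"

context limit_map
begin

text \<open>Branches map base points to points of the piece, so the values and derivatives on the piece
determine the frames.\<close>

lemma frame_of_affine_copy:
  assumes \<theta>: "\<theta> \<in> past K" and A: "A \<in> Aff"
    and same: "same_on (piece K (\<theta> 0)) h (A \<circ> limit_geometry K c \<theta>)"
    and h: "\<And>x. x \<in> piece K (\<theta> 0) \<Longrightarrow> h differentiable at x"
    and v: "v \<in> words K" "hd v = \<theta> 0"
  shows "frame c (ibranch K) h v = A \<circ> limit_transition \<theta> v"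
proof
  fix x
  let ?q = "c (last v)" and ?k = "limit_geometry K c \<theta>"
  have lv: "last v \<in> letters K" using words_letters[OF v(1)] by blast
  define y where "y = br v ?q"
  have y: "y \<in> piece K (\<theta> 0)" using word_map_piece(1)[OF v(1) base_piece[OF lv]] v(2) by (simp add: y_def)
  then have ys: "y \<in> star K (\<theta> 0)" using piece_subset_star by blast
  define s where "s = limit_slope \<theta> y (deriv_at (br v) ?q (x - ?q))"
  note dv = B.word_map_differentiable[OF v(1) base_star[OF lv]]
  note dk = limit_geometry_has_derivative[OF \<theta> ys]
  have kd: "?k differentiable at y" using dk by (auto simp: differentiable_def)
  have Ad: "A differentiable at z" "deriv_at A z = (\<lambda>v. A v - A 0)" for z
    using Aff_has_derivative[OF A, of z] deriv_at_eqI[OF Aff_has_derivative[OF A, of z]] by (auto simp: differentiable_def)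
  have dh: "deriv_at h y = (\<lambda>v. A v - A 0) \<circ> limit_slope \<theta> y"
    using same y by (simp add: same_on_def deriv_at_comp[OF kd Ad(1)] Ad(2) deriv_at_eqI[OF dk])
  have "frame c (ibranch K) h v x = h y + deriv_at h y (deriv_at (br v) ?q (x - ?q))"
    using deriv_at_comp[OF dv, of h] h[OF y] by (simp add: frame_def tangent_map_def y_def)
  also have "\<dots> = A (?k y) + (A s - A 0)"
    using same y by (simp add: dh s_def same_on_def)
  also have "\<dots> = A (?k y + s)"
  proof -
    obtain L where L: "linear L" "\<And>x. A x = L x + A 0" using AffE[OF A] by blast
    show ?thesis using L(2)[of "?k y"] L(2)[of s] L(2)[of "?k y + s"] linear_add[OF L(1)] by simp
  qed
  also have "?k y + s = limit_transition \<theta> v x"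
    using deriv_at_comp[OF dv, of ?k] kd deriv_at_eqI[OF dk] by (simp add: tangent_map_def y_def s_def)
  finally show "frame c (ibranch K) h v x = (A \<circ> limit_transition \<theta> v) x" by simp
qed

text \<open>The quotient of the frames of \<open>u @ tl w\<close> and \<open>u\<close> is compared with the transition map of \<open>K\<close> in two
ways. For a long word \<open>u\<close>, all but its last \<open>n1 + 1\<close> letters and the configuration itself are dropped,
at an exponentially small cost for \<open>L\<close> (\<open>frame_transition_tail\<close>) and for \<open>K\<close> (\<open>transition_approx\<close>); what
remains are finitely many words, for which the frames of \<open>L\<close> and \<open>K\<close> are close by continuity. For the
finitely many short words \<open>u\<close>, the frames of \<open>l\<close> are close to those of \<open>h\<close>, whose quotients are exactly the
transition maps because \<open>h\<close> is an affine copy of the limit geometry.\<close>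

lemma shadowing:
  assumes \<theta>: "\<theta> \<in> past K" and A: "A \<in> Aff"
    and same: "same_on (piece K (\<theta> 0)) h (A \<circ> limit_geometry K c \<theta>)"
    and W: "piece K (\<theta> 0) \<subseteq> W" and emb: "C1a_embedding \<alpha> W h" and \<eta>: "0 < \<eta>"
  obtains \<epsilon>0 where "0 < \<epsilon>0"
    "\<And>\<epsilon> L l. \<epsilon> \<le> \<epsilon>0 \<Longrightarrow> cantor_close \<alpha> \<epsilon> K L \<Longrightarrow> C1a_close \<alpha> \<epsilon> W h l \<Longrightarrow> tracks K c \<theta> A nw \<eta> L l"
proof -
  let ?P = "piece K (\<theta> 0)"
  note \<theta>0 = past_letter[OF \<theta>, of 0]
  have hC: "C1a_on \<alpha> W h" using emb by (simp add: C1a_embedding_def)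
  then have "open W" by (simp add: C1a_on_def)
  then obtain r where r: "0 < r" "(\<Union>x\<in>?P. cball x r) \<subseteq> W"
    using compact_subset_open_imp_cball_epsilon_subset[OF piece_props(1)[OF \<theta>0] _ W] by blast
  define \<rho> where "\<rho> = min r (radius K / 2)"
  have \<rho>: "0 < \<rho>" "\<rho> < radius K" "\<rho> \<le> r" using r radius_pos by (auto simp: \<rho>_def min_def)
  define Z where "Z = {x. \<exists>a\<in>?P. dist a x \<le> \<rho>}"
  let ?S = "\<lambda>a. thicken \<rho> (piece K a)"
  have Z: "compact Z" "Z \<subseteq> W" "?S (\<theta> 0) \<subseteq> Z" "?P \<subseteq> Z"
    using closed_thickening_subset[OF piece_props(1)[OF \<theta>0]] r(2) \<rho> by (force simp: Z_def thicken_def)+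
  obtain G where G: "0 \<le> G"
    "\<And>x y v. x \<in> Z \<Longrightarrow> y \<in> Z \<Longrightarrow> norm (deriv_at h x v - deriv_at h y v) \<le> G * norm (x - y) powr \<alpha> * norm v"
    using C1a_on_hoelder[OF hC Z(1,2)] by blast
  obtain b where b: "0 < b" "\<And>x v. x \<in> Z \<Longrightarrow> norm (deriv_at h x v) \<le> b * norm v"
    using C1a_on_bounded[OF hC Z(1,2) alpha] by blast
  obtain mh where mh: "0 < mh" "\<And>x. x \<in> Z \<Longrightarrow> expanding_at mh h x"
    using C1a_embedding_expanding[OF emb Z(1,2) alpha] by blast
  have hd: "h differentiable at x" if "x \<in> W" for x by (rule C1a_on_differentiable[OF hC that])
  obtain \<mu>1 where \<mu>1: "\<mu> < \<mu>1" "\<mu>1 < 1" and bunched: "stays_bunched \<mu>1"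
    by (rule bunched_perturbation)
  obtain H' m' M' where m': "0 < m'" and pert:
    "\<And>e. 0 < e \<Longrightarrow> \<exists>\<delta>>0. \<forall>\<epsilon> L. \<epsilon> \<le> \<delta> \<and> cantor_close \<alpha> \<epsilon> K L \<longrightarrow>
       near_branches \<rho> e (ibranch L) \<and> ifs K ?S (ibranch L) \<alpha> \<mu>1 H' m' M' \<and> (\<forall>b\<in>letters K. ?S b \<subseteq> star L b)"
    by (rule perturbed_branches[OF \<rho>(1,2) \<mu>1]) (rule that)
  obtain e0 Lc C' \<nu>' where e0: "0 < e0" and \<nu>': "0 < \<nu>'" "\<nu>' < 1" and bifs: "\<And>\<rho> f \<epsilon>.
       0 \<le> \<epsilon> \<Longrightarrow> \<epsilon> \<le> e0 \<Longrightarrow> 0 < \<rho> \<Longrightarrow> \<rho> + real Lc * \<epsilon> \<le> radius K \<Longrightarrow> near_branches \<rho> \<epsilon> f \<Longrightarrow>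
       ifs K (\<lambda>a. thicken \<rho> (piece K a)) f \<alpha> \<mu>1 H' m' M' \<Longrightarrow>
       bunched_ifs K (\<lambda>a. thicken \<rho> (piece K a)) f \<alpha> \<mu>1 H' m' M' C' \<nu>'"
    by (rule stays_bunchedE[OF bunched m', of H' M']) (rule that)
  define cs where "cs = (\<Sum>a\<in>letters K. norm (c a))"
  have cs: "0 \<le> cs" "\<And>a. a \<in> letters K \<Longrightarrow> norm (c a) \<le> cs"
    unfolding cs_def using norm_base_le by (auto intro: sum_nonneg)
  (* the constant of frame_transition_tail for the perturbed system and the perturbed configuration *)
  define R where "R = C' * (G + 1) * M' powr \<alpha> / (mh / 2) + C' * H' * M' powr \<alpha> / m' / (1 - \<nu>')"
  have "(\<lambda>n. (1 + M') * (R * \<nu>' ^ n) * (1 + cs)) \<longlonglongrightarrow> (1 + M') * (R * 0) * (1 + cs)"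
    using \<nu>' by (intro tendsto_intros LIMSEQ_realpow_zero) auto
  then have ev1: "eventually (\<lambda>n. (1 + M') * (R * \<nu>' ^ n) * (1 + cs) < \<eta> / 3) sequentially"
    using \<eta> by (intro order_tendstoD) auto
  have "(\<lambda>n. approx_const * \<nu> ^ n) \<longlonglongrightarrow> approx_const * 0"
    using B.lam by (intro tendsto_intros LIMSEQ_realpow_zero) auto
  then have "eventually (\<lambda>n. approx_const * \<nu> ^ n < \<eta> / 3) sequentially"
    using \<eta> by (intro order_tendstoD) auto
  with ev1 have "eventually (\<lambda>n. (1 + M') * (R * \<nu>' ^ n) * (1 + cs) < \<eta> / 3 \<and> approx_const * \<nu> ^ n < \<eta> / 3) sequentially"
    by eventually_elim simp
  then obtain n1 where n1: "(1 + M') * (R * \<nu>' ^ n1) * (1 + cs) < \<eta> / 3" "approx_const * \<nu> ^ n1 < \<eta> / 3"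
    unfolding eventually_sequentially by blast
  let ?FK = "\<lambda>v. frame c (ibranch K) id v" and ?Fh = "\<lambda>v. frame c (ibranch K) h v"
  define X1 where "X1 = {(v, w). v \<in> words K \<and> length v \<le> n1 + 1 \<and> w \<in> words K \<and> length w \<le> nw \<and> hd w = last v}"
  have "X1 \<subseteq> {w \<in> words K. length w \<le> n1 + 1} \<times> {w \<in> words K. length w \<le> nw}" by (auto simp: X1_def)
  then have fX1: "finite X1"
    using finite_words_of_length(2)[OF finite_letters] by (meson finite_SigmaI finite_subset)
  define X2 where "X2 = {(v, w) \<in> X1. hd v = \<theta> 0}"
  have fX2: "finite X2" using fX1 by (auto simp: X2_def elim: rev_finite_subset)
  have FK: "?FK v \<in> Aff" if "v \<in> words K" for v
    using tangent_map_Aff[OF B.word_map_exp[OF that]] base_star words_letters[OF that] by (simp add: frame_def)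
  have Fh: "?Fh v = A \<circ> limit_transition \<theta> v" if "v \<in> words K" "hd v = \<theta> 0" for v
    using W hd by (intro frame_of_affine_copy \<theta> A same that) auto
  have FhA: "?Fh v \<in> Aff" if "v \<in> words K" "hd v = \<theta> 0" for v
    unfolding Fh[OF that] by (intro Aff_comp A limit_transition_exp(2) \<theta> that)
  have glue: "v @ tl w \<in> words K" "hd (v @ tl w) = hd v" "last (v @ tl w) = last w" if "(v, w) \<in> X1" for v w
    using words_glue[of v K w] that by (auto simp: X1_def)
  have \<eta>3: "0 < \<eta> / 3" using \<eta> by simp
  obtain \<kappa>1 where \<kappa>1: "0 < \<kappa>1" "\<And>x F' B'. x \<in> X1 \<Longrightarrow> F' \<in> Aff \<Longrightarrow> B' \<in> Aff \<Longrightarrow> aff_near \<kappa>1 F' (?FK (fst x)) \<Longrightarrow>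
      aff_near \<kappa>1 B' (?FK (fst x @ tl (snd x))) \<Longrightarrow> aff_near (\<eta> / 3) (inv F' \<circ> B') (inv (?FK (fst x)) \<circ> ?FK (fst x @ tl (snd x)))"
  proof (rule finite_transition_close[OF fX1 _ \<eta>3, of "\<lambda>x. ?FK (fst x)" "\<lambda>x. ?FK (fst x @ tl (snd x))"])
    show "?FK (fst x) \<in> Aff \<and> ?FK (fst x @ tl (snd x)) \<in> Aff" if "x \<in> X1" for x
      using glue[of "fst x" "snd x"] that FK by (auto simp: X1_def)
  qed blast
  obtain \<kappa>2 where \<kappa>2: "0 < \<kappa>2" "\<And>x F' B'. x \<in> X2 \<Longrightarrow> F' \<in> Aff \<Longrightarrow> B' \<in> Aff \<Longrightarrow> aff_near \<kappa>2 F' (?Fh (fst x)) \<Longrightarrow>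
      aff_near \<kappa>2 B' (?Fh (fst x @ tl (snd x))) \<Longrightarrow> aff_near (\<eta> / 3) (inv F' \<circ> B') (inv (?Fh (fst x)) \<circ> ?Fh (fst x @ tl (snd x)))"
  proof (rule finite_transition_close[OF fX2 _ \<eta>3, of "\<lambda>x. ?Fh (fst x)" "\<lambda>x. ?Fh (fst x @ tl (snd x))"])
    show "?Fh (fst x) \<in> Aff \<and> ?Fh (fst x @ tl (snd x)) \<in> Aff" if "x \<in> X2" for x
      using glue[of "fst x" "snd x"] that FhA by (auto simp: X1_def X2_def)
  qed blast
  define \<kappa> where "\<kappa> = min \<eta> (min \<kappa>1 \<kappa>2)"
  have \<kappa>: "0 < \<kappa>" "\<kappa> \<le> \<eta>" "\<kappa> \<le> \<kappa>1" "\<kappa> \<le> \<kappa>2" using \<kappa>1 \<kappa>2 \<eta> by (auto simp: \<kappa>_def)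
  (* values and derivatives within t at the base points put the frames within \<kappa> *)
  define t where "t = \<kappa> / (1 + cs)"
  have t: "0 < t" "t * (1 + cs) = \<kappa>" using \<kappa>(1) cs(1) by (auto simp: t_def)
  obtain d where d: "0 < d" "\<And>s. 0 \<le> s \<Longrightarrow> s \<le> d \<Longrightarrow> G * s powr \<alpha> \<le> t / 2"
    using small_powr[OF alpha G(1), of "t / 2"] t by auto
  (* the closeness of the branches of words that h turns into closeness t *)
  define \<kappa>0 where "\<kappa>0 = min \<rho> (min d (t / (2 * (1 + b))))"
  have "0 < t / (2 * (1 + b))" using t b by simp
  then have \<kappa>0: "0 < \<kappa>0" "\<kappa>0 \<le> \<rho>" "\<kappa>0 \<le> d" "\<kappa>0 \<le> t / (2 * (1 + b))" using \<rho> d unfolding \<kappa>0_def by linarith+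
  then have \<kappa>0t: "(1 + b) * \<kappa>0 \<le> t / 2" using b by (simp add: field_simps)
  have b\<kappa>: "b * \<kappa>0 + \<kappa>0 \<le> t / 2" using \<kappa>0t by (simp add: algebra_simps)
  have "0 < b * \<kappa>0" using b \<kappa>0 by simp
  then have \<kappa>0t': "\<kappa>0 \<le> t" using b\<kappa> t by linarith
  obtain e1 where e1: "0 < e1" and wclose:
    "\<And>f \<mu>' H' m' M' w x v. ifs K ?S f \<alpha> \<mu>' H' m' M' \<Longrightarrow> near_branches \<rho> e1 f \<Longrightarrow>
      w \<in> words K \<Longrightarrow> length w \<le> n1 + nw + 1 + 1 \<Longrightarrow> x \<in> ?S (last w) \<Longrightarrow>
      norm (word_map f w x - br w x) \<le> \<kappa>0 \<and>
      norm (deriv_at (word_map f w) x v - deriv_at (br w) x v) \<le> \<kappa>0 * norm v"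
    using words_close[OF \<rho>(1,2) \<kappa>0(1), of "n1 + nw + 1"] by blast
  define e where "e = min e1 (min e0 ((radius K - \<rho>) / (real Lc + 1)))"
  have "0 < (radius K - \<rho>) / (real Lc + 1)" using \<rho> by simp
  then have e: "0 < e" "e \<le> e1" "e \<le> e0" "e \<le> (radius K - \<rho>) / (real Lc + 1)" using e0 e1 unfolding e_def by linarith+
  have "(real Lc + 1) * e \<le> radius K - \<rho>" using e(4) by (simp add: field_simps)
  then have eL: "\<rho> + real Lc * e \<le> radius K" using e(1) by (simp add: algebra_simps)
  obtain \<delta> where \<delta>: "0 < \<delta>" and close: "\<And>\<epsilon> L. \<epsilon> \<le> \<delta> \<Longrightarrow> cantor_close \<alpha> \<epsilon> K L \<Longrightarrow>
       near_branches \<rho> e (ibranch L) \<and> ifs K ?S (ibranch L) \<alpha> \<mu>1 H' m' M' \<and> (\<forall>b\<in>letters K. ?S b \<subseteq> star L b)"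
    using pert[OF e(1)] by blast
  define \<epsilon>0 where "\<epsilon>0 = min \<delta> (min 1 (min (mh / 2) \<kappa>0))"
  have \<epsilon>0: "0 < \<epsilon>0" "\<epsilon>0 \<le> \<delta>" "\<epsilon>0 \<le> 1" "\<epsilon>0 \<le> mh / 2" "\<epsilon>0 \<le> \<kappa>0"
    using \<delta> mh(1) \<kappa>0(1) unfolding \<epsilon>0_def by linarith+
  show thesis
  proof (rule that[OF \<epsilon>0(1)])
    fix \<epsilon> L l
    assume \<epsilon>: "\<epsilon> \<le> \<epsilon>0" and LK: "cantor_close \<alpha> \<epsilon> K L" and hl: "C1a_close \<alpha> \<epsilon> W h l"
    have nb: "near_branches \<rho> e (ibranch L)" and J: "ifs K ?S (ibranch L) \<alpha> \<mu>1 H' m' M'"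
      and cover: "\<And>b. b \<in> letters K \<Longrightarrow> ?S b \<subseteq> star L b"
      using close[OF _ LK] \<epsilon> \<epsilon>0(2) by auto
    have BJ: "bunched_ifs K ?S (ibranch L) \<alpha> \<mu>1 H' m' M' C' \<nu>'"
      by (rule bifs[OF less_imp_le[OF e(1)] e(3) \<rho>(1) eL nb J])
    interpret J: bunched_ifs K ?S "ibranch L" \<alpha> \<mu>1 H' m' M' C' \<nu>' by (rule BJ)
    let ?f = "ibranch L" and ?F = "frame c (ibranch L) l" and ?G = "frame c (ibranch L) id"
    let ?bl = "word_map (ibranch L)"
    have lp: "letters L = letters K" "pairs L = pairs K" using LK by (auto simp: cantor_close_def)
    have bL: "bunched_cantor \<alpha> L" using LK by (simp add: cantor_close_def)
    then obtain \<mu>L where "expands_by \<mu>L L" unfolding bunched_cantor_def by blast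
    then have LM: "cantor_map L \<alpha> \<mu>L" using bL alpha by unfold_locales (auto simp: bunched_cantor_def)
    interpret L: cantor_map L \<alpha> \<mu>L by (rule LM)
    have wL: "words L = words K" by (simp add: words_def lp)
    have basS: "c a \<in> ?S a" if "a \<in> letters K" for a using base_piece[OF that] subset_thicken[OF \<rho>(1)] by blast
    have basW: "c (last w) \<in> ?S (last w)" if "w \<in> words K" for w using basS words_letters[OF that] by blast
    have ZW: "x \<in> Z \<Longrightarrow> x \<in> W" for x using Z by blast
    have l_near: "norm (deriv_at h x v - deriv_at l x v) \<le> \<epsilon> * norm v" "norm (h x - l x) < \<epsilon>" "l differentiable at x"
      if "x \<in> W" for x v
      using C1a_closeD(4)[OF hl that] C1a_closeD(3)[OF hl that] C1a_closeD(2)[OF hl that] by auto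
    have l_exp: "expanding_at (mh / 2) l x" if x: "x \<in> Z" for x
      unfolding expanding_at_def
    proof (intro conjI allI)
      show "0 < mh / 2" using mh by simp
      show "l differentiable at x" using l_near(3) ZW x by blast
      fix v
      have "mh * norm v \<le> norm (deriv_at h x v)" using mh(2)[OF x] by (simp add: expanding_at_def)
      moreover have "norm (deriv_at h x v - deriv_at l x v) \<le> mh / 2 * norm v"
        using l_near(1)[OF ZW[OF x], of v] \<epsilon> \<epsilon>0(4) mult_right_mono[of \<epsilon> "mh / 2" "norm v"] by simp
      ultimately show "mh / 2 * norm v \<le> norm (deriv_at l x v)"
        using norm_triangle_sub[of "deriv_at h x v" "deriv_at l x v"] by linarith
    qed
    have l_osc: "norm (deriv_at l y v - deriv_at l z v) \<le> (G + 1) * norm (y - z) powr \<alpha> * norm v"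
      if "y \<in> Z" "z \<in> Z" for y z v
    proof -
      let ?t = "norm (y - z) powr \<alpha>"
      have "norm ((deriv_at h y v - deriv_at l y v) - (deriv_at h z v - deriv_at l z v)) \<le> \<epsilon> * ?t * norm v"
        by (rule C1a_closeD(5)[OF hl ZW[OF that(1)] ZW[OF that(2)]])
      also have "\<dots> \<le> 1 * ?t * norm v" using \<epsilon> \<epsilon>0(3) by (intro mult_right_mono) auto
      finally have 1: "norm ((deriv_at h y v - deriv_at l y v) - (deriv_at h z v - deriv_at l z v)) \<le> ?t * norm v" by simp
      have "deriv_at l y v - deriv_at l z v = (deriv_at h y v - deriv_at h z v)
          - ((deriv_at h y v - deriv_at l y v) - (deriv_at h z v - deriv_at l z v))" by simp
      then have "norm (deriv_at l y v - deriv_at l z v) \<le> norm (deriv_at h y v - deriv_at h z v)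
          + norm ((deriv_at h y v - deriv_at l y v) - (deriv_at h z v - deriv_at l z v))"
        by (metis norm_triangle_ineq4)
      then show ?thesis using 1 G(2)[OF that, of v] by (simp add: algebra_simps)
    qed
    have l_bound: "norm (deriv_at l x v) \<le> (b + 1) * norm v" if x: "x \<in> Z" for x v
    proof -
      have "norm (deriv_at l x v) \<le> norm (deriv_at h x v) + norm (deriv_at h x v - deriv_at l x v)"
        using norm_triangle_sub[of "deriv_at l x v" "deriv_at h x v"] by (simp add: norm_minus_commute)
      also have "\<dots> \<le> b * norm v + 1 * norm v"
        using b(2)[OF x, of v] l_near(1)[OF ZW[OF x], of v] \<epsilon> \<epsilon>0(3) mult_right_mono[of \<epsilon> 1 "norm v"] by simp
      finally show ?thesis by (simp add: algebra_simps)
    qed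
    have inZ: "?bl u x \<in> Z" if "u \<in> words K" "hd u = \<theta> 0" "x \<in> ?S (last u)" for u x
      using J.word_map_in[OF that(1,3)] that(2) Z(3) by auto
    have lexp: "expanding_at (mh / 2 * m' ^ (length u - 1)) (l \<circ> ?bl u) (c (last u))" if "u \<in> words K" "hd u = \<theta> 0" for u
      by (rule expanding_at_comp[OF J.word_map_exp[OF that(1) basW[OF that(1)]] l_exp[OF inZ[OF that basW[OF that(1)]]]])
    have F_Aff: "?F u \<in> Aff" if "u \<in> words K" "hd u = \<theta> 0" for u
      unfolding frame_def by (rule tangent_map_Aff[OF lexp[OF that]])
    have G_Aff: "?G u \<in> Aff" if "u \<in> words K" for u
      unfolding frame_def using tangent_map_Aff[OF J.word_map_exp[OF that basW[OF that]]] by simp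
    note wcl = wclose[OF J near_branches_mono[OF nb e(2)]]
    have tc: "t * (1 + norm (c (last v))) \<le> \<kappa>" if "v \<in> words K" for v
      using t cs(2)[of "last v"] words_letters[OF that] by (metis add_left_mono less_imp_le mult_left_mono)
    have G_near: "aff_near \<kappa> (?G v) (?FK v)" if v: "v \<in> words K" "length v \<le> n1 + nw + 1 + 1" for v
    proof -
      let ?p = "c (last v)"
      have 1: "norm (?bl v ?p - br v ?p) \<le> t" using wcl[OF v basW[OF v(1)], of 0] \<kappa>0t' by linarith
      have 2: "norm (deriv_at (?bl v) ?p x - deriv_at (br v) ?p x) \<le> t * norm x" for x
        using wcl[OF v basW[OF v(1)], of x] mult_right_mono[OF \<kappa>0t' norm_ge_zero[of x]] by linarith
      show ?thesis unfolding frame_def id_comp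
        by (rule aff_near_mono[OF tangent_map_near[OF 1 2 less_imp_le[OF t(1)]] tc[OF v(1)]])
    qed
    have F_near: "aff_near \<kappa> (?F v) (?Fh v)" if v: "v \<in> words K" "length v \<le> n1 + nw + 1 + 1" and hv: "hd v = \<theta> 0" for v
    proof -
      let ?p = "c (last v)"
      define y y' where "y = br v ?p" and "y' = ?bl v ?p"
      have lv: "last v \<in> letters K" using words_letters[OF v(1)] by blast
      have y: "y \<in> ?P" using word_map_piece(1)[OF v(1) base_piece[OF lv]] hv by (simp add: y_def)
      have yZ: "y \<in> Z" "y' \<in> Z" using y Z(4) inZ[OF v(1) hv basW[OF v(1)]] by (auto simp: y'_def)
      have yy: "norm (y' - y) \<le> \<kappa>0" using wcl[OF v basW[OF v(1)], of 0] by (simp add: y_def y'_def)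
      have sub: "cball y \<rho> \<subseteq> Z" using y by (auto simp: Z_def)
      have in_ball: "y' \<in> cball y \<rho>" "y \<in> cball y \<rho>" using yy \<kappa>0(2) \<rho>(1) by (auto simp: dist_norm norm_minus_commute)
      have "norm (h y' - h y) \<le> b * norm (y' - y)"
      proof (rule lipschitz_on_convex[OF convex_cball _ _ in_ball])
        show "(h has_derivative deriv_at h x) (at x)" if "x \<in> cball y \<rho>" for x
          by (rule frechet_has_derivative[OF hd[OF ZW]]) (use sub that in blast)
        show "norm (deriv_at h x v) \<le> b * norm v" if "x \<in> cball y \<rho>" for x v
          by (rule b(2)) (use sub that in blast)
      qed
      also have "\<dots> \<le> b * \<kappa>0" using yy b(1) by (intro mult_left_mono) auto
      finally have "norm (h y' - h y) \<le> b * \<kappa>0" .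
      moreover have "norm (l y' - h y') \<le> \<kappa>0"
        using l_near(2)[OF ZW[OF yZ(2)]] \<epsilon> \<epsilon>0(5) by (simp add: norm_minus_commute)
      ultimately have 1: "norm (l y' - h y) \<le> t"
        using norm_triangle_ineq[of "l y' - h y'" "h y' - h y"] b\<kappa> t by simp
      have dl: "deriv_at (l \<circ> ?bl v) ?p = deriv_at l y' \<circ> deriv_at (?bl v) ?p"
        unfolding y'_def
        by (intro deriv_at_comp J.word_map_differentiable[OF v(1) basW[OF v(1)]] l_near(3)) (use ZW yZ y'_def in auto)
      have dh: "deriv_at (h \<circ> br v) ?p = deriv_at h y \<circ> deriv_at (br v) ?p"
        unfolding y_def
        by (intro deriv_at_comp B.word_map_differentiable[OF v(1) base_star[OF lv]] hd) (use ZW yZ y_def in auto)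
      have 2: "norm (deriv_at (l \<circ> ?bl v) ?p x - deriv_at (h \<circ> br v) ?p x) \<le> t * norm x" for x
      proof -
        let ?X = "deriv_at (?bl v) ?p x" and ?Y = "deriv_at (br v) ?p x"
        have X: "norm ?X \<le> norm x" by (rule J.word_map_nonexpanding[OF v(1) basW[OF v(1)]])
        have lin: "linear (deriv_at h y)" by (rule linear_deriv_at[OF hd[OF ZW[OF yZ(1)]]])
        have a: "norm (deriv_at l y' ?X - deriv_at h y' ?X) \<le> \<kappa>0 * norm x"
        proof -
          have "norm (deriv_at l y' ?X - deriv_at h y' ?X) \<le> \<epsilon> * norm ?X"
            using l_near(1)[OF ZW[OF yZ(2)], of ?X] by (simp add: norm_minus_commute)
          also have "\<dots> \<le> \<kappa>0 * norm x" using \<epsilon> \<epsilon>0(5) X \<kappa>0(1) by (intro mult_mono) auto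
          finally show ?thesis .
        qed
        have b1: "norm (deriv_at h y' ?X - deriv_at h y ?X) \<le> t / 2 * norm x"
        proof -
          have "norm (deriv_at h y' ?X - deriv_at h y ?X) \<le> G * norm (y' - y) powr \<alpha> * norm ?X"
            by (rule G(2)[OF yZ(2,1)])
          also have "\<dots> \<le> t / 2 * norm x"
            using d(2)[of "norm (y' - y)"] yy \<kappa>0(3) X t by (intro mult_mono) auto
          finally show ?thesis .
        qed
        have c1: "norm (deriv_at h y ?X - deriv_at h y ?Y) \<le> b * \<kappa>0 * norm x"
        proof -
          have "norm (deriv_at h y (?X - ?Y)) \<le> b * norm (?X - ?Y)" by (rule b(2)[OF yZ(1)])
          also have "\<dots> \<le> b * (\<kappa>0 * norm x)"
            using wcl[OF v basW[OF v(1)], of x] b(1) by (intro mult_left_mono) auto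
          finally show ?thesis by (simp add: linear_diff[OF lin] mult.assoc)
        qed
        have "norm (deriv_at l y' ?X - deriv_at h y ?Y) \<le> \<kappa>0 * norm x + t / 2 * norm x + b * \<kappa>0 * norm x"
          using a b1 c1 norm_triangle_ineq[of "deriv_at l y' ?X - deriv_at h y' ?X" "deriv_at h y' ?X - deriv_at h y ?X"]
            norm_triangle_ineq[of "deriv_at l y' ?X - deriv_at h y ?X" "deriv_at h y ?X - deriv_at h y ?Y"] by simp
        also have "\<dots> = (b * \<kappa>0 + \<kappa>0 + t / 2) * norm x" by (simp add: algebra_simps)
        also have "\<dots> \<le> t * norm x" using b\<kappa> by (intro mult_right_mono) auto
        finally show ?thesis by (simp add: dl dh)
      qed
      have val: "norm ((l \<circ> ?bl v) ?p - (h \<circ> br v) ?p) \<le> t" using 1 by (simp add: y_def y'_def)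
      show ?thesis unfolding frame_def
        by (rule aff_near_mono[OF tangent_map_near[OF val 2 less_imp_le[OF t(1)]] tc[OF v(1)]])
    qed
    let ?X = "{u \<in> words K. hd u = \<theta> 0}"
    have c1: "\<forall>u\<in>?X. ?F u \<in> Aff" using F_Aff by blast
    have c2: "aff_near \<eta> (?F [\<theta> 0]) A"
    proof -
      have s: "[\<theta> 0] \<in> words K" using \<theta>0 by (simp add: words_def)
      have "limit_transition \<theta> [\<theta> 0] = id"
      proof
        fix x
        have "deriv_at (limit_geometry K c \<theta>) (c (\<theta> 0)) = id"
          using deriv_at_eqI[OF limit_geometry_has_derivative[OF \<theta> base_star[OF \<theta>0]]] limit_geometry_base(2)[OF \<theta>] by simp
        then show "limit_transition \<theta> [\<theta> 0] x = id x"
          by (simp add: tangent_map_def limit_geometry_base(1)[OF \<theta>])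
      qed
      then have "?Fh [\<theta> 0] = A" using Fh[OF s] by simp
      then show ?thesis using F_near[OF s] aff_near_mono[OF _ \<kappa>(2)] by simp
    qed
    have c3: "aff_near \<eta> (inv (?F u) \<circ> ?F (u @ tl w)) (transition K c (append_word \<theta> u) w)"
      if u: "u \<in> words K" "hd u = \<theta> 0" and w: "w \<in> words K" "hd w = last u" "length w \<le> nw" for u w
    proof -
      define \<tau> where "\<tau> = append_word \<theta> u"
      have ne: "u \<noteq> []" "w \<noteq> []" using u w by (auto simp: words_def)
      have \<tau>: "\<tau> \<in> past K" "\<tau> 0 = last u"
        using append_word_past[OF \<theta> u] append_word_0[OF ne(1)] by (auto simp: \<tau>_def)
      have hw: "hd w = \<tau> 0" using w(2) \<tau>(2) by simp
      have tr: "transition K c (append_word \<theta> u) w = limit_transition \<tau> w"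
        using transition_eq[OF \<tau>(1) w(1) hw] by (simp add: \<tau>_def)
      note g = words_glue[OF u(1) w(1) w(2)[symmetric]]
      show ?thesis
      proof (cases "length u \<le> n1 + 1")
        case True
        have x: "(u, w) \<in> X2" using u w True by (auto simp: X2_def X1_def)
        have len: "length (u @ tl w) \<le> n1 + nw + 1 + 1" "length u \<le> n1 + nw + 1 + 1" using True w(3) by auto
        have "aff_near (\<eta> / 3) (inv (?F u) \<circ> ?F (u @ tl w)) (inv (?Fh u) \<circ> ?Fh (u @ tl w))"
          using \<kappa>2(2)[OF x, of "?F u" "?F (u @ tl w)"] F_Aff[OF u] F_Aff[OF g(1)] g(3) u
            aff_near_mono[OF F_near[OF u(1) len(2) u(2)] \<kappa>(4)] aff_near_mono[OF F_near[OF g(1) len(1)] \<kappa>(4)] by simp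
        moreover have "inv (?Fh u) \<circ> ?Fh (u @ tl w) = limit_transition \<tau> w"
        proof
          fix x
          have "?Fh (u @ tl w) x = ?Fh u (limit_transition \<tau> w x)"
            using Fh[OF u] Fh[OF g(1)] g(3) u(2) transition_cocycle[OF \<theta> u w(1,2)] by (simp add: \<tau>_def)
          then show "(inv (?Fh u) \<circ> ?Fh (u @ tl w)) x = limit_transition \<tau> w x"
            using Aff_inv_simps(1)[OF FhA[OF u]] by simp
        qed
        ultimately show ?thesis unfolding tr using \<eta> by (auto intro: aff_near_mono)
      next
        case False
        have tu: "truncate \<tau> (length u - 1) = u"
        proof -
          have "truncate \<theta> 0 @ tl u = u" using u(2) ne(1) by (cases u) (auto simp: truncate_def)
          then show ?thesis using truncate_append_word[where \<theta> = \<theta> and n = 0, OF ne(1) u(2)] by (simp add: \<tau>_def)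
        qed
        define v where "v = truncate \<tau> n1"
        have "n1 \<le> length u - 1" using False by simp
        then obtain u' where u': "u = u' @ v" using truncate_extend[of n1 "length u - 1" \<tau>] tu by (metis v_def)
        have v: "v \<in> words K" "length v = n1 + 1" "last v = last u" "v \<noteq> []"
          using truncate_in_words[OF \<tau>(1)] \<tau>(2) by (auto simp: v_def) (simp add: truncate_def)
        have x: "(v, w) \<in> X1" using v w by (simp add: X1_def)
        have wv: "hd w = last v" using w(2) v(3) by simp
        have len: "length (v @ tl w) \<le> n1 + nw + 1 + 1" "length v \<le> n1 + nw + 1 + 1" using v w(3) by auto
        have uw: "u' @ v \<in> words K" "hd (u' @ v) = \<theta> 0" using u u' by auto
        have Req: "C' * (G + 1) * M' powr \<alpha> / (mh / 2) + J.Q = R" by (simp add: R_def J.Q_def)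
        have tail: "aff_near ((1 + M') * (R * \<nu>' ^ n1) * (1 + norm (c (last w))))
            (inv (?F (u' @ v)) \<circ> ?F (u' @ v @ tl w)) (inv (?G v) \<circ> ?G (v @ tl w))"
          using J.frame_transition_tail[OF uw(1) v(4) w(1) wv, of c "mh / 2" l "G + 1"]
            basW[OF v(1)] basW[OF w(1)] l_exp l_osc Z(3) mh(1) G(1) v(2) uw(2) unfolding Req by (auto simp: subset_eq)
        have small: "(1 + M') * (R * \<nu>' ^ n1) * (1 + norm (c (last w))) \<le> \<eta> / 3"
        proof -
          have "0 \<le> (1 + M') * (R * \<nu>' ^ n1)"
            using J.M J.C J.H m' mh(1) G(1) \<nu>' by (simp add: R_def)
          then have "(1 + M') * (R * \<nu>' ^ n1) * (1 + norm (c (last w))) \<le> (1 + M') * (R * \<nu>' ^ n1) * (1 + cs)"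
            using cs(2) words_letters[OF w(1)] by (intro mult_left_mono) auto
          then show ?thesis using n1(1) by simp
        qed
        have 1: "aff_near (\<eta> / 3) (inv (?F u) \<circ> ?F (u @ tl w)) (inv (?G v) \<circ> ?G (v @ tl w))"
          using aff_near_mono[OF tail small] by (simp add: u')
        have 2: "aff_near (\<eta> / 3) (inv (?G v) \<circ> ?G (v @ tl w)) (inv (?FK v) \<circ> ?FK (v @ tl w))"
          using \<kappa>1(2)[OF x, of "?G v" "?G (v @ tl w)"] G_Aff[OF v(1)] G_Aff[OF glue(1)[OF x]]
            aff_near_mono[OF G_near[OF v(1) len(2)] \<kappa>(3)] aff_near_mono[OF G_near[OF glue(1)[OF x] len(1)] \<kappa>(3)] by simp
        have "br (v @ tl w) = br v \<circ> br w" using v(4) ne(2) wv by (intro word_map_glue) auto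
        then have "aff_near (approx_const * \<nu> ^ n1) (inv (?FK v) \<circ> ?FK (v @ tl w)) (limit_transition \<tau> w)"
          using transition_approx[OF \<tau>(1) w(1) hw, of n1] \<tau>(2) v(3) glue(3)[OF x] by (simp add: frame_def v_def)
        then have 3: "aff_near (\<eta> / 3) (inv (?FK v) \<circ> ?FK (v @ tl w)) (limit_transition \<tau> w)"
          by (rule aff_near_mono) (use n1(2) in simp)
        show ?thesis unfolding tr using aff_near_trans[OF aff_near_trans[OF 1 2] 3] by simp
      qed
    qed
    have diff: "?F u x - ?F u y = deriv_at (l \<circ> ?bl u) (c (last u)) (x - y)" if "u \<in> words K" "hd u = \<theta> 0" for u x y
      using linear_diff[OF expanding_at_inverse(6)[OF lexp[OF that]], of "x - c (last u)" "y - c (last u)"]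
      by (simp add: frame_def tangent_map_def)
    have pw: "q ^ length u = q * q ^ (length u - 1)" if "u \<in> words K" for u and q :: real
      using that by (cases u) (auto simp: words_def)
    have \<mu>1p: "0 < \<mu>1" using mu(1) \<mu>1(1) by simp
    have c4: "norm (?F u x - ?F u y) \<le> (b + 1) / \<mu>1 * \<mu>1 ^ length u * norm (x - y)" if u: "u \<in> words K" "hd u = \<theta> 0" for u x y
    proof -
      let ?p = "c (last u)"
      have "deriv_at (l \<circ> ?bl u) ?p = deriv_at l (?bl u ?p) \<circ> deriv_at (?bl u) ?p"
        using l_exp[OF inZ[OF u basW[OF u(1)]]]
        by (intro deriv_at_comp J.word_map_differentiable[OF u(1) basW[OF u(1)]]) (auto simp: expanding_at_def)
      then have "norm (deriv_at (l \<circ> ?bl u) ?p (x - y)) \<le> (b + 1) * norm (deriv_at (?bl u) ?p (x - y))"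
        using l_bound[OF inZ[OF u basW[OF u(1)]]] by simp
      also have "\<dots> \<le> (b + 1) * (\<mu>1 ^ (length u - 1) * norm (x - y))"
        using J.word_map_contr[OF u(1) basW[OF u(1)]] b(1) by (intro mult_left_mono) auto
      also have "\<dots> = (b + 1) / \<mu>1 * \<mu>1 ^ length u * norm (x - y)" using \<mu>1p by (simp add: pw[OF u(1)])
      finally show ?thesis by (simp add: diff[OF u])
    qed
    have c5: "mh / 2 / m' * m' ^ length u * norm (x - y) \<le> norm (?F u x - ?F u y)" if u: "u \<in> words K" "hd u = \<theta> 0" for u x y
      using lexp[OF u] m' by (simp add: diff[OF u] pw[OF u(1)] expanding_at_def)
    have c6: "\<exists>x\<in>cantor_piece L (\<theta> 0). (\<lambda>i. ?F (u i) (c (last (u i)))) \<longlonglongrightarrow> l x"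
      if u: "\<forall>i. u i \<in> ?X \<and> (\<exists>z. u (Suc i) = u i @ z)" and long: "\<forall>k. \<exists>i. k < length (u i)" for u
    proof -
      have uw: "u i \<in> words K" "hd (u i) = \<theta> 0" for i using u by auto
      have cS: "c (last (u i)) \<in> star L (last (u i))" for i
        using basW[OF uw(1)] cover words_letters[OF uw(1)] by blast
      obtain x where x: "x \<in> cantor_piece L (\<theta> 0)" "(\<lambda>i. ?bl (u i) (c (last (u i)))) \<longlonglongrightarrow> x"
        using L.nested_limit[of u "\<theta> 0" "\<lambda>i. c (last (u i))"] uw cS u long wL by auto
      have "x \<in> Z"
        by (rule closed_sequentially[OF compact_imp_closed[OF Z(1)] _ x(2)]) (use inZ[OF uw basW[OF uw(1)]] in blast)
      then have "isCont l x" using l_near(3) ZW differentiable_imp_continuous_within by blast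
      then have "(\<lambda>i. l (?bl (u i) (c (last (u i))))) \<longlonglongrightarrow> l x" using x(2) by (rule isCont_tendsto_compose)
      moreover have "?F (u i) (c (last (u i))) = l (?bl (u i) (c (last (u i))))" for i
        using linear_0[OF expanding_at_inverse(6)[OF lexp[OF uw]]] by (simp add: frame_def tangent_map_def)
      ultimately show ?thesis using x(1) by auto
    qed
    show "tracks K c \<theta> A nw \<eta> L l"
      unfolding tracks_def Let_def
    proof (intro conjI)
      show "\<exists>C q. 0 < q \<and> q < 1 \<and> (\<forall>u\<in>?X. \<forall>x y. norm (?F u x - ?F u y) \<le> C * q ^ length u * norm (x - y))"
        using c4 \<mu>1(2) \<mu>1p by (intro exI[of _ "(b + 1) / \<mu>1"] exI[of _ \<mu>1]) blast
      show "\<exists>C k. 0 < C \<and> 0 < k \<and> (\<forall>u\<in>?X. \<forall>x y. C * k ^ length u * norm (x - y) \<le> norm (?F u x - ?F u y))"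
        using c5 m' mh(1) by (intro exI[of _ "mh / 2 / m'"] exI[of _ m']) (auto simp del: times_divide_eq_left)
    qed (use c1 c2 c3 c6 in blast)+
  qed
qed

end

section \<open>The covering condition with uniform room\<close>

lemma bunched_cantor_limit_map:
  assumes "bunched_cantor \<alpha> K" "base_points K c" "0 < \<alpha>"
  shows "\<exists>\<mu> H m M N \<mu>' C \<nu>. limit_map K \<alpha> \<mu> H m M N c \<mu>' C \<nu>"
proof -
  obtain \<mu> N where K: "regular_cantor \<alpha> K" "good_radius \<alpha> K" "expands_by \<mu> K"
    "\<forall>x\<in>cantor_set K. onorm (deriv_at (gmap K ^^ N) x) * inverse (conorm (deriv_at (gmap K ^^ N) x))
       * \<mu> powr (\<alpha> * real N) < 1"
    using assms(1) unfolding bunched_cantor_def by blast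
  interpret cantor_map K \<alpha> \<mu> using K assms(3) by unfold_locales
  obtain H m M where "ifs K (star K) (ibranch K) \<alpha> \<mu> H m M" using ifs_star by blast
  then interpret cantor_ifs K \<alpha> \<mu> H m M by (intro cantor_ifs.intro cantor_map_axioms)
  interpret bunched_map K \<alpha> \<mu> H m M N c using K(4) assms(2) by unfold_locales auto
  obtain \<mu>' where \<mu>': "\<mu> < \<mu>'" "\<mu>' < 1" and bunched: "stays_bunched \<mu>'"
    by (rule bunched_perturbation)
  have st: "star K = (\<lambda>a. thicken (radius K) (piece K a))" by (rule ext) (rule star_eq_thicken)
  obtain e L C \<nu> where e: "0 < e" and b: "\<And>\<rho> f \<epsilon>.
       0 \<le> \<epsilon> \<Longrightarrow> \<epsilon> \<le> e \<Longrightarrow> 0 < \<rho> \<Longrightarrow> \<rho> + real L * \<epsilon> \<le> radius K \<Longrightarrow> near_branches \<rho> \<epsilon> f \<Longrightarrow>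
       ifs K (\<lambda>a. thicken \<rho> (piece K a)) f \<alpha> \<mu>' H m M \<Longrightarrow>
       bunched_ifs K (\<lambda>a. thicken \<rho> (piece K a)) f \<alpha> \<mu>' H m M C \<nu>"
    by (rule stays_bunchedE[OF bunched I.m, of H M]) (rule that)
  have "ifs K (star K) (ibranch K) \<alpha> \<mu>' H m M"
  proof (unfold_locales)
    fix a b' x v assume ab: "(a, b') \<in> pairs K" "x \<in> star K b'"
    have "\<mu> * norm (v::'b) \<le> \<mu>' * norm v" using \<mu>'(1) by (intro mult_right_mono) auto
    then show "norm (deriv_at (ibranch K a) x v) \<le> \<mu>' * norm v" using I.contr[OF ab, of v] by simp
  qed (use I.alpha I.H I.m I.M I.maps I.exp I.hoelder I.diam mu \<mu>' in auto)
  moreover have "near_branches (radius K) 0 (ibranch K)" by (auto simp: near_branches_def)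
  ultimately have "bunched_ifs K (star K) (ibranch K) \<alpha> \<mu>' H m M C \<nu>"
    unfolding st using e radius_pos by (intro b[of 0]) auto
  then have "limit_map K \<alpha> \<mu> H m M N c \<mu>' C \<nu>"
    by (intro limit_map.intro bunched_map_axioms)
  then show ?thesis by blast
qed

lemma (in limit_map) transition_continuous:
  assumes \<theta>: "\<theta> \<in> past K" and w: "w = [] \<or> w \<in> words K \<and> hd w = \<theta> 0" and \<eta>: "0 < \<eta>"
  obtains n where "\<And>\<tau>. \<tau> \<in> past K \<Longrightarrow> (\<And>i. i \<le> n \<Longrightarrow> \<tau> i = \<theta> i) \<Longrightarrow>
    aff_near \<eta> (transition K c \<tau> w) (transition K c \<theta> w)"
proof (cases "w = []")
  case True
  then show thesis using that[of 0] \<eta> by (simp add: transition_def aff_near_refl)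
next
  case False
  then have w: "w \<in> words K" "hd w = \<theta> 0" using w by auto
  have "(\<lambda>n. approx_const * \<nu> ^ n) \<longlonglongrightarrow> approx_const * 0"
    using B.lam by (intro tendsto_intros LIMSEQ_realpow_zero) auto
  then have "eventually (\<lambda>n. approx_const * \<nu> ^ n < \<eta> / 2) sequentially"
    using \<eta> by (intro order_tendstoD) auto
  then obtain n where n: "approx_const * \<nu> ^ n < \<eta> / 2" unfolding eventually_sequentially by blast
  show thesis
  proof (rule that[of n])
    fix \<tau> assume \<tau>: "\<tau> \<in> past K" and eq: "\<And>i. i \<le> n \<Longrightarrow> \<tau> i = \<theta> i"
    have t: "truncate \<tau> n = truncate \<theta> n" using eq by (auto simp: truncate_def)
    have 0: "\<tau> 0 = \<theta> 0" using eq by simp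
    have hw: "hd w = \<tau> 0" using w(2) 0 by simp
    note a = transition_approx[OF \<theta> w, of n] and b = transition_approx[OF \<tau> w(1) hw, of n, unfolded t 0]
    have "aff_near (approx_const * \<nu> ^ n + approx_const * \<nu> ^ n) (limit_transition \<tau> w) (limit_transition \<theta> w)"
      by (rule aff_near_trans[OF aff_near_sym[OF b] a])
    then show "aff_near \<eta> (transition K c \<tau> w) (transition K c \<theta> w)"
      unfolding transition_eq[OF \<theta> w] transition_eq[OF \<tau> w(1) hw]
      by (rule aff_near_mono) (use n in linarith)
  qed
qed

lemma topspace_past_topology: "topspace (past_topology K) = past K"
  by (auto simp: past_topology_def past_def PiE_def)

lemma past_topology_contains_cylinder:
  assumes "openin (past_topology K) V" "\<theta> \<in> V"
  obtains n where "\<And>\<tau>. \<tau> \<in> past K \<Longrightarrow> (\<And>i. i \<le> n \<Longrightarrow> \<tau> i = \<theta> i) \<Longrightarrow> \<tau> \<in> V"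
proof -
  let ?P = "product_topology (\<lambda>_. discrete_topology (letters K)) (UNIV::nat set)"
  obtain T where T: "openin ?P T" "V = T \<inter> past K"
    using assms(1) unfolding past_topology_def openin_subtopology by blast
  have "\<theta> \<in> T" using assms(2) T(2) by blast
  obtain X where X: "\<theta> \<in> (\<Pi>\<^sub>E i\<in>UNIV. X i)" "finite {i. X i \<noteq> letters K}" "(\<Pi>\<^sub>E i\<in>UNIV. X i) \<subseteq> T"
    using product_topology_open_contains_basis[OF T(1) \<open>\<theta> \<in> T\<close>] by auto
  obtain n where n: "\<And>i. X i \<noteq> letters K \<Longrightarrow> i \<le> n"
    using X(2) unfolding finite_nat_set_iff_bounded_le by auto
  show thesis
  proof (rule that[of n])
    fix \<tau> assume \<tau>: "\<tau> \<in> past K" "\<And>i. i \<le> n \<Longrightarrow> \<tau> i = \<theta> i"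
    have "\<tau> i \<in> X i" for i
    proof (cases "i \<le> n")
      case True
      then show ?thesis using \<tau>(2) X(1) by (auto simp: PiE_def)
    next
      case False
      then have "X i = letters K" using n by blast
      then show ?thesis using \<tau>(1) by (simp add: past_def)
    qed
    then show "\<tau> \<in> V" using X(3) T(2) \<tau>(1) by (auto simp: PiE_def)
  qed
qed

lemma openin_cylinder:
  assumes "\<theta> \<in> past K"
  shows "openin (past_topology K) {\<tau> \<in> past K. \<forall>i\<le>n. \<tau> i = \<theta> i}"
proof -
  let ?P = "product_topology (\<lambda>_. discrete_topology (letters K)) (UNIV::nat set)"
  let ?X = "\<lambda>i. if i \<le> n then {\<theta> i} else letters K"
  have "openin ?P (PiE UNIV ?X)"
    unfolding openin_PiE_gen
  proof (intro disjI2 conjI ballI)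
    show "finite {i \<in> UNIV. ?X i \<noteq> topspace (discrete_topology (letters K))}"
      by (rule finite_subset[of _ "{..n}"]) (auto split: if_splits)
    show "openin (discrete_topology (letters K)) (?X i)" for i using assms by (auto simp: past_def)
  qed
  moreover have "{\<tau> \<in> past K. \<forall>i\<le>n. \<tau> i = \<theta> i} = PiE UNIV ?X \<inter> past K"
    by (auto simp: PiE_def Pi_def past_def split: if_splits)
  ultimately show ?thesis unfolding past_topology_def openin_subtopology by blast
qed

text \<open>This lemma and the next one describe neighbourhoods in the space of affine configurations by a
distance of the affine maps and a number of common letters of the sequences.\<close>

lemma QAff_contains_box:
  assumes "openin (QAff_topology K K') U" "(B, \<theta>, \<theta>') \<in> U"
  obtains \<eta> n where "0 < \<eta>"
    "\<And>A \<tau> \<tau>'. A \<in> Aff \<Longrightarrow> aff_near \<eta> A B \<Longrightarrow> \<tau> \<in> past K \<Longrightarrow> (\<And>i. i \<le> n \<Longrightarrow> \<tau> i = \<theta> i) \<Longrightarrow>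
      \<tau>' \<in> past K' \<Longrightarrow> (\<And>i. i \<le> n \<Longrightarrow> \<tau>' i = \<theta>' i) \<Longrightarrow> (A, \<tau>, \<tau>') \<in> U"
proof -
  obtain O1 O23 where O: "openin Aff_topology O1" "openin (prod_topology (past_topology K) (past_topology K')) O23"
    "B \<in> O1" "(\<theta>, \<theta>') \<in> O23" "O1 \<times> O23 \<subseteq> U"
    using assms unfolding QAff_topology_def openin_prod_topology_alt by meson
  obtain O2 O3 where O': "openin (past_topology K) O2" "openin (past_topology K') O3"
    "\<theta> \<in> O2" "\<theta>' \<in> O3" "O2 \<times> O3 \<subseteq> O23"
    using O(2,4) unfolding openin_prod_topology_alt by meson
  obtain \<eta> where \<eta>: "0 < \<eta>" "\<And>A. A \<in> Aff \<Longrightarrow> aff_near \<eta> A B \<Longrightarrow> A \<in> O1"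
    using Aff_topology_contains_near[OF O(1,3)] by blast
  obtain n where n: "\<And>\<tau>. \<tau> \<in> past K \<Longrightarrow> (\<And>i. i \<le> n \<Longrightarrow> \<tau> i = \<theta> i) \<Longrightarrow> \<tau> \<in> O2"
    using past_topology_contains_cylinder[OF O'(1,3)] by metis
  obtain n' where n': "\<And>\<tau>. \<tau> \<in> past K' \<Longrightarrow> (\<And>i. i \<le> n' \<Longrightarrow> \<tau> i = \<theta>' i) \<Longrightarrow> \<tau> \<in> O3"
    using past_topology_contains_cylinder[OF O'(2,4)] by metis
  show thesis
  proof (rule that[OF \<eta>(1), of "max n n'"])
    fix A \<tau> \<tau>' assume "A \<in> Aff" "aff_near \<eta> A B" "\<tau> \<in> past K" "\<And>i. i \<le> max n n' \<Longrightarrow> \<tau> i = \<theta> i"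
      "\<tau>' \<in> past K'" "\<And>i. i \<le> max n n' \<Longrightarrow> \<tau>' i = \<theta>' i"
    then have "A \<in> O1" "\<tau> \<in> O2" "\<tau>' \<in> O3" by (auto intro!: \<eta>(2) n n')
    then show "(A, \<tau>, \<tau>') \<in> U" using O(5) O'(5) by blast
  qed
qed

lemma QAff_box_nbhd:
  assumes "B \<in> Aff" "\<theta> \<in> past K" "\<theta>' \<in> past K'" "0 < \<eta>"
  obtains V where "openin (QAff_topology K K') V" "(B, \<theta>, \<theta>') \<in> V"
    "\<And>A \<tau> \<tau>'. (A, \<tau>, \<tau>') \<in> V \<Longrightarrow> A \<in> Aff \<and> aff_near \<eta> A B \<and> \<tau> \<in> past K \<and> (\<forall>i\<le>n. \<tau> i = \<theta> i) \<and>
      \<tau>' \<in> past K' \<and> (\<forall>i\<le>n. \<tau>' i = \<theta>' i)"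
proof -
  obtain W where W: "openin Aff_topology W" "B \<in> W" "\<And>A. A \<in> W \<Longrightarrow> A \<in> Aff \<and> aff_near \<eta> A B"
    using Aff_topology_near_nbhd[OF assms(1,4)] by blast
  show thesis
  proof (rule that[of "W \<times> {\<tau> \<in> past K. \<forall>i\<le>n. \<tau> i = \<theta> i} \<times> {\<tau> \<in> past K'. \<forall>i\<le>n. \<tau> i = \<theta>' i}"])
    show "openin (QAff_topology K K') (W \<times> {\<tau> \<in> past K. \<forall>i\<le>n. \<tau> i = \<theta> i} \<times> {\<tau> \<in> past K'. \<forall>i\<le>n. \<tau> i = \<theta>' i})"
      unfolding QAff_topology_def openin_prod_Times_iff
      using W(1) openin_cylinder[OF assms(2)] openin_cylinder[OF assms(3)] by blast
  qed (use W assms in auto)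
qed

lemma compactin_uniform:
  fixes P :: "real \<Rightarrow> 'x \<Rightarrow> bool"
  assumes S: "compactin X S"
    and loc: "\<And>x. x \<in> S \<Longrightarrow> \<exists>V \<eta>. openin X V \<and> x \<in> V \<and> 0 < \<eta> \<and> (\<forall>y\<in>V. P \<eta> y)"
    and mono: "\<And>\<eta> \<eta>' x. P \<eta> x \<Longrightarrow> 0 < \<eta>' \<Longrightarrow> \<eta>' \<le> \<eta> \<Longrightarrow> P \<eta>' x"
  shows "\<exists>\<eta>>0. \<forall>x\<in>S. P \<eta> x"
proof -
  define \<V> where "\<V> = {V. openin X V \<and> (\<exists>\<eta>>0. \<forall>y\<in>V. P \<eta> y)}"
  have "S \<subseteq> \<Union>\<V>" using loc unfolding \<V>_def by blast
  moreover have "\<And>V. V \<in> \<V> \<Longrightarrow> openin X V" by (simp add: \<V>_def)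
  ultimately obtain \<F> where \<F>: "finite \<F>" "\<F> \<subseteq> \<V>" "S \<subseteq> \<Union>\<F>"
    using S unfolding compactin_def by meson
  have "\<exists>\<eta>>0. \<forall>V\<in>\<F>. \<forall>y\<in>V. P \<eta> y"
  proof (rule finite_uniform_pos[OF \<F>(1)])
    show "\<exists>e>0. \<forall>y\<in>V. P e y" if "V \<in> \<F>" for V using that \<F>(2) by (auto simp: \<V>_def)
  qed (use mono in blast)
  then show ?thesis using \<F>(3) by blast
qed

definition applicable :: "('a, 'v) cantor \<Rightarrow> 'a list \<Rightarrow> (nat \<Rightarrow> 'a) \<Rightarrow> bool" where
  "applicable K w \<theta> \<longleftrightarrow> w = [] \<or> w \<in> words K \<and> 2 \<le> length w \<and> hd w = \<theta> 0"

text \<open>The configuration can be renormalized into \<open>U\<close> with room \<open>\<eta>\<close> to spare: the words have length at most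
\<open>1 / \<eta>\<close>, and the transition maps may be replaced by any others within \<open>\<eta>\<close>. The last three clauses
confine the affine part to a relatively compact subset of the affine group.\<close>

definition robust ::
  "('a, 'v::euclidean_space) cantor \<Rightarrow> ('a \<Rightarrow> 'v) \<Rightarrow> ('b, 'v) cantor \<Rightarrow> ('b \<Rightarrow> 'v) \<Rightarrow>
   ('a, 'b, 'v) affine_config set \<Rightarrow> real \<Rightarrow> ('a, 'b, 'v) affine_config \<Rightarrow> bool" where
  "robust K c K' c' U \<eta> = (\<lambda>(B, \<theta>, \<theta>').
     (\<exists>w w'. applicable K w \<theta> \<and> applicable K' w' \<theta>' \<and> \<not> (w = [] \<and> w' = []) \<and>
        \<eta> * real (length w) \<le> 1 \<and> \<eta> * real (length w') \<le> 1 \<and>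
        (\<forall>T T'. T \<in> Aff \<and> T' \<in> Aff \<and> aff_near \<eta> T (transition K c \<theta> w) \<and> aff_near \<eta> T' (transition K' c' \<theta>' w')
           \<longrightarrow> (inv T \<circ> B \<circ> T', append_word \<theta> w, append_word \<theta>' w') \<in> U)) \<and>
     (\<forall>x y. \<eta> * norm (x - y) \<le> norm (B x - B y)) \<and>
     (\<forall>x y. \<eta> * norm (B x - B y) \<le> norm (x - y)) \<and>
     (\<forall>x. \<eta> * norm (B x) \<le> 1 + norm x))"

lemma robust_mono:
  assumes "robust K c K' c' U \<eta> z" "0 < \<eta>'" "\<eta>' \<le> \<eta>"
  shows "robust K c K' c' U \<eta>' z"
proof -
  obtain B \<theta> \<theta>' where z: "z = (B, \<theta>, \<theta>')" by (cases z)
  have m: "\<eta>' * t \<le> s" if "\<eta> * t \<le> s" "0 \<le> t" for t s :: real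
    using mult_right_mono[OF assms(3) that(2)] that(1) by linarith
  obtain w w' where w: "applicable K w \<theta>" "applicable K' w' \<theta>'" "\<not> (w = [] \<and> w' = [])"
    "\<eta> * real (length w) \<le> 1" "\<eta> * real (length w') \<le> 1"
    "\<And>T T'. T \<in> Aff \<Longrightarrow> T' \<in> Aff \<Longrightarrow> aff_near \<eta> T (transition K c \<theta> w) \<Longrightarrow> aff_near \<eta> T' (transition K' c' \<theta>' w')
           \<Longrightarrow> (inv T \<circ> B \<circ> T', append_word \<theta> w, append_word \<theta>' w') \<in> U"
    and bds: "\<And>x y. \<eta> * norm (x - y) \<le> norm (B x - B y)" "\<And>x y. \<eta> * norm (B x - B y) \<le> norm (x - y)"
     "\<And>x. \<eta> * norm (B x) \<le> 1 + norm x"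
    using assms(1) unfolding robust_def z by auto
  show ?thesis
    unfolding robust_def z prod.case
  proof (intro conjI allI exI[of _ w] exI[of _ w'] impI)
    fix T T' assume "T \<in> Aff \<and> T' \<in> Aff \<and> aff_near \<eta>' T (transition K c \<theta> w) \<and> aff_near \<eta>' T' (transition K' c' \<theta>' w')"
    then show "(inv T \<circ> B \<circ> T', append_word \<theta> w, append_word \<theta>' w') \<in> U"
      using w(6) aff_near_mono[OF _ assms(3)] by blast
  qed (use w bds m in auto)
qed

lemma append_word_agree:
  assumes "\<And>i. i \<le> n \<Longrightarrow> \<tau> i = \<theta> i" "i \<le> n"
  shows "append_word \<tau> w i = append_word \<theta> w i"
  using assms by (cases w) (auto simp: append_word_def)

text \<open>If an operator maps a point of the closure of \<open>U\<close> into the open set \<open>U\<close>, then so do, for all nearby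
points, nearby transition maps, by continuity of \<open>inv T \<circ> B \<circ> T'\<close> and of the transition maps in the
sequence. Compactness of the closure makes the room uniform.\<close>

lemma uniform_covering:
  fixes K :: "('a, 'v::euclidean_space) cantor" and K' :: "('b, 'v) cantor"
  assumes \<alpha>: "0 < \<alpha>" and K: "bunched_cantor \<alpha> K" "bunched_cantor \<alpha> K'" and c: "base_points K c" "base_points K' c'"
    and U: "openin (QAff_topology K K') U"
    and comp: "compactin (QAff_topology K K') (QAff_topology K K' closure_of U)"
    and cover: "QAff_topology K K' closure_of U \<subseteq> (\<Union>\<Psi>\<in>renorm_operators K c K' c'. \<Psi> -` (Some ` U))"
  obtains \<eta> where "0 < \<eta>" "\<And>z. z \<in> U \<Longrightarrow> robust K c K' c' U \<eta> z"
proof -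
  obtain \<mu> H m M N \<mu>' C \<nu> where "limit_map K \<alpha> \<mu> H m M N c \<mu>' C \<nu>"
    using bunched_cantor_limit_map[OF K(1) c(1) \<alpha>] by blast
  then interpret S: limit_map K \<alpha> \<mu> H m M N c \<mu>' C \<nu> .
  obtain \<mu> H m M N \<mu>' C \<nu> where "limit_map K' \<alpha> \<mu> H m M N c' \<mu>' C \<nu>"
    using bunched_cantor_limit_map[OF K(2) c(2) \<alpha>] by blast
  then interpret S': limit_map K' \<alpha> \<mu> H m M N c' \<mu>' C \<nu> .
  have "\<exists>\<eta>>0. \<forall>z\<in>QAff_topology K K' closure_of U. robust K c K' c' U \<eta> z"
  proof (rule compactin_uniform[OF comp])
    fix z assume "z \<in> QAff_topology K K' closure_of U"
    then obtain \<Psi> v where \<Psi>: "\<Psi> \<in> renorm_operators K c K' c'" "\<Psi> z = Some v" "v \<in> U" using cover by blast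
    obtain w w' where w: "\<Psi> = renorm K c K' c' w w'" "w = [] \<or> w \<in> words K \<and> length w \<ge> 2"
      "w' = [] \<or> w' \<in> words K' \<and> length w' \<ge> 2" "\<not> (w = [] \<and> w' = [])"
      using \<Psi>(1) unfolding renorm_operators_def by blast
    obtain B \<theta> \<theta>' where z: "z = (B, \<theta>, \<theta>')" by (cases z)
    have B: "B \<in> Aff" and \<theta>: "\<theta> \<in> past K" "\<theta>' \<in> past K'" and hw: "w \<noteq> [] \<longrightarrow> \<theta> 0 = hd w" "w' \<noteq> [] \<longrightarrow> \<theta>' 0 = hd w'"
      and v: "v = (inv (transition K c \<theta> w) \<circ> B \<circ> transition K' c' \<theta>' w', append_word \<theta> w, append_word \<theta>' w')"
      using \<Psi>(2) unfolding w(1) z renorm_def by (auto split: if_splits)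
    have app: "applicable K w \<theta>" "applicable K' w' \<theta>'" using w hw by (auto simp: applicable_def)
    have w1: "w = [] \<or> w \<in> words K \<and> hd w = \<theta> 0" "w' = [] \<or> w' \<in> words K' \<and> hd w' = \<theta>' 0"
      using app by (auto simp: applicable_def)
    let ?F = "transition K c \<theta> w" and ?F' = "transition K' c' \<theta>' w'"
    have F: "?F \<in> Aff" "?F' \<in> Aff" using S.transition_Aff S'.transition_Aff \<theta> w1 by auto
    obtain \<eta>1 n1 where \<eta>1: "0 < \<eta>1" and box: "\<And>A \<tau> \<tau>'. A \<in> Aff \<Longrightarrow> aff_near \<eta>1 A (inv ?F \<circ> B \<circ> ?F') \<Longrightarrow> \<tau> \<in> past K \<Longrightarrow>
       (\<And>i. i \<le> n1 \<Longrightarrow> \<tau> i = append_word \<theta> w i) \<Longrightarrow> \<tau>' \<in> past K' \<Longrightarrow> (\<And>i. i \<le> n1 \<Longrightarrow> \<tau>' i = append_word \<theta>' w' i)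
       \<Longrightarrow> (A, \<tau>, \<tau>') \<in> U"
      using QAff_contains_box[OF U \<Psi>(3)[unfolded v]] by metis
    obtain \<eta>2 where \<eta>2: "0 < \<eta>2" "\<And>T A T'. T \<in> Aff \<Longrightarrow> A \<in> Aff \<Longrightarrow> T' \<in> Aff \<Longrightarrow> aff_near \<eta>2 T ?F \<Longrightarrow>
        aff_near \<eta>2 A B \<Longrightarrow> aff_near \<eta>2 T' ?F' \<Longrightarrow> aff_near \<eta>1 (inv T \<circ> A \<circ> T') (inv ?F \<circ> B \<circ> ?F')"
      using aff_near_conjugate[OF F(1) B F(2) \<eta>1] by metis
    have \<eta>2h: "0 < \<eta>2 / 2" using \<eta>2(1) by simp
    obtain n2 where n2: "\<And>\<tau>. \<tau> \<in> past K \<Longrightarrow> (\<And>i. i \<le> n2 \<Longrightarrow> \<tau> i = \<theta> i) \<Longrightarrow> aff_near (\<eta>2 / 2) (transition K c \<tau> w) ?F"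
      using S.transition_continuous[OF \<theta>(1) w1(1) \<eta>2h] by metis
    obtain n3 where n3: "\<And>\<tau>. \<tau> \<in> past K' \<Longrightarrow> (\<And>i. i \<le> n3 \<Longrightarrow> \<tau> i = \<theta>' i) \<Longrightarrow> aff_near (\<eta>2 / 2) (transition K' c' \<tau> w') ?F'"
      using S'.transition_continuous[OF \<theta>(2) w1(2) \<eta>2h] by metis
    obtain k where k: "0 < k" "\<And>x y. k * norm (x - y) \<le> norm (B x - B y)"
      "\<And>x y. norm (B x - B y) \<le> norm (x - y) / k" "\<And>x. norm (B x) \<le> (1 + norm x) / k"
      using Aff_bounds[OF B] by metis
    define n where "n = max n1 (max n2 n3)"
    (* within k / 6 the lower bound k of B is at most halved *)
    define s where "s = min \<eta>2 (min 1 (k / 6))"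
    have s: "0 < s" "s \<le> \<eta>2" "s \<le> 1" "s \<le> k / 6" using \<eta>2 k(1) unfolding s_def by linarith+
    obtain V where V: "openin (QAff_topology K K') V" "(B, \<theta>, \<theta>') \<in> V"
      "\<And>A \<tau> \<tau>'. (A, \<tau>, \<tau>') \<in> V \<Longrightarrow> A \<in> Aff \<and> aff_near s A B \<and> \<tau> \<in> past K \<and> (\<forall>i\<le>n. \<tau> i = \<theta> i) \<and>
        \<tau>' \<in> past K' \<and> (\<forall>i\<le>n. \<tau>' i = \<theta>' i)"
      using QAff_box_nbhd[OF B \<theta> s(1)] by metis
    define \<eta> where "\<eta> = min (\<eta>2 / 2) (min (k / 2) (min (1 / (1 / k + 3)) (1 / (real (length w) + real (length w') + 1))))"
    have pos: "0 < 1 / (1 / k + 3)" "0 < 1 / (real (length w) + real (length w') + 1)" using k(1) by (auto intro: add_pos_nonneg)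
    have \<eta>: "0 < \<eta>" "\<eta> \<le> \<eta>2 / 2" "\<eta> \<le> k / 2" "\<eta> \<le> 1 / (1 / k + 3)" "\<eta> \<le> 1 / (real (length w) + real (length w') + 1)"
      using pos \<eta>2(1) k(1) unfolding \<eta>_def by linarith+
    have k3: "0 < 1 / k + 3" using k(1) by (simp add: add_pos_pos)
    have \<eta>k: "\<eta> * (1 / k + 3) \<le> 1" using \<eta>(4) k3 by (simp add: field_simps)
    have \<eta>l: "\<eta> * (real (length w) + real (length w') + 1) \<le> 1" using \<eta>(5) by (simp add: field_simps)
    have len: "\<eta> * real (length w) \<le> 1" "\<eta> * real (length w') \<le> 1"
    proof -
      have "0 \<le> \<eta> * real (length w)" "0 \<le> \<eta> * real (length w')" using \<eta>(1) by auto
      then show "\<eta> * real (length w) \<le> 1" "\<eta> * real (length w') \<le> 1"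
        using \<eta>l[unfolded distrib_left] \<eta>(1) by linarith+
    qed
    have "robust K c K' c' U \<eta> (A, \<tau>, \<tau>')" if inV: "(A, \<tau>, \<tau>') \<in> V" for A \<tau> \<tau>'
    proof -
      have A: "A \<in> Aff" "aff_near s A B" and \<tau>: "\<tau> \<in> past K" "\<And>i. i \<le> n \<Longrightarrow> \<tau> i = \<theta> i"
        and \<tau>': "\<tau>' \<in> past K'" "\<And>i. i \<le> n \<Longrightarrow> \<tau>' i = \<theta>' i" using V(3)[OF inV] by auto
      have 0: "\<tau> 0 = \<theta> 0" "\<tau>' 0 = \<theta>' 0" using \<tau> \<tau>' by auto
      show ?thesis
        unfolding robust_def prod.case
      proof (intro conjI exI[of _ w] exI[of _ w'] allI impI)
        show "applicable K w \<tau>" "applicable K' w' \<tau>'" using app 0 by (simp_all add: applicable_def)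
        show "\<not> (w = [] \<and> w' = [])" by (rule w(4))
        show "\<eta> * real (length w) \<le> 1" "\<eta> * real (length w') \<le> 1" by (rule len)+
      next
        fix T T' assume "T \<in> Aff \<and> T' \<in> Aff \<and> aff_near \<eta> T (transition K c \<tau> w) \<and> aff_near \<eta> T' (transition K' c' \<tau>' w')"
        then have T: "T \<in> Aff" "T' \<in> Aff" "aff_near \<eta> T (transition K c \<tau> w)" "aff_near \<eta> T' (transition K' c' \<tau>' w')" by auto
        have "aff_near \<eta>2 T ?F"
          by (rule aff_near_mono[OF aff_near_trans[OF T(3) n2[OF \<tau>(1)]]]) (use \<tau>(2) \<eta>(2) in \<open>auto simp: n_def\<close>)
        moreover have "aff_near \<eta>2 T' ?F'"
          by (rule aff_near_mono[OF aff_near_trans[OF T(4) n3[OF \<tau>'(1)]]]) (use \<tau>'(2) \<eta>(2) in \<open>auto simp: n_def\<close>)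
        ultimately have "aff_near \<eta>1 (inv T \<circ> A \<circ> T') (inv ?F \<circ> B \<circ> ?F')"
          using \<eta>2(2)[OF T(1) A(1) T(2)] aff_near_mono[OF A(2) s(2)] by blast
        moreover have "inv T \<circ> A \<circ> T' \<in> Aff" by (intro Aff_comp Aff_inv T A)
        moreover have "append_word \<tau> w \<in> past K"
          using append_word_past[OF \<tau>(1), of w] \<tau>(1) w1(1) 0 by (auto simp: append_word_def)
        moreover have "append_word \<tau>' w' \<in> past K'"
          using append_word_past[OF \<tau>'(1), of w'] \<tau>'(1) w1(2) 0 by (auto simp: append_word_def)
        moreover have "append_word \<tau> w i = append_word \<theta> w i" "append_word \<tau>' w' i = append_word \<theta>' w' i" if "i \<le> n1" for i
          using append_word_agree[of n \<tau> \<theta> i w] append_word_agree[of n \<tau>' \<theta>' i w'] \<tau>(2) \<tau>'(2) that by (auto simp: n_def)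
        ultimately show "(inv T \<circ> A \<circ> T', append_word \<tau> w, append_word \<tau>' w') \<in> U" by (intro box)
      next
        fix x y :: 'v
        have "\<eta> * norm (x - y) \<le> (k - 3 * s) * norm (x - y)" using \<eta>(3) s(4) by (intro mult_right_mono) auto
        then show "\<eta> * norm (x - y) \<le> norm (A x - A y)"
          using aff_near_lower_bound[OF A(1) B A(2) k(2), of x y] by linarith
        have "norm (A x - A y) \<le> norm (B x - B y) + norm ((A x - A y) - (B x - B y))"
          using norm_triangle_sub[of "A x - A y" "B x - B y"] by simp
        also have "\<dots> \<le> norm (x - y) / k + 3 * 1 * norm (x - y)"
          using k(3)[of x y] aff_near_diff[OF A(1) B A(2), of x y] mult_right_mono[OF s(3), of "norm (x - y)"]
          by (simp add: mult.assoc)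
        also have "\<dots> = (1 / k + 3) * norm (x - y)" by (simp add: algebra_simps)
        finally have "\<eta> * norm (A x - A y) \<le> \<eta> * ((1 / k + 3) * norm (x - y))" using \<eta>(1) by (intro mult_left_mono) auto
        also have "\<dots> = (\<eta> * (1 / k + 3)) * norm (x - y)" by simp
        also have "\<dots> \<le> 1 * norm (x - y)" by (rule mult_right_mono[OF \<eta>k norm_ge_zero])
        finally show "\<eta> * norm (A x - A y) \<le> norm (x - y)" by simp
      next
        fix x :: 'v
        have "norm (A x) \<le> norm (B x) + norm (A x - B x)" using norm_triangle_sub[of "A x" "B x"] by simp
        also have "\<dots> \<le> (1 + norm x) / k + 1 * (1 + norm x)"
          using k(4)[of x] aff_nearD[OF A(2), of x] mult_right_mono[OF s(3), of "1 + norm x"] by simp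
        also have "\<dots> \<le> (1 / k + 3) * (1 + norm x)" using k(1) by (simp add: field_simps)
        finally have "\<eta> * norm (A x) \<le> \<eta> * ((1 / k + 3) * (1 + norm x))" using \<eta>(1) by (intro mult_left_mono) auto
        also have "\<dots> = (\<eta> * (1 / k + 3)) * (1 + norm x)" by simp
        also have "\<dots> \<le> 1 * (1 + norm x)" by (rule mult_right_mono[OF \<eta>k]) simp
        finally show "\<eta> * norm (A x) \<le> 1 + norm x" by simp
      qed
    qed
    then show "\<exists>V \<eta>. openin (QAff_topology K K') V \<and> z \<in> V \<and> 0 < \<eta> \<and> (\<forall>y\<in>V. robust K c K' c' U \<eta> y)"
      using V(1,2) \<eta>(1) unfolding z by (intro exI[of _ V] exI[of _ \<eta>]) auto
  qed (rule robust_mono)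
  then obtain \<eta> where "0 < \<eta>" "\<And>z. z \<in> QAff_topology K K' closure_of U \<Longrightarrow> robust K c K' c' U \<eta> z" by auto
  moreover have "U \<subseteq> QAff_topology K K' closure_of U" by (rule closure_of_subset[OF openin_subset[OF U]])
  ultimately show thesis by (intro that[of \<eta>]) auto
qed

section \<open>Stable intersection\<close>

text \<open>For comparing scales: if \<open>i\<close> were bounded, then \<open>j\<close> would tend to infinity, and the right hand side of the
inequality would tend to \<open>0\<close> while the left hand side stays away from \<open>0\<close>.\<close>

lemma unbounded_of_exponential_balance:
  fixes c1 k D q :: real
  assumes sum: "\<And>n. n \<le> i n + j n" and le: "\<And>n. c1 * k ^ i n \<le> D * q ^ j n"
    and pos: "0 < c1" "0 < k" "0 < q" "q < 1"
  shows "\<exists>n. r < i n"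
proof (rule ccontr)
  assume "\<nexists>n. r < i n"
  then have i: "i n \<le> r" for n by (meson not_less)
  define p where "p = min k 1 ^ r"
  have p: "0 < p" using pos by (simp add: p_def)
  have low: "c1 * p \<le> D * q ^ j n" for n
  proof -
    have "p \<le> min k 1 ^ i n" unfolding p_def using i pos by (intro power_decreasing) auto
    also have "\<dots> \<le> k ^ i n" using pos by (intro power_mono) auto
    finally show ?thesis using le[of n] pos(1) by (meson less_imp_le mult_left_mono order_trans)
  qed
  have D: "0 < D"
  proof (rule ccontr)
    assume "\<not> 0 < D"
    then have "D * q ^ j 0 \<le> 0" using pos by (simp add: mult_nonpos_nonneg)
    then show False using low[of 0] mult_pos_pos[OF pos(1) p] by linarith
  qed
  have "(\<lambda>n. D * q ^ n) \<longlonglongrightarrow> D * 0" using pos by (intro tendsto_intros LIMSEQ_realpow_zero) auto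
  then have "eventually (\<lambda>n. D * q ^ n < c1 * p) sequentially" using pos p by (intro order_tendstoD) auto
  then obtain n where n: "D * q ^ n < c1 * p" unfolding eventually_sequentially by blast
  have "n \<le> j (n + r)" using sum[of "n + r"] i[of "n + r"] by simp
  then have "D * q ^ j (n + r) \<le> D * q ^ n" using D pos by (intro mult_left_mono power_decreasing) auto
  then show False using low[of "n + r"] n by linarith
qed

lemma self_in_relative_config:
  assumes "p \<in> configs \<alpha> K" "p' \<in> configs \<alpha> K'"
  shows "(p, p') \<in> relative_config \<alpha> K K' p p'"
proof -
  obtain a h a' h' where p: "p = (a, h)" "p' = (a', h')" by (cases p, cases p')
  have "((p, p'), (p, p')) \<in> aff_rel \<alpha> K K'"
    using assms id_Aff unfolding aff_rel_def p by (auto simp: same_on_def intro!: bexI[of _ id])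
  then show ?thesis by (simp add: relative_config_def)
qed

lemma append_word_singleton: "append_word \<tau> [\<tau> 0] = \<tau>"
  by (auto simp: append_word_def)

text \<open>Quotients of successive frames act on the relative position of the two frames exactly like a
renormalization operator, and the result is the relative position of the next two frames.\<close>

lemma affine_quotient_compose:
  fixes F :: "'v::euclidean_space \<Rightarrow> 'v"
  assumes "F \<in> Aff" "F' \<in> Aff" "Fz \<in> Aff"
  shows "inv (inv F \<circ> Fz) \<circ> (inv F \<circ> F') \<circ> (inv F' \<circ> F'z) = inv Fz \<circ> F'z"
proof
  fix x
  let ?y = "(inv Fz \<circ> F'z) x" and ?T = "inv F \<circ> Fz"
  have T: "?T \<in> Aff" by (intro Aff_comp Aff_inv assms)
  have "?T ?y = ((inv F \<circ> F') \<circ> (inv F' \<circ> F'z)) x" by (simp add: Aff_inv_simps assms)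
  then have "inv ?T (?T ?y) = (inv ?T \<circ> (inv F \<circ> F') \<circ> (inv F' \<circ> F'z)) x" by simp
  then show "(inv ?T \<circ> (inv F \<circ> F') \<circ> (inv F' \<circ> F'z)) x = ?y" using Aff_inv_simps(1)[OF T] by simp
qed

lemma tracksD:
  assumes "tracks K c \<theta> A n \<eta> L l"
  defines "F \<equiv> frame c (ibranch L) l"
  shows "u \<in> words K \<Longrightarrow> hd u = \<theta> 0 \<Longrightarrow> F u \<in> Aff"
    "aff_near \<eta> (F [\<theta> 0]) A"
    "u \<in> words K \<Longrightarrow> hd u = \<theta> 0 \<Longrightarrow> w \<in> words K \<Longrightarrow> hd w = last u \<Longrightarrow> length w \<le> n \<Longrightarrow>
        aff_near \<eta> (inv (F u) \<circ> F (u @ tl w)) (transition K c (append_word \<theta> u) w)"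
    "\<exists>C q. 0 < q \<and> q < 1 \<and> (\<forall>u x y. u \<in> words K \<and> hd u = \<theta> 0 \<longrightarrow> norm (F u x - F u y) \<le> C * q ^ length u * norm (x - y))"
    "\<exists>C k. 0 < C \<and> 0 < k \<and> (\<forall>u x y. u \<in> words K \<and> hd u = \<theta> 0 \<longrightarrow> C * k ^ length u * norm (x - y) \<le> norm (F u x - F u y))"
    "(\<And>i. us i \<in> words K \<and> hd (us i) = \<theta> 0 \<and> (\<exists>z. us (Suc i) = us i @ z)) \<Longrightarrow> (\<And>k. \<exists>i. k < length (us i)) \<Longrightarrow>
        \<exists>x\<in>cantor_piece L (\<theta> 0). (\<lambda>i. F (us i) (c (last (us i)))) \<longlonglongrightarrow> l x"
proof -
  note t = assms(1)[unfolded tracks_def Let_def, folded F_def]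
  note t1 = conjunct1[OF t] and t' = conjunct2[OF t]
  note t2 = conjunct1[OF t'] and t'' = conjunct2[OF t']
  note t3 = conjunct1[OF t''] and t''' = conjunct2[OF t'']
  note t4 = conjunct1[OF t'''] and t'''' = conjunct2[OF t''']
  note t5 = conjunct1[OF t''''] and t6 = conjunct2[OF t'''']
  show "u \<in> words K \<Longrightarrow> hd u = \<theta> 0 \<Longrightarrow> F u \<in> Aff" using t1 by simp
  show "aff_near \<eta> (F [\<theta> 0]) A" by (rule t2)
  show "u \<in> words K \<Longrightarrow> hd u = \<theta> 0 \<Longrightarrow> w \<in> words K \<Longrightarrow> hd w = last u \<Longrightarrow> length w \<le> n \<Longrightarrow>
        aff_near \<eta> (inv (F u) \<circ> F (u @ tl w)) (transition K c (append_word \<theta> u) w)" using t3 by simp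
  show "\<exists>C q. 0 < q \<and> q < 1 \<and> (\<forall>u x y. u \<in> words K \<and> hd u = \<theta> 0 \<longrightarrow> norm (F u x - F u y) \<le> C * q ^ length u * norm (x - y))"
    using t4 by simp
  show "\<exists>C k. 0 < C \<and> 0 < k \<and> (\<forall>u x y. u \<in> words K \<and> hd u = \<theta> 0 \<longrightarrow> C * k ^ length u * norm (x - y) \<le> norm (F u x - F u y))"
    using t5 by simp
  assume "\<And>i. us i \<in> words K \<and> hd (us i) = \<theta> 0 \<and> (\<exists>z. us (Suc i) = us i @ z)" "\<And>k. \<exists>i. k < length (us i)"
  then show "\<exists>x\<in>cantor_piece L (\<theta> 0). (\<lambda>i. F (us i) (c (last (us i)))) \<longlonglongrightarrow> l x"
    by (intro t6[rule_format]) auto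
qed

text \<open>As long as the relative position of the two frames lies in \<open>U\<close>, robustness supplies the next
pair of words, and the new relative position lies in \<open>U\<close> again. Since the relative position stays
bounded, the two frames have comparable scales, so both words grow without bound, and the distance
of their origins is at most a multiple of their size. Both sequences of origins converge, to points of the
two configured Cantor sets, and the limits agree.\<close>

lemma tracked_pair_intersects:
  fixes K :: "('a, 'v::euclidean_space) cantor" and K' :: "('b, 'v) cantor"
  assumes robust: "\<And>z. z \<in> U \<Longrightarrow> robust K c K' c' U \<eta> z" and \<eta>: "0 < \<eta>"
    and fin: "finite (letters K)" "finite (letters K')"
    and \<theta>: "\<theta> \<in> past K" "\<theta>' \<in> past K'"
    and tr: "tracks K c \<theta> A n \<eta>1 L l" "tracks K' c' \<theta>' A' n \<eta>1 L' l'" and \<eta>1: "\<eta>1 \<le> \<eta>"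
    and n: "1 / \<eta> \<le> real n"
    and start: "(inv (frame c (ibranch L) l [\<theta> 0]) \<circ> frame c' (ibranch L') l' [\<theta>' 0], \<theta>, \<theta>') \<in> U"
  shows "l ` cantor_piece L (\<theta> 0) \<inter> l' ` cantor_piece L' (\<theta>' 0) \<noteq> {}"
proof -
  let ?F = "frame c (ibranch L) l" and ?F' = "frame c' (ibranch L') l'"
  note F = tracksD[OF tr(1)] and F' = tracksD[OF tr(2)]
  define ok where "ok = (\<lambda>(u, u'). u \<in> words K \<and> hd u = \<theta> 0 \<and> u' \<in> words K' \<and> hd u' = \<theta>' 0 \<and>
     (inv (?F u) \<circ> ?F' u', append_word \<theta> u, append_word \<theta>' u') \<in> U)"
  have init: "ok ([\<theta> 0], [\<theta>' 0])"
    using start \<theta> by (simp add: ok_def words_def past_def append_word_singleton)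
  have len_le: "length w \<le> n" if "\<eta> * real (length w) \<le> 1" for w :: "'x list"
  proof -
    have "real (length w) \<le> 1 / \<eta>" using that \<eta> by (simp add: field_simps)
    then show ?thesis using n by simp
  qed
  have step: "\<exists>t. ok t \<and> (\<exists>z z'. fst t = fst s @ z \<and> snd t = snd s @ z' \<and> 0 < length z + length z')"
    if s: "ok s" for s
  proof -
    obtain u u' where uu: "s = (u, u')" by (cases s)
    have u: "u \<in> words K" "hd u = \<theta> 0" "u' \<in> words K'" "hd u' = \<theta>' 0"
      and inU: "(inv (?F u) \<circ> ?F' u', append_word \<theta> u, append_word \<theta>' u') \<in> U"
      using s by (auto simp: ok_def uu)
    have ne: "u \<noteq> []" "u' \<noteq> []" using u by (auto simp: words_def)
    obtain w w' where w: "applicable K w (append_word \<theta> u)" "applicable K' w' (append_word \<theta>' u')"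
      "\<not> (w = [] \<and> w' = [])" "\<eta> * real (length w) \<le> 1" "\<eta> * real (length w') \<le> 1"
      and res: "\<And>T T'. T \<in> Aff \<Longrightarrow> T' \<in> Aff \<Longrightarrow> aff_near \<eta> T (transition K c (append_word \<theta> u) w) \<Longrightarrow>
         aff_near \<eta> T' (transition K' c' (append_word \<theta>' u') w') \<Longrightarrow>
         (inv T \<circ> (inv (?F u) \<circ> ?F' u') \<circ> T', append_word (append_word \<theta> u) w, append_word (append_word \<theta>' u') w') \<in> U"
      using robust[OF inU] unfolding robust_def prod.case by (elim conjE exE) auto
    have lw: "length w \<le> n" "length w' \<le> n" using len_le w by auto
    define z z' where "z = tl w" and "z' = tl w'"
    have cas: "w = [] \<or> w \<in> words K \<and> hd w = last u \<and> 0 < length z"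
      using w(1) append_word_0[OF ne(1)] by (auto simp: applicable_def z_def)
    have cas': "w' = [] \<or> w' \<in> words K' \<and> hd w' = last u' \<and> 0 < length z'"
      using w(2) append_word_0[OF ne(2)] by (auto simp: applicable_def z'_def)
    have g: "u @ z \<in> words K" "hd (u @ z) = \<theta> 0" "append_word (append_word \<theta> u) w = append_word \<theta> (u @ z)"
      using cas words_glue[OF u(1), of w] append_word_glue[of u w \<theta>] u ne by (auto simp: z_def) (auto simp: append_word_def words_def)
    have g': "u' @ z' \<in> words K'" "hd (u' @ z') = \<theta>' 0" "append_word (append_word \<theta>' u') w' = append_word \<theta>' (u' @ z')"
      using cas' words_glue[OF u(3), of w'] append_word_glue[of u' w' \<theta>'] u ne by (auto simp: z'_def) (auto simp: append_word_def words_def)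
    let ?T = "inv (?F u) \<circ> ?F (u @ z)" and ?T' = "inv (?F' u') \<circ> ?F' (u' @ z')"
    have FA: "?F u \<in> Aff" "?F (u @ z) \<in> Aff" "?F' u' \<in> Aff" "?F' (u' @ z') \<in> Aff"
      using F(1) F'(1) u g g' by auto
    have T: "?T \<in> Aff" "?T' \<in> Aff" by (intro Aff_comp Aff_inv FA)+
    have n1: "aff_near \<eta> ?T (transition K c (append_word \<theta> u) w)"
    proof (cases "w = []")
      case True
      then have "?T = id" using Aff_inv_simps(1)[OF FA(1)] by (auto simp: z_def)
      then show ?thesis using True \<eta> by (simp add: transition_def aff_near_refl)
    next
      case False
      then show ?thesis using F(3)[OF u(1,2), of w] cas lw aff_near_mono[OF _ \<eta>1] by (simp add: z_def)
    qed
    have n2: "aff_near \<eta> ?T' (transition K' c' (append_word \<theta>' u') w')"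
    proof (cases "w' = []")
      case True
      then have "?T' = id" using Aff_inv_simps(1)[OF FA(3)] by (auto simp: z'_def)
      then show ?thesis using True \<eta> by (simp add: transition_def aff_near_refl)
    next
      case False
      then show ?thesis using F'(3)[OF u(3,4), of w'] cas' lw aff_near_mono[OF _ \<eta>1] by (simp add: z'_def)
    qed
    have "ok (u @ z, u' @ z')"
      using res[OF T n1 n2] g g' unfolding affine_quotient_compose[OF FA(1,3,2)] by (simp add: ok_def)
    moreover have "0 < length z + length z'" using cas cas' w(3) by auto
    ultimately show ?thesis unfolding uu by (intro exI[of _ "(u @ z, u' @ z')"]) auto
  qed
  obtain s where s: "\<And>i. ok (s i)"
    "\<And>i. \<exists>z z'. fst (s (Suc i)) = fst (s i) @ z \<and> snd (s (Suc i)) = snd (s i) @ z' \<and> 0 < length z + length z'"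
    using dependent_nat_choice[of "\<lambda>_ t. ok t"
       "\<lambda>_ s t. \<exists>z z'. fst t = fst s @ z \<and> snd t = snd s @ z' \<and> 0 < length z + length z'"] init step by metis
  define u u' where "u = (\<lambda>i. fst (s i))" and "u' = (\<lambda>i. snd (s i))"
  have w: "u i \<in> words K" "hd (u i) = \<theta> 0" "u' i \<in> words K'" "hd (u' i) = \<theta>' 0"
    and inU: "(inv (?F (u i)) \<circ> ?F' (u' i), append_word \<theta> (u i), append_word \<theta>' (u' i)) \<in> U" for i
    using s(1)[of i] by (auto simp: ok_def u_def u'_def split: prod.splits)
  have chain: "\<exists>z. u (Suc i) = u i @ z" "\<exists>z. u' (Suc i) = u' i @ z" for i using s(2)[of i] by (auto simp: u_def u'_def)
  have sum: "i \<le> length (u i) + length (u' i)" for i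
  proof (induction i)
    case (Suc i)
    obtain z z' where "u (Suc i) = u i @ z" "u' (Suc i) = u' i @ z'" "0 < length z + length z'"
      using s(2)[of i] by (auto simp: u_def u'_def)
    then show ?case using Suc by (simp only: length_append)
  qed simp
  define B where "B = (\<lambda>i. inv (?F (u i)) \<circ> ?F' (u' i))"
  have FB: "?F' (u' i) x = ?F (u i) (B i x)" for i x
    using Aff_inv_simps(2)[OF F(1)[OF w(1,2)]] by (simp add: B_def)
  have B: "\<eta> * norm (x - y) \<le> norm (B i x - B i y)" "\<eta> * norm (B i x - B i y) \<le> norm (x - y)"
    "\<eta> * norm (B i x) \<le> 1 + norm x" for i x y
    using robust[OF inU[of i]] unfolding robust_def prod.case B_def by blast+
  obtain C q where up: "0 < q" "q < 1" "\<And>u x y. u \<in> words K \<Longrightarrow> hd u = \<theta> 0 \<Longrightarrow> norm (?F u x - ?F u y) \<le> C * q ^ length u * norm (x - y)"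
    using F(4) by blast
  obtain C' q' where up': "0 < q'" "q' < 1" "\<And>u x y. u \<in> words K' \<Longrightarrow> hd u = \<theta>' 0 \<Longrightarrow> norm (?F' u x - ?F' u y) \<le> C' * q' ^ length u * norm (x - y)"
    using F'(4) by blast
  obtain D k where low: "0 < D" "0 < k" "\<And>u x y. u \<in> words K \<Longrightarrow> hd u = \<theta> 0 \<Longrightarrow> D * k ^ length u * norm (x - y) \<le> norm (?F u x - ?F u y)"
    using F(5) by blast
  obtain D' k' where low': "0 < D'" "0 < k'" "\<And>u x y. u \<in> words K' \<Longrightarrow> hd u = \<theta>' 0 \<Longrightarrow> D' * k' ^ length u * norm (x - y) \<le> norm (?F' u x - ?F' u y)"
    using F'(5) by blast
  obtain b :: 'v where "b \<in> Basis" using nonempty_Basis by blast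
  then have b: "norm b = 1" by simp
  have long: "\<exists>i. r < length (u i)" for r
  proof (rule unbounded_of_exponential_balance[of "\<lambda>i. length (u i)" "\<lambda>i. length (u' i)" "\<eta> * D" k C' q'])
    show "\<eta> * D * k ^ length (u i) \<le> C' * q' ^ length (u' i)" for i
    proof -
      have "\<eta> * D * k ^ length (u i) = D * k ^ length (u i) * (\<eta> * norm (b - 0))" using b by simp
      also have "\<dots> \<le> D * k ^ length (u i) * norm (B i b - B i 0)"
        using low(1,2) B(1)[of b 0 i] by (intro mult_left_mono) auto
      also have "\<dots> \<le> norm (?F' (u' i) b - ?F' (u' i) 0)" unfolding FB by (rule low(3)[OF w(1,2)])
      also have "\<dots> \<le> C' * q' ^ length (u' i) * norm (b - 0)" by (rule up'(3)[OF w(3,4)])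
      finally show ?thesis using b by simp
    qed
  qed (use sum \<eta> low(1,2) up'(1,2) in auto)
  have Cpos: "0 \<le> C"
  proof (rule ccontr)
    assume "\<not> 0 \<le> C"
    then have "C * q ^ length (u 0) < 0" using up by (simp add: mult_neg_pos)
    moreover have "0 \<le> C * q ^ length (u 0) * norm (b - 0)"
      using up(3)[OF w(1,2), of 0 b 0] norm_ge_zero order_trans by blast
    ultimately show False using b by simp
  qed
  have long': "\<exists>i. r < length (u' i)" for r
  proof (rule unbounded_of_exponential_balance[of "\<lambda>i. length (u' i)" "\<lambda>i. length (u i)" "\<eta> * D'" k' C q])
    show "\<eta> * D' * k' ^ length (u' i) \<le> C * q ^ length (u i)" for i
    proof -
      have "D' * k' ^ length (u' i) * norm (b - 0) \<le> norm (?F' (u' i) b - ?F' (u' i) 0)" by (rule low'(3)[OF w(3,4)])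
      also have "\<dots> \<le> C * q ^ length (u i) * norm (B i b - B i 0)" unfolding FB by (rule up(3)[OF w(1,2)])
      finally have "\<eta> * (D' * k' ^ length (u' i)) \<le> \<eta> * (C * q ^ length (u i) * norm (B i b - B i 0))"
        using b \<eta> by (simp add: mult_left_mono)
      also have "\<dots> = C * q ^ length (u i) * (\<eta> * norm (B i b - B i 0))" by simp
      also have "\<dots> \<le> C * q ^ length (u i) * norm (b - 0)"
        using B(2)[of i b 0] Cpos up(1) by (intro mult_left_mono) auto
      finally show ?thesis using b by (simp add: mult_ac)
    qed
  qed (use sum \<eta> low'(1,2) up(1,2) in \<open>auto simp: add.commute\<close>)
  obtain x where x: "x \<in> cantor_piece L (\<theta> 0)" "(\<lambda>i. ?F (u i) (c (last (u i)))) \<longlonglongrightarrow> l x"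
    using F(6)[of u] w chain long by blast
  obtain x' where x': "x' \<in> cantor_piece L' (\<theta>' 0)" "(\<lambda>i. ?F' (u' i) (c' (last (u' i)))) \<longlonglongrightarrow> l' x'"
    using F'(6)[of u'] w chain long' by blast
  (* the distance of the two origins, measured in the first frame *)
  define cs where "cs = (\<Sum>a\<in>letters K. norm (c a)) + (1 + (\<Sum>a\<in>letters K'. norm (c' a))) / \<eta>"
  have dist: "norm (?F (u i) (c (last (u i))) - ?F' (u' i) (c' (last (u' i)))) \<le> C * q ^ length (u i) * cs" for i
  proof -
    let ?p = "c (last (u i))" and ?p' = "c' (last (u' i))"
    have p: "norm ?p \<le> (\<Sum>a\<in>letters K. norm (c a))"
      using fin(1) words_letters[OF w(1)[of i]] by (intro member_le_sum) auto
    have "norm ?p' \<le> (\<Sum>a\<in>letters K'. norm (c' a))"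
      using fin(2) words_letters[OF w(3)[of i]] by (intro member_le_sum) auto
    then have "\<eta> * norm (B i ?p') \<le> 1 + (\<Sum>a\<in>letters K'. norm (c' a))" using B(3)[of i ?p'] by linarith
    then have "norm (B i ?p') \<le> (1 + (\<Sum>a\<in>letters K'. norm (c' a))) / \<eta>" using \<eta> by (simp add: field_simps)
    then have "norm (?p - B i ?p') \<le> cs" using p norm_triangle_ineq4[of ?p "B i ?p'"] by (simp add: cs_def)
    then have "C * q ^ length (u i) * norm (?p - B i ?p') \<le> C * q ^ length (u i) * cs"
      using Cpos up(1) by (intro mult_left_mono) auto
    then show ?thesis using up(3)[OF w(1,2), of i ?p "B i ?p'"] unfolding FB by linarith
  qed
  have mono: "length (u i) \<le> length (u j)" if "i \<le> j" for i j
  proof (rule lift_Suc_mono_le[OF _ that])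
    show "length (u i) \<le> length (u (Suc i))" for i using chain(1)[of i] by auto
  qed
  have "filterlim (\<lambda>i. length (u i)) at_top sequentially"
    unfolding filterlim_at_top eventually_sequentially
    using long mono by (meson less_imp_le order_trans)
  then have "(\<lambda>i. q ^ length (u i)) \<longlonglongrightarrow> 0"
    using filterlim_compose[OF LIMSEQ_realpow_zero[of q]] up by simp
  then have "(\<lambda>i. C * q ^ length (u i) * cs) \<longlonglongrightarrow> C * 0 * cs" by (intro tendsto_intros)
  then have g: "(\<lambda>i. C * q ^ length (u i) * cs) \<longlonglongrightarrow> 0" by simp
  have "(\<lambda>i. ?F (u i) (c (last (u i))) - ?F' (u' i) (c' (last (u' i)))) \<longlonglongrightarrow> 0"
    by (rule Lim_null_comparison[OF always_eventually g]) (use dist in blast)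
  moreover have "(\<lambda>i. ?F (u i) (c (last (u i))) - ?F' (u' i) (c' (last (u' i)))) \<longlonglongrightarrow> l x - l' x'"
    by (intro tendsto_diff x x')
  ultimately have "l x - l' x' = 0" using LIMSEQ_unique by blast
  then have "l x = l' x'" by simp
  then show ?thesis using x(1) x'(1) by (metis IntI empty_iff imageI)
qed

text \<open>A pair of configurations whose class lies in the image of \<open>U\<close> belongs to its own class, hence on the
pieces it is an affine copy of a pair of limit geometries. Close perturbations of both members are
tracked with an error below the room that the covering leaves.\<close>

lemma stably_intersecting_of_covering:
  fixes K :: "('a, 'v::euclidean_space) cantor" and K' :: "('b, 'v) cantor"
  assumes \<alpha>: "0 < \<alpha>" and K: "bunched_cantor \<alpha> K" "bunched_cantor \<alpha> K'" and c: "base_points K c" "base_points K' c'"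
    and U: "openin (QAff_topology K K') U"
    and comp: "compactin (QAff_topology K K') (QAff_topology K K' closure_of U)"
    and cover: "QAff_topology K K' closure_of U \<subseteq> (\<Union>\<Psi>\<in>renorm_operators K c K' c'. \<Psi> -` (Some ` U))"
    and p: "p \<in> configs \<alpha> K" "p' \<in> configs \<alpha> K'"
    and rel: "relative_config \<alpha> K K' p p' \<in> Phi_q \<alpha> K c K' c' ` U"
  shows "stably_intersecting \<alpha> K K' p p'"
proof -
  obtain a h a' h' where pp: "p = (a, h)" "p' = (a', h')" by (cases p, cases p')
  obtain B \<theta> \<theta>' where inU: "(B, \<theta>, \<theta>') \<in> U"
    and eq: "relative_config \<alpha> K K' p p' = Phi_q \<alpha> K c K' c' (B, \<theta>, \<theta>')" using rel by auto
  have "(p, p') \<in> Phi_q \<alpha> K c K' c' (B, \<theta>, \<theta>')" using self_in_relative_config[OF p] eq by simp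
  then obtain A where a: "a = \<theta> 0" "a' = \<theta>' 0" and A: "A \<in> Aff"
    and same: "same_on (piece K (\<theta> 0)) h (A \<circ> limit_geometry K c \<theta>)"
      "same_on (piece K' (\<theta>' 0)) h' (A \<circ> (B \<circ> limit_geometry K' c' \<theta>'))"
    unfolding Phi_q_def relative_config_def aff_rel_def pp by auto
  have same': "same_on (piece K' (\<theta>' 0)) h' ((A \<circ> B) \<circ> limit_geometry K' c' \<theta>')"
    using same(2) by (simp add: comp_assoc)
  have "U \<subseteq> topspace (QAff_topology K K')" using U by (rule openin_subset)
  then have B: "B \<in> Aff" and \<theta>: "\<theta> \<in> past K" "\<theta>' \<in> past K'"
    using inU by (auto simp: QAff_topology_def topspace_Aff_topology topspace_past_topology)
  obtain \<eta> where \<eta>: "0 < \<eta>" and rob: "\<And>z. z \<in> U \<Longrightarrow> robust K c K' c' U \<eta> z"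
    using uniform_covering[OF \<alpha> K c U comp cover] by metis
  obtain \<eta>1 n1 where \<eta>1: "0 < \<eta>1" and box: "\<And>D \<tau> \<tau>'. D \<in> Aff \<Longrightarrow> aff_near \<eta>1 D B \<Longrightarrow> \<tau> \<in> past K \<Longrightarrow>
       (\<And>i. i \<le> n1 \<Longrightarrow> \<tau> i = \<theta> i) \<Longrightarrow> \<tau>' \<in> past K' \<Longrightarrow> (\<And>i. i \<le> n1 \<Longrightarrow> \<tau>' i = \<theta>' i) \<Longrightarrow> (D, \<tau>, \<tau>') \<in> U"
    using QAff_contains_box[OF U inU] by metis
  have AB: "A \<circ> B \<in> Aff" by (intro Aff_comp A B)
  have iAB: "inv A \<circ> (A \<circ> B) \<circ> id = B" using Aff_inv_simps(1)[OF A] by auto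
  obtain \<eta>2 where \<eta>2: "0 < \<eta>2" and conj: "\<And>T D G. T \<in> Aff \<Longrightarrow> D \<in> Aff \<Longrightarrow> G \<in> Aff \<Longrightarrow> aff_near \<eta>2 T A \<Longrightarrow>
      aff_near \<eta>2 D (A \<circ> B) \<Longrightarrow> aff_near \<eta>2 G id \<Longrightarrow> aff_near \<eta>1 (inv T \<circ> D \<circ> G) B"
    using aff_near_conjugate[OF A AB id_Aff \<eta>1] unfolding iAB by metis
  define e where "e = min \<eta> \<eta>2"
  have e: "0 < e" "e \<le> \<eta>" "e \<le> \<eta>2" using \<eta> \<eta>2 by (auto simp: e_def)
  obtain n where n: "1 / \<eta> \<le> real n" using real_arch_simple by blast
  obtain \<mu> H m M N \<mu>' C \<nu> where "limit_map K \<alpha> \<mu> H m M N c \<mu>' C \<nu>"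
    using bunched_cantor_limit_map[OF K(1) c(1) \<alpha>] by blast
  then interpret S: limit_map K \<alpha> \<mu> H m M N c \<mu>' C \<nu> .
  obtain \<mu> H m M N \<mu>' C \<nu> where "limit_map K' \<alpha> \<mu> H m M N c' \<mu>' C \<nu>"
    using bunched_cantor_limit_map[OF K(2) c(2) \<alpha>] by blast
  then interpret S': limit_map K' \<alpha> \<mu> H m M N c' \<mu>' C \<nu> .
  show ?thesis
    unfolding stably_intersecting_def pp prod.case
  proof (intro allI impI, elim conjE)
    fix W W' assume W: "piece K a \<subseteq> W" "C1a_embedding \<alpha> W h" and W': "piece K' a' \<subseteq> W'" "C1a_embedding \<alpha> W' h'"
    obtain \<epsilon>1 where \<epsilon>1: "0 < \<epsilon>1" and tr1: "\<And>\<epsilon> L l. \<epsilon> \<le> \<epsilon>1 \<Longrightarrow> cantor_close \<alpha> \<epsilon> K L \<Longrightarrow> C1a_close \<alpha> \<epsilon> W h l \<Longrightarrow>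
        tracks K c \<theta> A n e L l"
      by (rule S.shadowing[OF \<theta>(1) A same(1) W(1)[unfolded a] W(2) e(1), where nw = n]) (rule that)
    obtain \<epsilon>2 where \<epsilon>2: "0 < \<epsilon>2" and tr2: "\<And>\<epsilon> L l. \<epsilon> \<le> \<epsilon>2 \<Longrightarrow> cantor_close \<alpha> \<epsilon> K' L \<Longrightarrow> C1a_close \<alpha> \<epsilon> W' h' l \<Longrightarrow>
        tracks K' c' \<theta>' (A \<circ> B) n e L l"
      by (rule S'.shadowing[OF \<theta>(2) AB same' W'(1)[unfolded a] W'(2) e(1), where nw = n]) (rule that)
    show "\<exists>\<epsilon>>0. \<forall>L L' l l'. cantor_close \<alpha> \<epsilon> K L \<and> cantor_close \<alpha> \<epsilon> K' L' \<and> (a, l) \<in> configs \<alpha> L \<and> (a', l') \<in> configs \<alpha> L' \<and>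
        C1a_close \<alpha> \<epsilon> W h l \<and> C1a_close \<alpha> \<epsilon> W' h' l' \<longrightarrow> l ` cantor_piece L a \<inter> l' ` cantor_piece L' a' \<noteq> {}"
    proof (rule exI[of _ "min \<epsilon>1 \<epsilon>2"], intro conjI allI impI, use \<epsilon>1 \<epsilon>2 in simp, elim conjE)
      fix L L' l l'
      let ?\<epsilon> = "min \<epsilon>1 \<epsilon>2"
      assume cl: "cantor_close \<alpha> ?\<epsilon> K L" "cantor_close \<alpha> ?\<epsilon> K' L'" "C1a_close \<alpha> ?\<epsilon> W h l" "C1a_close \<alpha> ?\<epsilon> W' h' l'"
      have t1: "tracks K c \<theta> A n e L l" by (rule tr1[OF _ cl(1,3)]) simp
      have t2: "tracks K' c' \<theta>' (A \<circ> B) n e L' l'" by (rule tr2[OF _ cl(2,4)]) simp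
      let ?F = "frame c (ibranch L) l [\<theta> 0]" and ?F' = "frame c' (ibranch L') l' [\<theta>' 0]"
      have w: "[\<theta> 0] \<in> words K" "[\<theta>' 0] \<in> words K'" using \<theta> by (auto simp: words_def past_def)
      have F: "?F \<in> Aff" "?F' \<in> Aff" using tracksD(1)[OF t1 w(1)] tracksD(1)[OF t2 w(2)] by auto
      have "aff_near \<eta>1 (inv ?F \<circ> ?F' \<circ> id) B"
        by (rule conj[OF F id_Aff aff_near_mono[OF tracksD(2)[OF t1] e(3)] aff_near_mono[OF tracksD(2)[OF t2] e(3)] aff_near_refl])
          (use \<eta>2 in simp)
      then have "(inv ?F \<circ> ?F', \<theta>, \<theta>') \<in> U" using F \<theta> by (intro box Aff_comp Aff_inv) auto
      then show "l ` cantor_piece L a \<inter> l' ` cantor_piece L' a' \<noteq> {}"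
        using tracked_pair_intersects[OF rob \<eta> S.finite_letters S'.finite_letters \<theta> t1 t2 e(2) n] a by simp
    qed
  qed
qed

lemma C1a_embedding_id: "C1a_embedding \<alpha> (UNIV :: 'v::euclidean_space set) id"
proof -
  have on: "C1a_on \<alpha> (UNIV :: 'v set) id"
    unfolding C1a_on_def deriv_at_id by (auto simp: onorm_zero intro!: exI[of _ 0])
  have "inv_into UNIV (id :: 'v \<Rightarrow> 'v) = id" by (rule inv_id)
  then show ?thesis using on by (simp add: C1a_embedding_def)
qed

lemma C1a_close_id: "0 < \<epsilon> \<Longrightarrow> C1a_close \<alpha> \<epsilon> (UNIV :: 'v::euclidean_space set) id id"
  using C1a_embedding_id[of \<alpha>] by (auto simp: C1a_close_def C1a_embedding_def onorm_zero)

text \<open>The identity is a configuration of every perturbed piece.\<close>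

lemma stable_intersection_of_identity:
  fixes K :: "('a, 'v::euclidean_space) cantor" and K' :: "('b, 'v) cantor"
  assumes "a \<in> letters K" "a' \<in> letters K'" "stably_intersecting \<alpha> K K' (a, id) (a', id)"
  shows "stable_intersection \<alpha> K K'"
proof -
  obtain \<epsilon> where \<epsilon>: "0 < \<epsilon>" and st: "\<forall>L L' l l'. cantor_close \<alpha> \<epsilon> K L \<and> cantor_close \<alpha> \<epsilon> K' L' \<and>
      (a, l) \<in> configs \<alpha> L \<and> (a', l') \<in> configs \<alpha> L' \<and> C1a_close \<alpha> \<epsilon> UNIV id l \<and> C1a_close \<alpha> \<epsilon> UNIV id l' \<longrightarrow>
      l ` cantor_piece L a \<inter> l' ` cantor_piece L' a' \<noteq> {}"
    using assms(3)[unfolded stably_intersecting_def prod.case, THEN spec, THEN spec, of UNIV UNIV] C1a_embedding_id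
    by auto
  show ?thesis
    unfolding stable_intersection_def
  proof (rule exI[of _ \<epsilon>], intro conjI \<epsilon> allI impI, elim conjE)
    fix L L' assume cl: "cantor_close \<alpha> \<epsilon> K L" "cantor_close \<alpha> \<epsilon> K' L'"
    have "letters L = letters K" "letters L' = letters K'" using cl by (auto simp: cantor_close_def)
    then have "(a, id) \<in> configs \<alpha> L" "(a', id) \<in> configs \<alpha> L'"
      using assms(1,2) C1a_embedding_id by (auto simp: configs_def)
    then have "id ` cantor_piece L a \<inter> id ` cantor_piece L' a' \<noteq> {}"
      using st[rule_format, of L L' id id] cl C1a_close_id[OF \<epsilon>] by blast
    then show "cantor_set L \<inter> cantor_set L' \<noteq> {}" by (auto simp: cantor_piece_def)
  qed
qed

theorem theorem3:
  fixes \<alpha> :: real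
    and K :: "('a, real ^ 'n) cantor" and c :: "'a \<Rightarrow> real ^ 'n"
    and K' :: "('b, real ^ 'n) cantor" and c' :: "'b \<Rightarrow> real ^ 'n"
    and U :: "('a, 'b, real ^ 'n) affine_config set"
  assumes "0 < \<alpha>" and "\<alpha> < 1"
    and "bunched_cantor \<alpha> K" and "bunched_cantor \<alpha> K'"
    and "base_points K c" and "base_points K' c'"
    and "openin (QAff_topology K K') U"
    and "compactin (QAff_topology K K') (QAff_topology K K' closure_of U)"
    and "QAff_topology K K' closure_of U
           \<subseteq> (\<Union>\<Psi>\<in>renorm_operators K c K' c'. \<Psi> -` (Some ` U))"
  shows "(\<forall>p\<in>configs \<alpha> K. \<forall>p'\<in>configs \<alpha> K'.
            relative_config \<alpha> K K' p p' \<in> Phi_q \<alpha> K c K' c' ` U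
              \<longrightarrow> stably_intersecting \<alpha> K K' p p')
       \<and> (\<forall>a\<in>letters K. \<forall>a'\<in>letters K'.
            relative_config \<alpha> K K' (a, id) (a', id) \<in> Phi_q \<alpha> K c K' c' ` U
              \<longrightarrow> stable_intersection \<alpha> K K')"
proof -
  note main = stably_intersecting_of_covering[OF assms(1,3-9)]
  have "stable_intersection \<alpha> K K'"
    if a: "a \<in> letters K" "a' \<in> letters K'"
      and rel: "relative_config \<alpha> K K' (a, id) (a', id) \<in> Phi_q \<alpha> K c K' c' ` U" for a a'
  proof (rule stable_intersection_of_identity[OF a main[OF _ _ rel]])
    show "(a, id) \<in> configs \<alpha> K" "(a', id) \<in> configs \<alpha> K'"
      using a C1a_embedding_id by (auto simp: configs_def)
  qed
  then show ?thesis using main by blast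
qed

end
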